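(* Let $(H,\iota)$ be a $p$-divisible group over $\mathcal{O}_K$ with endomorphism structure for $\mathcal{O}_F$, with $\operatorname{ht}H=dn$. Then $\mathrm{Hdg}^{\mathrm{int}}(H,\iota)\le\mathrm{PR}(H,\iota)$.
   Context: Let $p$ be a prime. Let $K$ be a field extension of $\mathbb{Q}_p$, complete for a real valuation $v$ with $v(p)=1$, with valuation ring $\mathcal{O}_K$ and perfect residue field $k$. Let $F$ be a finite extension of $\mathbb{Q}_p$ of degree $d$, with ring of integers $\mathcal{O}_F$, a uniformiser $\pi$, maximal unramified subextension $F^{\mathrm{nr}}$ (ring of integers $\mathcal{O}_{F^{\mathrm{nr}}}$), ramification index $e$ and inertia degree $f$. Assume $K$ contains a Galois closure of $F$ over $\mathbb{Q}_p$. Let $W(k)\subseteq\mathcal{O}_K$ be the Witt vectors, $K_0$ its fraction field. A $p$-divisible group over $\mathcal{O}_K$ with endomorphism structure for $\mathcal{O}_F$ is a pair $(H,\iota)$ with $H$ a $p$-divisible group over $\operatorname{Spec}\mathcal{O}_K$ and $\iota:\mathcal{O}_F\to\operatorname{End}(H)$ a $\mathbb{Z}_p$-algebra map; its height is $dn$ with $n\in\mathbb{N}$. $\omega_H=\varprojlim_i\omega_{H[p^i]}$ is a free $\mathcal{O}_K$-module with induced $\mathcal{O}_F$-action. Polygons: $\mathbb{R}^n_+$ = decreasing $n$-tuples of reals, identified with continuous concave piecewise affine functions on $[0,n]$, value $0$ at $0$, slope $a_i$ on $[i-1,i]$; $f\le g$ means pointwise $f\le g$ and $f(n)=g(n)$.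 Integral Hodge polygon: $\omega_H=\bigoplus_\upsilon\omega_{H,\upsilon}$ over the $f$ embeddings $\upsilon:F^{\mathrm{nr}}\to K_0$, $\mathcal{O}_{F^{\mathrm{nr}}}$ acting on $\omega_{H,\upsilon}$ via $\upsilon$. With $[\pi]$ the endomorphism induced by $\iota(\pi)$, write $\omega_{H,\upsilon}/[\pi]\omega_{H,\upsilon}\cong\bigoplus_{i=1}^n\mathcal{O}_K/a_{\upsilon,i}\mathcal{O}_K$, $a_{\upsilon,i}\neq0$, $v(a_{\upsilon,1})\ge\dots\ge v(a_{\upsilon,n})$; $\mathrm{Hdg}^{\mathrm{int}}(H,\iota)_\upsilon=(v(a_{\upsilon,i}))_i$ and $\mathrm{Hdg}^{\mathrm{int}}(H,\iota)=\frac1f\sum_\upsilon\mathrm{Hdg}^{\mathrm{int}}(H,\iota)_\upsilon$. Pappas–Rapoport polygon: $\omega_H\otimes_{\mathcal{O}_K}K=\bigoplus_{\tau:F\to K}\omega_{H,K,\tau}$, where $\omega_{H,K,\tau}=\{w:\iota(a)w=\tau(a)w\ \forall a\in F\}$; put $r_\tau=\dim_K\omega_{H,K,\tau}$ ($\le n$). Then $\mathrm{PR}(H,\iota)(x)=\frac1d\sum_\tau\min\{x,r_\tau\}$ for $x\in[0,n]$. *)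

theory Defs
  imports
    "HOL-Algebra.Algebra"
    "HOL-Library.Extended_Real"
begin

section \<open>Complete valued fields over the p-adic numbers\<close>

abbreviation nat_in :: "('a, 'm) ring_scheme \<Rightarrow> nat \<Rightarrow> 'a" where
  "nat_in R m \<equiv> [m] \<cdot>\<^bsub>R\<^esub> \<one>\<^bsub>R\<^esub>"

definition complete_valued_field :: "('k, 'm) ring_scheme \<Rightarrow> ('k \<Rightarrow> ereal) \<Rightarrow> bool" where
  "complete_valued_field K v \<longleftrightarrow>
     field K \<and>
     (\<forall>x\<in>carrier K. v x \<noteq> -\<infinity> \<and> (v x = \<infinity> \<longleftrightarrow> x = \<zero>\<^bsub>K\<^esub>)) \<and>
     (\<forall>x\<in>carrier K. \<forall>y\<in>carrier K. v (x \<otimes>\<^bsub>K\<^esub> y) = v x + v y) \<and>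
     (\<forall>x\<in>carrier K. \<forall>y\<in>carrier K. min (v x) (v y) \<le> v (x \<oplus>\<^bsub>K\<^esub> y)) \<and>
     (\<forall>s :: nat \<Rightarrow> 'k.
        (\<forall>i. s i \<in> carrier K) \<and>
        (\<forall>N::nat. \<exists>M. \<forall>i\<ge>M. \<forall>j\<ge>M. ereal (real N) \<le> v (s i \<ominus>\<^bsub>K\<^esub> s j)) \<longrightarrow>
        (\<exists>l\<in>carrier K. \<forall>N::nat. \<exists>M. \<forall>i\<ge>M. ereal (real N) \<le> v (s i \<ominus>\<^bsub>K\<^esub> l)))"

definition val_ring :: "('k, 'm) ring_scheme \<Rightarrow> ('k \<Rightarrow> ereal) \<Rightarrow> ('k, 'm) ring_scheme" where
  "val_ring K v = K\<lparr>carrier := {x \<in> carrier K. 0 \<le> v x}\<rparr>"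

definition val_ideal :: "('k, 'm) ring_scheme \<Rightarrow> ('k \<Rightarrow> ereal) \<Rightarrow> 'k set" where
  "val_ideal K v = {x \<in> carrier K. 0 < v x}"

definition perfect_residue_field ::
  "nat \<Rightarrow> ('k, 'm) ring_scheme \<Rightarrow> ('k \<Rightarrow> ereal) \<Rightarrow> bool" where
  "perfect_residue_field p K v \<longleftrightarrow>
     (let k = val_ring K v Quot val_ideal K v in
      \<forall>a\<in>carrier k. \<exists>b\<in>carrier k. b [^]\<^bsub>k\<^esub> p = a)"

text \<open>In a complete valued field with \<open>v(p) = 1\<close>, the closure of the prime field is the
  field of p-adic numbers, and the elements of nonnegative valuation in it are the
  p-adic integers. This is how \<open>K\<close> is regarded as an extension of the p-adic numbers.\<close>

definition Qp :: "('k, 'm) ring_scheme \<Rightarrow> ('k \<Rightarrow> ereal) \<Rightarrow> 'k set" where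
  "Qp K v = {x \<in> carrier K. \<forall>N::nat. \<exists>y\<in>generate_field K {}. ereal (real N) \<le> v (x \<ominus>\<^bsub>K\<^esub> y)}"

definition Zp :: "('k, 'm) ring_scheme \<Rightarrow> ('k \<Rightarrow> ereal) \<Rightarrow> 'k set" where
  "Zp K v = {x \<in> Qp K v. 0 \<le> v x}"

text \<open>\<open>W\<close> is a subring of the valuation ring mapping onto the residue field \<open>k\<close> with kernel
  \<open>pW\<close> and p-adically complete, i.e. a strict p-ring with residue ring the perfect field \<open>k\<close>.
  Up to unique isomorphism the strict p-ring with residue ring \<open>k\<close> is the ring of Witt vectors
  of \<open>k\<close>; the embedding into the valuation ring (a lift of the identity of \<open>k\<close>) is part of the
  data.\<close>

definition is_witt_subring ::
  "nat \<Rightarrow> ('k, 'm) ring_scheme \<Rightarrow> ('k \<Rightarrow> ereal) \<Rightarrow> 'k set \<Rightarrow> bool" where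
  "is_witt_subring p K v W \<longleftrightarrow>
     subring W K \<and> W \<subseteq> carrier (val_ring K v) \<and>
     (\<forall>x\<in>carrier (val_ring K v). \<exists>w\<in>W. x \<ominus>\<^bsub>K\<^esub> w \<in> val_ideal K v) \<and>
     W \<inter> val_ideal K v = {nat_in K p \<otimes>\<^bsub>K\<^esub> w | w. w \<in> W} \<and>
     (\<forall>s :: nat \<Rightarrow> 'k.
        (\<forall>i. s i \<in> W) \<and>
        (\<forall>i. \<exists>w\<in>W. s (Suc i) \<ominus>\<^bsub>K\<^esub> s i = nat_in K (p ^ i) \<otimes>\<^bsub>K\<^esub> w) \<longrightarrow>
        (\<exists>l\<in>W. \<forall>i. \<exists>w\<in>W. l \<ominus>\<^bsub>K\<^esub> s i = nat_in K (p ^ i) \<otimes>\<^bsub>K\<^esub> w))"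

definition fractions_in :: "('k, 'm) ring_scheme \<Rightarrow> 'k set \<Rightarrow> 'k set" where
  "fractions_in K W = {a \<otimes>\<^bsub>K\<^esub> inv\<^bsub>K\<^esub> b | a b. a \<in> W \<and> b \<in> W - {\<zero>\<^bsub>K\<^esub>}}"


section \<open>Finite extensions of the p-adic numbers\<close>

text \<open>The extension \<open>F\<close> is given by a homomorphism \<open>j\<close> from \<open>Qp K v\<close> to \<open>F\<close>.\<close>

definition finite_extension_of_Qp ::
  "('k, 'm) ring_scheme \<Rightarrow> ('k \<Rightarrow> ereal) \<Rightarrow> 'f ring \<Rightarrow> ('k \<Rightarrow> 'f) \<Rightarrow> nat \<Rightarrow> bool" where
  "finite_extension_of_Qp K v F j d \<longleftrightarrow>
     field F \<and> j \<in> ring_hom (K\<lparr>carrier := Qp K v\<rparr>) F \<and>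
     ring.dimension F d (j ` Qp K v) (carrier F)"

definition integral_closure :: "'f ring \<Rightarrow> 'f set \<Rightarrow> 'f set \<Rightarrow> 'f ring" where
  "integral_closure F Z E =
     F\<lparr>carrier := {x \<in> E. \<exists>q. q \<noteq> [] \<and> set q \<subseteq> Z \<and> hd q = \<one>\<^bsub>F\<^esub> \<and> ring.eval F q x = \<zero>\<^bsub>F\<^esub>}\<rparr>"

abbreviation int_ring ::
  "('k, 'm) ring_scheme \<Rightarrow> ('k \<Rightarrow> ereal) \<Rightarrow> 'f ring \<Rightarrow> ('k \<Rightarrow> 'f) \<Rightarrow> 'f set \<Rightarrow> 'f ring" where
  "int_ring K v F j E \<equiv> integral_closure F (j ` Zp K v) E"

definition nonunits :: "('a, 'm) ring_scheme \<Rightarrow> 'a set" where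
  "nonunits R = carrier R - Units R"

definition subextension ::
  "('k, 'm) ring_scheme \<Rightarrow> ('k \<Rightarrow> ereal) \<Rightarrow> 'f ring \<Rightarrow> ('k \<Rightarrow> 'f) \<Rightarrow> 'f set \<Rightarrow> bool" where
  "subextension K v F j E \<longleftrightarrow> subfield E F \<and> j ` Qp K v \<subseteq> E"

text \<open>The residue extension is automatically separable, its base being a finite prime field.\<close>

definition unramified_subextension ::
  "nat \<Rightarrow> ('k, 'm) ring_scheme \<Rightarrow> ('k \<Rightarrow> ereal) \<Rightarrow> 'f ring \<Rightarrow> ('k \<Rightarrow> 'f) \<Rightarrow> 'f set \<Rightarrow> bool" where
  "unramified_subextension p K v F j E \<longleftrightarrow>
     subextension K v F j E \<and>
     nonunits (int_ring K v F j E) = PIdl\<^bsub>int_ring K v F j E\<^esub> (nat_in F p)"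

definition maximal_unramified_subextension ::
  "nat \<Rightarrow> ('k, 'm) ring_scheme \<Rightarrow> ('k \<Rightarrow> ereal) \<Rightarrow> 'f ring \<Rightarrow> ('k \<Rightarrow> 'f) \<Rightarrow> 'f set \<Rightarrow> bool" where
  "maximal_unramified_subextension p K v F j E \<longleftrightarrow>
     unramified_subextension p K v F j E \<and>
     (\<forall>E'. unramified_subextension p K v F j E' \<longrightarrow> E' \<subseteq> E)"

definition is_uniformiser ::
  "('k, 'm) ring_scheme \<Rightarrow> ('k \<Rightarrow> ereal) \<Rightarrow> 'f ring \<Rightarrow> ('k \<Rightarrow> 'f) \<Rightarrow> 'f \<Rightarrow> bool" where
  "is_uniformiser K v F j w \<longleftrightarrow>
     (let B = int_ring K v F j (carrier F) in w \<in> carrier B \<and> PIdl\<^bsub>B\<^esub> w = nonunits B)"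

definition ramification_index ::
  "nat \<Rightarrow> ('k, 'm) ring_scheme \<Rightarrow> ('k \<Rightarrow> ereal) \<Rightarrow> 'f ring \<Rightarrow> ('k \<Rightarrow> 'f) \<Rightarrow> 'f \<Rightarrow> nat \<Rightarrow> bool" where
  "ramification_index p K v F j w e \<longleftrightarrow>
     (let B = int_ring K v F j (carrier F) in PIdl\<^bsub>B\<^esub> (nat_in F p) = PIdl\<^bsub>B\<^esub> (w [^]\<^bsub>F\<^esub> e))"

definition inertia_degree ::
  "('k, 'm) ring_scheme \<Rightarrow> ('k \<Rightarrow> ereal) \<Rightarrow> 'f ring \<Rightarrow> ('k \<Rightarrow> 'f) \<Rightarrow> nat \<Rightarrow> bool" where
  "inertia_degree K v F j f \<longleftrightarrow>
     (let B = int_ring K v F j (carrier F); m = nonunits B in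
      ring.dimension (B Quot m) f ((\<lambda>z. m +>\<^bsub>B\<^esub> z) ` (j ` Zp K v)) (carrier (B Quot m)))"

text \<open>Homomorphisms over the p-adic numbers from the subfield \<open>E\<close> of \<open>F\<close> to the subfield \<open>L\<close>
  of \<open>K\<close>.\<close>

definition embeddings ::
  "('k, 'm) ring_scheme \<Rightarrow> ('k \<Rightarrow> ereal) \<Rightarrow> 'f ring \<Rightarrow> ('k \<Rightarrow> 'f) \<Rightarrow> 'f set \<Rightarrow> 'k set \<Rightarrow> ('f \<Rightarrow> 'k) set"
  where
  "embeddings K v F j E L =
     {s \<in> extensional E. s \<in> ring_hom (F\<lparr>carrier := E\<rparr>) (K\<lparr>carrier := L\<rparr>) \<and>
                         (\<forall>x\<in>Qp K v. s (j x) = x)}"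

definition galois_over ::
  "('k, 'm) ring_scheme \<Rightarrow> 'k set \<Rightarrow> 'k set \<Rightarrow> bool" where
  "galois_over K Q L \<longleftrightarrow>
     subfield Q K \<and> subfield L K \<and> Q \<subseteq> L \<and> (\<exists>m. ring.dimension K m Q L) \<and>
     {x \<in> L. \<forall>s \<in> ring_iso (K\<lparr>carrier := L\<rparr>) (K\<lparr>carrier := L\<rparr>). (\<forall>y\<in>Q. s y = y) \<longrightarrow> s x = x} = Q"

definition contains_galois_closure ::
  "('k, 'm) ring_scheme \<Rightarrow> ('k \<Rightarrow> ereal) \<Rightarrow> 'f ring \<Rightarrow> ('k \<Rightarrow> 'f) \<Rightarrow> bool" where
  "contains_galois_closure K v F j \<longleftrightarrow>
     (\<exists>L. \<exists>s \<in> embeddings K v F j (carrier F) (carrier K).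
        galois_over K (Qp K v) L \<and> s ` carrier F \<subseteq> L \<and>
        (\<forall>L'. galois_over K (Qp K v) L' \<and> s ` carrier F \<subseteq> L' \<and> L' \<subseteq> L \<longrightarrow> L' = L))"


section \<open>Modules\<close>

text \<open>Modules are records of type \<^typ>\<open>('r, 'a) module\<close>; where only a module is meant, the
  multiplicative fields of the record carry no information.\<close>

definition is_basis :: "('r, 'm) ring_scheme \<Rightarrow> ('r, 'a, 'n) module_scheme \<Rightarrow> 'a set \<Rightarrow> bool" where
  "is_basis R M B \<longleftrightarrow>
     B \<subseteq> carrier M \<and>
     (\<forall>x\<in>carrier M. \<exists>!c. c \<in> B \<rightarrow>\<^sub>E carrier R \<and> finite {b \<in> B. c b \<noteq> \<zero>\<^bsub>R\<^esub>} \<and>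
        x = (\<Oplus>\<^bsub>M\<^esub>b\<in>{b \<in> B. c b \<noteq> \<zero>\<^bsub>R\<^esub>}. c b \<odot>\<^bsub>M\<^esub> b))"

definition free_module :: "('r, 'm) ring_scheme \<Rightarrow> ('r, 'a, 'n) module_scheme \<Rightarrow> bool" where
  "free_module R M \<longleftrightarrow> module R M \<and> (\<exists>B. is_basis R M B)"

definition free_of_rank ::
  "('r, 'm) ring_scheme \<Rightarrow> ('r, 'a, 'n) module_scheme \<Rightarrow> nat \<Rightarrow> bool" where
  "free_of_rank R M r \<longleftrightarrow> module R M \<and> (\<exists>B. is_basis R M B \<and> finite B \<and> card B = r)"

definition vdim :: "('r, 'm) ring_scheme \<Rightarrow> ('r, 'a, 'n) module_scheme \<Rightarrow> nat" where
  "vdim K V = (THE r. free_of_rank K V r)"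

definition linear_map ::
  "('r, 'm) ring_scheme \<Rightarrow> ('r, 'a, 'n) module_scheme \<Rightarrow> ('r, 'b, 'o) module_scheme \<Rightarrow> ('a \<Rightarrow> 'b) set"
  where
  "linear_map R M N =
     {h \<in> carrier M \<rightarrow> carrier N.
        (\<forall>x\<in>carrier M. \<forall>y\<in>carrier M. h (x \<oplus>\<^bsub>M\<^esub> y) = h x \<oplus>\<^bsub>N\<^esub> h y) \<and>
        (\<forall>r\<in>carrier R. \<forall>x\<in>carrier M. h (r \<odot>\<^bsub>M\<^esub> x) = r \<odot>\<^bsub>N\<^esub> h x)}"

definition module_isomorphic ::
  "('r, 'm) ring_scheme \<Rightarrow> ('r, 'a, 'n) module_scheme \<Rightarrow> ('r, 'b, 'o) module_scheme \<Rightarrow> bool" where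
  "module_isomorphic R M N \<longleftrightarrow> (\<exists>h\<in>linear_map R M N. bij_betw h (carrier M) (carrier N))"

definition self_module :: "('r, 'm) ring_scheme \<Rightarrow> ('r, 'r) module" where
  "self_module R =
     \<lparr>carrier = carrier R, monoid.mult = monoid.mult R, monoid.one = monoid.one R,
      ring.zero = ring.zero R, ring.add = ring.add R, module.smult = monoid.mult R\<rparr>"

definition quot_module :: "('r, 'a, 'n) module_scheme \<Rightarrow> 'a set \<Rightarrow> ('r, 'a set) module" where
  "quot_module M N =
     \<lparr>carrier = a_rcosets\<^bsub>M\<^esub> N, monoid.mult = undefined, monoid.one = undefined, ring.zero = N,
      ring.add = (\<lambda>C D. set_add M C D), module.smult = (\<lambda>r C. \<Union>x\<in>C. N +>\<^bsub>M\<^esub> (r \<odot>\<^bsub>M\<^esub> x))\<rparr>"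

text \<open>The map induced by \<open>h\<close> on cosets, with values in the cosets of \<open>N'\<close> in \<open>M'\<close>.\<close>

definition coset_map :: "('b, 'm) ring_scheme \<Rightarrow> 'b set \<Rightarrow> ('a \<Rightarrow> 'b) \<Rightarrow> 'a set \<Rightarrow> 'b set" where
  "coset_map M' N' h C = (\<Union>x\<in>C. N' +>\<^bsub>M'\<^esub> h x)"

definition fin_direct_sum :: "nat set \<Rightarrow> (nat \<Rightarrow> ('r, 'a) module) \<Rightarrow> ('r, nat \<Rightarrow> 'a) module" where
  "fin_direct_sum I M =
     \<lparr>carrier = (\<Pi>\<^sub>E i\<in>I. carrier (M i)), monoid.mult = undefined, monoid.one = undefined,
      ring.zero = (\<lambda>i\<in>I. \<zero>\<^bsub>M i\<^esub>), ring.add = (\<lambda>x y. \<lambda>i\<in>I. x i \<oplus>\<^bsub>M i\<^esub> y i),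
      module.smult = (\<lambda>r x. \<lambda>i\<in>I. r \<odot>\<^bsub>M i\<^esub> x i)\<rparr>"

text \<open>Tensor products. A list of pairs represents the sum of the corresponding pure tensors;
  the tensor product consists of the classes for the congruence generated by bilinearity.\<close>

inductive tensor_eq ::
  "('r, 'm) ring_scheme \<Rightarrow> ('r, 'a, 'n) module_scheme \<Rightarrow> ('r, 'b, 'o) module_scheme
     \<Rightarrow> ('a \<times> 'b) list \<Rightarrow> ('a \<times> 'b) list \<Rightarrow> bool"
  for R and M and N where
  refl: "set xs \<subseteq> carrier M \<times> carrier N \<Longrightarrow> tensor_eq R M N xs xs"
| sym: "tensor_eq R M N xs ys \<Longrightarrow> tensor_eq R M N ys xs"
| trans: "tensor_eq R M N xs ys \<Longrightarrow> tensor_eq R M N ys zs \<Longrightarrow> tensor_eq R M N xs zs"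
| append: "tensor_eq R M N xs ys \<Longrightarrow> tensor_eq R M N us vs \<Longrightarrow> tensor_eq R M N (xs @ us) (ys @ vs)"
| comm: "set xs \<subseteq> carrier M \<times> carrier N \<Longrightarrow> set ys \<subseteq> carrier M \<times> carrier N \<Longrightarrow>
         tensor_eq R M N (xs @ ys) (ys @ xs)"
| zero: "y \<in> carrier N \<Longrightarrow> tensor_eq R M N [(\<zero>\<^bsub>M\<^esub>, y)] []"
| add_left: "x \<in> carrier M \<Longrightarrow> x' \<in> carrier M \<Longrightarrow> y \<in> carrier N \<Longrightarrow>
             tensor_eq R M N [(x \<oplus>\<^bsub>M\<^esub> x', y)] [(x, y), (x', y)]"
| add_right: "x \<in> carrier M \<Longrightarrow> y \<in> carrier N \<Longrightarrow> y' \<in> carrier N \<Longrightarrow>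
              tensor_eq R M N [(x, y \<oplus>\<^bsub>N\<^esub> y')] [(x, y), (x, y')]"
| smult: "r \<in> carrier R \<Longrightarrow> x \<in> carrier M \<Longrightarrow> y \<in> carrier N \<Longrightarrow>
          tensor_eq R M N [(r \<odot>\<^bsub>M\<^esub> x, y)] [(x, r \<odot>\<^bsub>N\<^esub> y)]"

definition tensor_class ::
  "('r, 'm) ring_scheme \<Rightarrow> ('r, 'a, 'n) module_scheme \<Rightarrow> ('r, 'b, 'o) module_scheme
     \<Rightarrow> ('a \<times> 'b) list \<Rightarrow> ('a \<times> 'b) list set" where
  "tensor_class R M N xs = {ys. tensor_eq R M N xs ys}"

definition tensor ::
  "('r, 'm) ring_scheme \<Rightarrow> ('r, 'a, 'n) module_scheme \<Rightarrow> ('r, 'b, 'o) module_scheme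
     \<Rightarrow> ('r, ('a \<times> 'b) list set) module" where
  "tensor R M N =
     \<lparr>carrier = {tensor_class R M N xs | xs. set xs \<subseteq> carrier M \<times> carrier N},
      monoid.mult = undefined, monoid.one = undefined, ring.zero = tensor_class R M N [],
      ring.add = (\<lambda>C D. \<Union>xs\<in>C. \<Union>ys\<in>D. tensor_class R M N (xs @ ys)),
      module.smult = (\<lambda>r C. \<Union>xs\<in>C. tensor_class R M N (map (\<lambda>(x, y). (r \<odot>\<^bsub>M\<^esub> x, y)) xs))\<rparr>"

text \<open>The tensor product of \<open>M\<close> with \<open>K\<close> over the subring \<open>R\<close> of \<open>K\<close>, as a module over \<open>K\<close>,
  and the map induced by an endomorphism of \<open>M\<close>.\<close>

definition base_change ::
  "('r, 'm) ring_scheme \<Rightarrow> ('r, 'o) ring_scheme \<Rightarrow> ('r, 'a, 'n) module_scheme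
     \<Rightarrow> ('r, ('a \<times> 'r) list set) module" where
  "base_change R K M =
     (tensor R M (self_module K))
       \<lparr>module.smult := (\<lambda>c C. \<Union>xs\<in>C. tensor_class R M (self_module K)
                                  (map (\<lambda>(x, y). (x, c \<otimes>\<^bsub>K\<^esub> y)) xs))\<rparr>"

definition base_change_map ::
  "('r, 'm) ring_scheme \<Rightarrow> ('r, 'o) ring_scheme \<Rightarrow> ('r, 'a, 'n) module_scheme
     \<Rightarrow> ('a \<Rightarrow> 'a) \<Rightarrow> ('a \<times> 'r) list set \<Rightarrow> ('a \<times> 'r) list set" where
  "base_change_map R K M h C =
     (\<Union>xs\<in>C. tensor_class R M (self_module K) (map (\<lambda>(x, y). (h x, y)) xs))"


section \<open>Finite flat commutative group schemes as Hopf algebras\<close>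

text \<open>A finite locally free commutative group scheme over the spectrum of a local ring \<open>R\<close> is
  given by a commutative and cocommutative Hopf algebra, free of finite rank over \<open>R\<close>. The list
  \<open>comult A x\<close> of pairs represents the element of \<open>A \<otimes> A\<close> to which \<open>x\<close> is mapped by the
  comultiplication.\<close>

record ('r, 'a) hopf = "('r, 'a) module" +
  comult :: "'a \<Rightarrow> ('a \<times> 'a) list"
  counit :: "'a \<Rightarrow> 'r"
  antipode :: "'a \<Rightarrow> 'a"

definition list_sum :: "('a, 'm) ring_scheme \<Rightarrow> 'a list \<Rightarrow> 'a" where
  "list_sum A xs = foldr (\<lambda>x y. x \<oplus>\<^bsub>A\<^esub> y) xs \<zero>\<^bsub>A\<^esub>"

locale comm_hopf_algebra = algebra R A
  for R :: "('r, 'm) ring_scheme" and A :: "('r, 'a) hopf" +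
  assumes comult_closed: "x \<in> carrier A \<Longrightarrow> set (comult A x) \<subseteq> carrier A \<times> carrier A"
    and comult_add: "x \<in> carrier A \<Longrightarrow> y \<in> carrier A \<Longrightarrow>
          tensor_eq R A A (comult A (x \<oplus>\<^bsub>A\<^esub> y)) (comult A x @ comult A y)"
    and comult_smult: "r \<in> carrier R \<Longrightarrow> x \<in> carrier A \<Longrightarrow>
          tensor_eq R A A (comult A (r \<odot>\<^bsub>A\<^esub> x)) (map (\<lambda>(u, w). (r \<odot>\<^bsub>A\<^esub> u, w)) (comult A x))"
    and comult_one: "tensor_eq R A A (comult A \<one>\<^bsub>A\<^esub>) [(\<one>\<^bsub>A\<^esub>, \<one>\<^bsub>A\<^esub>)]"
    and comult_mult: "x \<in> carrier A \<Longrightarrow> y \<in> carrier A \<Longrightarrow>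
          tensor_eq R A A (comult A (x \<otimes>\<^bsub>A\<^esub> y))
            [(u \<otimes>\<^bsub>A\<^esub> u', w \<otimes>\<^bsub>A\<^esub> w'). (u, w) \<leftarrow> comult A x, (u', w') \<leftarrow> comult A y]"
    and coassoc: "x \<in> carrier A \<Longrightarrow>
          tensor_eq R A (tensor R A A)
            [(u, tensor_class R A A (comult A w)). (u, w) \<leftarrow> comult A x]
            [(u', tensor_class R A A [(u'', w)]). (u, w) \<leftarrow> comult A x, (u', u'') \<leftarrow> comult A u]"
    and cocomm: "x \<in> carrier A \<Longrightarrow>
          tensor_eq R A A (comult A x) [(w, u). (u, w) \<leftarrow> comult A x]"
    and counit_hom: "counit A \<in> ring_hom A R"
    and counit_smult: "r \<in> carrier R \<Longrightarrow> x \<in> carrier A \<Longrightarrow>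
          counit A (r \<odot>\<^bsub>A\<^esub> x) = r \<otimes>\<^bsub>R\<^esub> counit A x"
    and counit_left: "x \<in> carrier A \<Longrightarrow>
          list_sum A [counit A u \<odot>\<^bsub>A\<^esub> w. (u, w) \<leftarrow> comult A x] = x"
    and antipode_linear: "antipode A \<in> linear_map R A A"
    and antipode_left: "x \<in> carrier A \<Longrightarrow>
          list_sum A [antipode A u \<otimes>\<^bsub>A\<^esub> w. (u, w) \<leftarrow> comult A x] = counit A x \<odot>\<^bsub>A\<^esub> \<one>\<^bsub>A\<^esub>"

text \<open>Homomorphisms of Hopf algebras; they are compatible with counit and antipode as soon as
  they are bialgebra maps.\<close>

definition hopf_hom ::
  "('r, 'm) ring_scheme \<Rightarrow> ('r, 'a) hopf \<Rightarrow> ('r, 'b) hopf \<Rightarrow> ('a \<Rightarrow> 'b) set" where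
  "hopf_hom R A B =
     {h \<in> ring_hom A B \<inter> linear_map R A B.
        (\<forall>x\<in>carrier A. counit B (h x) = counit A x) \<and>
        (\<forall>x\<in>carrier A. tensor_eq R B B (map (map_prod h h) (comult A x)) (comult B (h x)))}"

text \<open>The sum of two homomorphisms from a group scheme to itself, on coordinate rings.\<close>

definition convolution :: "('r, 'a) hopf \<Rightarrow> ('a \<Rightarrow> 'a) \<Rightarrow> ('a \<Rightarrow> 'a) \<Rightarrow> 'a \<Rightarrow> 'a" where
  "convolution A g h =
     (\<lambda>x\<in>carrier A. list_sum A [g u \<otimes>\<^bsub>A\<^esub> h w. (u, w) \<leftarrow> comult A x])"

primrec mult_by :: "('r, 'a) hopf \<Rightarrow> nat \<Rightarrow> 'a \<Rightarrow> 'a" where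
  "mult_by A 0 = (\<lambda>x\<in>carrier A. counit A x \<odot>\<^bsub>A\<^esub> \<one>\<^bsub>A\<^esub>)"
| "mult_by A (Suc m) = convolution A (\<lambda>x\<in>carrier A. x) (mult_by A m)"

definition aug_ideal :: "('r, 'm) ring_scheme \<Rightarrow> ('r, 'a) hopf \<Rightarrow> 'a set" where
  "aug_ideal R A = {x \<in> carrier A. counit A x = \<zero>\<^bsub>R\<^esub>}"

definition aug_ideal_sq :: "('r, 'm) ring_scheme \<Rightarrow> ('r, 'a) hopf \<Rightarrow> 'a set" where
  "aug_ideal_sq R A = ideal_prod A (aug_ideal R A) (aug_ideal R A)"

text \<open>The pullback of the differentials along the unit section: the conormal module of the
  augmentation ideal.\<close>

definition omega_fin :: "('r, 'm) ring_scheme \<Rightarrow> ('r, 'a) hopf \<Rightarrow> ('r, 'a set) module" where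
  "omega_fin R A =
     quot_module (module.truncate (A\<lparr>carrier := aug_ideal R A\<rparr>)) (aug_ideal_sq R A)"


section \<open>p-divisible groups\<close>

text \<open>A p-divisible group of height \<open>h\<close> over a local ring \<open>R\<close>: \<open>A i\<close> is the coordinate ring of
  the \<open>p\<^sup>i\<close>-torsion \<open>H[p\<^sup>i]\<close>, a group scheme of order \<open>p\<^sup>i\<^sup>h\<close>, and \<open>res i\<close> corresponds to the
  closed immersion \<open>H[p\<^sup>i] \<rightarrow> H[p\<^sup>i\<^sup>+\<^sup>1]\<close>, which identifies \<open>H[p\<^sup>i]\<close> with the kernel of
  multiplication by \<open>p\<^sup>i\<close>.\<close>

definition p_divisible_group ::
  "('r, 'm) ring_scheme \<Rightarrow> nat \<Rightarrow> nat \<Rightarrow> (nat \<Rightarrow> ('r, 'a) hopf) \<Rightarrow> (nat \<Rightarrow> 'a \<Rightarrow> 'a) \<Rightarrow> bool" where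
  "p_divisible_group R p h A res \<longleftrightarrow>
     (\<forall>i. comm_hopf_algebra R (A i) \<and> free_of_rank R (A i) (p ^ (i * h)) \<and>
          res i \<in> hopf_hom R (A (Suc i)) (A i) \<and>
          res i ` carrier (A (Suc i)) = carrier (A i) \<and>
          a_kernel (A (Suc i)) (A i) (res i) =
            Idl\<^bsub>A (Suc i)\<^esub> (mult_by (A (Suc i)) (p ^ i) ` aug_ideal R (A (Suc i))))"

text \<open>An endomorphism is given by the maps which it induces on the coordinate rings; as these are
  contravariant, the order of composition is reversed.\<close>

definition End_ring ::
  "('r, 'm) ring_scheme \<Rightarrow> (nat \<Rightarrow> ('r, 'a) hopf) \<Rightarrow> (nat \<Rightarrow> 'a \<Rightarrow> 'a) \<Rightarrow> (nat \<Rightarrow> 'a \<Rightarrow> 'a) ring" where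
  "End_ring R A res =
     \<lparr>carrier = {g. \<forall>i. g i \<in> hopf_hom R (A i) (A i) \<inter> extensional (carrier (A i)) \<and>
                       (\<forall>x\<in>carrier (A (Suc i)). res i (g (Suc i) x) = g i (res i x))},
      monoid.mult = (\<lambda>g h i. compose (carrier (A i)) (h i) (g i)),
      monoid.one = (\<lambda>i. \<lambda>x\<in>carrier (A i). x),
      ring.zero = (\<lambda>i. mult_by (A i) 0),
      ring.add = (\<lambda>g h i. convolution (A i) (g i) (h i))\<rparr>"

text \<open>A p-adic integer \<open>z\<close> congruent to \<open>m\<close> modulo \<open>p\<^sup>i\<close> acts on \<open>H[p\<^sup>i]\<close> as multiplication
  by \<open>m\<close>; this is the last clause.\<close>

definition endomorphism_structure ::
  "('k, 'm) ring_scheme \<Rightarrow> ('k \<Rightarrow> ereal) \<Rightarrow> 'f ring \<Rightarrow> ('k \<Rightarrow> 'f) \<Rightarrow>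
   (nat \<Rightarrow> ('k, 'a) hopf) \<Rightarrow> (nat \<Rightarrow> 'a \<Rightarrow> 'a) \<Rightarrow> ('f \<Rightarrow> nat \<Rightarrow> 'a \<Rightarrow> 'a) \<Rightarrow> bool" where
  "endomorphism_structure K v F j A res \<iota> \<longleftrightarrow>
     \<iota> \<in> ring_hom (int_ring K v F j (carrier F)) (End_ring (val_ring K v) A res) \<and>
     (\<forall>z\<in>Zp K v. \<forall>i m. ereal (real i) \<le> v (z \<ominus>\<^bsub>K\<^esub> nat_in K m) \<longrightarrow>
        \<iota> (j z) i = mult_by (A i) m)"

definition omega ::
  "('r, 'm) ring_scheme \<Rightarrow> (nat \<Rightarrow> ('r, 'a) hopf) \<Rightarrow> (nat \<Rightarrow> 'a \<Rightarrow> 'a) \<Rightarrow> ('r, nat \<Rightarrow> 'a set) module"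
  where
  "omega R A res =
     \<lparr>carrier = {w. \<forall>i. w i \<in> carrier (omega_fin R (A i)) \<and>
                       coset_map (A i) (aug_ideal_sq R (A i)) (res i) (w (Suc i)) = w i},
      monoid.mult = undefined, monoid.one = undefined,
      ring.zero = (\<lambda>i. \<zero>\<^bsub>omega_fin R (A i)\<^esub>),
      ring.add = (\<lambda>w w' i. w i \<oplus>\<^bsub>omega_fin R (A i)\<^esub> w' i),
      module.smult = (\<lambda>r w i. r \<odot>\<^bsub>omega_fin R (A i)\<^esub> w i)\<rparr>"

definition omega_map ::
  "('r, 'm) ring_scheme \<Rightarrow> (nat \<Rightarrow> ('r, 'a) hopf) \<Rightarrow> (nat \<Rightarrow> 'a \<Rightarrow> 'a)
     \<Rightarrow> (nat \<Rightarrow> 'a set) \<Rightarrow> (nat \<Rightarrow> 'a set)" where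
  "omega_map R A g w = (\<lambda>i. coset_map (A i) (aug_ideal_sq R (A i)) (g i) (w i))"


section \<open>Polygons\<close>

text \<open>The polygon of a tuple \<open>a 1, \<dots>, a n\<close>: the piecewise affine function with value \<open>0\<close> at \<open>0\<close>
  and slope \<open>a i\<close> on \<open>[i - 1, i]\<close>.\<close>

definition polygon :: "nat \<Rightarrow> (nat \<Rightarrow> real) \<Rightarrow> real \<Rightarrow> real" where
  "polygon n a x = (\<Sum>i=1..n. a i * max 0 (min 1 (x - (real i - 1))))"

definition polygon_le :: "nat \<Rightarrow> (real \<Rightarrow> real) \<Rightarrow> (real \<Rightarrow> real) \<Rightarrow> bool" where
  "polygon_le n g h \<longleftrightarrow> (\<forall>x\<in>{0..real n}. g x \<le> h x) \<and> g (real n) = h (real n)"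


section \<open>The integral Hodge polygon\<close>

definition omega_nr ::
  "('k, 'm) ring_scheme \<Rightarrow> ('k \<Rightarrow> ereal) \<Rightarrow> 'f ring \<Rightarrow> ('k \<Rightarrow> 'f) \<Rightarrow> 'f set \<Rightarrow>
   (nat \<Rightarrow> ('k, 'a) hopf) \<Rightarrow> (nat \<Rightarrow> 'a \<Rightarrow> 'a) \<Rightarrow> ('f \<Rightarrow> nat \<Rightarrow> 'a \<Rightarrow> 'a) \<Rightarrow> ('f \<Rightarrow> 'k)
     \<Rightarrow> ('k, nat \<Rightarrow> 'a set) module" where
  "omega_nr K v F j Fnr A res \<iota> \<upsilon> =
     (omega (val_ring K v) A res)\<lparr>carrier :=
        {w \<in> carrier (omega (val_ring K v) A res).
           \<forall>b\<in>carrier (int_ring K v F j Fnr).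
             omega_map (val_ring K v) A (\<iota> b) w = \<upsilon> b \<odot>\<^bsub>omega (val_ring K v) A res\<^esub> w}\<rparr>"

text \<open>The tuple \<open>a\<close> describes \<open>\<omega>\<^sub>\<upsilon> / [w] \<omega>\<^sub>\<upsilon>\<close>, where \<open>w\<close> is the uniformiser. The valuations of
  its entries do not depend on the choice of \<open>a\<close>, and form the \<open>\<upsilon>\<close>-component of the integral
  Hodge polygon.\<close>

definition hdg_int_tuple ::
  "('k, 'm) ring_scheme \<Rightarrow> ('k \<Rightarrow> ereal) \<Rightarrow> 'f ring \<Rightarrow> ('k \<Rightarrow> 'f) \<Rightarrow> 'f set \<Rightarrow> 'f \<Rightarrow>
   (nat \<Rightarrow> ('k, 'a) hopf) \<Rightarrow> (nat \<Rightarrow> 'a \<Rightarrow> 'a) \<Rightarrow> ('f \<Rightarrow> nat \<Rightarrow> 'a \<Rightarrow> 'a) \<Rightarrow> nat \<Rightarrow> ('f \<Rightarrow> 'k)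
     \<Rightarrow> (nat \<Rightarrow> 'k) \<Rightarrow> bool" where
  "hdg_int_tuple K v F j Fnr w A res \<iota> n \<upsilon> a \<longleftrightarrow>
     (\<forall>i\<in>{1..n}. a i \<in> carrier (val_ring K v) \<and> a i \<noteq> \<zero>\<^bsub>K\<^esub>) \<and>
     (\<forall>i\<in>{1..n}. \<forall>l\<in>{1..n}. i \<le> l \<longrightarrow> v (a l) \<le> v (a i)) \<and>
     module_isomorphic (val_ring K v)
       (quot_module (omega_nr K v F j Fnr A res \<iota> \<upsilon>)
          (omega_map (val_ring K v) A (\<iota> w) ` carrier (omega_nr K v F j Fnr A res \<iota> \<upsilon>)))
       (fin_direct_sum {1..n}
          (\<lambda>i. quot_module (self_module (val_ring K v)) (PIdl\<^bsub>val_ring K v\<^esub> (a i))))"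

definition hdg_int ::
  "('k \<Rightarrow> ereal) \<Rightarrow> nat \<Rightarrow> ('f \<Rightarrow> 'k) set \<Rightarrow> (('f \<Rightarrow> 'k) \<Rightarrow> nat \<Rightarrow> 'k) \<Rightarrow> nat \<Rightarrow> real" where
  "hdg_int v f \<Upsilon> a i = (1 / real f) * (\<Sum>\<upsilon>\<in>\<Upsilon>. real_of_ereal (v (a \<upsilon> i)))"


section \<open>The Pappas-Rapoport polygon\<close>

text \<open>The action of \<open>b\<close> in \<open>F\<close> on \<open>\<omega> \<otimes> K\<close>: writing \<open>b = b' / p\<^sup>m\<close> with \<open>b'\<close> integral,
  it is \<open>p\<^sup>-\<^sup>m\<close> times the action of \<open>b'\<close>; the choice of \<open>m\<close> does not matter.\<close>

definition omega_K_act ::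
  "nat \<Rightarrow> ('k, 'm) ring_scheme \<Rightarrow> ('k \<Rightarrow> ereal) \<Rightarrow> 'f ring \<Rightarrow> ('k \<Rightarrow> 'f) \<Rightarrow>
   (nat \<Rightarrow> ('k, 'a) hopf) \<Rightarrow> (nat \<Rightarrow> 'a \<Rightarrow> 'a) \<Rightarrow> ('f \<Rightarrow> nat \<Rightarrow> 'a \<Rightarrow> 'a) \<Rightarrow> 'f
     \<Rightarrow> ((nat \<Rightarrow> 'a set) \<times> 'k) list set \<Rightarrow> ((nat \<Rightarrow> 'a set) \<times> 'k) list set" where
  "omega_K_act p K v F j A res \<iota> b C =
     (let R = val_ring K v; M = omega R A res;
          m = (LEAST m. nat_in F (p ^ m) \<otimes>\<^bsub>F\<^esub> b \<in> carrier (int_ring K v F j (carrier F)))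
      in inv\<^bsub>K\<^esub> (nat_in K (p ^ m)) \<odot>\<^bsub>base_change R K M\<^esub>
           base_change_map R K M (omega_map R A (\<iota> (nat_in F (p ^ m) \<otimes>\<^bsub>F\<^esub> b))) C)"

definition omega_K ::
  "nat \<Rightarrow> ('k, 'm) ring_scheme \<Rightarrow> ('k \<Rightarrow> ereal) \<Rightarrow> 'f ring \<Rightarrow> ('k \<Rightarrow> 'f) \<Rightarrow>
   (nat \<Rightarrow> ('k, 'a) hopf) \<Rightarrow> (nat \<Rightarrow> 'a \<Rightarrow> 'a) \<Rightarrow> ('f \<Rightarrow> nat \<Rightarrow> 'a \<Rightarrow> 'a) \<Rightarrow> ('f \<Rightarrow> 'k)
     \<Rightarrow> ('k, ((nat \<Rightarrow> 'a set) \<times> 'k) list set) module" where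
  "omega_K p K v F j A res \<iota> \<tau> =
     (let V = base_change (val_ring K v) K (omega (val_ring K v) A res) in
      V\<lparr>carrier := {C \<in> carrier V. \<forall>b\<in>carrier F. omega_K_act p K v F j A res \<iota> b C = \<tau> b \<odot>\<^bsub>V\<^esub> C}\<rparr>)"

definition PR ::
  "nat \<Rightarrow> ('k, 'm) ring_scheme \<Rightarrow> ('k \<Rightarrow> ereal) \<Rightarrow> 'f ring \<Rightarrow> ('k \<Rightarrow> 'f) \<Rightarrow> nat \<Rightarrow>
   (nat \<Rightarrow> ('k, 'a) hopf) \<Rightarrow> (nat \<Rightarrow> 'a \<Rightarrow> 'a) \<Rightarrow> ('f \<Rightarrow> nat \<Rightarrow> 'a \<Rightarrow> 'a) \<Rightarrow> real \<Rightarrow> real" where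
  "PR p K v F j d A res \<iota> x =
     (1 / real d) * (\<Sum>\<tau>\<in>embeddings K v F j (carrier F) (carrier K).
                       min x (real (vdim K (omega_K p K v F j A res \<iota> \<tau>))))"

end

(* Fix an embedding u of the maximal unramified subextension, let L be the u-part of omega_H, so that
L / pi L is the sum of the O_K / a_i, and let m <= n. Lift generators of the first m summands to
y_1, ..., y_m and let N be the O_K[pi]-submodule of L that they span. An eigenspace of pi in N_K is
spanned by the m projections of the y_i, so it has dimension at most min(m, r_tau), where tau is the
embedding of F above u with tau(pi) the eigenvalue. The pairs (x, z), where x in N has the class of z
in L / pi L, form a lattice; comparing its degree in two orders of the coordinates bounds
v(a_1) + ... + v(a_m) by v(det(pi | N_K)) = dim(N_K) / e, with equality for m = n. Averaging over u
and using d = e f gives the inequality of polygons at the integer m; both polygons are affine in between. *)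
theory Submission
 imports Defs "Jordan_Normal_Form.Missing_VectorSpace"
begin

\<comment> \<open>The value group of \<open>K\<close> may be dense, so a lattice over the valuation
  ring need not be finitely generated and has no determinant to compare. Its degree is built one
  coordinate at a time: the infimum of the valuations of a coordinate, plus the degree of the
  sublattice where that coordinate vanishes. Independence of the order of the coordinates takes over
  the role of the determinant. The same comparison with the two blocks of coordinates exchanged
  gives the opposite bound behind the equality for m = n. It also bounds every eigenspace of [pi] by
  n; since the basis of omega_H may be infinite a priori, this bound is what gives r_tau a meaning.
  The factor 1/e is the valuation of tau(pi), the same for all tau because (p) = (pi^e) in O_F. The
  sums over u combine into a sum over all tau because tau, restricted to the maximal unramified
  subextension, takes values in K_0: an integer c of that subextension satisfies c^q = c + p x with
  q the order of the residue field of F, so tau(c) is a p-adic limit of elements of W(k).\<close>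
text \<open>Index arguments of one token may be written \<open>x \<oplus>\<^sub>K y\<close> instead of \<open>x \<oplus>\<^bsub>K\<^esub> y\<close>.\<close>

syntax "_subscript_index" :: "logic => index" ("(\<open>unbreakable\<close>\<^sub>_)" [1000] 1000)
translations "_subscript_index x" \<rightharpoonup> "_index x"

section \<open>Valued fields\<close>

locale valued_field = field K for K :: "('k, 'm) ring_scheme" (structure) +
 fixes v :: "'k => ereal"
 assumes v_not_MInf: "x \<in> carrier K ==> v x \<noteq> -\<infinity>"
  and v_PInf_iff: "x \<in> carrier K ==> v x = \<infinity> \<longleftrightarrow> x = \<zero>"
  and v_mult: "x \<in> carrier K ==> y \<in> carrier K ==> v (x \<otimes> y) = v x + v y"
  and v_add: "x \<in> carrier K ==> y \<in> carrier K ==> min (v x) (v y) \<le> v (x \<oplus> y)"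
begin

text \<open>\<open>real_of_ereal\<close> sends \<infinity> to 0, so \<open>rv \<zero>\<close> is 0.
  The laws for \<open>rv\<close> therefore ask for nonzero arguments.\<close>

definition rv :: "'k => real" where "rv x = real_of_ereal (v x)"

abbreviation vint :: "'k set" where "vint \<equiv> {x \<in> carrier K. 0 \<le> v x}"

lemma v_zero [simp]: "v \<zero> = \<infinity>"
 using v_PInf_iff by simp

lemma v_rv: "x \<in> carrier K ==> x \<noteq> \<zero> ==> v x = ereal (rv x)"
 unfolding rv_def using v_not_MInf v_PInf_iff by (cases "v x") auto

lemma rv_mult:
 "x \<in> carrier K ==> y \<in> carrier K ==> x \<noteq> \<zero> ==> y \<noteq> \<zero> ==> rv (x \<otimes> y) = rv x + rv y"
 using v_rv[of x] v_rv[of y] v_mult[of x y]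
 by (metis plus_ereal.simps(1) real_of_ereal.simps(1) rv_def)

lemma v_one [simp]: "v \<one> = 0"
 using v_rv[of \<one>] rv_mult[of \<one> \<one>] by simp

lemma rv_one [simp]: "rv \<one> = 0"
 by (simp add: rv_def)

text \<open>The square of \<open>\<ominus> \<one>\<close> is \<open>\<one>\<close>, so twice its
  valuation is 0.\<close>

lemma v_neg [simp]: assumes "x \<in> carrier K" shows "v (\<ominus> x) = v x"
proof -
 have "rv (\<ominus> \<one>) + rv (\<ominus> \<one>) = rv (\<ominus> \<one> \<otimes> \<ominus> \<one>)"
  by (rule rv_mult[symmetric]) (auto simp: add.inv_eq_1_iff)
 hence "rv (\<ominus> \<one>) = 0"
  by (simp add: l_minus)
 hence "v (\<ominus> \<one>) = 0"
  using v_rv[of "\<ominus> \<one>"] by (metis add.inv_closed add.inv_eq_1_iff one_closed one_not_zero zero_ereal_def)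
 thus ?thesis
  using v_mult[of "\<ominus> \<one>" x] assms by (simp add: l_minus)
qed

lemma v_diff: "x \<in> carrier K ==> y \<in> carrier K ==> min (v x) (v y) \<le> v (x \<ominus> y)"
 using v_add[of x "\<ominus> y"] by (simp add: a_minus_def)

lemma v_add_ge: "x \<in> carrier K ==> y \<in> carrier K ==> r \<le> v x ==> r \<le> v y ==> r \<le> v (x \<oplus> y)"
 using v_add[of x y] by (metis min.bounded_iff order_trans)

lemma v_diff_ge: "x \<in> carrier K ==> y \<in> carrier K ==> r \<le> v x ==> r \<le> v y ==> r \<le> v (x \<ominus> y)"
 using v_diff[of x y] by (metis min.bounded_iff order_trans)

lemma v_minus_commute: "x \<in> carrier K ==> y \<in> carrier K ==> v (x \<ominus> y) = v (y \<ominus> x)"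
 using v_neg[of "x \<ominus> y"] by (simp add: minus_minus minus_add a_minus_def add.m_comm)

text \<open>If \<open>x \<oplus> y\<close> had larger valuation than \<open>x\<close>, then
  \<open>x = (x \<oplus> y) \<ominus> y\<close> would be a difference of two elements of larger
  valuation.\<close>

lemma v_add_eq:
 assumes "x \<in> carrier K" "y \<in> carrier K" "v x < v y"
 shows "v (x \<oplus> y) = v x"
proof -
 have "x = (x \<oplus> y) \<ominus> y"
  using assms by (simp add: a_minus_def a_assoc r_neg)
 hence "min (v (x \<oplus> y)) (v y) \<le> v x"
  using v_diff[of "x \<oplus> y" y] assms by simp
 thus ?thesis
  using v_add[of x y] assms by (auto simp: min_def split: if_splits)
qed

lemma inv_nonzero:
 assumes "x \<in> carrier K" "x \<noteq> \<zero>"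
 shows "inv x \<in> carrier K" "inv x \<noteq> \<zero>" "x \<otimes> inv x = \<one>" "inv x \<otimes> x = \<one>"
proof -
 have "x \<in> Units K"
  using assms field_Units by simp
 thus "inv x \<in> carrier K" "x \<otimes> inv x = \<one>" "inv x \<otimes> x = \<one>"
  by (auto simp: Units_inv_closed Units_r_inv Units_l_inv)
 thus "inv x \<noteq> \<zero>"
  using assms by auto
qed

lemma rv_inv: "x \<in> carrier K ==> x \<noteq> \<zero> ==> rv (inv x) = - rv x"
 using rv_mult[of x "inv x"] inv_nonzero[of x] by simp

lemma v_divides:
 assumes "x \<in> carrier K" "y \<in> carrier K" "x \<noteq> \<zero>" "v x \<le> v y"
 obtains t where "t \<in> vint" "y = t \<otimes> x"
proof
 show "y = (y \<otimes> inv x) \<otimes> x"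
  using assms inv_nonzero[of x] by (simp add: m_assoc)
 show "y \<otimes> inv x \<in> vint"
 proof (cases "y = \<zero>")
  case False
  hence "rv x \<le> rv y"
   using assms v_rv[of x] v_rv[of y] by simp
  moreover have "y \<otimes> inv x \<noteq> \<zero>"
   using False assms inv_nonzero[of x] integral by blast
  ultimately show ?thesis
   using assms inv_nonzero[of x] False v_rv[of "y \<otimes> inv x"] rv_mult[of y "inv x"] rv_inv[of x]
   by simp
 qed (use assms inv_nonzero[of x] in simp)
qed

lemma v_pow: "x \<in> carrier K ==> v (x [^] (n::nat)) = ereal (real n) * v x"
proof (induction n)
 case (Suc n)
 show ?case
 proof (cases "x = \<zero>")
  case False
  thus ?thesis
   using Suc v_rv[of x] by (simp add: v_mult distrib_right)
 qed (use Suc in \<open>simp add: v_mult\<close>)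
qed (simp add: zero_ereal_def[symmetric])

lemma vint_add: "x \<in> vint ==> y \<in> vint ==> x \<oplus> y \<in> vint"
 using v_add_ge by auto

lemma vint_mult: "x \<in> vint ==> y \<in> vint ==> x \<otimes> y \<in> vint"
 by (auto simp: v_mult)

lemma subring_vint: "subring vint K"
 by (rule subringI) (auto intro: v_add_ge simp: v_mult)

end

subsection \<open>Degrees of lattices with respect to an ordered set of coordinates\<close>

context valued_field
begin

definition int_submodule :: "('i => 'k) set => bool" where
 "int_submodule R \<longleftrightarrow>
   (\<forall>c\<in>R. \<forall>i. c i \<in> carrier K) \<and>
   (\<forall>c\<in>R. \<forall>c'\<in>R. (\<lambda>i. c i \<oplus> c' i) \<in> R) \<and>
   (\<forall>t\<in>vint. \<forall>c\<in>R. (\<lambda>i. t \<otimes> c i) \<in> R)"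

text \<open>Vectors are functions on the whole index type and only the coordinates in
  \<open>I\<close> are controlled. One set \<open>R\<close> is thus a lattice for every subset of
  \<open>I\<close> at once, and its degree over a sublist of coordinates is the degree of a
  projection. The last condition expresses full rank without a basis.\<close>

definition lattice_on :: "'i set => ('i => 'k) set => bool" where
 "lattice_on I R \<longleftrightarrow>
   int_submodule R \<and>
   (\<forall>i\<in>I. \<exists>B::real. \<forall>c\<in>R. ereal B \<le> v (c i)) \<and>
   (\<forall>i\<in>I. \<exists>c\<in>R. c i \<noteq> \<zero> \<and> (\<forall>j\<in>I - {i}. c j = \<zero>))"

text \<open>The infimum is not attained in general, the value group being possibly dense; hence the
  approximation \<open>cinf_approx\<close> and the arguments with a small error.\<close>

definition cinf :: "'i => ('i => 'k) set => real" where
 "cinf i R = Inf {rv (c i) | c. c \<in> R \<and> c i \<noteq> \<zero>}"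

text \<open>For a lattice with a basis that is triangular in the order of the list, this is the sum
  of the valuations of the diagonal entries, that is, the valuation of the determinant.\<close>

primrec lattice_deg :: "'i list => ('i => 'k) set => real" where
 "lattice_deg [] R = 0"
| "lattice_deg (i # is) R = cinf i R + lattice_deg is {c \<in> R. c i = \<zero>}"

lemma int_submoduleD:
 assumes "int_submodule R"
 shows "c \<in> R ==> c i \<in> carrier K"
  and "c \<in> R ==> c' \<in> R ==> (\<lambda>i. c i \<oplus> c' i) \<in> R"
  and "t \<in> vint ==> c \<in> R ==> (\<lambda>i. t \<otimes> c i) \<in> R"
 using assms unfolding int_submodule_def by blast+

lemma int_submodule_diff:
 assumes R: "int_submodule R" and c: "c \<in> R" "c' \<in> R"
 shows "(\<lambda>i. c i \<ominus> c' i) \<in> R"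
proof -
 have "(\<lambda>i. c i \<oplus> (\<ominus> \<one> \<otimes> c' i)) \<in> R"
  using int_submoduleD(2,3)[OF R] c by simp
 moreover have "(\<lambda>i. c i \<oplus> (\<ominus> \<one> \<otimes> c' i)) = (\<lambda>i. c i \<ominus> c' i)"
  using int_submoduleD(1)[OF R] c by (auto simp: l_minus a_minus_def)
 ultimately show ?thesis by simp
qed

lemma int_submodule_restrict:
 assumes "int_submodule R" shows "int_submodule {c \<in> R. c i = \<zero>}"
 using assms unfolding int_submodule_def by auto

lemma lattice_on_restrict:
 assumes R: "lattice_on (insert i I) R" and i: "i \<notin> I"
 shows "lattice_on I {c \<in> R. c i = \<zero>}"
proof -
 have "\<exists>c\<in>{c \<in> R. c i = \<zero>}. c j \<noteq> \<zero> \<and> (\<forall>l\<in>I - {j}. c l = \<zero>)" if j: "j \<in> I" for j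
 proof -
  obtain c where "c \<in> R" "c j \<noteq> \<zero>" "\<forall>l\<in>insert i I - {j}. c l = \<zero>"
   using R j unfolding lattice_on_def by blast
  thus ?thesis using i j by blast
 qed
 thus ?thesis
  using R int_submodule_restrict[of R i] unfolding lattice_on_def by blast
qed

lemma lattice_on_mono:
 assumes "lattice_on I R" "J \<subseteq> I" shows "lattice_on J R"
proof -
 have "\<exists>c\<in>R. c i \<noteq> \<zero> \<and> (\<forall>j\<in>J - {i}. c j = \<zero>)" if "i \<in> J" for i
 proof -
  obtain c where "c \<in> R" "c i \<noteq> \<zero>" "\<forall>j\<in>I - {i}. c j = \<zero>"
   using assms \<open>i \<in> J\<close> unfolding lattice_on_def by blast
  thus ?thesis using assms(2) by blast
 qed
 thus ?thesis
  using assms unfolding lattice_on_def by blast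
qed

lemma cinf_le:
 assumes R: "lattice_on I R" and i: "i \<in> I" and c: "c \<in> R" "c i \<noteq> \<zero>"
 shows "cinf i R \<le> rv (c i)"
proof -
 obtain B :: real where B: "\<forall>c\<in>R. ereal B \<le> v (c i)"
  using R i unfolding lattice_on_def by blast
 have "B \<le> rv (c' i)" if "c' \<in> R" "c' i \<noteq> \<zero>" for c'
  using B that R v_rv[of "c' i"] unfolding lattice_on_def int_submodule_def by fastforce
 hence "bdd_below {rv (c i) | c. c \<in> R \<and> c i \<noteq> \<zero>}"
  by (intro bdd_belowI[of _ B]) auto
 thus ?thesis
  unfolding cinf_def using c by (intro cInf_lower) auto
qed

lemma cinf_ge:
 assumes R: "lattice_on I R" and i: "i \<in> I"
  and B: "!!c. c \<in> R ==> c i \<noteq> \<zero> ==> B \<le> rv (c i)"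
 shows "B \<le> cinf i R"
proof -
 obtain c where "c \<in> R" "c i \<noteq> \<zero>"
  using R i unfolding lattice_on_def by blast
 thus ?thesis
  unfolding cinf_def using B by (intro cInf_greatest) auto
qed

lemma cinf_approx:
 assumes R: "lattice_on I R" and i: "i \<in> I" and e: "0 < e"
 obtains c where "c \<in> R" "c i \<noteq> \<zero>" "rv (c i) < cinf i R + e"
 using cinf_ge[OF R i, of "cinf i R + e"] e by fastforce

text \<open>A vector \<open>p\<close> nearly minimal in both coordinates is compared with a vector
  \<open>q\<close> that vanishes at \<open>j\<close> and is nearly minimal at \<open>i\<close>. One
  of \<open>p i\<close> and \<open>q i\<close> divides the other, and eliminating coordinate
  \<open>i\<close> gives a vector of the kernel of \<open>i\<close> whose entry at \<open>j\<close>
  bounds the infimum there. The error \<open>e\<close> is the price of near minimality.\<close>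

lemma cinf_swap_le:
 assumes R: "lattice_on I R" and ij: "i \<in> I" "j \<in> I" "i \<noteq> j"
 shows "cinf i R + cinf j {c \<in> R. c i = \<zero>} \<le> cinf j R + cinf i {c \<in> R. c j = \<zero>}"
proof (rule field_le_epsilon)
 fix e :: real assume e: "0 < e"
 define d where "d = e / 2"
 have d: "0 < d" "e = d + d" using e by (auto simp: d_def)
 have sub: "int_submodule R" using R by (simp add: lattice_on_def)
 note cl = int_submoduleD(1)[OF sub]
 have Rj: "lattice_on (I - {j}) {c \<in> R. c j = \<zero>}" and Ri: "lattice_on (I - {i}) {c \<in> R. c i = \<zero>}"
  using ij R by (auto intro!: lattice_on_restrict simp: insert_absorb)
 \<comment> \<open>If neither \<open>c\<close> nor \<open>c'\<close> is nearly minimal in both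
   coordinates, each is strictly smaller than the other in its own coordinate, so their sum keeps
   both valuations.\<close>
 obtain p where p: "p \<in> R" "p i \<noteq> \<zero>" "p j \<noteq> \<zero>" "rv (p i) < cinf i R + d" "rv (p j) < cinf j R + d"
 proof -
  obtain c where c: "c \<in> R" "c i \<noteq> \<zero>" "rv (c i) < cinf i R + d"
   using cinf_approx[OF R ij(1) d(1)] .
  obtain c' where c': "c' \<in> R" "c' j \<noteq> \<zero>" "rv (c' j) < cinf j R + d"
   using cinf_approx[OF R ij(2) d(1)] .
  have s: "(\<lambda>l. c l \<oplus> c' l) \<in> R"
   using int_submoduleD(2)[OF sub] c c' by blast
  have vc: "v (c i) = ereal (rv (c i))" "v (c' j) = ereal (rv (c' j))"
   using v_rv c c' cl by auto
  consider "c j \<noteq> \<zero> \<and> rv (c j) < cinf j R + d" | "c' i \<noteq> \<zero> \<and> rv (c' i) < cinf i R + d"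
   | "v (c' j) < v (c j)" "v (c i) < v (c' i)"
  proof -
   have *: "v (c' j) < v (c j)" if "\<not> (c j \<noteq> \<zero> \<and> rv (c j) < cinf j R + d)"
    using that c' vc cl[OF c(1), of j] v_rv[of "c j"] by (cases "c j = \<zero>") auto
   have "v (c i) < v (c' i)" if "\<not> (c' i \<noteq> \<zero> \<and> rv (c' i) < cinf i R + d)"
    using that c vc cl[OF c'(1), of i] v_rv[of "c' i"] by (cases "c' i = \<zero>") auto
   thus thesis using * that by blast
  qed
  thus thesis
  proof cases
   case 3
   have e: "v (c i \<oplus> c' i) = v (c i)" "v (c j \<oplus> c' j) = v (c' j)"
    using v_add_eq[of "c i" "c' i"] v_add_eq[of "c' j" "c j"] 3 cl c c' by (auto simp: add.m_comm)
   hence "c i \<oplus> c' i \<noteq> \<zero>" "c j \<oplus> c' j \<noteq> \<zero>"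
    using vc by auto
   moreover have "rv (c i \<oplus> c' i) = rv (c i)" "rv (c j \<oplus> c' j) = rv (c' j)"
    unfolding rv_def e by simp_all
   ultimately show thesis
    using that[OF s] c(3) c'(3) by simp
  qed (use c c' that in blast)+
 qed
 obtain q where q: "q \<in> R" "q j = \<zero>" "q i \<noteq> \<zero>" "rv (q i) < cinf i {c \<in> R. c j = \<zero>} + d"
  using cinf_approx[OF Rj, of i d] ij d by blast
 have vp: "v (p i) = ereal (rv (p i))" and vq: "v (q i) = ereal (rv (q i))"
  using v_rv p q cl by auto
 have le1: "cinf i R \<le> cinf i {c \<in> R. c j = \<zero>}"
  using ij by (intro cinf_ge[OF Rj]) (auto intro: cinf_le[OF R])
 have le2: "cinf i R \<le> rv (p i)"
  using cinf_le[OF R ij(1)] p by blast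
 show "cinf i R + cinf j {c \<in> R. c i = \<zero>} \<le> cinf j R + cinf i {c \<in> R. c j = \<zero>} + e"
 proof (cases "v (p i) \<le> v (q i)")
  case True
  obtain t where t: "t \<in> vint" "q i = t \<otimes> p i"
   using v_divides[OF cl[OF p(1)] cl[OF q(1)] p(2) True] .
  \<comment> \<open>The factor \<open>t\<close> raises the entry of \<open>p\<close> at
    \<open>j\<close> by \<open>rv (q i) - rv (p i)\<close>; the loss of \<open>rv (p i)\<close> is
    balanced by \<open>cinf i R \<le> rv (p i)\<close>.\<close>
  define z where "z = (\<lambda>l. t \<otimes> p l \<ominus> q l)"
  have t0: "t \<noteq> \<zero>" using t q cl[OF p(1)] by auto
  have z: "z \<in> {c \<in> R. c i = \<zero>}"
   unfolding z_def using t p q cl int_submodule_diff[OF sub] int_submoduleD(3)[OF sub]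
   by (auto simp: a_minus_def r_neg)
  have zj: "z j = t \<otimes> p j"
   using cl p q t by (auto simp: z_def a_minus_def)
  have "z j \<noteq> \<zero>" using zj t0 p cl t integral by auto
  hence "cinf j {c \<in> R. c i = \<zero>} \<le> rv (z j)"
   using cinf_le[OF Ri, of j z] z ij by blast
  also have "\<dots> = rv t + rv (p j)"
   unfolding zj using t0 t p cl by (intro rv_mult) auto
  also have "rv t = rv (q i) - rv (p i)"
   using rv_mult[of t "p i"] t t0 p cl by auto
  finally show ?thesis
   using p q le2 d by linarith
 next
  case False
  hence "v (q i) \<le> v (p i)" by simp
  then obtain t where t: "t \<in> vint" "p i = t \<otimes> q i"
   using v_divides[OF cl[OF q(1)] cl[OF p(1)] q(3)] by blast
  \<comment> \<open>Now \<open>q\<close> carries the factor \<open>t\<close>. Since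
    \<open>q j\<close> is zero, the entry of \<open>p\<close> at \<open>j\<close> survives
    unchanged.\<close>
  define z where "z = (\<lambda>l. p l \<ominus> t \<otimes> q l)"
  have z: "z \<in> {c \<in> R. c i = \<zero>}"
   unfolding z_def using t p q cl int_submodule_diff[OF sub] int_submoduleD(3)[OF sub]
   by (auto simp: a_minus_def r_neg)
  have zj: "z j = p j"
   using cl p q t by (auto simp: z_def a_minus_def)
  hence "cinf j {c \<in> R. c i = \<zero>} \<le> rv (p j)"
   using cinf_le[OF Ri, of j z] z ij p by auto
  thus ?thesis
   using p le1 d by linarith
 qed
qed

lemma deg_swap:
 assumes "lattice_on (set (i # j # is)) R" "distinct (i # j # is)"
 shows "lattice_deg (i # j # is) R = lattice_deg (j # i # is) R"
proof -
 have "{c \<in> {c \<in> R. c i = \<zero>}. c j = \<zero>} = {c \<in> {c \<in> R. c j = \<zero>}. c i = \<zero>}"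
  by auto
 thus ?thesis
  using cinf_swap_le[OF assms(1), of i j] cinf_swap_le[OF assms(1), of j i] assms(2)
  by (auto simp: conj_commute)
qed

lemma deg_move:
 assumes "lattice_on (set (xs @ i # ys)) R" "distinct (xs @ i # ys)"
 shows "lattice_deg (xs @ i # ys) R = lattice_deg (i # xs @ ys) R"
 using assms
proof (induction xs arbitrary: R)
 case (Cons x xs)
 have "lattice_deg ((x # xs) @ i # ys) R = cinf x R + lattice_deg (i # xs @ ys) {c \<in> R. c x = \<zero>}"
  using Cons.prems Cons.IH[of "{c \<in> R. c x = \<zero>}"] lattice_on_restrict[of x "set (xs @ i # ys)" R]
  by simp
 also have "\<dots> = lattice_deg (x # i # xs @ ys) R"
  by simp
 also have "\<dots> = lattice_deg (i # x # xs @ ys) R"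
  using Cons.prems by (intro deg_swap) (auto simp: insert_commute)
 finally show ?case by simp
qed simp

lemma deg_append_commute:
 assumes "lattice_on (set xs \<union> set ys) R" "distinct (xs @ ys)"
 shows "lattice_deg (xs @ ys) R = lattice_deg (ys @ xs) R"
 using assms
proof (induction xs arbitrary: R)
 case (Cons x xs)
 have "lattice_deg ((x # xs) @ ys) R = cinf x R + lattice_deg (ys @ xs) {c \<in> R. c x = \<zero>}"
  using Cons.prems Cons.IH[of "{c \<in> R. c x = \<zero>}"] lattice_on_restrict[of x "set xs \<union> set ys" R]
  by simp
 also have "\<dots> = lattice_deg (x # ys @ xs) R"
  by simp
 also have "\<dots> = lattice_deg (ys @ x # xs) R"
  using Cons.prems by (intro deg_move[symmetric]) (auto simp: Un_commute)
 finally show ?case by simp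
qed simp

text \<open>Additivity of the degree in an exact sequence: the first term is the degree of the
  projection to the block \<open>xs\<close>, the second that of the kernel of this
  projection.\<close>

lemma deg_append:
 "lattice_deg (xs @ ys) R = lattice_deg xs R + lattice_deg ys {c \<in> R. \<forall>i\<in>set xs. c i = \<zero>}"
proof (induction xs arbitrary: R)
 case (Cons x xs)
 have "{c \<in> {c \<in> R. c x = \<zero>}. \<forall>i\<in>set xs. c i = \<zero>} = {c \<in> R. \<forall>i\<in>set (x # xs). c i = \<zero>}"
  by auto
 thus ?case by (simp add: Cons.IH)
qed simp

text \<open>Scaling by \<open>l\<close> shifts the infimum of coordinate \<open>i\<close> by
  \<open>rv (l i)\<close>, and a lattice containing the scaled vectors can only have smaller infima.
  Induction passes to the kernel of the leading coordinate, which scaling preserves.\<close>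

lemma deg_compare:
 assumes "lattice_on (set xs) R" "lattice_on (set xs) R'" "distinct xs"
  and "!!i. i \<in> set xs ==> l i \<in> carrier K \<and> l i \<noteq> \<zero>"
  and "!!c. c \<in> R ==> \<exists>c'\<in>R'. \<forall>i\<in>set xs. c' i = l i \<otimes> c i"
 shows "lattice_deg xs R' \<le> lattice_deg xs R + (\<Sum>i\<in>set xs. rv (l i))"
 using assms
proof (induction xs arbitrary: R R')
 case (Cons x xs)
 note lx = Cons.prems(4)[of x, simplified]
 have cl: "c i \<in> carrier K" if "c \<in> R" for c i
  using Cons.prems(1) that unfolding lattice_on_def int_submodule_def by blast
 have "cinf x R' - rv (l x) \<le> cinf x R"
 proof (rule cinf_ge[OF Cons.prems(1)])
  fix c assume c: "c \<in> R" "c x \<noteq> \<zero>"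
  then obtain c' where c': "c' \<in> R'" "c' x = l x \<otimes> c x"
   using Cons.prems(5) by auto
  have "c' x \<noteq> \<zero>" using c' c lx cl integral by auto
  hence "cinf x R' \<le> rv (c' x)"
   using c'(1) cinf_le[OF Cons.prems(2), of x c'] by simp
  also have "\<dots> = rv (l x) + rv (c x)"
   unfolding c'(2) using c lx cl by (intro rv_mult) auto
  finally show "cinf x R' - rv (l x) \<le> rv (c x)" by simp
 qed simp
 moreover have "lattice_deg xs {c \<in> R'. c x = \<zero>} \<le> lattice_deg xs {c \<in> R. c x = \<zero>} + (\<Sum>i\<in>set xs. rv (l i))"
 proof (rule Cons.IH)
  show "\<exists>c'\<in>{c \<in> R'. c x = \<zero>}. \<forall>i\<in>set xs. c' i = l i \<otimes> c i" if "c \<in> {c \<in> R. c x = \<zero>}" for c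
   using Cons.prems(5)[of c] that lx by auto
 qed (use Cons.prems in \<open>auto intro!: lattice_on_restrict\<close>)
 ultimately show ?case
  using Cons.prems(3) by simp
qed simp

text \<open>The degree of \<open>R\<close> is computed twice, through the two orders of the blocks \<open>ws\<close> and \<open>xs\<close> of
 coordinates.\<close>

theorem sum_valuations_le:
 assumes lat: "lattice_on (set ws \<union> set xs) R" and dist: "distinct (ws @ xs)"
  and l: "!!i. i \<in> set ws ==> l i \<in> carrier K \<and> l i \<noteq> \<zero>"
  and a: "!!i. i \<in> set xs ==> a i \<in> carrier K \<and> a i \<noteq> \<zero>"
  and scale_ws: "!!c. c \<in> R ==> \<exists>c'\<in>R. (\<forall>i\<in>set xs. c' i = \<zero>) \<and> (\<forall>i\<in>set ws. c' i = l i \<otimes> c i)"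
  and scale_xs: "!!c. c \<in> R ==> \<forall>i\<in>set ws. c i = \<zero> ==> \<exists>c'\<in>R. \<forall>i\<in>set xs. c i = a i \<otimes> c' i"
 shows "(\<Sum>i\<in>set xs. rv (a i)) \<le> (\<Sum>i\<in>set ws. rv (l i))"
proof -
 \<comment> \<open>\<open>?D\<close> and \<open>?E\<close> are the intersections of \<open>R\<close>
   with the kernels of the blocks \<open>ws\<close> and \<open>xs\<close>. Dividing by
   \<open>a\<close> sends \<open>?D\<close> into the projection of \<open>R\<close> to
   \<open>xs\<close>, and multiplying by \<open>l\<close> sends the projection of \<open>R\<close>
   to \<open>ws\<close> into \<open>?E\<close>. In either order of the blocks the total degree is
   that of a projection plus that of an intersection.\<close>
 let ?D = "{c \<in> R. \<forall>i\<in>set ws. c i = \<zero>}" and ?E = "{c \<in> R. \<forall>i\<in>set xs. c i = \<zero>}"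
 have R: "lattice_on (set ws) R" "lattice_on (set xs) R"
  using lattice_on_mono[OF lat] by auto
 have sub: "lattice_on Y {c \<in> R. \<forall>i\<in>set zs. c i = \<zero>}"
  if "lattice_on (set zs \<union> Y) R" "distinct zs" "set zs \<inter> Y = {}" for zs Y and R :: "('b => 'k) set"
  using that
 proof (induction zs arbitrary: R)
  case (Cons z zs)
  have "{c \<in> {c \<in> R. c z = \<zero>}. \<forall>i\<in>set zs. c i = \<zero>} = {c \<in> R. \<forall>i\<in>set (z # zs). c i = \<zero>}"
   by auto
  thus ?case
   using Cons.IH[of "{c \<in> R. c z = \<zero>}"] Cons.prems lattice_on_restrict[of z "set zs \<union> Y" R] by auto
 qed simp
 have D: "lattice_on (set xs) ?D" and E: "lattice_on (set ws) ?E"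
  using sub[of ws "set xs" R] sub[of xs "set ws" R] lat dist by (auto simp: Un_commute Int_commute)
 have "lattice_deg xs R \<le> lattice_deg xs ?D + (\<Sum>i\<in>set xs. rv (inv (a i)))"
 proof (rule deg_compare[OF D R(2)])
  show "\<exists>c'\<in>R. \<forall>i\<in>set xs. c' i = inv (a i) \<otimes> c i" if "c \<in> ?D" for c
  proof -
   obtain c' where c': "c' \<in> R" "\<forall>i\<in>set xs. c i = a i \<otimes> c' i"
    using scale_xs[of c] \<open>c \<in> ?D\<close> by blast
   have "c' i \<in> carrier K" for i
    using c' lat unfolding lattice_on_def int_submodule_def by blast
   hence "\<forall>i\<in>set xs. c' i = inv (a i) \<otimes> c i"
    using c' a inv_nonzero by (simp add: m_assoc[symmetric])
   thus ?thesis using c' by blast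
  qed
 qed (use dist a inv_nonzero in auto)
 moreover have "(\<Sum>i\<in>set xs. rv (inv (a i))) = - (\<Sum>i\<in>set xs. rv (a i))"
  using a by (simp add: rv_inv sum_negf)
 moreover have "lattice_deg ws ?E \<le> lattice_deg ws R + (\<Sum>i\<in>set ws. rv (l i))"
 proof (rule deg_compare[OF R(1) E])
  show "\<exists>c'\<in>?E. \<forall>i\<in>set ws. c' i = l i \<otimes> c i" if "c \<in> R" for c
   using scale_ws[OF that] by blast
 qed (use dist l in auto)
 moreover have "lattice_deg ws R + lattice_deg xs ?D = lattice_deg xs R + lattice_deg ws ?E"
  using deg_append_commute[OF lat dist] deg_append by metis
 ultimately show ?thesis by linarith
qed

end

section \<open>Eigenvectors of commuting operators\<close>

lemma (in abelian_group) diff_zero_imp_eq: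
 assumes "a \<in> carrier G" "b \<in> carrier G" "a \<ominus> b = \<zero>" shows "a = b"
proof -
 have "a = (a \<ominus> b) \<oplus> b" using assms(1,2) by (simp add: a_minus_def a_assoc l_neg)
 thus ?thesis unfolding assms(3) using assms(2) by simp
qed

context vectorspace
begin

lemma smult_r_diff:
 "c \<in> carrier K ==> x \<in> carrier V ==> y \<in> carrier V ==> c \<odot>\<^sub>V (x \<ominus>\<^sub>V y) = c \<odot>\<^sub>V x \<ominus>\<^sub>V c \<odot>\<^sub>V y"
 by (simp add: a_minus_def smult_r_distr smult_r_minus)

lemma smult_l_diff:
 "c \<in> carrier K ==> d \<in> carrier K ==> x \<in> carrier V ==>
  (c \<ominus>\<^sub>K d) \<odot>\<^sub>V x = c \<odot>\<^sub>V x \<ominus>\<^sub>V d \<odot>\<^sub>V x"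
 by (simp add: a_minus_def smult_l_distr smult_l_minus)

lemma smult_cancel:
 assumes "c \<in> carrier K" "x \<in> carrier V" "c \<odot>\<^sub>V x = \<zero>\<^sub>V" "c \<noteq> \<zero>\<^sub>K"
 shows "x = \<zero>\<^sub>V"
proof -
 have c: "inv\<^bsub>K\<^esub> c \<in> carrier K" "inv\<^bsub>K\<^esub> c \<otimes>\<^sub>K c = \<one>\<^sub>K"
  using assms field.field_Units by (auto simp: field_Units Units_inv_closed Units_l_inv)
 have "x = inv\<^bsub>K\<^esub> c \<odot>\<^sub>V (c \<odot>\<^sub>V x)"
  using assms(1,2) c by (simp add: smult_assoc1[symmetric])
 thus ?thesis using assms(3) c by simp
qed

lemma smult_left_cancel:
 assumes c: "c \<in> carrier K" "c \<noteq> \<zero>\<^sub>K" and "x \<in> carrier V" "y \<in> carrier V" "c \<odot>\<^sub>V x = c \<odot>\<^sub>V y"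
 shows "x = y"
 using smult_cancel[of c "x \<ominus>\<^sub>V y"] smult_r_diff[of c x y] M.diff_zero_imp_eq[of x y] assms
 by (simp add: a_minus_def M.r_neg)

lemma smult_right_cancel:
 assumes "c \<in> carrier K" "d \<in> carrier K" "x \<in> carrier V" "x \<noteq> \<zero>\<^sub>V" "c \<odot>\<^sub>V x = d \<odot>\<^sub>V x"
 shows "c = d"
proof -
 have "(c \<ominus>\<^sub>K d) \<odot>\<^sub>V x = \<zero>\<^sub>V"
  unfolding smult_l_diff[OF assms(1-3)] using assms by (simp add: a_minus_def M.r_neg)
 hence "c \<ominus>\<^sub>K d = \<zero>\<^sub>K" using smult_cancel[of "c \<ominus>\<^sub>K d" x] assms by auto
 thus ?thesis using assms by simp
qed

lemma card_le_of_indpt: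
 assumes "finite A" "finite B" "B \<subseteq> carrier V" "lin_indpt A" "A \<subseteq> span B"
 shows "card A \<le> card B"
 using replacement[OF assms] by auto

lemma exists_indpt_subset:
 assumes "finite S" "S \<subseteq> carrier V"
 obtains W where "W \<subseteq> S" "lin_indpt W" "S \<subseteq> span W"
 using assms
proof (induction S arbitrary: thesis rule: finite_induct)
 case empty
 show ?case by (rule empty.prems) (auto simp: lin_dep_def)
next
 case (insert x S)
 obtain W where W: "W \<subseteq> S" "lin_indpt W" "S \<subseteq> span W"
  using insert by auto
 have WV: "W \<subseteq> carrier V" "x \<in> carrier V" using W insert.prems by auto
 show ?case
 proof (cases "x \<in> span W")
  case True
  thus ?thesis using insert.prems(1)[of W] W by auto
 next
  case False
  have "lin_indpt (W \<union> {x})"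
   using lin_dep_iff_in_span[OF WV(1) W(2) WV(2)] False in_own_span[OF WV(1)] by blast
  moreover have "insert x S \<subseteq> span (W \<union> {x})"
   using W(3) span_is_monotone[of W "W \<union> {x}"] in_own_span[of "W \<union> {x}"] WV by auto
  ultimately show ?thesis
   using insert.prems(1)[of "W \<union> {x}"] W by auto
 qed
qed

lemma lin_indpt_UN:
 assumes I: "finite I"
  and E: "!!i. i \<in> I ==> submodule K (E i) V"
  and direct: "!!f. (!!i. i \<in> I ==> f i \<in> E i) ==> (\<Oplus>\<^sub>V i\<in>I. f i) = \<zero>\<^sub>V ==> \<forall>i\<in>I. f i = \<zero>\<^sub>V"
  and W: "!!i. i \<in> I ==> finite (W i)" "!!i. i \<in> I ==> W i \<subseteq> E i" "!!i. i \<in> I ==> lin_indpt (W i)"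
 shows "lin_indpt (\<Union>i\<in>I. W i)" "card (\<Union>i\<in>I. W i) = (\<Sum>i\<in>I. card (W i))"
proof -
 have EV: "E i \<subseteq> carrier V" if "i \<in> I" for i
  using E[OF that] by (simp add: submodule_def)
 hence WV: "W i \<subseteq> carrier V" if "i \<in> I" for i using W(2) that by blast
 have disj: "W i \<inter> W l = {}" if il: "i \<in> I" "l \<in> I" "i \<noteq> l" for i l
 proof (rule ccontr)
  assume "W i \<inter> W l \<noteq> {}"
  then obtain w where w: "w \<in> W i" "w \<in> W l" by blast
  have wV: "w \<in> carrier V" using w WV il by blast
  have wl: "\<ominus>\<^sub>V w \<in> E l"
   using submodule.smult_closed[OF E[OF il(2)], of "\<ominus>\<^sub>K \<one>\<^sub>K" w] w W(2) il wV by (auto simp: smult_l_minus)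
  \<comment> \<open>A common vector \<open>w\<close> gives the relation w + (-w) = 0 with one term
    in \<open>E i\<close> and the other in \<open>E l\<close>.\<close>
  define f where "f = (\<lambda>k. if k = i then w else if k = l then \<ominus>\<^sub>V w else \<zero>\<^sub>V)"
  have fE: "f k \<in> E k" if "k \<in> I" for k
   using that w wl W(2) il submodule.zero_closed[OF E] unfolding f_def by auto
  have "(\<Oplus>\<^sub>V k\<in>I. f k) = (\<Oplus>\<^sub>V k\<in>{i, l}. f k)"
   using I il wV by (intro M.add.finprod_mono_neutral_cong_right) (auto simp: f_def)
  also have "\<dots> = \<zero>\<^sub>V"
   using il wV by (simp add: f_def M.r_neg)
  finally have "\<forall>k\<in>I. f k = \<zero>\<^sub>V"
   using direct[of f] fE by blast
  hence "w = \<zero>\<^sub>V" using il by (auto simp: f_def)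
  thus False
   using zero_nin_lin_indpt[OF WV W(3), of i] il w one_not_zero by (metis R.one_closed singletonD)
 qed
 show "card (\<Union>i\<in>I. W i) = (\<Sum>i\<in>I. card (W i))"
  using I W(1) disj by (intro card_UN_disjoint) auto
 show "lin_indpt (\<Union>i\<in>I. W i)"
 proof (rule finite_lin_indpt2)
  fix c assume c: "c \<in> (\<Union>i\<in>I. W i) \<rightarrow> carrier K" and z: "lincomb c (\<Union>i\<in>I. W i) = \<zero>\<^sub>V"
  have "lincomb c (\<Union>i\<in>I. W i) = (\<Oplus>\<^sub>V i\<in>I. lincomb c (W i))"
   unfolding lincomb_def using I W(1) disj c WV
   by (intro M.add.finprod_UN_disjoint) (fastforce simp: pairwise_def disjnt_def)+
  moreover have "lincomb c (W i) \<in> E i" if i: "i \<in> I" for i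
  proof -
   have "lincomb c (W i) \<in> span (W i)"
    unfolding span_def using W(1)[OF i] c i by auto
   thus ?thesis using span_is_subset[OF W(2)[OF i] E[OF i]] by blast
  qed
  ultimately have "\<forall>i\<in>I. lincomb c (W i) = \<zero>\<^sub>V"
   using direct[of "\<lambda>i. lincomb c (W i)"] z by metis
  thus "\<forall>w\<in>(\<Union>i\<in>I. W i). c w = \<zero>\<^sub>K"
   using lin_dep_crit[OF W(1) subset_refl, of _ c] W(3) c by blast
 qed (use I W(1) WV in auto)
qed

section \<open>Operators annihilated by a product of distinct linear factors\<close>

definition lin_op :: "('c => 'c) => bool" where
 "lin_op T \<longleftrightarrow> (\<forall>x\<in>carrier V. T x \<in> carrier V) \<and>
   (\<forall>x\<in>carrier V. \<forall>y\<in>carrier V. T (x \<oplus>\<^sub>V y) = T x \<oplus>\<^sub>V T y) \<and>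
   (\<forall>c\<in>carrier K. \<forall>x\<in>carrier V. T (c \<odot>\<^sub>V x) = c \<odot>\<^sub>V T x)"

lemma lin_opD:
 assumes "lin_op T"
 shows "x \<in> carrier V ==> T x \<in> carrier V"
  and "x \<in> carrier V ==> y \<in> carrier V ==> T (x \<oplus>\<^sub>V y) = T x \<oplus>\<^sub>V T y"
  and "c \<in> carrier K ==> x \<in> carrier V ==> T (c \<odot>\<^sub>V x) = c \<odot>\<^sub>V T x"
 using assms unfolding lin_op_def by blast+

lemma lin_op_zero: "lin_op T ==> T \<zero>\<^sub>V = \<zero>\<^sub>V"
 using lin_opD(3)[of T "\<zero>\<^sub>K" "\<zero>\<^sub>V"] lin_opD(1)[of T "\<zero>\<^sub>V"] by simp

lemma lin_op_diff:
 assumes "lin_op T" "x \<in> carrier V" "y \<in> carrier V"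
 shows "T (x \<ominus>\<^sub>V y) = T x \<ominus>\<^sub>V T y"
proof -
 have "\<ominus>\<^sub>V y = (\<ominus>\<^sub>K \<one>\<^sub>K) \<odot>\<^sub>V y" "\<ominus>\<^sub>V (T y) = (\<ominus>\<^sub>K \<one>\<^sub>K) \<odot>\<^sub>V T y"
  using assms lin_opD(1)[OF assms(1)] by (simp_all add: smult_l_minus)
 thus ?thesis
  using assms lin_opD[OF assms(1)] by (simp add: a_minus_def)
qed

lemma lin_op_finsum:
 assumes "lin_op T" "finite I" "!!i. i \<in> I ==> f i \<in> carrier V"
 shows "T (\<Oplus>\<^sub>V i\<in>I. f i) = (\<Oplus>\<^sub>V i\<in>I. T (f i))"
 using assms(2,3)
proof (induction I rule: finite_induct)
 case (insert i I)
 thus ?case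
  using lin_opD[OF assms(1)] by (simp add: Pi_iff M.finsum_closed)
qed (simp add: lin_op_zero assms)

text \<open>The monic polynomial with roots \<open>cs\<close>, evaluated at the operator
  \<open>T\<close>.\<close>

primrec op_prod :: "('c => 'c) => 'a list => 'c => 'c" where
 "op_prod T [] x = x"
| "op_prod T (c # cs) x = op_prod T cs (T x \<ominus>\<^sub>V c \<odot>\<^sub>V x)"

lemma lin_op_comp: "lin_op S ==> lin_op T ==> lin_op (\<lambda>x. S (T x))"
 unfolding lin_op_def by auto

lemma lin_op_shift:
 assumes T: "lin_op T" and m: "m \<in> carrier K" shows "lin_op (\<lambda>x. T x \<ominus>\<^sub>V m \<odot>\<^sub>V x)"
 unfolding lin_op_def using lin_opD[OF T] m
 by (simp add: a_minus_def smult_r_distr M.minus_add M.a_ac smult_r_minus smult_assoc1[symmetric] R.m_comm)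

lemma op_prod_lin_op: "lin_op T ==> set cs \<subseteq> carrier K ==> lin_op (op_prod T cs)"
proof (induction cs)
 case Nil
 thus ?case by (simp add: lin_op_def)
next
 case (Cons c cs)
 have "op_prod T (c # cs) = (\<lambda>x. op_prod T cs (T x \<ominus>\<^sub>V c \<odot>\<^sub>V x))" by auto
 thus ?case using Cons lin_op_comp[OF _ lin_op_shift[of T c]] by simp
qed

text \<open>The scalar \<open>d\<close> is the product of the \<open>m - c\<close>. It is nonzero
  because \<open>m\<close> is not in \<open>cs\<close>, and it is the same for all
  eigenvectors.\<close>

lemma op_prod_eigenvector:
 assumes "lin_op T" "set cs \<subseteq> carrier K" "m \<in> carrier K" "m \<notin> set cs"
 obtains d where "d \<in> carrier K" "d \<noteq> \<zero>\<^sub>K"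
  "!!x. x \<in> carrier V ==> T x = m \<odot>\<^sub>V x ==> op_prod T cs x = d \<odot>\<^sub>V x"
 using assms(2,4)
proof (induction cs arbitrary: thesis)
 case Nil
 show ?case by (rule Nil(1)[of "\<one>\<^sub>K"]) (use assms in auto)
next
 case (Cons c cs)
 then obtain d where d: "d \<in> carrier K" "d \<noteq> \<zero>\<^sub>K"
  "!!x. x \<in> carrier V ==> T x = m \<odot>\<^sub>V x ==> op_prod T cs x = d \<odot>\<^sub>V x" by auto
 have c: "c \<in> carrier K" "m \<noteq> c" using Cons.prems by auto
 have mc: "m \<ominus>\<^sub>K c \<in> carrier K" "m \<ominus>\<^sub>K c \<noteq> \<zero>\<^sub>K" using c assms by auto
 have "op_prod T (c # cs) x = ((m \<ominus>\<^sub>K c) \<otimes>\<^sub>K d) \<odot>\<^sub>V x"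
  if x: "x \<in> carrier V" "T x = m \<odot>\<^sub>V x" for x
 proof -
  have "op_prod T (c # cs) x = op_prod T cs ((m \<ominus>\<^sub>K c) \<odot>\<^sub>V x)"
   using assms c x by (simp add: smult_l_diff)
  also have "\<dots> = (m \<ominus>\<^sub>K c) \<odot>\<^sub>V (d \<odot>\<^sub>V x)"
   using lin_opD(3)[OF op_prod_lin_op[OF assms(1)], of cs "m \<ominus>\<^sub>K c" x] Cons.prems mc x d by simp
  also have "\<dots> = ((m \<ominus>\<^sub>K c) \<otimes>\<^sub>K d) \<odot>\<^sub>V x"
   using mc d x by (simp add: smult_assoc1)
  finally show ?thesis .
 qed
 thus ?case
  using Cons.prems(1)[of "(m \<ominus>\<^sub>K c) \<otimes>\<^sub>K d"] mc d(1,2) integral by blast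
qed

lemma submodule_finsum:
 assumes U: "submodule K U V" and "finite I" "!!i. i \<in> I ==> f i \<in> U"
 shows "(\<Oplus>\<^sub>V i\<in>I. f i) \<in> U"
 using assms(2,3)
proof (induction I rule: finite_induct)
 case empty
 thus ?case using U by (simp add: submodule_def)
next
 case (insert i I)
 have UV: "U \<subseteq> carrier V" using U by (simp add: submodule_def)
 have "f i \<oplus>\<^sub>V (\<Oplus>\<^sub>V i\<in>I. f i) \<in> U" using insert U unfolding submodule_def by blast
 moreover have "f \<in> I \<rightarrow> carrier V" "f i \<in> carrier V" using insert.prems UV by auto
 ultimately show ?case using insert.hyps by simp
qed

text \<open>By induction \<open>T x - m x\<close> is a sum of eigenvectors \<open>g c\<close> with
  eigenvalues other than \<open>m\<close>. Dividing each \<open>g c\<close> by \<open>c - m\<close>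
  gives a preimage of this sum under \<open>T - m\<close>, and what remains of \<open>x\<close> is
  an eigenvector for \<open>m\<close>. The argument stays inside the invariant subspace
  \<open>U\<close>, whose dimension may be infinite.\<close>

lemma eigen_decomposition:
 assumes T: "lin_op T" and U: "submodule K U V" "!!x. x \<in> U ==> T x \<in> U"
  and cs: "distinct cs" "set cs \<subseteq> carrier K" and x: "x \<in> U" "op_prod T cs x = \<zero>\<^sub>V"
 obtains f where "!!c. c \<in> set cs ==> f c \<in> U \<and> T (f c) = c \<odot>\<^sub>V f c" "x = (\<Oplus>\<^sub>V c\<in>set cs. f c)"
 using cs x
proof (induction cs arbitrary: x thesis)
 case Nil
 show ?case by (rule Nil(1)[of undefined]) (use Nil in auto)
next
 case (Cons m cs)
 note UD = submodule.m_closed[OF U(1)] submodule.smult_closed[OF U(1)]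
 have UV: "y \<in> U ==> y \<in> carrier V" for y using U(1) by (auto simp: submodule_def)
 have Udiff: "y \<ominus>\<^sub>V z \<in> U" if "y \<in> U" "z \<in> U" for y z
  using UD(1)[OF that(1) UD(2)[OF _ that(2), of "\<ominus>\<^sub>K \<one>\<^sub>K"]] UV[OF that(2)] by (simp add: smult_l_minus a_minus_def)
 have m: "m \<in> carrier K" and cs: "set cs \<subseteq> carrier K" "m \<notin> set cs" using Cons.prems by auto
 let ?S = "\<lambda>x. T x \<ominus>\<^sub>V m \<odot>\<^sub>V x"
 note S = lin_op_shift[OF T m]
 have x: "x \<in> U" "x \<in> carrier V" using Cons.prems UV by auto
 obtain g where g: "!!c. c \<in> set cs ==> g c \<in> U \<and> T (g c) = c \<odot>\<^sub>V g c" "?S x = (\<Oplus>\<^sub>V c\<in>set cs. g c)"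
  using Cons.IH[of "?S x"] Cons.prems Udiff[OF U(2) UD(2)[OF m]] by auto
 define h where "h = (\<lambda>c. inv\<^bsub>K\<^esub> (c \<ominus>\<^sub>K m) \<odot>\<^sub>V g c)"
 have h: "h c \<in> U" "T (h c) = c \<odot>\<^sub>V h c" "?S (h c) = g c" if c: "c \<in> set cs" for c
 proof -
  have gc: "g c \<in> U" "g c \<in> carrier V" "T (g c) = c \<odot>\<^sub>V g c" "c \<in> carrier K" using g(1) c UV cs by auto
  have "c \<ominus>\<^sub>K m \<in> Units K" using gc(4) m c cs(2) by (auto simp: field_Units)
  hence i: "inv\<^bsub>K\<^esub> (c \<ominus>\<^sub>K m) \<in> carrier K" "(c \<ominus>\<^sub>K m) \<otimes>\<^sub>K inv\<^bsub>K\<^esub> (c \<ominus>\<^sub>K m) = \<one>\<^sub>K" by auto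
  show "h c \<in> U" unfolding h_def using gc i UD by auto
  show Th: "T (h c) = c \<odot>\<^sub>V h c"
   unfolding h_def using gc i lin_opD[OF T] by (simp add: smult_assoc1[symmetric] R.m_comm)
  have "?S (h c) = (c \<ominus>\<^sub>K m) \<odot>\<^sub>V h c" unfolding Th using gc i m by (simp add: smult_l_diff h_def)
  thus "?S (h c) = g c" unfolding h_def using gc i m by (simp add: smult_assoc1[symmetric])
 qed
 define s where "s = (\<Oplus>\<^sub>V c\<in>set cs. h c)"
 have s: "s \<in> U" "s \<in> carrier V" unfolding s_def using submodule_finsum[OF U(1), of "set cs" h] h(1) UV by auto
 have "?S s = (\<Oplus>\<^sub>V c\<in>set cs. ?S (h c))" unfolding s_def by (rule lin_op_finsum[OF S]) (use h(1) UV in auto)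
 also have "\<dots> = ?S x" unfolding g(2) by (intro M.finsum_cong') (use h(3) g(1) UV in auto)
 finally have "?S (x \<ominus>\<^sub>V s) = \<zero>\<^sub>V"
  using lin_op_diff[OF S x(2) s(2)] lin_opD(1)[OF S x(2)] by (simp add: a_minus_def M.r_neg)
 hence Tm: "T (x \<ominus>\<^sub>V s) = m \<odot>\<^sub>V (x \<ominus>\<^sub>V s)"
  using M.diff_zero_imp_eq[of "T (x \<ominus>\<^sub>V s)"] lin_opD(1)[OF T] x s m by simp
 define f where "f = (\<lambda>c. if c = m then x \<ominus>\<^sub>V s else h c)"
 note xs = Udiff[OF x(1) s(1)]
 show ?case
 proof (rule Cons.prems(1)[of f])
  show "f c \<in> U \<and> T (f c) = c \<odot>\<^sub>V f c" if "c \<in> set (m # cs)" for c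
   using that h xs Tm unfolding f_def by auto
  have "(\<Oplus>\<^sub>V c\<in>set (m # cs). f c) = f m \<oplus>\<^sub>V (\<Oplus>\<^sub>V c\<in>set cs. f c)"
   using cs(2) xs h(1) UV unfolding f_def by (simp add: Pi_iff)
  also have "(\<Oplus>\<^sub>V c\<in>set cs. f c) = s"
   unfolding s_def using cs(2) h(1) UV by (intro M.finsum_cong') (auto simp: f_def)
  also have "f m \<oplus>\<^sub>V s = x"
   using x s by (simp add: f_def a_minus_def M.a_assoc M.l_neg)
  finally show "x = (\<Oplus>\<^sub>V c\<in>set (m # cs). f c)" by simp
 qed
qed

text \<open>Any two indices are told apart by some operator in \<open>Ops\<close>, which may depend
  on the pair. Applying \<open>P T - ev k T\<close> removes the term at \<open>k\<close>, keeps all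
  terms joint eigenvectors, and multiplies the term at \<open>l\<close> by a nonzero scalar.\<close>

lemma eigenvectors_direct:
 assumes "finite I"
  and "!!T. T \<in> Ops ==> lin_op (P T)"
  and "!!i T. i \<in> I ==> T \<in> Ops ==> ev i T \<in> carrier K"
  and "!!i l. i \<in> I ==> l \<in> I ==> i \<noteq> l ==> \<exists>T\<in>Ops. ev i T \<noteq> ev l T"
  and "!!i. i \<in> I ==> f i \<in> carrier V" "!!i T. i \<in> I ==> T \<in> Ops ==> P T (f i) = ev i T \<odot>\<^sub>V f i"
  and "(\<Oplus>\<^sub>V i\<in>I. f i) = \<zero>\<^sub>V"
 shows "\<forall>i\<in>I. f i = \<zero>\<^sub>V"
 using assms(1,3-)
proof (induction I arbitrary: f rule: finite_induct)
 case (insert k I)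
 have split: "f k \<oplus>\<^sub>V (\<Oplus>\<^sub>V i\<in>I. f i) = \<zero>\<^sub>V"
  using insert by (simp add: Pi_iff)
 have fV: "f i \<in> carrier V" if "i \<in> insert k I" for i using insert.prems that by blast
 have sV: "(\<Oplus>\<^sub>V i\<in>I. f i) \<in> carrier V" using fV by (intro M.finsum_closed) auto
 have zero: "f l = \<zero>\<^sub>V" if l: "l \<in> I" for l
 proof -
  obtain T where T: "T \<in> Ops" "ev k T \<noteq> ev l T"
   using insert.prems(2)[of k l] insert.hyps l by auto
  note lin = assms(2)[OF T(1)]
  define g where "g = (\<lambda>i. (ev i T \<ominus>\<^sub>K ev k T) \<odot>\<^sub>V f i)"
  have ev: "ev i T \<in> carrier K" if "i \<in> insert k I" for i using insert.prems(1) T that by blast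
  let ?S = "\<lambda>x. P T x \<ominus>\<^sub>V ev k T \<odot>\<^sub>V x"
  note S = lin_op_shift[OF lin ev[of k, simplified]]
  have Sf: "?S (f i) = g i" if "i \<in> insert k I" for i
   using insert.prems(4)[OF that T(1)] ev[OF that] ev[of k] fV[OF that] by (simp add: g_def smult_l_diff)
  have gV: "g i \<in> carrier V" if "i \<in> insert k I" for i using ev[OF that] ev[of k] fV[OF that] by (simp add: g_def)
  have "(\<Oplus>\<^sub>V i\<in>insert k I. ?S (f i)) = ?S (\<Oplus>\<^sub>V i\<in>insert k I. f i)"
   by (rule lin_op_finsum[OF S, symmetric]) (use insert.hyps fV in auto)
  also have "\<dots> = \<zero>\<^sub>V" unfolding insert.prems(5) by (rule lin_op_zero[OF S])
  also have "(\<Oplus>\<^sub>V i\<in>insert k I. ?S (f i)) = (\<Oplus>\<^sub>V i\<in>insert k I. g i)"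
   by (intro M.finsum_cong') (use Sf gV in auto)
  also have "\<dots> = g k \<oplus>\<^sub>V (\<Oplus>\<^sub>V i\<in>I. g i)" using insert.hyps gV by simp
  also have "g k = \<zero>\<^sub>V" using ev[of k] fV[of k] by (simp add: g_def a_minus_def R.r_neg)
  finally have "(\<Oplus>\<^sub>V i\<in>I. g i) = \<zero>\<^sub>V" using gV by (simp add: Pi_iff)
  moreover have "P S (g i) = ev i S \<odot>\<^sub>V g i" if i: "i \<in> I" and S: "S \<in> Ops" for i S
  proof -
   have "ev i S \<in> carrier K" "P S (f i) = ev i S \<odot>\<^sub>V f i"
    using insert.prems(1,4) S i by auto
   thus ?thesis
    unfolding g_def using lin_opD(3)[OF assms(2)[OF S]] ev fV i
    by (simp add: smult_assoc1[symmetric] R.m_comm)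
  qed
  ultimately have "\<forall>i\<in>I. g i = \<zero>\<^sub>V"
   using insert.prems ev fV by (intro insert.IH) (auto simp: g_def)
  hence "(ev l T \<ominus>\<^sub>K ev k T) \<odot>\<^sub>V f l = \<zero>\<^sub>V" using l by (simp add: g_def)
  moreover have "ev l T \<ominus>\<^sub>K ev k T \<noteq> \<zero>\<^sub>K" using T ev l by auto
  ultimately show ?thesis
   using smult_cancel[of "ev l T \<ominus>\<^sub>K ev k T" "f l"] ev[of k] ev[of l] fV[of l] l by simp
 qed
 hence "(\<Oplus>\<^sub>V i\<in>I. f i) = (\<Oplus>\<^sub>V i\<in>I. \<zero>\<^sub>V)" by (intro M.finsum_cong') auto
 hence "f k = \<zero>\<^sub>V" using split fV by (simp add: M.finsum_zero)
 thus ?case using zero by simp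
qed simp

end

section \<open>Elementary divisors of an operator on a lattice\<close>

text \<open>The functionals in \<open>\<Phi>\<close> play the role of the coordinates with respect to a basis of a free
 module containing \<open>L\<close>.\<close>

locale lattice_space = VF?: valued_field K v + vectorspace K V
 for K :: "('k, 'm) ring_scheme" (structure) and v and V :: "('k, 'c, 'n) module_scheme" +
 fixes L :: "'c set" and \<Phi> :: "('c => 'k) set"
 assumes L_carrier: "L \<subseteq> carrier V" and L_zero: "\<zero>\<^sub>V \<in> L"
  and L_add: "x \<in> L ==> y \<in> L ==> x \<oplus>\<^sub>V y \<in> L"
  and L_smult: "t \<in> vint ==> x \<in> L ==> t \<odot>\<^sub>V x \<in> L"
  and Phi_closed: "\<phi> \<in> \<Phi> ==> x \<in> carrier V ==> \<phi> x \<in> carrier K"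
  and Phi_add: "\<phi> \<in> \<Phi> ==> x \<in> carrier V ==> y \<in> carrier V ==> \<phi> (x \<oplus>\<^sub>V y) = \<phi> x \<oplus> \<phi> y"
  and Phi_smult: "\<phi> \<in> \<Phi> ==> c \<in> carrier K ==> x \<in> carrier V ==> \<phi> (c \<odot>\<^sub>V x) = c \<otimes> \<phi> x"
  and Phi_L: "\<phi> \<in> \<Phi> ==> x \<in> L ==> 0 \<le> v (\<phi> x)"
  and Phi_separates: "x \<in> carrier V ==> (!!\<phi>. \<phi> \<in> \<Phi> ==> \<phi> x = \<zero>) ==> x = \<zero>\<^sub>V"
  and Phi_bounded: "x \<in> carrier V ==> \<exists>B::real. \<forall>\<phi>\<in>\<Phi>. ereal B \<le> v (\<phi> x)"
begin

text \<open>This is the \<open>K\<close>-span of \<open>L\<close>, as every scalar becomes integral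
  after multiplication by a nonzero integral one.\<close>

definition Lspan :: "'c set" where
 "Lspan = {x \<in> carrier V. \<exists>t\<in>vint. t \<noteq> \<zero> \<and> t \<odot>\<^sub>V x \<in> L}"

lemma LspanI: "x \<in> carrier V ==> t \<in> vint ==> t \<noteq> \<zero> ==> t \<odot>\<^sub>V x \<in> L ==> x \<in> Lspan"
 unfolding Lspan_def by blast

lemma LspanE:
 assumes "x \<in> Lspan"
 obtains t where "x \<in> carrier V" "t \<in> vint" "t \<noteq> \<zero>" "t \<odot>\<^sub>V x \<in> L"
 using assms unfolding Lspan_def by blast

lemma L_Lspan: "L \<subseteq> Lspan"
 using L_carrier by (auto intro!: LspanI[of _ \<one>])

lemma Lspan_carrier: "Lspan \<subseteq> carrier V"
 by (auto simp: Lspan_def)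

lemma submodule_Lspan: "submodule K Lspan V"
proof -
 have "x \<oplus>\<^sub>V y \<in> Lspan" if "x \<in> Lspan" "y \<in> Lspan" for x y
 proof -
  obtain s where s: "x \<in> carrier V" "s \<in> vint" "s \<noteq> \<zero>" "s \<odot>\<^sub>V x \<in> L"
   using \<open>x \<in> Lspan\<close> by (rule LspanE)
  obtain t where t: "y \<in> carrier V" "t \<in> vint" "t \<noteq> \<zero>" "t \<odot>\<^sub>V y \<in> L"
   using \<open>y \<in> Lspan\<close> by (rule LspanE)
  note st = s t
  have "(s \<otimes> t) \<odot>\<^sub>V (x \<oplus>\<^sub>V y) = t \<odot>\<^sub>V (s \<odot>\<^sub>V x) \<oplus>\<^sub>V s \<odot>\<^sub>V (t \<odot>\<^sub>V y)"
   using st by (simp add: smult_r_distr smult_assoc1[symmetric] m_comm)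
  also have "\<dots> \<in> L" by (intro L_add L_smult s t)
  finally show ?thesis
   using st vint_mult[OF s(2) t(2)] integral[of s t] by (intro LspanI[of _ "s \<otimes> t"]) auto
 qed
 moreover have "c \<odot>\<^sub>V x \<in> Lspan" if c: "c \<in> carrier K" and x: "x \<in> Lspan" for c x
 proof -
  obtain s where s: "s \<in> vint" "s \<noteq> \<zero>" "s \<odot>\<^sub>V x \<in> L" "x \<in> carrier V"
   using x unfolding Lspan_def by blast
  show ?thesis
  proof (cases "c \<in> vint")
   case True
   have "s \<odot>\<^sub>V (c \<odot>\<^sub>V x) = c \<odot>\<^sub>V (s \<odot>\<^sub>V x)"
    using s c by (simp add: smult_assoc1[symmetric] m_comm)
   thus ?thesis using s c L_smult[OF True s(3)] by (intro LspanI[of _ s]) auto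
  next
   case False
   hence c0: "c \<noteq> \<zero>" using c by auto
   have ic: "inv c \<in> vint" "inv c \<noteq> \<zero>" "inv c \<in> carrier K"
    using False c c0 inv_nonzero[OF c c0] v_rv[of c] v_rv[of "inv c"] rv_inv[OF c c0] by auto
   have "(s \<otimes> inv c) \<odot>\<^sub>V (c \<odot>\<^sub>V x) = s \<odot>\<^sub>V x"
    using s c ic inv_nonzero[OF c c0] by (simp add: smult_assoc1[symmetric] m_assoc)
   thus ?thesis
    using s c ic vint_mult[OF s(1) ic(1)] integral[of s "inv c"]
    by (intro LspanI[of _ "s \<otimes> inv c"]) auto
  qed
 qed
 ultimately show ?thesis
  using L_Lspan L_zero Lspan_carrier by (intro submodule.intro) (auto intro: module_axioms)
qed

section \<open>Bounded linear forms and bounds for coefficients\<close>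

text \<open>Linear forms continuous for the sup norm given by \<open>\<Phi>\<close>;
  \<open>C\<close> is the logarithm of a bound for the operator norm.\<close>

definition bounded_form :: "('c => 'k) => bool" where
 "bounded_form \<psi> \<longleftrightarrow> (\<forall>x\<in>carrier V. \<psi> x \<in> carrier K) \<and>
   (\<forall>x\<in>carrier V. \<forall>y\<in>carrier V. \<psi> (x \<oplus>\<^sub>V y) = \<psi> x \<oplus> \<psi> y) \<and>
   (\<forall>c\<in>carrier K. \<forall>x\<in>carrier V. \<psi> (c \<odot>\<^sub>V x) = c \<otimes> \<psi> x) \<and>
   (\<exists>C::real. \<forall>x\<in>carrier V. \<forall>N::real. (\<forall>\<phi>\<in>\<Phi>. ereal N \<le> v (\<phi> x)) \<longrightarrow> ereal (N - C) \<le> v (\<psi> x))"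

lemma bounded_formD:
 assumes "bounded_form \<psi>"
 shows "x \<in> carrier V ==> \<psi> x \<in> carrier K"
  and "x \<in> carrier V ==> y \<in> carrier V ==> \<psi> (x \<oplus>\<^sub>V y) = \<psi> x \<oplus> \<psi> y"
  and "c \<in> carrier K ==> x \<in> carrier V ==> \<psi> (c \<odot>\<^sub>V x) = c \<otimes> \<psi> x"
 using assms unfolding bounded_form_def by blast+

lemma bounded_form_Phi: "\<phi> \<in> \<Phi> ==> bounded_form \<phi>"
 unfolding bounded_form_def using Phi_closed Phi_add Phi_smult by (auto intro!: exI[of _ 0])

lemma bounded_form_diff:
 assumes p: "bounded_form \<psi>" and q: "bounded_form \<chi>" and c: "c \<in> carrier K"
 shows "bounded_form (\<lambda>x. \<psi> x \<ominus> c \<otimes> \<chi> x)"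
proof -
 obtain C D :: real where C: "!!x N. x \<in> carrier V ==> \<forall>\<phi>\<in>\<Phi>. ereal N \<le> v (\<phi> x) ==> ereal (N - C) \<le> v (\<psi> x)"
  and D: "!!x N. x \<in> carrier V ==> \<forall>\<phi>\<in>\<Phi>. ereal N \<le> v (\<phi> x) ==> ereal (N - D) \<le> v (\<chi> x)"
  using p q unfolding bounded_form_def by metis
 obtain B :: real where B: "ereal B \<le> v c" using v_rv[OF c] by (cases "c = \<zero>") auto
 have "ereal (N - max C (D - B)) \<le> v (\<psi> x \<ominus> c \<otimes> \<chi> x)"
  if x: "x \<in> carrier V" and N: "\<forall>\<phi>\<in>\<Phi>. ereal N \<le> v (\<phi> x)" for x N
 proof (rule v_diff_ge)
  show "ereal (N - max C (D - B)) \<le> v (\<psi> x)" by (rule order_trans[OF _ C[OF x N]]) simp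
  have "ereal (B + (N - D)) \<le> v (c \<otimes> \<chi> x)"
   using add_mono[OF B D[OF x N]] c bounded_formD(1)[OF q x] by (simp add: v_mult)
  thus "ereal (N - max C (D - B)) \<le> v (c \<otimes> \<chi> x)" by (rule order_trans[rotated]) simp
 qed (use bounded_formD(1)[OF p x] bounded_formD(1)[OF q x] c in auto)
 moreover have "\<psi> (x \<oplus>\<^sub>V y) \<ominus> c \<otimes> \<chi> (x \<oplus>\<^sub>V y) = (\<psi> x \<ominus> c \<otimes> \<chi> x) \<oplus> (\<psi> y \<ominus> c \<otimes> \<chi> y)"
  if xy: "x \<in> carrier V" "y \<in> carrier V" for x y
  unfolding bounded_formD(2)[OF p xy] bounded_formD(2)[OF q xy]
  using bounded_formD(1)[OF p] bounded_formD(1)[OF q] c xy by algebra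
 moreover have "\<psi> (d \<odot>\<^sub>V x) \<ominus> c \<otimes> \<chi> (d \<odot>\<^sub>V x) = d \<otimes> (\<psi> x \<ominus> c \<otimes> \<chi> x)"
  if x: "d \<in> carrier K" "x \<in> carrier V" for d x
  unfolding bounded_formD(3)[OF p x] bounded_formD(3)[OF q x]
  using bounded_formD(1)[OF p x(2)] bounded_formD(1)[OF q x(2)] c x by algebra
 ultimately show ?thesis
  unfolding bounded_form_def using bounded_formD(1)[OF p] bounded_formD(1)[OF q] c by auto
qed

lemma bounded_form_lincomb:
 assumes p: "bounded_form \<psi>" and W: "finite W" "W \<subseteq> carrier V" "c \<in> W \<rightarrow> carrier K"
 shows "\<psi> (lincomb c W) = (\<Oplus>w\<in>W. c w \<otimes> \<psi> w)"
 using W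
proof (induction W rule: finite_induct)
 case empty
 show ?case using bounded_formD(3)[OF p, of \<zero> "\<zero>\<^sub>V"] bounded_formD(1)[OF p, of "\<zero>\<^sub>V"] by (simp add: lincomb_def)
next
 case (insert w W)
 have "lincomb c W \<in> carrier V" using insert.prems by (intro lincomb_closed) auto
 moreover have "lincomb c (insert w W) = c w \<odot>\<^sub>V w \<oplus>\<^sub>V lincomb c W"
  unfolding lincomb_def using insert by (subst M.finsum_insert) (auto simp: Pi_iff)
 ultimately show ?case
  using insert bounded_formD[OF p] by (subst VF.finsum_insert) (auto simp: Pi_iff subset_iff)
qed

lemma bounded_form_span:
 assumes "bounded_form \<psi>" "finite W" "W \<subseteq> carrier V" "\<forall>w\<in>W. \<psi> w = \<zero>" "y \<in> span W" shows "\<psi> y = \<zero>"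
proof -
 obtain c where c: "c \<in> W \<rightarrow> carrier K" "y = lincomb c W" using assms(5) finite_in_span[OF assms(2,3)] by blast
 have "(\<Oplus>w\<in>W. c w \<otimes> \<psi> w) = (\<Oplus>w\<in>W. \<zero>)" using assms(4) c(1) by (intro VF.finsum_cong') (auto simp: Pi_iff)
 thus ?thesis using bounded_form_lincomb[OF assms(1-3) c(1)] c(2) by (simp add: VF.finsum_zero)
qed

text \<open>A Hahn-Banach statement for finite sets, by elimination. Let \<chi> kill
  \<open>W\<close> but not \<open>w\<close>, and translate \<open>x\<close> by a multiple of
  \<open>w\<close> so that \<chi> vanishes on it. If \<psi> kills \<open>W\<close> but not this
  translate, then subtracting from \<psi> a multiple of \<chi> makes it kill \<open>w\<close> too,
  and its value at \<open>x\<close> becomes that of \<psi> at the translate.\<close>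

lemma separating_form:
 assumes "finite W" "W \<subseteq> carrier V" "x \<in> carrier V" "x \<notin> span W"
 shows "\<exists>\<psi>. bounded_form \<psi> \<and> (\<forall>w\<in>W. \<psi> w = \<zero>) \<and> \<psi> x \<noteq> \<zero>"
 using assms
proof (induction W arbitrary: x rule: finite_induct)
 case empty
 have "\<zero>\<^sub>V \<in> span {}" using span_is_submodule[of "{}"] by (simp add: submodule_def)
 hence "\<exists>\<phi>\<in>\<Phi>. \<phi> x \<noteq> \<zero>" using Phi_separates[OF empty.prems(2)] empty.prems(3) by blast
 thus ?case using bounded_form_Phi by blast
next
 case (insert w W)
 have WV: "W \<subseteq> carrier V" "insert w W \<subseteq> carrier V" "w \<in> carrier V" using insert.prems by auto
 note S = span_is_submodule[OF WV(2)]
 have xW: "x \<notin> span W" using insert.prems(3) span_is_monotone[of W "insert w W"] by blast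
 show ?case
 proof (cases "w \<in> span W")
  case True
  obtain \<psi> where "bounded_form \<psi>" "\<forall>u\<in>W. \<psi> u = \<zero>" "\<psi> x \<noteq> \<zero>"
   using insert.IH[OF WV(1) insert.prems(2) xW] by blast
  thus ?thesis using bounded_form_span[OF _ insert.hyps(1) WV(1) _ True] by blast
 next
  case False
  obtain \<chi> where q: "bounded_form \<chi>" "\<forall>u\<in>W. \<chi> u = \<zero>" "\<chi> w \<noteq> \<zero>" using insert.IH[OF WV(1,3) False] by blast
  note qK = bounded_formD(1)[OF q(1) WV(3)] bounded_formD(1)[OF q(1) insert.prems(2)]
  note i = inv_nonzero[OF qK(1) q(3)]
  let ?t = "\<chi> x \<otimes> inv (\<chi> w)"
  have t: "?t \<in> carrier K" using qK i by simp
  let ?x = "x \<ominus>\<^sub>V ?t \<odot>\<^sub>V w"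
  have xV: "?x \<in> carrier V" using insert.prems(2) t WV(3) by simp
  have "?x \<notin> span W"
  proof
   assume "?x \<in> span W"
   hence "?x \<in> span (insert w W)" using span_is_monotone[of W "insert w W"] by blast
   moreover have "?t \<odot>\<^sub>V w \<in> span (insert w W)"
    using S t in_own_span[OF WV(2)] by (auto simp: submodule_def)
   ultimately have "?x \<oplus>\<^sub>V ?t \<odot>\<^sub>V w \<in> span (insert w W)" using S by (simp add: submodule_def)
   moreover have "?x \<oplus>\<^sub>V ?t \<odot>\<^sub>V w = x"
    using insert.prems(2) smult_closed[OF t WV(3)] by (simp add: a_minus_def M.a_assoc M.l_neg)
   ultimately show False using insert.prems(3) by simp
  qed
  from insert.IH[OF WV(1) xV this]
  obtain \<psi> where p: "bounded_form \<psi>" "\<forall>u\<in>W. \<psi> u = \<zero>" "\<psi> ?x \<noteq> \<zero>" by blast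
  note pK = bounded_formD(1)[OF p(1) WV(3)] bounded_formD(1)[OF p(1) insert.prems(2)]
  let ?c = "\<psi> w \<otimes> inv (\<chi> w)"
  have c: "?c \<in> carrier K" using pK i by simp
  have "\<psi> ?x = \<psi> x \<oplus> (\<ominus> ?t) \<otimes> \<psi> w"
   using bounded_formD(2)[OF p(1) insert.prems(2), of "(\<ominus> ?t) \<odot>\<^sub>V w"] bounded_formD(3)[OF p(1) _ WV(3), of "\<ominus> ?t"] t WV(3)
   by (simp add: a_minus_def smult_l_minus)
  also have "\<dots> = \<psi> x \<ominus> ?c \<otimes> \<chi> x" using pK qK i(1) by algebra
  finally have "\<psi> x \<ominus> ?c \<otimes> \<chi> x \<noteq> \<zero>" using p(3) by simp
  moreover have "\<psi> u \<ominus> ?c \<otimes> \<chi> u = \<zero>" if "u \<in> insert w W" for u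
   using that p(2) q(2) c pK(1) qK(1) i by (auto simp: a_minus_def m_assoc VF.r_neg)
  ultimately show ?thesis using bounded_form_diff[OF p(1) q(1) c] by blast
 qed
qed

text \<open>Comparison of norms on a finite-dimensional span: for each \<open>w\<close> a bounded
  form that kills the rest of \<open>W\<close> reads off the coefficient of \<open>w\<close>, up to
  the constant \<psi> w. It makes the coordinates of the lattice of pairs bounded even though
  \<open>\<Phi>\<close> may be infinite.\<close>

lemma coefficient_bound:
 assumes W: "finite W" "W \<subseteq> carrier V" "lin_indpt W"
 shows "\<exists>C::real. \<forall>c\<in>W \<rightarrow> carrier K. \<forall>N::real. (\<forall>\<phi>\<in>\<Phi>. ereal N \<le> v (\<phi> (lincomb c W))) \<longrightarrow>
      (\<forall>w\<in>W. ereal (N - C) \<le> v (c w))"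
proof -
 have "\<exists>C::real. \<forall>c\<in>W \<rightarrow> carrier K. \<forall>N::real. (\<forall>\<phi>\<in>\<Phi>. ereal N \<le> v (\<phi> (lincomb c W))) \<longrightarrow> ereal (N - C) \<le> v (c w)"
  if w: "w \<in> W" for w
 proof -
  have W': "finite (W - {w})" "W - {w} \<subseteq> carrier V" "w \<in> carrier V" "W - {w} \<union> {w} = W" using W w by auto
  have "lin_indpt (W - {w})" using subset_li_is_li[OF W(3), of "W - {w}"] by blast
  hence "w \<notin> span (W - {w})" using lin_dep_iff_in_span[OF W'(2) _ W'(3)] W' W(3) by auto
  then obtain \<psi> where p: "bounded_form \<psi>" "\<forall>u\<in>W - {w}. \<psi> u = \<zero>" "\<psi> w \<noteq> \<zero>"
   using separating_form[OF W'(1-3)] by blast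
  obtain C :: real where C: "!!x N. x \<in> carrier V ==> \<forall>\<phi>\<in>\<Phi>. ereal N \<le> v (\<phi> x) ==> ereal (N - C) \<le> v (\<psi> x)"
   using p(1) unfolding bounded_form_def by metis
  have pw: "\<psi> w \<in> carrier K" by (rule bounded_formD(1)[OF p(1) W'(3)])
  have "ereal (N - (C + rv (\<psi> w))) \<le> v (c w)"
   if c: "c \<in> W \<rightarrow> carrier K" and N: "\<forall>\<phi>\<in>\<Phi>. ereal N \<le> v (\<phi> (lincomb c W))" for c N
  proof -
   have cw: "c w \<in> carrier K" using c w by auto
   have "(\<Oplus>u\<in>W. c u \<otimes> \<psi> u) = (\<Oplus>u\<in>W. if w = u then c u \<otimes> \<psi> u else \<zero>)"
    using p(2) c pw w by (intro VF.finsum_cong') (auto simp: Pi_iff)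
   also have "\<dots> = c w \<otimes> \<psi> w" using w W c bounded_formD(1)[OF p(1)] by (intro VF.finsum_singleton) auto
   finally have "\<psi> (lincomb c W) = c w \<otimes> \<psi> w" using bounded_form_lincomb[OF p(1) W(1,2) c] by simp
   moreover have "ereal (N - C) \<le> v (\<psi> (lincomb c W))"
    by (rule C[OF _ N]) (use W c in \<open>auto intro: lincomb_closed\<close>)
   ultimately have "ereal (N - C) \<le> v (c w) + ereal (rv (\<psi> w))" using v_mult[OF cw pw] v_rv[OF pw p(3)] by simp
   thus ?thesis by (cases "v (c w)") auto
  qed
  thus ?thesis by blast
 qed
 then obtain C :: "'c => real" where C: "!!w c N. w \<in> W ==> c \<in> W \<rightarrow> carrier K ==>
   \<forall>\<phi>\<in>\<Phi>. ereal N \<le> v (\<phi> (lincomb c W)) ==> ereal (N - C w) \<le> v (c w)" by metis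
 have "ereal (N - Max (C ` W)) \<le> v (c w)"
  if "w \<in> W" "c \<in> W \<rightarrow> carrier K" "\<forall>\<phi>\<in>\<Phi>. ereal N \<le> v (\<phi> (lincomb c W))" for w c N
  by (rule order_trans[OF _ C[OF that]]) (use Max_ge[of "C ` W" "C w"] W(1) that(1) in simp)
 thus ?thesis by blast
qed

end

text \<open>\<open>\<rho> x z\<close> says that the class of \<open>x\<close> in \<open>L / T L\<close> corresponds to the class of \<open>z\<close> in the direct
 sum of the quotients of the valuation ring by the \<open>a i\<close>.\<close>

locale elementary_divisors = lattice_space K v V L \<Phi>
 for K :: "('k, 'm) ring_scheme" (structure) and v and V :: "('k, 'c, 'n) module_scheme" and L \<Phi> +
 fixes T :: "'c => 'c" and ms :: "'k list" and \<epsilon> :: real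
  and n :: nat and a :: "nat => 'k" and \<rho> :: "'c => (nat => 'k) => bool"
 assumes T_lin: "lin_op T" and T_L: "x \<in> L ==> T x \<in> L"
  and ms_distinct: "distinct ms"
  and ms: "m \<in> set ms ==> m \<in> carrier K \<and> m \<noteq> \<zero> \<and> rv m = \<epsilon>"
  and eps_pos: "0 < \<epsilon>"
  and T_annihilated: "x \<in> L ==> op_prod T ms x = \<zero>\<^sub>V"
  and a: "i \<in> {1..n} ==> a i \<in> vint \<and> a i \<noteq> \<zero>"
  and rho_dom: "\<rho> x z ==> x \<in> L \<and> (\<forall>i. z i \<in> vint) \<and> (\<forall>i. i \<notin> {1..n} \<longrightarrow> z i = \<zero>)"
  and rho_add: "\<rho> x z ==> \<rho> y z' ==> \<rho> (x \<oplus>\<^sub>V y) (\<lambda>i. z i \<oplus> z' i)"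
  and rho_smult: "t \<in> vint ==> \<rho> x z ==> \<rho> (t \<odot>\<^sub>V x) (\<lambda>i. t \<otimes> z i)"
  and rho_total: "x \<in> L ==> \<exists>z. \<rho> x z"
  and rho_surj: "(!!i. z i \<in> vint) ==> (!!i. i \<notin> {1..n} ==> z i = \<zero>) ==> \<exists>x. \<rho> x z"
  and rho_ker: "\<rho> x (\<lambda>_. \<zero>) \<longleftrightarrow> x \<in> T ` L"
  and rho_zero: "(!!i. z i \<in> vint) ==> (!!i. i \<notin> {1..n} ==> z i = \<zero>) ==>
   \<rho> \<zero>\<^sub>V z \<longleftrightarrow> (\<forall>i\<in>{1..n}. \<exists>t\<in>vint. z i = t \<otimes> a i)"
begin

definition eigenspace :: "'k => 'c set" where
 "eigenspace m = {x \<in> Lspan. T x = m \<odot>\<^sub>V x}"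

lemma ms_carrier: "set ms \<subseteq> carrier K"
 using ms by auto

lemma T_Lspan: "x \<in> Lspan ==> T x \<in> Lspan"
 unfolding Lspan_def using lin_opD[OF T_lin] T_L by (auto simp: lin_opD(3)[OF T_lin, symmetric] intro!: bexI)

lemma T_annihilated_Lspan: assumes "x \<in> Lspan" shows "op_prod T ms x = \<zero>\<^sub>V"
proof -
 obtain t where t: "t \<in> vint" "t \<noteq> \<zero>" "t \<odot>\<^sub>V x \<in> L" "x \<in> carrier V"
  using assms by (auto simp: Lspan_def)
 note P = op_prod_lin_op[OF T_lin ms_carrier]
 have "t \<odot>\<^sub>V op_prod T ms x = \<zero>\<^sub>V"
  using lin_opD(3)[OF P, of t x] t T_annihilated[OF t(3)] by simp
 thus ?thesis using t lin_opD(1)[OF P] smult_cancel by blast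
qed

lemma submodule_eigenspace: assumes "m \<in> carrier K" shows "submodule K (eigenspace m) V"
proof -
 note S = submodule.m_closed[OF submodule_Lspan] submodule.smult_closed[OF submodule_Lspan]
  submodule.zero_closed[OF submodule_Lspan]
 show ?thesis
  using assms S Lspan_carrier lin_opD[OF T_lin] lin_op_zero[OF T_lin] unfolding eigenspace_def
  by (intro submodule.intro)
   (auto intro: module_axioms simp: smult_r_distr smult_assoc1[symmetric] m_comm subset_iff)
qed

lemma eigenspaces_direct:
 assumes "!!m. m \<in> set ms ==> f m \<in> eigenspace m" "(\<Oplus>\<^sub>V m\<in>set ms. f m) = \<zero>\<^sub>V"
 shows "\<forall>m\<in>set ms. f m = \<zero>\<^sub>V"
 by (rule eigenvectors_direct[where Ops = "{()}" and P = "\<lambda>_. T" and ev = "\<lambda>m _. m"])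
  (use assms ms T_lin Lspan_carrier in \<open>auto simp: eigenspace_def\<close>)

lemma L_decomposition:
 assumes "x \<in> L"
 obtains f where "!!m. m \<in> set ms ==> f m \<in> eigenspace m" "x = (\<Oplus>\<^sub>V m\<in>set ms. f m)"
proof -
 have x: "x \<in> Lspan" using assms L_Lspan by blast
 show thesis
  by (rule eigen_decomposition[OF T_lin submodule_Lspan T_Lspan ms_distinct ms_carrier x
     T_annihilated_Lspan[OF x]]) (use that in \<open>auto simp: eigenspace_def\<close>)
qed

lemma rho_lincomb:
 assumes y: "!!i. i \<in> {1..n} ==> \<rho> (y i) (\<lambda>l. if l = i then \<one> else \<zero>)"
  and m: "m \<le> n" and z: "!!i. z i \<in> vint" "!!i. i \<notin> {1..m} ==> z i = \<zero>"
 shows "\<rho> (\<Oplus>\<^sub>V i\<in>{1..m}. z i \<odot>\<^sub>V y i) z"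
 using m z
proof (induction m arbitrary: z)
 case 0
 have "\<zero>\<^sub>V = T \<zero>\<^sub>V" using lin_op_zero[OF T_lin] by simp
 hence "\<rho> \<zero>\<^sub>V (\<lambda>_. \<zero>)" using rho_ker L_zero by blast
 moreover have "z = (\<lambda>_. \<zero>)" using 0 by auto
 ultimately show ?case by simp
next
 case (Suc m)
 define z' where "z' = (\<lambda>i. if i = Suc m then \<zero> else z i)"
 have yV: "y i \<in> carrier V" if "i \<in> {1..n}" for i
  using rho_dom[OF y[OF that]] L_carrier by blast
 have zi: "z i \<in> carrier K" for i using Suc.prems by auto
 have "\<rho> (\<Oplus>\<^sub>V i\<in>{1..m}. z' i \<odot>\<^sub>V y i) z'"
  using Suc.prems by (intro Suc.IH) (auto simp: z'_def)
 moreover have "\<rho> (z (Suc m) \<odot>\<^sub>V y (Suc m)) (\<lambda>l. z (Suc m) \<otimes> (if l = Suc m then \<one> else \<zero>))"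
  using Suc.prems by (intro rho_smult y) auto
 ultimately have "\<rho> ((\<Oplus>\<^sub>V i\<in>{1..m}. z' i \<odot>\<^sub>V y i) \<oplus>\<^sub>V z (Suc m) \<odot>\<^sub>V y (Suc m))
   (\<lambda>l. z' l \<oplus> z (Suc m) \<otimes> (if l = Suc m then \<one> else \<zero>))"
  by (rule rho_add)
 moreover have "(\<lambda>l. z' l \<oplus> z (Suc m) \<otimes> (if l = Suc m then \<one> else \<zero>)) = z"
  using zi by (auto simp: z'_def)
 moreover have "(\<Oplus>\<^sub>V i\<in>{1..m}. z' i \<odot>\<^sub>V y i) = (\<Oplus>\<^sub>V i\<in>{1..m}. z i \<odot>\<^sub>V y i)"
  using zi yV Suc.prems by (intro M.finsum_cong') (auto simp: z'_def)
 moreover have "(\<Oplus>\<^sub>V i\<in>{1..Suc m}. z i \<odot>\<^sub>V y i) =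
   z (Suc m) \<odot>\<^sub>V y (Suc m) \<oplus>\<^sub>V (\<Oplus>\<^sub>V i\<in>{1..m}. z i \<odot>\<^sub>V y i)"
  using zi yV Suc.prems by (simp add: atLeastAtMostSuc_conv Pi_iff)
 moreover have "(\<Oplus>\<^sub>V i\<in>{1..m}. z i \<odot>\<^sub>V y i) \<in> carrier V"
  using zi yV Suc.prems by (intro M.finsum_closed) auto
 ultimately show ?case
  using zi yV[of "Suc m"] Suc.prems by (simp add: M.a_comm)
qed

lemma unit_lifts:
 obtains y where "!!i. i \<in> {1..n} ==> \<rho> (y i) (\<lambda>l. if l = i then \<one> else \<zero>)"
proof -
 have "\<exists>x. \<rho> x (\<lambda>l. if l = i then \<one> else \<zero>)" if "i \<in> {1..n}" for i
  using that by (intro rho_surj) auto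
 thus thesis using that by metis
qed

section \<open>The lattice of pairs and its two degree estimates\<close>

text \<open>A vector of \<open>span W\<close> is recorded by its coefficients, indexed by
  \<open>Inl\<close>, and the representative of its class by \<open>Inr\<close>. Everything outside
  \<open>W\<close> and beyond \<open>m\<close> is zero, so the coordinates \<open>Inl w\<close> and
  \<open>Inr i\<close> with \<open>i\<close> up to \<open>m\<close> determine the pair.\<close>

definition graph :: "'c set => nat => ('c + nat => 'k) set" where
 "graph W m = {c. c \<circ> Inl \<in> W \<rightarrow> carrier K \<and> (\<forall>w. w \<notin> W \<longrightarrow> c (Inl w) = \<zero>) \<and>
   (\<forall>i>m. c (Inr i) = \<zero>) \<and> \<rho> (lincomb (c \<circ> Inl) W) (c \<circ> Inr)}"

lemma graphI:
 assumes "\<rho> x z" "lincomb (c \<circ> Inl) W = x" "c \<circ> Inr = z" "c \<circ> Inl \<in> W \<rightarrow> carrier K"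
  and "!!w. w \<notin> W ==> c (Inl w) = \<zero>" "!!i. m < i ==> z i = \<zero>"
 shows "c \<in> graph W m"
 using assms unfolding graph_def by auto

lemma int_submodule_graph:
 assumes W: "finite W" "W \<subseteq> carrier V"
 shows "int_submodule (graph W m)"
 unfolding int_submodule_def
proof (intro conjI ballI)
 fix c :: "'c + nat => 'k" assume c: "c \<in> graph W m"
 show "\<forall>i. c i \<in> carrier K"
 proof
  fix i show "c i \<in> carrier K"
  proof (cases i)
   case (Inl w)
   thus ?thesis using c by (cases "w \<in> W") (auto simp: graph_def)
  next
   case (Inr i')
   have "\<rho> (lincomb (c \<circ> Inl) W) (c \<circ> Inr)" using c by (simp add: graph_def)
   thus ?thesis using rho_dom Inr by fastforce
  qed
 qed
next
 fix c d assume c: "c \<in> graph W m" and d: "d \<in> graph W m"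
 have "lincomb (\<lambda>w. (c \<circ> Inl) w \<oplus> (d \<circ> Inl) w) W = lincomb (c \<circ> Inl) W \<oplus>\<^sub>V lincomb (d \<circ> Inl) W"
  using W c d by (intro lincomb_sum) (auto simp: graph_def)
 thus "(\<lambda>i. c i \<oplus> d i) \<in> graph W m"
  using c d rho_add[of "lincomb (c \<circ> Inl) W" "c \<circ> Inr" "lincomb (d \<circ> Inl) W" "d \<circ> Inr"]
  by (auto simp: graph_def o_def)
next
 fix t c assume t: "t \<in> vint" and c: "c \<in> graph W m"
 have "lincomb (\<lambda>w. t \<otimes> (c \<circ> Inl) w) W = t \<odot>\<^sub>V lincomb (c \<circ> Inl) W"
  using W c t by (intro lincomb_smult) (auto simp: graph_def)
 thus "(\<lambda>i. t \<otimes> c i) \<in> graph W m"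
  using c t rho_smult[OF t, of "lincomb (c \<circ> Inl) W" "c \<circ> Inr"]
  by (auto simp: graph_def o_def)
qed

lemma T_lincomb:
 assumes W: "finite W" "W \<subseteq> carrier V" "!!w. w \<in> W ==> ev w \<in> carrier K \<and> T w = ev w \<odot>\<^sub>V w"
  and c: "c \<in> W \<rightarrow> carrier K"
 shows "T (lincomb c W) = lincomb (\<lambda>w. ev w \<otimes> c w) W"
proof -
 have "T (lincomb c W) = (\<Oplus>\<^sub>V w\<in>W. T (c w \<odot>\<^sub>V w))"
  unfolding lincomb_def using W c by (intro lin_op_finsum[OF T_lin]) auto
 also have "\<dots> = (\<Oplus>\<^sub>V w\<in>W. (ev w \<otimes> c w) \<odot>\<^sub>V w)"
  using W c by (intro M.finsum_cong')
   (auto simp: lin_opD(3)[OF T_lin] smult_assoc1[symmetric] VF.m_comm Pi_iff subset_iff)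
 finally show ?thesis by (simp add: lincomb_def)
qed

lemma zero_coeffs: "W \<subseteq> carrier V ==> lincomb (\<lambda>_. \<zero>) W = \<zero>\<^sub>V"
 unfolding lincomb_def by (subst M.finsum_cong'[where g = "\<lambda>_. \<zero>\<^sub>V"]) (auto simp: M.finsum_zero)

lemma single_coeff:
 assumes "finite W" "W \<subseteq> carrier V" "w \<in> W" "t \<in> carrier K"
 shows "lincomb (\<lambda>u. if u = w then t else \<zero>) W = t \<odot>\<^sub>V w"
proof -
 have "(\<Oplus>\<^sub>V u\<in>W. (if u = w then t else \<zero>) \<odot>\<^sub>V u) = (\<Oplus>\<^sub>V u\<in>{w}. t \<odot>\<^sub>V u)"
  using assms by (intro M.add.finprod_mono_neutral_cong_right) auto
 thus ?thesis using assms by (auto simp: lincomb_def)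
qed

text \<open>Coefficients are bounded because \<rho> forces the vector into \<open>L\<close>, where
  the forms are integral. For full rank, a multiple of \<open>w\<close> in \<open>T L\<close> has
  class zero and isolates \<open>Inl w\<close>; and \<open>a k\<close> times the unit vector at
  \<open>k\<close> is zero in the quotient and isolates \<open>Inr k\<close>.\<close>

lemma lattice_on_graph:
 assumes W: "finite W" "W \<subseteq> Lspan" "lin_indpt W"
  and ev: "!!w. w \<in> W ==> ev w \<in> set ms \<and> T w = ev w \<odot>\<^sub>V w"
  and m: "m \<le> n"
 shows "lattice_on (Inl ` W \<union> Inr ` {1..m}) (graph W m)"
 unfolding lattice_on_def
proof (intro conjI ballI)
 have WV: "W \<subseteq> carrier V" using W Lspan_carrier by blast
 show "int_submodule (graph W m)" by (rule int_submodule_graph[OF W(1) WV])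
 obtain C :: real where C:
  "!!c N. c \<in> W \<rightarrow> carrier K ==> \<forall>\<phi>\<in>\<Phi>. ereal N \<le> v (\<phi> (lincomb c W)) ==> \<forall>w\<in>W. ereal (N - C) \<le> v (c w)"
  using coefficient_bound[OF W(1) WV W(3)] by blast
 fix i :: "'c + nat" assume i: "i \<in> Inl ` W \<union> Inr ` {1..m}"
 show "\<exists>B::real. \<forall>c\<in>graph W m. ereal B \<le> v (c i)"
 proof (cases i)
  case (Inl w)
  have "ereal (0 - C) \<le> v (c i)" if c: "c \<in> graph W m" for c
  proof -
   have "lincomb (c \<circ> Inl) W \<in> L" using c rho_dom by (auto simp: graph_def)
   hence "\<forall>\<phi>\<in>\<Phi>. ereal 0 \<le> v (\<phi> (lincomb (c \<circ> Inl) W))"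
    using Phi_L by (simp add: zero_ereal_def[symmetric])
   moreover have "w \<in> W" using i Inl by auto
   ultimately have "ereal (0 - C) \<le> v ((c \<circ> Inl) w)"
    using C[of "c \<circ> Inl" 0] c by (auto simp: graph_def)
   thus ?thesis using Inl by simp
  qed
  thus ?thesis by blast
 next
  case (Inr k)
  have "ereal 0 \<le> v (c i)" if c: "c \<in> graph W m" for c
  proof -
   have "\<rho> (lincomb (c \<circ> Inl) W) (c \<circ> Inr)" using c by (simp add: graph_def)
   hence "(c \<circ> Inr) k \<in> vint" using rho_dom by blast
   thus ?thesis using Inr by (simp add: zero_ereal_def[symmetric])
  qed
  thus ?thesis by blast
 qed
 show "\<exists>c\<in>graph W m. c i \<noteq> \<zero> \<and> (\<forall>j\<in>Inl ` W \<union> Inr ` {1..m} - {i}. c j = \<zero>)"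
 proof (cases i)
  case (Inl w)
  hence w: "w \<in> W" using i by auto
  then obtain t where t: "w \<in> carrier V" "t \<in> vint" "t \<noteq> \<zero>" "t \<odot>\<^sub>V w \<in> L"
   using W(2) by (blast elim: LspanE)
  have e: "ev w \<in> carrier K" "ev w \<noteq> \<zero>" "T w = ev w \<odot>\<^sub>V w" using ev[OF w] ms by auto
  define c where "c = (\<lambda>j::'c + nat. case j of Inl u => if u = w then t \<otimes> ev w else \<zero> | Inr _ => \<zero>)"
  have "T (t \<odot>\<^sub>V w) = (t \<otimes> ev w) \<odot>\<^sub>V w"
   using t e lin_opD(3)[OF T_lin] by (simp add: smult_assoc1)
  hence "\<rho> ((t \<otimes> ev w) \<odot>\<^sub>V w) (\<lambda>_. \<zero>)"
   using rho_ker t by (metis image_eqI)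
  moreover have "lincomb (c \<circ> Inl) W = (t \<otimes> ev w) \<odot>\<^sub>V w"
   using single_coeff[OF W(1) WV w, of "t \<otimes> ev w"] t e by (simp add: c_def o_def)
  moreover have "c \<circ> Inr = (\<lambda>_. \<zero>)" by (auto simp: c_def)
  ultimately have "c \<in> graph W m"
   by (rule graphI) (use t e w in \<open>auto simp: c_def\<close>)
  moreover have "c i \<noteq> \<zero>"
   using Inl t e integral[of t "ev w"] by (auto simp: c_def)
  moreover have "c j = \<zero>" if "j \<noteq> i" for j
   using that Inl by (cases j) (auto simp: c_def)
  ultimately show ?thesis by blast
 next
  case (Inr k)
  hence k: "k \<in> {1..m}" using i by auto
  hence ak: "a k \<in> vint" "a k \<noteq> \<zero>" using a m by auto
  define c where "c = (\<lambda>j::'c + nat. case j of Inl u => \<zero> | Inr l => if l = k then a k else \<zero>)"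
  have "\<rho> \<zero>\<^sub>V (\<lambda>l. if l = k then a k else \<zero>)"
  proof (subst rho_zero)
   show "\<forall>i\<in>{1..n}. \<exists>t\<in>vint. (if i = k then a k else \<zero>) = t \<otimes> a i"
   proof
    fix i assume i: "i \<in> {1..n}"
    show "\<exists>t\<in>vint. (if i = k then a k else \<zero>) = t \<otimes> a i"
     by (rule bexI[of _ "if i = k then \<one> else \<zero>"]) (use a[OF i] in auto)
   qed
  qed (use ak k m in auto)
  moreover have "lincomb (c \<circ> Inl) W = \<zero>\<^sub>V"
   using zero_coeffs[OF WV] by (simp add: c_def o_def)
  moreover have "c \<circ> Inr = (\<lambda>l. if l = k then a k else \<zero>)" by (auto simp: c_def)
  ultimately have "c \<in> graph W m"
   by (rule graphI) (use k in \<open>auto simp: c_def\<close>)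
  moreover have "c i \<noteq> \<zero>"
   using Inr ak by (auto simp: c_def)
  moreover have "c j = \<zero>" if "j \<noteq> i" for j
   using that Inr by (cases j) (auto simp: c_def)
  ultimately show ?thesis by blast
 qed
qed

lemma sum_rv_Inr: "(\<Sum>i\<in>set (map Inr [1..<Suc m]). rv (case_sum f g i)) = (\<Sum>i=1..m. rv (g i))"
 by (simp add: sum.reindex atLeastLessThanSuc_atLeastAtMost del: upt_Suc)

lemma sum_rv_Inl:
 assumes "!!w. w \<in> set ws ==> f w \<in> set ms"
 shows "(\<Sum>i\<in>set (map Inl ws). rv (case_sum f g i)) = \<epsilon> * real (card (set ws))"
proof -
 have "(\<Sum>i\<in>set (map Inl ws). rv (case_sum f g i)) = (\<Sum>w\<in>set ws. rv (f w))"
  by (simp add: sum.reindex)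
 also have "\<dots> = (\<Sum>w\<in>set ws. \<epsilon>)"
  using assms ms by (intro sum.cong) auto
 finally show ?thesis by simp
qed

text \<open>Two scalings feed \<open>sum_valuations_le\<close>. Sending (x, z) to (T x, 0)
  multiplies the coefficient of \<open>w\<close> by the eigenvalue \<open>ev w\<close>, of valuation
  \<open>\<epsilon>\<close>. And a pair (0, z) has entries z_i = t_i a_i, where \<open>t\<close>
  represents the class of the combination of the lifts \<open>y i\<close> with coefficients
  \<open>t\<close>, again a vector of \<open>span W\<close>.\<close>

lemma sum_le_card:
 assumes W: "finite W" "W \<subseteq> Lspan" "lin_indpt W"
  and ev: "!!w. w \<in> W ==> ev w \<in> set ms \<and> T w = ev w \<odot>\<^sub>V w"
  and m: "m \<le> n"
  and y: "!!i. i \<in> {1..n} ==> \<rho> (y i) (\<lambda>l. if l = i then \<one> else \<zero>)" "!!i. i \<in> {1..m} ==> y i \<in> span W"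
 shows "(\<Sum>i=1..m. rv (a i)) \<le> \<epsilon> * real (card W)"
proof -
 have WV: "W \<subseteq> carrier V" using W Lspan_carrier by blast
 obtain ws where ws: "distinct ws" "set ws = W" using finite_distinct_list[OF W(1)] by blast
 let ?ws = "map Inl ws :: ('c + nat) list" and ?xs = "map Inr [1..<Suc m] :: ('c + nat) list"
 have sets: "set ?ws = Inl ` W" "set ?xs = Inr ` {1..m}"
  using ws by (auto simp del: upt_Suc)
 have evK: "ev w \<in> carrier K \<and> T w = ev w \<odot>\<^sub>V w" if "w \<in> W" for w using ev that ms by blast
 have "(\<Sum>i\<in>set ?xs. rv (case_sum ev a i)) \<le> (\<Sum>i\<in>set ?ws. rv (case_sum ev a i))"
 proof (rule sum_valuations_le)
  show "lattice_on (set ?ws \<union> set ?xs) (graph W m)"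
   using lattice_on_graph[OF W ev m] sets by simp
  show "distinct (?ws @ ?xs)" using ws by (auto simp: distinct_map simp del: upt_Suc)
  show "case_sum ev a i \<in> carrier K \<and> case_sum ev a i \<noteq> \<zero>" if "i \<in> set ?ws" for i
   using that sets ev ms by auto
  show "case_sum ev a i \<in> carrier K \<and> case_sum ev a i \<noteq> \<zero>" if "i \<in> set ?xs" for i
   using that sets a m by auto
  fix c :: "'c + nat => 'k" assume c: "c \<in> graph W m"
  have cW: "c \<circ> Inl \<in> W \<rightarrow> carrier K" and cr: "\<rho> (lincomb (c \<circ> Inl) W) (c \<circ> Inr)"
   using c by (auto simp: graph_def)
  show "\<exists>c'\<in>graph W m. (\<forall>i\<in>set ?xs. c' i = \<zero>) \<and> (\<forall>i\<in>set ?ws. c' i = case_sum ev a i \<otimes> c i)"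
  proof -
   define c' where "c' = (\<lambda>j::'c + nat. case j of Inl w => if w \<in> W then ev w \<otimes> c (Inl w) else \<zero> | Inr _ => \<zero>)"
   have "lincomb (c' \<circ> Inl) W = lincomb (\<lambda>w. ev w \<otimes> (c \<circ> Inl) w) W"
    using cW evK by (intro lincomb_cong[OF HOL.refl WV]) (auto simp: c'_def Pi_iff)
   also have "\<dots> = T (lincomb (c \<circ> Inl) W)"
    using T_lincomb[OF W(1) WV evK cW] by simp
   finally have cT: "lincomb (c' \<circ> Inl) W = T (lincomb (c \<circ> Inl) W)" .
   have "\<rho> (T (lincomb (c \<circ> Inl) W)) (\<lambda>_. \<zero>)"
    using rho_ker rho_dom[OF cr] by blast
   hence "c' \<in> graph W m"
    using cT by (rule graphI) (use cW evK in \<open>auto simp: c'_def Pi_iff\<close>)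
   moreover have "\<forall>i\<in>set ?xs. c' i = \<zero>" "\<forall>i\<in>set ?ws. c' i = case_sum ev a i \<otimes> c i"
    using sets by (auto simp: c'_def)
   ultimately show ?thesis by blast
  qed
  assume c0: "\<forall>i\<in>set ?ws. c i = \<zero>"
  show "\<exists>c'\<in>graph W m. \<forall>i\<in>set ?xs. c i = case_sum ev a i \<otimes> c' i"
  proof -
   have "lincomb (c \<circ> Inl) W = lincomb (\<lambda>_. \<zero>) W"
    using c0 sets by (intro lincomb_cong[OF HOL.refl WV]) auto
   hence r0: "\<rho> \<zero>\<^sub>V (c \<circ> Inr)" using cr zero_coeffs[OF WV] by simp
   have "\<forall>i\<in>{1..n}. \<exists>t\<in>vint. (c \<circ> Inr) i = t \<otimes> a i"
    by (rule rho_zero[THEN iffD1, OF _ _ r0]) (use rho_dom[OF r0] in auto)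
   then obtain t where t: "!!i. i \<in> {1..n} ==> t i \<in> vint \<and> c (Inr i) = t i \<otimes> a i"
    unfolding o_def by metis
   \<comment> \<open>The coefficients are cut off after \<open>m\<close>, as only the lifts
     \<open>y 1, ..., y m\<close> are known to lie in \<open>span W\<close>.\<close>
   define z where "z = (\<lambda>i. if i \<in> {1..m} then t i else \<zero>)"
   have z: "z i \<in> vint" "i \<notin> {1..m} ==> z i = \<zero>" for i
    using t[of i] m by (auto simp: z_def)
   define x where "x = (\<Oplus>\<^sub>V i\<in>{1..m}. z i \<odot>\<^sub>V y i)"
   have rx: "\<rho> x z" unfolding x_def by (rule rho_lincomb[OF y(1) m z])
   note S = span_is_submodule[OF WV]
   have "(\<Oplus>\<^sub>V i\<in>{1..l}. z i \<odot>\<^sub>V y i) \<in> span W" if "l \<le> m" for l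
    using that
   proof (induction l)
    case 0
    thus ?case using submodule.zero_closed[OF S] by simp
   next
    case (Suc l)
    have yV: "y i \<in> carrier V" if "i \<in> {1..Suc l}" for i
     using rho_dom[OF y(1)] L_carrier that Suc.prems m by auto
    have "(\<Oplus>\<^sub>V i\<in>{1..Suc l}. z i \<odot>\<^sub>V y i) = z (Suc l) \<odot>\<^sub>V y (Suc l) \<oplus>\<^sub>V (\<Oplus>\<^sub>V i\<in>{1..l}. z i \<odot>\<^sub>V y i)"
     using z yV by (simp add: atLeastAtMostSuc_conv Pi_iff)
    thus ?case
     using Suc z(1)[of "Suc l"] y(2)[of "Suc l"] submodule.m_closed[OF S] submodule.smult_closed[OF S] by auto
   qed
   hence "x \<in> span W" by (simp add: x_def)
   then obtain b where b: "b \<in> W \<rightarrow> carrier K" "lincomb b W = x"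
    using finite_in_span[OF W(1) WV] by blast
   define c' where "c' = (\<lambda>j::'c + nat. case j of Inl w => if w \<in> W then b w else \<zero> | Inr i => z i)"
   have "lincomb (c' \<circ> Inl) W = x"
    unfolding b(2)[symmetric] using b by (intro lincomb_cong[OF HOL.refl WV]) (auto simp: c'_def)
   moreover have "c' \<circ> Inr = z" by (auto simp: c'_def)
   ultimately have "c' \<in> graph W m"
    by (rule graphI[OF rx]) (use z b in \<open>auto simp: c'_def\<close>)
   moreover have "\<forall>i\<in>set ?xs. c i = case_sum ev a i \<otimes> c' i"
    using sets t a m by (auto simp: c'_def z_def VF.m_comm)
   ultimately show ?thesis by blast
  qed
 qed
 moreover have "(\<Sum>i\<in>set ?xs. rv (case_sum ev a i)) = (\<Sum>i=1..m. rv (a i))"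
  by (rule sum_rv_Inr)
 moreover have "(\<Sum>i\<in>set ?ws. rv (case_sum ev a i)) = \<epsilon> * real (card W)"
  using sum_rv_Inl[of ws ev a] ev ws by blast
 ultimately show ?thesis by simp
qed

lemma ms_vint: "m \<in> set ms ==> m \<in> vint"
 using ms[of m] v_rv[of m] eps_pos by (auto simp: zero_ereal_def)

text \<open>Zero is not among the roots \<open>ms\<close>, so on the kernel of \<open>T\<close> the
  annihilating product acts by a nonzero scalar.\<close>

lemma T_inj: assumes x: "x \<in> Lspan" "T x = \<zero>\<^sub>V" shows "x = \<zero>\<^sub>V"
proof -
 have xV: "x \<in> carrier V" using x(1) Lspan_carrier by blast
 have 0: "\<zero> \<notin> set ms" using ms by blast
 obtain d where d: "d \<in> carrier K" "d \<noteq> \<zero>" "!!x. x \<in> carrier V ==> T x = \<zero> \<odot>\<^sub>V x ==> op_prod T ms x = d \<odot>\<^sub>V x"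
  by (rule op_prod_eigenvector[OF T_lin ms_carrier VF.zero_closed 0]) (blast intro: that)
 have "d \<odot>\<^sub>V x = \<zero>\<^sub>V" using d(3)[OF xV] T_annihilated_Lspan[OF x(1)] x(2) xV by simp
 thus ?thesis by (rule smult_cancel[OF d(1) xV _ d(2)])
qed

text \<open>The opposite estimate, with the two blocks exchanged. The weights \<open>l\<close> kill
  the classes of vectors of \<open>span W\<close>, so (0, l z) is again a pair; and a pair (x, 0)
  has \<open>x\<close> in \<open>T L\<close>, so its coefficients are divisible by the eigenvalues.
  The weights are \<open>a\<close> for the equality at \<open>n\<close>, and the eigenvalue itself
  for the bound on an eigenspace.\<close>

lemma card_le_weights:
 assumes W: "finite W" "W \<subseteq> Lspan" "lin_indpt W"
  and ev: "!!w. w \<in> W ==> ev w \<in> set ms \<and> T w = ev w \<odot>\<^sub>V w"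
  and l: "!!i. i \<in> {1..n} ==> l i \<in> vint \<and> l i \<noteq> \<zero>"
  and scale: "!!x z i. \<rho> x z ==> x \<in> span W ==> i \<in> {1..n} ==> \<exists>t\<in>vint. l i \<otimes> z i = t \<otimes> a i"
 shows "\<epsilon> * real (card W) \<le> (\<Sum>i=1..n. rv (l i))"
proof -
 have WV: "W \<subseteq> carrier V" using W Lspan_carrier by blast
 have WL: "span W \<subseteq> Lspan" by (rule span_is_subset[OF W(2) submodule_Lspan])
 obtain ws where ws: "distinct ws" "set ws = W" using finite_distinct_list[OF W(1)] by blast
 let ?ws = "map Inl ws :: ('c + nat) list" and ?xs = "map Inr [1..<Suc n] :: ('c + nat) list"
 have sets: "set ?ws = Inl ` W" "set ?xs = Inr ` {1..n}"
  using ws by (auto simp del: upt_Suc)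
 have evK: "ev w \<in> carrier K \<and> T w = ev w \<odot>\<^sub>V w" if "w \<in> W" for w using ev that ms by blast
 have in_span: "lincomb c W \<in> span W" if "c \<in> W \<rightarrow> carrier K" for c
  using W(1) that unfolding span_def by blast
 have "(\<Sum>i\<in>set ?ws. rv (case_sum ev l i)) \<le> (\<Sum>i\<in>set ?xs. rv (case_sum ev l i))"
 proof (rule sum_valuations_le)
  show "lattice_on (set ?xs \<union> set ?ws) (graph W n)"
   using lattice_on_graph[OF W ev order.refl] sets by (simp add: Un_commute)
  show "distinct (?xs @ ?ws)" using ws by (auto simp: distinct_map simp del: upt_Suc)
  show "case_sum ev l i \<in> carrier K \<and> case_sum ev l i \<noteq> \<zero>" if "i \<in> set ?ws" for i
   using that sets ev ms by auto
  show "case_sum ev l i \<in> carrier K \<and> case_sum ev l i \<noteq> \<zero>" if "i \<in> set ?xs" for i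
   using that sets l by auto
  fix c :: "'c + nat => 'k" assume c: "c \<in> graph W n"
  have cW: "c \<circ> Inl \<in> W \<rightarrow> carrier K" and cr: "\<rho> (lincomb (c \<circ> Inl) W) (c \<circ> Inr)"
   using c by (auto simp: graph_def)
  have cv: "c (Inr i) \<in> vint" "i \<notin> {1..n} ==> c (Inr i) = \<zero>" for i
   using rho_dom[OF cr] by auto
  show "\<exists>c'\<in>graph W n. (\<forall>i\<in>set ?ws. c' i = \<zero>) \<and> (\<forall>i\<in>set ?xs. c' i = case_sum ev l i \<otimes> c i)"
  proof -
   define c' where "c' = (\<lambda>j::'c + nat. case j of Inl w => \<zero> | Inr i => if i \<in> {1..n} then l i \<otimes> c (Inr i) else \<zero>)"
   have "\<rho> \<zero>\<^sub>V (c' \<circ> Inr)"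
   proof (subst rho_zero)
    show "\<forall>i\<in>{1..n}. \<exists>t\<in>vint. (c' \<circ> Inr) i = t \<otimes> a i"
     using scale[OF cr in_span[OF cW]] by (simp add: c'_def)
    show "(c' \<circ> Inr) i \<in> vint" for i
     using cv(1)[of i] l[of i] vint_mult[of "l i" "c (Inr i)"] by (auto simp: c'_def)
   qed (auto simp: c'_def)
   moreover have "lincomb (c' \<circ> Inl) W = \<zero>\<^sub>V" using zero_coeffs[OF WV] by (simp add: c'_def o_def)
   ultimately have "c' \<in> graph W n"
    using HOL.refl by (rule graphI) (auto simp: c'_def)
   thus ?thesis using sets by (intro bexI[of _ c']) (auto simp: c'_def)
  qed
  assume c0: "\<forall>i\<in>set ?xs. c i = \<zero>"
  show "\<exists>c'\<in>graph W n. \<forall>i\<in>set ?ws. c i = case_sum ev l i \<otimes> c' i"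
  proof -
   have "c (Inr i) = \<zero>" for i
    using c0[unfolded sets] cv(2)[of i] by (cases "i \<in> {1..n}") auto
   hence "c \<circ> Inr = (\<lambda>_. \<zero>)" by auto
   hence "lincomb (c \<circ> Inl) W \<in> T ` L" using cr rho_ker by simp
   then obtain x where x: "x \<in> L" "lincomb (c \<circ> Inl) W = T x" by blast
   obtain z where z: "\<rho> x z" using rho_total x by blast
   define b where "b = (\<lambda>w. if w \<in> W then inv (ev w) \<otimes> c (Inl w) else \<zero>)"
   have b: "b \<in> W \<rightarrow> carrier K" "w \<in> W ==> c (Inl w) = ev w \<otimes> b w" for w
    using cW ev ms inv_nonzero by (auto simp: b_def Pi_iff m_assoc[symmetric])
   have "lincomb (\<lambda>w. ev w \<otimes> b w) W = lincomb (c \<circ> Inl) W"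
    using b cW evK by (intro lincomb_cong[OF HOL.refl WV]) (auto simp: Pi_iff)
   hence Tb: "T (lincomb b W) = T x" using T_lincomb[OF W(1) WV evK b(1)] x(2) by simp
   have sL: "lincomb b W \<in> Lspan" "x \<in> Lspan" using in_span[OF b(1)] WL x(1) L_Lspan by auto
   hence sV: "lincomb b W \<in> carrier V" "x \<in> carrier V" using Lspan_carrier by auto
   \<comment> \<open>The vector with coefficients \<open>b\<close> lies in \<open>span W\<close> and
     the preimage \<open>x\<close> lies in \<open>L\<close>. Both have the same image, and
     injectivity of \<open>T\<close> on the \<open>K\<close>-span of \<open>L\<close> identifies
     them.\<close>
   have "T (lincomb b W \<ominus>\<^sub>V x) = \<zero>\<^sub>V"
    unfolding lin_op_diff[OF T_lin sV] Tb using lin_opD(1)[OF T_lin sV(2)] by (simp add: a_minus_def M.r_neg)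
   moreover have "lincomb b W \<ominus>\<^sub>V x \<in> Lspan"
    using sL sV submodule.m_closed[OF submodule_Lspan] submodule.smult_closed[OF submodule_Lspan, of "\<ominus> \<one>" x]
    by (simp add: a_minus_def smult_l_minus)
   ultimately have "lincomb b W \<ominus>\<^sub>V x = \<zero>\<^sub>V" by (rule T_inj[rotated])
   hence bx: "lincomb b W = x" by (rule M.diff_zero_imp_eq[OF sV])
   define c' where "c' = (\<lambda>j::'c + nat. case j of Inl w => b w | Inr i => z i)"
   have "c' \<in> graph W n"
    by (rule graphI[OF z]) (use rho_dom[OF z] b(1) bx in \<open>auto simp: c'_def o_def b_def\<close>)
   thus ?thesis using sets b(2) by (intro bexI[of _ c']) (auto simp: c'_def)
  qed
 qed
 moreover have "(\<Sum>i\<in>set ?xs. rv (case_sum ev l i)) = (\<Sum>i=1..n. rv (l i))"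
  by (rule sum_rv_Inr)
 moreover have "(\<Sum>i\<in>set ?ws. rv (case_sum ev l i)) = \<epsilon> * real (card W)"
  using sum_rv_Inl[of ws ev l] ev ws by blast
 ultimately show ?thesis by simp
qed

text \<open>On an eigenspace, \<open>\<rho> x z\<close> gives \<open>\<rho> 0 (m z)\<close>, so all weights can be taken to be \<open>m\<close>.\<close>

lemma eigenspace_card_le:
 assumes m: "m \<in> set ms" and W: "finite W" "W \<subseteq> eigenspace m" "lin_indpt W"
 shows "card W \<le> n"
proof -
 have mK: "m \<in> carrier K" "m \<noteq> \<zero>" "rv m = \<epsilon>" "m \<in> vint" using ms[OF m] ms_vint[OF m] by auto
 have WE: "span W \<subseteq> eigenspace m" by (rule span_is_subset[OF W(2) submodule_eigenspace[OF mK(1)]])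
 have "\<epsilon> * real (card W) \<le> (\<Sum>i=1..n. rv m)"
 proof (rule card_le_weights[OF W(1) _ W(3), of "\<lambda>_. m"])
  show "W \<subseteq> Lspan" using W(2) by (auto simp: eigenspace_def)
  show "m \<in> set ms \<and> T w = m \<odot>\<^sub>V w" if "w \<in> W" for w using that m W(2) by (auto simp: eigenspace_def)
  fix x z and i :: nat assume xz: "\<rho> x z" "x \<in> span W" and i: "i \<in> {1..n}"
  have Tx: "T x = m \<odot>\<^sub>V x" using xz(2) WE by (auto simp: eigenspace_def)
  have xL: "x \<in> L" "x \<in> carrier V" and z: "!!i. z i \<in> vint" "!!i. i \<notin> {1..n} ==> z i = \<zero>"
   using rho_dom[OF xz(1)] L_carrier by auto
  have mx: "m \<odot>\<^sub>V x \<in> carrier V" using mK xL by simp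
  have "\<rho> (T x) (\<lambda>_. \<zero>)" using rho_ker xL(1) by blast
  from rho_add[OF rho_smult[OF mK(4) xz(1)] rho_smult[OF _ this, of "\<ominus> \<one>"]]
  have "\<rho> (m \<odot>\<^sub>V x \<oplus>\<^sub>V (\<ominus> \<one>) \<odot>\<^sub>V T x) (\<lambda>i. m \<otimes> z i \<oplus> (\<ominus> \<one>) \<otimes> \<zero>)" by simp
  moreover have "m \<odot>\<^sub>V x \<oplus>\<^sub>V (\<ominus> \<one>) \<odot>\<^sub>V T x = \<zero>\<^sub>V"
   unfolding Tx using mx by (simp add: smult_l_minus M.r_neg)
  moreover have "(\<lambda>i. m \<otimes> z i \<oplus> (\<ominus> \<one>) \<otimes> \<zero>) = (\<lambda>i. m \<otimes> z i)" using mK(1) z(1) by auto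
  ultimately have r0: "\<rho> \<zero>\<^sub>V (\<lambda>i. m \<otimes> z i)" by simp
  have "\<forall>i\<in>{1..n}. \<exists>t\<in>vint. m \<otimes> z i = t \<otimes> a i"
   by (rule rho_zero[THEN iffD1, OF _ _ r0]) (use vint_mult[OF mK(4) z(1)] z(2) mK(1) in auto)
  thus "\<exists>t\<in>vint. m \<otimes> z i = t \<otimes> a i" using i by blast
 qed (use mK in auto)
 hence "\<epsilon> * real (card W) \<le> \<epsilon> * real n" using mK(3) by (simp add: mult.commute)
 thus ?thesis using eps_pos by simp
qed

theorem partial_sum_le:
 assumes r: "!!k W. k \<in> set ms ==> finite W ==> W \<subseteq> eigenspace k ==> lin_indpt W ==> card W \<le> r k"
  and m: "m \<le> n"
 shows "(\<Sum>i=1..m. rv (a i)) \<le> \<epsilon> * (\<Sum>k\<in>set ms. real (min m (r k)))"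
proof -
 obtain y where y: "!!i. i \<in> {1..n} ==> \<rho> (y i) (\<lambda>l. if l = i then \<one> else \<zero>)"
  using unit_lifts by blast
 have yL: "y i \<in> L" if "i \<in> {1..n}" for i using rho_dom[OF y[OF that]] by blast
 have "\<exists>f. (\<forall>k\<in>set ms. f k \<in> eigenspace k) \<and> y i = (\<Oplus>\<^sub>V k\<in>set ms. f k)" if "i \<in> {1..n}" for i
  using L_decomposition[OF yL[OF that]] by metis
 then obtain f where f: "!!i k. i \<in> {1..n} ==> k \<in> set ms ==> f i k \<in> eigenspace k"
  and yf: "!!i. i \<in> {1..n} ==> y i = (\<Oplus>\<^sub>V k\<in>set ms. f i k)" by metis
 have EV: "eigenspace k \<subseteq> carrier V" for k using Lspan_carrier by (auto simp: eigenspace_def)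
 have "\<exists>W \<subseteq> (\<lambda>i. f i k) ` {1..m}. lin_indpt W \<and> (\<lambda>i. f i k) ` {1..m} \<subseteq> span W" if k: "k \<in> set ms" for k
 proof -
  have "(\<lambda>i. f i k) ` {1..m} \<subseteq> carrier V"
   using f[OF _ k] EV m by fastforce
  thus ?thesis using exists_indpt_subset[of "(\<lambda>i. f i k) ` {1..m}"] by (metis finite_atLeastAtMost finite_imageI)
 qed
 \<comment> \<open>\<open>W k\<close> is chosen among the components of the lifts themselves: this
   keeps its size at most \<open>m\<close>, keeps it inside the eigenspace, and lets the union span
   all of the \<open>y i\<close>.\<close>
 then obtain W where W: "!!k. k \<in> set ms ==> W k \<subseteq> (\<lambda>i. f i k) ` {1..m} \<and> lin_indpt (W k) \<and>
   (\<lambda>i. f i k) ` {1..m} \<subseteq> span (W k)" by metis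
 have Wfin: "finite (W k)" "W k \<subseteq> eigenspace k" "lin_indpt (W k)" if k: "k \<in> set ms" for k
 proof -
  show "finite (W k)" using W[OF k] by (meson finite_atLeastAtMost finite_imageI finite_subset)
  show "lin_indpt (W k)" using W[OF k] by blast
  have "(\<lambda>i. f i k) ` {1..m} \<subseteq> eigenspace k" using f[OF _ k] m by auto
  thus "W k \<subseteq> eigenspace k" using W[OF k] by blast
 qed
 define U where "U = (\<Union>k\<in>set ms. W k)"
 have subE: "submodule K (eigenspace k) V" if "k \<in> set ms" for k
  using submodule_eigenspace that ms by blast
 have U: "lin_indpt U" "card U = (\<Sum>k\<in>set ms. card (W k))"
  unfolding U_def
  by (rule lin_indpt_UN[OF _ subE eigenspaces_direct Wfin]; simp)+
 have Ufin: "finite U" "U \<subseteq> Lspan" unfolding U_def using Wfin by (auto simp: eigenspace_def)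
 have UV: "U \<subseteq> carrier V" using Ufin Lspan_carrier by blast
 have "\<exists>k. k \<in> set ms \<and> T w = k \<odot>\<^sub>V w" if "w \<in> U" for w
  using that Wfin(2) by (auto simp: U_def eigenspace_def)
 then obtain ev where ev: "!!w. w \<in> U ==> ev w \<in> set ms \<and> T w = ev w \<odot>\<^sub>V w" by metis
 have ySpan: "y i \<in> span U" if i: "i \<in> {1..m}" for i
 proof -
  note S = span_is_submodule[OF UV]
  have fs: "f i k \<in> span U" if k: "k \<in> set ms" for k
  proof -
   have "f i k \<in> span (W k)" using W[OF k] i by blast
   moreover have "W k \<subseteq> U" using k by (auto simp: U_def)
   ultimately show ?thesis using span_is_monotone by blast
  qed
  have "(\<Oplus>\<^sub>V k\<in>J. f i k) \<in> span U" if "finite J" "J \<subseteq> set ms" for J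
   using that
  proof (induction J rule: finite_induct)
   case empty
   show ?case using submodule.zero_closed[OF S] by simp
  next
   case (insert k J)
   have "f i l \<in> carrier V" if "l \<in> insert k J" for l
    using fs[of l] that insert.prems span_is_subset2[OF UV] by blast
   thus ?case
    using insert fs[of k] submodule.m_closed[OF S] by (subst M.finsum_insert) auto
  qed
  thus ?thesis using yf[of i] i m by auto
 qed
 have "(\<Sum>i=1..m. rv (a i)) \<le> \<epsilon> * real (card U)"
  by (rule sum_le_card[OF Ufin U(1) ev m y ySpan])
 also have "real (card U) \<le> (\<Sum>k\<in>set ms. real (min m (r k)))"
 proof -
  have "card (W k) \<le> min m (r k)" if k: "k \<in> set ms" for k
  proof -
   have "card (W k) \<le> card ((\<lambda>i. f i k) ` {1..m})"
    using W[OF k] by (intro card_mono) auto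
   also have "\<dots> \<le> m" using card_image_le[of "{1..m}" "\<lambda>i. f i k"] by simp
   finally show ?thesis using r[OF k Wfin[OF k]] by simp
  qed
  hence "(\<Sum>k\<in>set ms. real (card (W k))) \<le> (\<Sum>k\<in>set ms. real (min m (r k)))"
   by (intro sum_mono) simp
  thus ?thesis using U(2) by simp
 qed
 finally show ?thesis using eps_pos by (simp add: mult_left_mono)
qed

text \<open>One direction is \<open>sum_le_card\<close> at m = n. For the other the weights are
  \<open>a\<close>, since \<open>a i\<close> annihilates the summand with index
  \<open>i\<close>.\<close>

theorem total_sum:
 assumes W: "finite W" "W \<subseteq> Lspan" "lin_indpt W"
  and ev: "!!w. w \<in> W ==> ev w \<in> set ms \<and> T w = ev w \<odot>\<^sub>V w"
  and L: "L \<subseteq> span W"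
 shows "(\<Sum>i=1..n. rv (a i)) = \<epsilon> * real (card W)"
proof (rule antisym)
 obtain y where y: "!!i. i \<in> {1..n} ==> \<rho> (y i) (\<lambda>l. if l = i then \<one> else \<zero>)"
  using unit_lifts by blast
 have "y i \<in> span W" if "i \<in> {1..n}" for i using rho_dom[OF y[OF that]] L by blast
 thus "(\<Sum>i=1..n. rv (a i)) \<le> \<epsilon> * real (card W)"
  by (intro sum_le_card[OF W ev order.refl y]) auto
next
 show "\<epsilon> * real (card W) \<le> (\<Sum>i=1..n. rv (a i))"
 proof (rule card_le_weights[OF W ev a])
  fix x z and i :: nat assume "\<rho> x z" and i: "i \<in> {1..n}"
  hence "z i \<in> vint" using rho_dom by blast
  thus "\<exists>t\<in>vint. a i \<otimes> z i = t \<otimes> a i" using a[OF i] by (intro bexI[of _ "z i"]) (auto simp: m_comm)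
 qed
qed

end

section \<open>The conormal module of a Hopf algebra\<close>

lemma (in abelian_monoid) list_sum_simps [simp]:
 "list_sum G [] = \<zero>" "list_sum G (x # xs) = x \<oplus> list_sum G xs"
 by (simp_all add: list_sum_def)

lemma (in abelian_monoid) list_sum_closed: "set xs \<subseteq> carrier G ==> list_sum G xs \<in> carrier G"
 by (induction xs) auto

lemma (in abelian_monoid) list_sum_append:
 "set xs \<subseteq> carrier G ==> set ys \<subseteq> carrier G ==> list_sum G (xs @ ys) = list_sum G xs \<oplus> list_sum G ys"
 by (induction xs) (auto simp: a_assoc list_sum_closed)

lemma (in abelian_monoid) list_sum_map_add:
 "(!!x. x \<in> set xs ==> f x \<in> carrier G \<and> g x \<in> carrier G) ==>
  list_sum G (map (\<lambda>x. f x \<oplus> g x) xs) = list_sum G (map f xs) \<oplus> list_sum G (map g xs)"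
proof (induction xs)
 case (Cons x xs)
 have "list_sum G (map f xs) \<in> carrier G" "list_sum G (map g xs) \<in> carrier G"
  using Cons.prems by (auto intro!: list_sum_closed)
 thus ?case using Cons by (simp add: a_ac)
qed simp

lemma list_sum_hom:
 assumes "abelian_monoid G" "abelian_monoid H" "set xs \<subseteq> carrier G"
  and "!!x. x \<in> carrier G ==> h x \<in> carrier H" "h \<zero>\<^sub>G = \<zero>\<^sub>H"
  and "!!x y. x \<in> carrier G ==> y \<in> carrier G ==> h (x \<oplus>\<^sub>G y) = h x \<oplus>\<^sub>H h y"
 shows "h (list_sum G xs) = list_sum H (map h xs)"
 using assms(3)
proof (induction xs)
 case (Cons x xs)
 have "list_sum G xs \<in> carrier G"
  using Cons.prems by (auto intro!: abelian_monoid.list_sum_closed[OF assms(1)])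
 thus ?case
  using Cons assms by (simp add: abelian_monoid.list_sum_simps)
qed (use assms in \<open>simp add: abelian_monoid.list_sum_simps\<close>)

lemma tensor_eq_carrier:
 assumes "!!x x'. x \<in> carrier M ==> x' \<in> carrier M ==> x \<oplus>\<^sub>M x' \<in> carrier M" "\<zero>\<^sub>M \<in> carrier M"
  and "!!y y'. y \<in> carrier N ==> y' \<in> carrier N ==> y \<oplus>\<^sub>N y' \<in> carrier N"
  and "!!r x. r \<in> carrier R ==> x \<in> carrier M ==> r \<odot>\<^sub>M x \<in> carrier M"
  and "!!r y. r \<in> carrier R ==> y \<in> carrier N ==> r \<odot>\<^sub>N y \<in> carrier N"
  and "tensor_eq R M N xs ys"
 shows "set xs \<subseteq> carrier M \<times> carrier N \<and> set ys \<subseteq> carrier M \<times> carrier N"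
 using assms(6) by (induction rule: tensor_eq.induct) (use assms(1-5) in auto)

text \<open>The universal property of the tensor product on lists of pairs: every generating
  relation of the congruence preserves the sum of a bilinear map.\<close>

lemma tensor_eq_bilinear:
 assumes P: "abelian_group P"
  and M: "!!x x'. x \<in> carrier M ==> x' \<in> carrier M ==> x \<oplus>\<^sub>M x' \<in> carrier M" "\<zero>\<^sub>M \<in> carrier M"
   "\<zero>\<^sub>M \<oplus>\<^sub>M \<zero>\<^sub>M = \<zero>\<^sub>M"
  and N: "!!y y'. y \<in> carrier N ==> y' \<in> carrier N ==> y \<oplus>\<^sub>N y' \<in> carrier N"
  and "!!r x. r \<in> carrier R ==> x \<in> carrier M ==> r \<odot>\<^sub>M x \<in> carrier M"
  and "!!r y. r \<in> carrier R ==> y \<in> carrier N ==> r \<odot>\<^sub>N y \<in> carrier N"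
  and \<beta>: "!!x y. x \<in> carrier M ==> y \<in> carrier N ==> \<beta> x y \<in> carrier P"
  and \<beta>l: "!!x x' y. x \<in> carrier M ==> x' \<in> carrier M ==> y \<in> carrier N ==> \<beta> (x \<oplus>\<^sub>M x') y = \<beta> x y \<oplus>\<^sub>P \<beta> x' y"
  and \<beta>r: "!!x y y'. x \<in> carrier M ==> y \<in> carrier N ==> y' \<in> carrier N ==> \<beta> x (y \<oplus>\<^sub>N y') = \<beta> x y \<oplus>\<^sub>P \<beta> x y'"
  and \<beta>s: "!!r x y. r \<in> carrier R ==> x \<in> carrier M ==> y \<in> carrier N ==> \<beta> (r \<odot>\<^sub>M x) y = \<beta> x (r \<odot>\<^sub>N y)"
  and eq: "tensor_eq R M N xs ys"
 shows "list_sum P (map (\<lambda>(x, y). \<beta> x y) xs) = list_sum P (map (\<lambda>(x, y). \<beta> x y) ys)"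
proof -
 interpret P: abelian_group P by fact
 have sub: "set (map (\<lambda>(x, y). \<beta> x y) xs) \<subseteq> carrier P" if "set xs \<subseteq> carrier M \<times> carrier N" for xs
  using that \<beta> by auto
 have carr: "set xs \<subseteq> carrier M \<times> carrier N \<and> set ys \<subseteq> carrier M \<times> carrier N"
  if "tensor_eq R M N xs ys" for xs ys
  by (rule tensor_eq_carrier[where R = R]) (use M N assms(6,7) that in auto)
 show ?thesis using eq
 proof (induction rule: tensor_eq.induct)
  case (append xs ys us vs)
  thus ?case
   using carr[OF append.hyps(1)] carr[OF append.hyps(2)] sub by (simp add: P.list_sum_append)
 next
  case (comm xs ys)
  thus ?case using sub P.list_sum_closed by (simp add: P.list_sum_append P.a_comm)
 next
  case (zero y)
  have "\<beta> \<zero>\<^sub>M y = \<beta> \<zero>\<^sub>M y \<oplus>\<^sub>P \<beta> \<zero>\<^sub>M y" using \<beta>l[of "\<zero>\<^sub>M" "\<zero>\<^sub>M" y] zero M by simp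
  thus ?case using zero \<beta> M by (simp add: P.add.l_cancel_one)
 qed (use \<beta> \<beta>l \<beta>r \<beta>s in \<open>auto\<close>)
qed

text \<open>For \<open>c\<close> and \<open>d\<close> the counits of two factors, the leading term
  is a product of two elements of the augmentation ideal and the others are linear in at most one
  factor.\<close>

lemma (in cring) mult_shift:
 assumes "a \<in> carrier R" "b \<in> carrier R" "c \<in> carrier R" "d \<in> carrier R"
 shows "a \<otimes> b = (a \<ominus> c) \<otimes> (b \<ominus> d) \<oplus> (\<ominus> (c \<otimes> d) \<oplus> (d \<otimes> a \<oplus> c \<otimes> b))"
 using assms by algebra

context comm_hopf_algebra
begin

abbreviation aug :: "'a set" where "aug \<equiv> aug_ideal R A"
abbreviation aug2 :: "'a set" where "aug2 \<equiv> aug_ideal_sq R A"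

lemma counit_ring_hom: "ring_hom_ring A R (counit A)"
 using counit_hom by (intro ring_hom_ringI2) (auto intro: ring_axioms R.ring_axioms)

lemma counit_closed [simp]: "x \<in> carrier A ==> counit A x \<in> carrier R"
 using ring_hom_closed[OF counit_hom] by blast

lemma counit_add: "x \<in> carrier A ==> y \<in> carrier A ==> counit A (x \<oplus>\<^sub>A y) = counit A x \<oplus>\<^sub>R counit A y"
 using ring_hom_add[OF counit_hom] by blast

lemma counit_one: "counit A \<one>\<^sub>A = \<one>\<^sub>R"
 using ring_hom_one[OF counit_hom] by blast

lemma ideal_aug: "ideal aug A"
proof -
 have "aug = a_kernel A R (counit A)"
  by (auto simp: aug_ideal_def a_kernel_def kernel_def)
 thus ?thesis using ring_hom_ring.kernel_is_ideal[OF counit_ring_hom] by simp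
qed

lemma ideal_aug2: "ideal aug2 A"
 unfolding aug_ideal_sq_def by (rule ideal_prod_is_ideal[OF ideal_aug ideal_aug])

lemma aug2_mult: "x \<in> aug ==> y \<in> aug ==> x \<otimes>\<^sub>A y \<in> aug2"
 unfolding aug_ideal_sq_def by (rule ideal_prod.prod)

lemma aug2_subset: "aug2 \<subseteq> aug"
 unfolding aug_ideal_sq_def using ideal_prod_inter[OF ideal_aug ideal_aug] by blast

lemma aug_carrier: "aug \<subseteq> carrier A"
 by (auto simp: aug_ideal_def)

lemma aug2_carrier: "aug2 \<subseteq> carrier A"
 using aug2_subset aug_carrier by blast

definition cong2 :: "'a => 'a => bool" where
 "cong2 x y \<longleftrightarrow> x \<ominus>\<^sub>A y \<in> aug2"

text \<open>Multiplicativity is left out on purpose: the class so obtained contains the Hopf algebra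
  endomorphisms, is closed under convolution by a direct computation, hence contains
  \<open>mult_by\<close>, and is enough for the additivity of the action on the conormal
  module.\<close>

definition unital_counital :: "('a => 'a) => bool" where
 "unital_counital h \<longleftrightarrow> (\<forall>x\<in>carrier A. h x \<in> carrier A \<and> counit A (h x) = counit A x) \<and>
   (\<forall>x\<in>carrier A. \<forall>y\<in>carrier A. h (x \<oplus>\<^sub>A y) = h x \<oplus>\<^sub>A h y) \<and>
   (\<forall>r\<in>carrier R. \<forall>x\<in>carrier A. h (r \<odot>\<^sub>A x) = r \<odot>\<^sub>A h x) \<and> h \<one>\<^sub>A = \<one>\<^sub>A"

lemma unital_counitalD:
 assumes "unital_counital h"
 shows "x \<in> carrier A ==> h x \<in> carrier A" "x \<in> carrier A ==> counit A (h x) = counit A x"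
  "x \<in> carrier A ==> y \<in> carrier A ==> h (x \<oplus>\<^sub>A y) = h x \<oplus>\<^sub>A h y"
  "r \<in> carrier R ==> x \<in> carrier A ==> h (r \<odot>\<^sub>A x) = r \<odot>\<^sub>A h x" "h \<one>\<^sub>A = \<one>\<^sub>A"
 using assms unfolding unital_counital_def by blast+

lemma smult_mult_comm: "r \<in> carrier R ==> x \<in> carrier A ==> y \<in> carrier A ==>
  x \<otimes>\<^sub>A (r \<odot>\<^sub>A y) = r \<odot>\<^sub>A (x \<otimes>\<^sub>A y)"
 using smult_assoc2[of r y x] by (simp add: m_comm)

lemma tensor_eq_sum:
 assumes "tensor_eq R A A xs ys" "abelian_group P"
  and "!!x y. x \<in> carrier A ==> y \<in> carrier A ==> \<beta> x y \<in> carrier P"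
  and "!!x x' y. x \<in> carrier A ==> x' \<in> carrier A ==> y \<in> carrier A ==> \<beta> (x \<oplus>\<^sub>A x') y = \<beta> x y \<oplus>\<^sub>P \<beta> x' y"
  and "!!x y y'. x \<in> carrier A ==> y \<in> carrier A ==> y' \<in> carrier A ==> \<beta> x (y \<oplus>\<^sub>A y') = \<beta> x y \<oplus>\<^sub>P \<beta> x y'"
  and "!!r x y. r \<in> carrier R ==> x \<in> carrier A ==> y \<in> carrier A ==> \<beta> (r \<odot>\<^sub>A x) y = \<beta> x (r \<odot>\<^sub>A y)"
 shows "list_sum P (map (\<lambda>(x, y). \<beta> x y) xs) = list_sum P (map (\<lambda>(x, y). \<beta> x y) ys)"
 using assms by (intro tensor_eq_bilinear[where R = R and M = A and N = A and P = P]) auto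

text \<open>The left counit law combined with cocommutativity.\<close>

lemma counit_right:
 assumes x: "x \<in> carrier A"
 shows "list_sum A (map (\<lambda>(u, w). counit A w \<odot>\<^sub>A u) (comult A x)) = x"
proof -
 have "list_sum A (map (\<lambda>(u, w). counit A u \<odot>\<^sub>A w) (comult A x))
   = list_sum A (map (\<lambda>(u, w). counit A u \<odot>\<^sub>A w) (map (\<lambda>(u, w). (w, u)) (comult A x)))"
  by (rule tensor_eq_sum[OF cocomm[OF x]])
   (auto intro: M.abelian_group_axioms simp: counit_add smult_l_distr smult_r_distr counit_smult
    smult_assoc1[symmetric] R.m_comm)
 thus ?thesis
  using counit_left[OF x] by (simp add: o_def case_prod_unfold)
qed

lemma convolution_sum:
 "x \<in> carrier A ==> convolution A g h x = list_sum A (map (\<lambda>(u, w). g u \<otimes>\<^sub>A h w) (comult A x))"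
 by (simp add: convolution_def)

lemma convolution_tensor_eq:
 assumes "unital_counital g" "unital_counital h" "tensor_eq R A A xs ys"
 shows "list_sum A (map (\<lambda>(u, w). g u \<otimes>\<^sub>A h w) xs) = list_sum A (map (\<lambda>(u, w). g u \<otimes>\<^sub>A h w) ys)"
 by (rule tensor_eq_sum[OF assms(3)])
  (use unital_counitalD[OF assms(1)] unital_counitalD[OF assms(2)] in
   \<open>auto intro: M.abelian_group_axioms simp: l_distr r_distr smult_assoc2 smult_mult_comm\<close>)

lemma pairs_closed:
 assumes "unital_counital g" "unital_counital h" "set xs \<subseteq> carrier A \<times> carrier A"
 shows "set (map (\<lambda>(u, w). g u \<otimes>\<^sub>A h w) xs) \<subseteq> carrier A"
 using assms(3) unital_counitalD(1)[OF assms(1)] unital_counitalD(1)[OF assms(2)] by auto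

lemma unital_counital_convolution:
 assumes g: "unital_counital g" and h: "unital_counital h"
 shows "unital_counital (convolution A g h)"
proof -
 note gD = unital_counitalD[OF g] and hD = unital_counitalD[OF h]
 note pc = pairs_closed[OF g h]
 have "convolution A g h x \<in> carrier A" if "x \<in> carrier A" for x
  using that pc[OF comult_closed] by (simp add: convolution_sum M.list_sum_closed)
 moreover have "counit A (convolution A g h x) = counit A x" if x: "x \<in> carrier A" for x
 proof -
  have "counit A (convolution A g h x) =
    list_sum R (map (counit A) (map (\<lambda>(u, w). g u \<otimes>\<^sub>A h w) (comult A x)))"
   unfolding convolution_sum[OF x]
   by (rule list_sum_hom[OF M.abelian_monoid_axioms R.abelian_monoid_axioms pc[OF comult_closed[OF x]]])
    (use counit_add ring_hom_zero[OF counit_hom ring_axioms R.ring_axioms] in auto)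
  also have "map (counit A) (map (\<lambda>(u, w). g u \<otimes>\<^sub>A h w) (comult A x))
    = map (counit A) (map (\<lambda>(u, w). counit A u \<odot>\<^sub>A w) (comult A x))"
   using comult_closed[OF x] gD hD by (auto simp: ring_hom_mult[OF counit_hom] counit_smult)
  also have "list_sum R \<dots> = counit A (list_sum A (map (\<lambda>(u, w). counit A u \<odot>\<^sub>A w) (comult A x)))"
   by (rule list_sum_hom[OF M.abelian_monoid_axioms R.abelian_monoid_axioms, symmetric])
    (use comult_closed[OF x] counit_add ring_hom_zero[OF counit_hom ring_axioms R.ring_axioms] in auto)
  finally show ?thesis using counit_left[OF x] by simp
 qed
 moreover have "convolution A g h (x \<oplus>\<^sub>A y) = convolution A g h x \<oplus>\<^sub>A convolution A g h y"
  if xy: "x \<in> carrier A" "y \<in> carrier A" for x y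
  using convolution_tensor_eq[OF g h comult_add[OF xy]] xy pc[OF comult_closed]
  by (simp add: convolution_sum M.list_sum_append)
 moreover have "convolution A g h (r \<odot>\<^sub>A x) = r \<odot>\<^sub>A convolution A g h x"
  if x: "r \<in> carrier R" "x \<in> carrier A" for r x
 proof -
  have "r \<odot>\<^sub>A convolution A g h x =
    list_sum A (map (\<lambda>z. r \<odot>\<^sub>A z) (map (\<lambda>(u, w). g u \<otimes>\<^sub>A h w) (comult A x)))"
   unfolding convolution_sum[OF x(2)]
   by (rule list_sum_hom[OF M.abelian_monoid_axioms M.abelian_monoid_axioms pc[OF comult_closed[OF x(2)]]])
    (use x smult_r_distr in auto)
  also have "map (\<lambda>z. r \<odot>\<^sub>A z) (map (\<lambda>(u, w). g u \<otimes>\<^sub>A h w) (comult A x)) =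
    map (\<lambda>(u, w). g u \<otimes>\<^sub>A h w) (map (\<lambda>(u, w). (r \<odot>\<^sub>A u, w)) (comult A x))"
   using comult_closed[OF x(2)] gD hD x by (auto simp: smult_assoc2)
  also have "list_sum A \<dots> = convolution A g h (r \<odot>\<^sub>A x)"
   using convolution_tensor_eq[OF g h comult_smult[OF x]] x by (simp add: convolution_sum)
  finally show ?thesis by simp
 qed
 moreover have "convolution A g h \<one>\<^sub>A = \<one>\<^sub>A"
  using convolution_tensor_eq[OF g h comult_one] gD hD by (simp add: convolution_sum)
 ultimately show ?thesis unfolding unital_counital_def by blast
qed

lemma aug2_closed:
 "x \<in> aug2 ==> y \<in> aug2 ==> x \<oplus>\<^sub>A y \<in> aug2" "\<zero>\<^sub>A \<in> aug2"
 using additive_subgroup.a_closed[OF ideal.axioms(1)[OF ideal_aug2]]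
  additive_subgroup.zero_closed[OF ideal.axioms(1)[OF ideal_aug2]] by blast+

text \<open>Modulo the square of the augmentation ideal, comultiplication is \<open>x \<mapsto> x \<otimes> 1 + 1 \<otimes> x\<close> on the
 augmentation ideal.\<close>

lemma convolution_cong2:
 assumes g: "unital_counital g" and h: "unital_counital h" and x: "x \<in> aug"
 shows "cong2 (convolution A g h x) (g x \<oplus>\<^sub>A h x)"
proof -
 note gD = unital_counitalD[OF g] and hD = unital_counitalD[OF h]
 have xA: "x \<in> carrier A" "counit A x = \<zero>\<^sub>R" using x by (auto simp: aug_ideal_def)
 define \<epsilon> where "\<epsilon> = counit A"
 have \<epsilon>: "\<epsilon> u \<in> carrier R" if "u \<in> carrier A" for u using that by (simp add: \<epsilon>_def)
 \<comment> \<open>The product of \<open>g u\<close> and \<open>h w\<close> is expanded around the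
   counits of \<open>u\<close> and \<open>w\<close>. Summed over the comultiplication of
   \<open>x\<close>, the terms \<open>f1\<close> and \<open>f2\<close> give \<open>h x\<close> and
   \<open>g x\<close> by the counit laws, \<open>f3\<close> gives a multiple of the counit of
   \<open>x\<close>, which is zero, and \<open>f4\<close> lies in the square of the augmentation
   ideal.\<close>
 define f1 where "f1 = (\<lambda>(u, w). \<epsilon> u \<odot>\<^sub>A h w)"
 define f2 where "f2 = (\<lambda>(u, w). \<epsilon> w \<odot>\<^sub>A g u)"
 define f3 where "f3 = (\<lambda>(u, w). \<ominus>\<^sub>R (\<epsilon> u \<otimes>\<^sub>R \<epsilon> w) \<odot>\<^sub>A \<one>\<^sub>A)"
 define f4 where "f4 = (\<lambda>(u, w). (g u \<ominus>\<^sub>A \<epsilon> u \<odot>\<^sub>A \<one>\<^sub>A) \<otimes>\<^sub>A (h w \<ominus>\<^sub>A \<epsilon> w \<odot>\<^sub>A \<one>\<^sub>A))"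
 let ?c = "comult A x"
 have c: "set ?c \<subseteq> carrier A \<times> carrier A" by (rule comult_closed[OF xA(1)])
 have f_closed: "f1 z \<in> carrier A" "f2 z \<in> carrier A" "f3 z \<in> carrier A" "f4 z \<in> carrier A" if "z \<in> set ?c" for z
  using that c gD hD \<epsilon> by (auto simp: f1_def f2_def f3_def f4_def)
 have expand: "(case z of (u, w) => g u \<otimes>\<^sub>A h w) = f4 z \<oplus>\<^sub>A (f3 z \<oplus>\<^sub>A (f2 z \<oplus>\<^sub>A f1 z))" if "z \<in> set ?c" for z
 proof -
  obtain u w where z: "z = (u, w)" "u \<in> carrier A" "w \<in> carrier A" using \<open>z \<in> set ?c\<close> c by auto
  have "f3 z = \<ominus>\<^sub>A ((\<epsilon> u \<odot>\<^sub>A \<one>\<^sub>A) \<otimes>\<^sub>A (\<epsilon> w \<odot>\<^sub>A \<one>\<^sub>A))"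
   using z \<epsilon> by (simp add: f3_def smult_l_minus smult_assoc1 smult_assoc2)
  moreover have "f2 z = (\<epsilon> w \<odot>\<^sub>A \<one>\<^sub>A) \<otimes>\<^sub>A g u" "f1 z = (\<epsilon> u \<odot>\<^sub>A \<one>\<^sub>A) \<otimes>\<^sub>A h w"
   using z \<epsilon> gD hD by (simp_all add: f2_def f1_def smult_assoc2)
  moreover have "f4 z = (g u \<ominus>\<^sub>A \<epsilon> u \<odot>\<^sub>A \<one>\<^sub>A) \<otimes>\<^sub>A (h w \<ominus>\<^sub>A \<epsilon> w \<odot>\<^sub>A \<one>\<^sub>A)"
   by (simp add: f4_def z)
  ultimately show ?thesis
   using mult_shift[of "g u" "h w" "\<epsilon> u \<odot>\<^sub>A \<one>\<^sub>A" "\<epsilon> w \<odot>\<^sub>A \<one>\<^sub>A"] z \<epsilon> gD(1) hD(1) by simp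
 qed
 have s1: "list_sum A (map f1 ?c) = h x"
 proof -
  have "h (list_sum A (map (\<lambda>(u, w). counit A u \<odot>\<^sub>A w) ?c)) =
    list_sum A (map h (map (\<lambda>(u, w). counit A u \<odot>\<^sub>A w) ?c))"
   by (rule list_sum_hom[OF M.abelian_monoid_axioms M.abelian_monoid_axioms])
    (use c hD hD(4)[of "\<zero>\<^sub>R" "\<zero>\<^sub>A"] in auto)
  also have "map h (map (\<lambda>(u, w). counit A u \<odot>\<^sub>A w) ?c) = map f1 ?c"
   using c hD(4) by (auto simp: f1_def \<epsilon>_def)
  finally show ?thesis using counit_left[OF xA(1)] by simp
 qed
 have s2: "list_sum A (map f2 ?c) = g x"
 proof -
  have "g (list_sum A (map (\<lambda>(u, w). counit A w \<odot>\<^sub>A u) ?c)) =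
    list_sum A (map g (map (\<lambda>(u, w). counit A w \<odot>\<^sub>A u) ?c))"
   by (rule list_sum_hom[OF M.abelian_monoid_axioms M.abelian_monoid_axioms])
    (use c gD gD(4)[of "\<zero>\<^sub>R" "\<zero>\<^sub>A"] in auto)
  also have "map g (map (\<lambda>(u, w). counit A w \<odot>\<^sub>A u) ?c) = map f2 ?c"
   using c gD(4) by (auto simp: f2_def \<epsilon>_def)
  finally show ?thesis using counit_right[OF xA(1)] by simp
 qed
 have s3: "list_sum A (map f3 ?c) = \<zero>\<^sub>A"
 proof -
  let ?k = "\<lambda>y. (\<ominus>\<^sub>R counit A y) \<odot>\<^sub>A \<one>\<^sub>A"
  have e0: "counit A \<zero>\<^sub>A = \<zero>\<^sub>R" by (rule ring_hom_zero[OF counit_hom ring_axioms R.ring_axioms])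
  have "?k (list_sum A (map (\<lambda>(u, w). counit A u \<odot>\<^sub>A w) ?c)) =
    list_sum A (map ?k (map (\<lambda>(u, w). counit A u \<odot>\<^sub>A w) ?c))"
   by (rule list_sum_hom[OF M.abelian_monoid_axioms M.abelian_monoid_axioms])
    (use c e0 in \<open>auto simp: counit_add R.minus_add smult_l_distr\<close>)
  also have "map ?k (map (\<lambda>(u, w). counit A u \<odot>\<^sub>A w) ?c) = map f3 ?c"
   using c by (auto simp: f3_def \<epsilon>_def counit_smult)
  finally show ?thesis using counit_left[OF xA(1)] xA by simp
 qed
 have s4: "list_sum A (map f4 ?c) \<in> aug2"
 proof -
  have "f4 z \<in> aug2" if "z \<in> set ?c" for z
  proof -
   obtain u w where z: "z = (u, w)" "u \<in> carrier A" "w \<in> carrier A" using \<open>z \<in> set ?c\<close> c by auto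
   have sh: "y \<ominus>\<^sub>A \<epsilon> y' \<odot>\<^sub>A \<one>\<^sub>A \<in> aug" if "y \<in> carrier A" "y' \<in> carrier A" "counit A y = \<epsilon> y'" for y y'
    using that \<epsilon>[OF that(2)]
    by (auto simp: aug_ideal_def counit_smult counit_one a_minus_def counit_add
      smult_l_minus[symmetric] R.r_neg)
   show ?thesis
    using z gD hD by (auto simp: f4_def intro!: aug2_mult sh) (simp_all add: \<epsilon>_def)
  qed
  hence "list_sum A (map f4 cs) \<in> aug2" if "set cs \<subseteq> set ?c" for cs
   using that by (induction cs) (auto intro: aug2_closed)
  thus ?thesis by blast
 qed
 have "convolution A g h x = list_sum A (map (\<lambda>z. f4 z \<oplus>\<^sub>A (f3 z \<oplus>\<^sub>A (f2 z \<oplus>\<^sub>A f1 z))) ?c)"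
  unfolding convolution_sum[OF xA(1)] using expand by (intro arg_cong[where f = "list_sum A"] map_cong) auto
 also have "\<dots> = list_sum A (map f4 ?c) \<oplus>\<^sub>A (list_sum A (map f3 ?c) \<oplus>\<^sub>A (list_sum A (map f2 ?c) \<oplus>\<^sub>A list_sum A (map f1 ?c)))"
  using f_closed by (simp add: M.list_sum_map_add)
 finally have "convolution A g h x = list_sum A (map f4 ?c) \<oplus>\<^sub>A (g x \<oplus>\<^sub>A h x)"
  using s1 s2 s3 gD(1)[OF xA(1)] hD(1)[OF xA(1)] by simp
 hence "convolution A g h x \<ominus>\<^sub>A (g x \<oplus>\<^sub>A h x) = list_sum A (map f4 ?c)"
  using s4 aug2_carrier gD(1)[OF xA(1)] hD(1)[OF xA(1)] by (simp add: a_minus_def M.a_assoc M.r_neg subset_iff)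
 thus ?thesis using s4 by (simp add: cong2_def)
qed

lemma unital_counital_id: "unital_counital (\<lambda>x\<in>carrier A. x)"
 unfolding unital_counital_def by auto

lemma unital_counital_mult_by: "unital_counital (mult_by A m)"
proof (induction m)
 case 0
 show ?case
  unfolding unital_counital_def
  by (auto simp: counit_add smult_l_distr counit_smult counit_one smult_assoc1)
next
 case (Suc m)
 thus ?case using unital_counital_convolution[OF unital_counital_id] by simp
qed

lemma unital_counital_hopf_hom: "h \<in> hopf_hom R A A ==> unital_counital h"
 unfolding unital_counital_def hopf_hom_def Defs.linear_map_def
 using ring_hom_one[of h A A] by (auto simp: Pi_iff)

lemma unital_counital_aug:
 assumes "unital_counital h" "x \<in> aug" shows "h x \<in> aug"
 using assms unital_counitalD[OF assms(1)] by (auto simp: aug_ideal_def)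

definition cls :: "'a => 'a set" where "cls x = aug2 +>\<^bsub>A\<^esub> x"

lemma cls_eq_iff: "x \<in> carrier A ==> y \<in> carrier A ==> cls x = cls y \<longleftrightarrow> cong2 x y"
 unfolding cls_def cong2_def using quotient_eq_iff_same_a_r_cos[OF ideal_aug2] by blast

lemma mem_clsD: "x \<in> carrier A ==> y \<in> cls x ==> y \<in> carrier A \<and> cls y = cls x"
proof -
 assume x: "x \<in> carrier A" and y: "y \<in> cls x"
 then obtain h where h: "h \<in> aug2" "y = h \<oplus>\<^sub>A x" unfolding cls_def a_r_coset_def' by blast
 have hA: "h \<in> carrier A" using h aug2_carrier by blast
 have "y \<ominus>\<^sub>A x = h" using h hA x by (simp add: a_minus_def M.a_assoc M.r_neg)
 thus "y \<in> carrier A \<and> cls y = cls x" using cls_eq_iff[of y x] h hA x by (simp add: cong2_def)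
qed

lemma self_mem_cls: "x \<in> carrier A ==> x \<in> cls x"
 unfolding cls_def a_r_coset_def' using aug2_closed(2) by (auto intro!: bexI[of _ "\<zero>\<^sub>A"])

lemma omega_fin_carrier: "carrier (omega_fin R A) = cls ` aug"
 unfolding omega_fin_def quot_module_def cls_def
 by (auto simp: A_RCOSETS_def RCOSETS_def a_r_coset_def r_coset_def module.defs)

lemma omega_fin_add:
 assumes "x \<in> carrier A" "y \<in> carrier A"
 shows "cls x \<oplus>\<^bsub>omega_fin R A\<^esub> cls y = cls (x \<oplus>\<^sub>A y)"
proof -
 have "abelian_subgroup aug2 A"
  using abelian_subgroupI3 ideal.axioms(1)[OF ideal_aug2] M.abelian_group_axioms by blast
 hence "(aug2 +>\<^bsub>A\<^esub> x) <+>\<^bsub>A\<^esub> (aug2 +>\<^bsub>A\<^esub> y) = aug2 +>\<^bsub>A\<^esub> (x \<oplus>\<^sub>A y)"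
  using assms by (rule abelian_subgroup.a_rcos_sum)
 thus ?thesis
  by (simp add: omega_fin_def quot_module_def cls_def set_add_def set_mult_def module.defs)
qed

lemma omega_fin_smult:
 assumes "r \<in> carrier R" "x \<in> carrier A"
 shows "r \<odot>\<^bsub>omega_fin R A\<^esub> cls x = cls (r \<odot>\<^sub>A x)"
proof -
 have "cls (r \<odot>\<^sub>A y) = cls (r \<odot>\<^sub>A x)" if y: "y \<in> cls x" for y
 proof -
  have yA: "y \<in> carrier A" "cong2 y x" using mem_clsD[OF assms(2) y] cls_eq_iff assms by auto
  have "r \<odot>\<^sub>A y \<ominus>\<^sub>A r \<odot>\<^sub>A x = (r \<odot>\<^sub>A \<one>\<^sub>A) \<otimes>\<^sub>A (y \<ominus>\<^sub>A x)"
   using yA assms by (simp add: a_minus_def smult_assoc2 smult_r_distr smult_r_minus)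
  also have "\<dots> \<in> aug2"
   using yA assms by (intro ideal.I_l_closed[OF ideal_aug2]) (auto simp: cong2_def)
  finally show ?thesis using cls_eq_iff[of "r \<odot>\<^sub>A y" "r \<odot>\<^sub>A x"] yA assms by (simp add: cong2_def)
 qed
 hence "(\<Union>y\<in>cls x. cls (r \<odot>\<^sub>A y)) = cls (r \<odot>\<^sub>A x)"
  using self_mem_cls[OF assms(2)] by blast
 thus ?thesis
  by (simp add: omega_fin_def quot_module_def cls_def a_r_coset_def r_coset_def module.defs)
qed

text \<open>\<open>mult_by\<close> is an iterated convolution with the identity, and on the conormal
  module convolution becomes addition.\<close>

lemma mult_by_cls: "x \<in> aug ==> cls (mult_by A m x) = nat_in R m \<odot>\<^bsub>omega_fin R A\<^esub> cls x"
proof (induction m)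
 case 0
 thus ?case using aug_carrier by (auto simp: aug_ideal_def omega_fin_smult)
next
 case (Suc m)
 have x: "x \<in> carrier A" "mult_by A m x \<in> carrier A" "mult_by A (Suc m) x \<in> carrier A"
  using subsetD[OF aug_carrier Suc.prems] unital_counitalD(1)[OF unital_counital_mult_by] by blast+
 have "cong2 (mult_by A (Suc m) x) (x \<oplus>\<^sub>A mult_by A m x)"
  using convolution_cong2[OF unital_counital_id unital_counital_mult_by Suc.prems] x by simp
 hence "cls (mult_by A (Suc m) x) = cls (x \<oplus>\<^sub>A mult_by A m x)"
  using cls_eq_iff x by simp
 also have "\<dots> = cls x \<oplus>\<^bsub>omega_fin R A\<^esub> cls (nat_in R m \<odot>\<^sub>A x)"
  using Suc x by (simp add: omega_fin_add[symmetric] omega_fin_smult)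
 also have "\<dots> = nat_in R (Suc m) \<odot>\<^bsub>omega_fin R A\<^esub> cls x"
  using x by (simp add: omega_fin_add omega_fin_smult smult_l_distr M.a_comm)
 finally show ?case .
qed

end

text \<open>A ring map compatible with the counits preserves the augmentation ideals and hence their
  squares, so all cosets in the union that defines \<open>coset_map\<close> are equal.\<close>

lemma coset_map_cls:
 assumes A: "comm_hopf_algebra R A" and B: "comm_hopf_algebra R B"
  and h: "h \<in> ring_hom A B" "!!x. x \<in> carrier A ==> counit B (h x) = counit A x"
  and x: "x \<in> carrier A"
 shows "coset_map B (aug_ideal_sq R B) h (comm_hopf_algebra.cls R A x) = comm_hopf_algebra.cls R B (h x)"
proof -
 interpret A: comm_hopf_algebra R A by fact
 interpret B: comm_hopf_algebra R B by fact
 have h': "h x \<in> carrier B" if "x \<in> carrier A" for x using ring_hom_closed[OF h(1)] that by blast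
 have aug: "h x \<in> B.aug" if "x \<in> A.aug" for x using that h' h(2) by (auto simp: aug_ideal_def)
 have hdiff: "h (x \<ominus>\<^sub>A y) = h x \<ominus>\<^sub>B h y" if "x \<in> carrier A" "y \<in> carrier A" for x y
 proof -
  interpret ring_hom_ring A B h using h(1) by (intro ring_hom_ringI2 A.ring_axioms B.ring_axioms)
  show ?thesis using that by (simp add: a_minus_def)
 qed
 have aug2: "h x \<in> B.aug2" if "x \<in> A.aug2" for x
  using that[unfolded aug_ideal_sq_def]
 proof (induction rule: ideal_prod.induct)
  case (prod i j)
  thus ?case using ring_hom_mult[OF h(1), of i j] subsetD[OF A.aug_carrier] aug B.aug2_mult by simp
 next
  case (sum s t)
  have "s \<in> carrier A" "t \<in> carrier A"
   using sum A.aug2_carrier unfolding aug_ideal_sq_def by auto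
  thus ?case using sum ring_hom_add[OF h(1)] B.aug2_closed by simp
 qed
 have "B.cls (h y) = B.cls (h x)" if y: "y \<in> A.cls x" for y
 proof -
  have "y \<in> carrier A" "A.cong2 y x" using A.mem_clsD[OF x y] A.cls_eq_iff x by auto
  thus ?thesis
   using aug2[of "y \<ominus>\<^sub>A x"] hdiff[of y x] x h' B.cls_eq_iff by (simp add: A.cong2_def B.cong2_def)
 qed
 hence "(\<Union>y\<in>A.cls x. B.cls (h y)) = B.cls (h x)"
  using A.self_mem_cls[OF x] by blast
 thus ?thesis by (simp add: coset_map_def B.cls_def)
qed

section \<open>Differentials of a p-divisible group\<close>

locale pdiv_group =
 fixes R :: "('r, 'm) ring_scheme" and p h :: nat and A :: "nat => ('r, 'a) hopf" and res :: "nat => 'a => 'a"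
 assumes pdiv: "p_divisible_group R p h A res"
begin

lemma hopf: "comm_hopf_algebra R (A i)"
 and res_hom: "res i \<in> hopf_hom R (A (Suc i)) (A i)"
 and res_surj: "res i ` carrier (A (Suc i)) = carrier (A i)"
 and res_kernel: "a_kernel (A (Suc i)) (A i) (res i) =
      Idl\<^bsub>A (Suc i)\<^esub> (mult_by (A (Suc i)) (p ^ i) ` aug_ideal R (A (Suc i)))"
 using pdiv unfolding p_divisible_group_def by blast+

abbreviation acls :: "nat => 'a => 'a set" where "acls i \<equiv> comm_hopf_algebra.cls R (A i)"

abbreviation End :: "(nat => 'a => 'a) ring" where "End \<equiv> End_ring R A res"

abbreviation \<Omega> :: "('r, nat => 'a set) module" where "\<Omega> \<equiv> omega R A res"

lemma res_homD:
 shows "res i \<in> ring_hom (A (Suc i)) (A i)" "x \<in> carrier (A (Suc i)) ==> counit (A i) (res i x) = counit (A (Suc i)) x"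
  "x \<in> carrier (A (Suc i)) ==> tensor_eq R (A i) (A i) (map (map_prod (res i) (res i)) (comult (A (Suc i)) x)) (comult (A i) (res i x))"
  "x \<in> carrier (A (Suc i)) ==> res i x \<in> carrier (A i)"
 using res_hom[of i] ring_hom_closed unfolding hopf_hom_def by fastforce+

lemma coset_map_res:
 "x \<in> carrier (A (Suc i)) ==>
  coset_map (A i) (aug_ideal_sq R (A i)) (res i) (acls (Suc i) x) = acls i (res i x)"
 by (rule coset_map_cls[OF hopf hopf res_homD(1,2)])

lemma End_D:
 assumes "g \<in> carrier End"
 shows "g i \<in> hopf_hom R (A i) (A i)" "g i \<in> ring_hom (A i) (A i)"
  "x \<in> carrier (A i) ==> counit (A i) (g i x) = counit (A i) x"
  "x \<in> carrier (A (Suc i)) ==> res i (g (Suc i) x) = g i (res i x)"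
  "comm_hopf_algebra.unital_counital R (A i) (g i)"
 using assms comm_hopf_algebra.unital_counital_hopf_hom[OF hopf, of "g i"]
 unfolding End_ring_def hopf_hom_def by auto

lemma coset_map_End:
 assumes "g \<in> carrier End" "x \<in> carrier (A i)"
 shows "coset_map (A i) (aug_ideal_sq R (A i)) (g i) (acls i x) = acls i (g i x)"
 by (rule coset_map_cls[OF hopf hopf]) (use End_D[OF assms(1)] assms(2) in auto)

text \<open>Representatives are chosen separately on each level; they are compatible under
  \<open>res\<close> only modulo the squares of the augmentation ideals.\<close>

lemma omega_E:
 assumes "w \<in> carrier \<Omega>"
 obtains x where "!!i. x i \<in> aug_ideal R (A i)" "!!i. x i \<in> carrier (A i)" "!!i. w i = acls i (x i)"
  "!!i. acls i (res i (x (Suc i))) = acls i (x i)"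
proof -
 have "w i \<in> carrier (omega_fin R (A i))" for i
  using assms by (simp add: omega_def)
 hence "\<exists>x\<in>aug_ideal R (A i). w i = acls i x" for i
  unfolding comm_hopf_algebra.omega_fin_carrier[OF hopf] by blast
 then obtain x where x: "!!i. x i \<in> aug_ideal R (A i)" "!!i. w i = acls i (x i)" by metis
 have xA: "x i \<in> carrier (A i)" for i using x(1)[of i] by (auto simp: aug_ideal_def)
 have "coset_map (A i) (aug_ideal_sq R (A i)) (res i) (w (Suc i)) = w i" for i
  using assms by (auto simp: omega_def)
 hence "acls i (res i (x (Suc i))) = acls i (x i)" for i
  using coset_map_res[OF xA] x(2) by metis
 thus thesis using that x xA by blast
qed

lemma omega_I:
 assumes "!!i. x i \<in> aug_ideal R (A i)" "!!i. acls i (res i (x (Suc i))) = acls i (x i)"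
 shows "(\<lambda>i. acls i (x i)) \<in> carrier \<Omega>"
proof -
 have "x i \<in> carrier (A i)" for i using assms(1)[of i] by (auto simp: aug_ideal_def)
 thus ?thesis
  using assms comm_hopf_algebra.omega_fin_carrier[OF hopf] coset_map_res by (auto simp: omega_def)
qed

lemma omega_ops:
 "w \<oplus>\<^bsub>\<Omega>\<^esub> w' = (\<lambda>i. w i \<oplus>\<^bsub>omega_fin R (A i)\<^esub> w' i)"
 "r \<odot>\<^bsub>\<Omega>\<^esub> w = (\<lambda>i. r \<odot>\<^bsub>omega_fin R (A i)\<^esub> w i)"
 by (simp_all add: omega_def)

lemma omega_map_apply:
 assumes "g \<in> carrier End" "!!i. x i \<in> carrier (A i)" "!!i. w i = acls i (x i)"
 shows "omega_map R A g w = (\<lambda>i. acls i (g i (x i)))"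
 using coset_map_End[OF assms(1,2)] assms(3) by (simp add: omega_map_def)

lemma End_closed: "g \<in> carrier End ==> x \<in> carrier (A i) ==> g i x \<in> carrier (A i)"
 using comm_hopf_algebra.unital_counitalD(1)[OF hopf End_D(5)] .

lemma End_aug: "g \<in> carrier End ==> x \<in> aug_ideal R (A i) ==> g i x \<in> aug_ideal R (A i)"
 using comm_hopf_algebra.unital_counital_aug[OF hopf End_D(5)] .

lemma End_cls_cong:
 assumes "g \<in> carrier End" "x \<in> carrier (A i)" "y \<in> carrier (A i)" "acls i x = acls i y"
 shows "acls i (g i x) = acls i (g i y)"
 using coset_map_End[OF assms(1,2)] coset_map_End[OF assms(1,3)] assms(4) by simp

lemma omega_map_closed:
 assumes g: "g \<in> carrier End" and w: "w \<in> carrier \<Omega>"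
 shows "omega_map R A g w \<in> carrier \<Omega>"
proof -
 obtain x where x: "!!i. x i \<in> aug_ideal R (A i)" "!!i. x i \<in> carrier (A i)" "!!i. w i = acls i (x i)"
  "!!i. acls i (res i (x (Suc i))) = acls i (x i)" by (rule omega_E[OF w]) blast
 show ?thesis
  unfolding omega_map_apply[OF g x(2,3)]
 proof (rule omega_I)
  show "g i (x i) \<in> aug_ideal R (A i)" for i by (rule End_aug[OF g x(1)])
  show "acls i (res i (g (Suc i) (x (Suc i)))) = acls i (g i (x i))" for i
   using End_D(4)[OF g x(2)] End_cls_cong[OF g res_homD(4)[OF x(2)] x(2) x(4)] by simp
 qed
qed

lemma omega_map_add:
 assumes g: "g \<in> carrier End" and w: "w \<in> carrier \<Omega>" "w' \<in> carrier \<Omega>"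
 shows "omega_map R A g (w \<oplus>\<^bsub>\<Omega>\<^esub> w') = omega_map R A g w \<oplus>\<^bsub>\<Omega>\<^esub> omega_map R A g w'"
proof -
 obtain x where x: "!!i. x i \<in> carrier (A i)" "!!i. w i = acls i (x i)" using omega_E[OF w(1)] by metis
 obtain y where y: "!!i. y i \<in> carrier (A i)" "!!i. w' i = acls i (y i)" using omega_E[OF w(2)] by metis
 have "w \<oplus>\<^bsub>\<Omega>\<^esub> w' = (\<lambda>i. acls i (x i \<oplus>\<^bsub>A i\<^esub> y i))"
  using x y by (simp add: omega_ops comm_hopf_algebra.omega_fin_add[OF hopf])
 moreover have "x i \<oplus>\<^bsub>A i\<^esub> y i \<in> carrier (A i)" for i
 proof -
  interpret comm_hopf_algebra R "A i" by (rule hopf)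
  show ?thesis using x y by simp
 qed
 ultimately have "omega_map R A g (w \<oplus>\<^bsub>\<Omega>\<^esub> w') = (\<lambda>i. acls i (g i (x i \<oplus>\<^bsub>A i\<^esub> y i)))"
  by (intro omega_map_apply[OF g]) auto
 also have "\<dots> = (\<lambda>i. acls i (g i (x i)) \<oplus>\<^bsub>omega_fin R (A i)\<^esub> acls i (g i (y i)))"
  using comm_hopf_algebra.unital_counitalD(3)[OF hopf End_D(5)[OF g]] x(1) y(1) End_closed[OF g]
  by (simp add: comm_hopf_algebra.omega_fin_add[OF hopf])
 also have "\<dots> = omega_map R A g w \<oplus>\<^bsub>\<Omega>\<^esub> omega_map R A g w'"
  by (simp add: omega_ops omega_map_apply[OF g x] omega_map_apply[OF g y])
 finally show ?thesis .
qed

lemma omega_map_smult: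
 assumes g: "g \<in> carrier End" and r: "r \<in> carrier R" and w: "w \<in> carrier \<Omega>"
 shows "omega_map R A g (r \<odot>\<^bsub>\<Omega>\<^esub> w) = r \<odot>\<^bsub>\<Omega>\<^esub> omega_map R A g w"
proof -
 obtain x where x: "!!i. x i \<in> carrier (A i)" "!!i. w i = acls i (x i)" using omega_E[OF w] by metis
 have "r \<odot>\<^bsub>\<Omega>\<^esub> w = (\<lambda>i. acls i (r \<odot>\<^bsub>A i\<^esub> x i))"
  using x r by (simp add: omega_ops comm_hopf_algebra.omega_fin_smult[OF hopf])
 moreover have "r \<odot>\<^bsub>A i\<^esub> x i \<in> carrier (A i)" for i
 proof -
  interpret comm_hopf_algebra R "A i" by (rule hopf)
  show ?thesis using x r by simp
 qed
 ultimately have "omega_map R A g (r \<odot>\<^bsub>\<Omega>\<^esub> w) = (\<lambda>i. acls i (g i (r \<odot>\<^bsub>A i\<^esub> x i)))"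
  by (intro omega_map_apply[OF g]) auto
 also have "\<dots> = (\<lambda>i. r \<odot>\<^bsub>omega_fin R (A i)\<^esub> acls i (g i (x i)))"
  using comm_hopf_algebra.unital_counitalD(4)[OF hopf End_D(5)[OF g]] x(1) r End_closed[OF g]
  by (simp add: comm_hopf_algebra.omega_fin_smult[OF hopf])
 also have "\<dots> = r \<odot>\<^bsub>\<Omega>\<^esub> omega_map R A g w"
  by (simp add: omega_ops omega_map_apply[OF g x])
 finally show ?thesis .
qed

text \<open>The order is reversed because differentials are contravariant in the group, whereas the
  product in \<open>End_ring\<close> is composition of endomorphisms of the group.\<close>

lemma omega_map_mult:
 assumes g: "g \<in> carrier End" "k \<in> carrier End" "g \<otimes>\<^sub>End k \<in> carrier End" and w: "w \<in> carrier \<Omega>"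
 shows "omega_map R A (g \<otimes>\<^sub>End k) w = omega_map R A k (omega_map R A g w)"
proof -
 obtain x where x: "!!i. x i \<in> carrier (A i)" "!!i. w i = acls i (x i)" using omega_E[OF w] by metis
 have "omega_map R A k (omega_map R A g w) = (\<lambda>i. acls i (k i (g i (x i))))"
  by (rule omega_map_apply[OF g(2)]) (simp_all add: omega_map_apply[OF g(1) x] End_closed[OF g(1) x(1)])
 thus ?thesis
  unfolding omega_map_apply[OF g(3) x] using x by (simp add: End_ring_def compose_def)
qed

lemma omega_map_sum:
 assumes g: "g \<in> carrier End" "k \<in> carrier End" "g \<oplus>\<^sub>End k \<in> carrier End" and w: "w \<in> carrier \<Omega>"
 shows "omega_map R A (g \<oplus>\<^sub>End k) w = omega_map R A g w \<oplus>\<^bsub>\<Omega>\<^esub> omega_map R A k w"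
proof -
 obtain x where x: "!!i. x i \<in> aug_ideal R (A i)" "!!i. x i \<in> carrier (A i)" "!!i. w i = acls i (x i)"
  using omega_E[OF w] by metis
 have "acls i ((g \<oplus>\<^sub>End k) i (x i)) = acls i (g i (x i)) \<oplus>\<^bsub>omega_fin R (A i)\<^esub> acls i (k i (x i))" for i
 proof -
  interpret comm_hopf_algebra R "A i" by (rule hopf)
  have "cong2 (convolution (A i) (g i) (k i) (x i)) (g i (x i) \<oplus>\<^bsub>A i\<^esub> k i (x i))"
   by (rule convolution_cong2[OF End_D(5)[OF g(1)] End_D(5)[OF g(2)] x(1)])
  hence "cls (convolution (A i) (g i) (k i) (x i)) = cls (g i (x i) \<oplus>\<^bsub>A i\<^esub> k i (x i))"
   using cls_eq_iff End_closed[OF g(1) x(2)[of i]] End_closed[OF g(2) x(2)[of i]] x(2)[of i]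
    unital_counitalD(1)[OF unital_counital_convolution[OF End_D(5)[OF g(1)] End_D(5)[OF g(2)]]] by simp
  thus ?thesis
   using omega_fin_add End_closed[OF g(1) x(2)[of i]] End_closed[OF g(2) x(2)[of i]] by (simp add: End_ring_def)
 qed
 thus ?thesis
  by (simp add: omega_ops omega_map_apply[OF g(3) x(2,3)] omega_map_apply[OF g(1) x(2,3)] omega_map_apply[OF g(2) x(2,3)])
qed

text \<open>\<open>res i\<close> is multiplicative and compatible with comultiplication, so it
  carries convolutions to convolutions; each successor step of \<open>mult_by\<close> is one
  convolution.\<close>

lemma res_mult_by:
 assumes x: "x \<in> carrier (A (Suc i))"
 shows "res i (mult_by (A (Suc i)) m x) = mult_by (A i) m (res i x)"
 using x
proof (induction m arbitrary: x)
 case 0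
 interpret B: comm_hopf_algebra R "A (Suc i)" by (rule hopf)
 have "res i (r \<odot>\<^bsub>A (Suc i)\<^esub> y) = r \<odot>\<^bsub>A i\<^esub> res i y" if "r \<in> carrier R" "y \<in> carrier (A (Suc i))" for r y
  using res_hom[of i] that by (auto simp: hopf_hom_def Defs.linear_map_def)
 thus ?case
  using 0 res_homD(2,4)[OF 0] ring_hom_one[OF res_homD(1)[of i]] by simp
next
 case (Suc m)
 interpret B: comm_hopf_algebra R "A (Suc i)" by (rule hopf)
 interpret C: comm_hopf_algebra R "A i" by (rule hopf)
 note mB = B.unital_counitalD(1)[OF B.unital_counital_mult_by]
 let ?c = "comult (A (Suc i)) x"
 have c: "set ?c \<subseteq> carrier (A (Suc i)) \<times> carrier (A (Suc i))" by (rule B.comult_closed[OF Suc.prems])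
 have rx: "res i x \<in> carrier (A i)" by (rule res_homD(4)[OF Suc.prems])
 let ?f = "\<lambda>(u, w). (\<lambda>x\<in>carrier (A (Suc i)). x) u \<otimes>\<^bsub>A (Suc i)\<^esub> mult_by (A (Suc i)) m w"
 let ?f' = "\<lambda>(u, w). (\<lambda>x\<in>carrier (A i). x) u \<otimes>\<^bsub>A i\<^esub> mult_by (A i) m w"
 have "res i (mult_by (A (Suc i)) (Suc m) x) = res i (list_sum (A (Suc i)) (map ?f ?c))"
  by (simp add: B.convolution_sum[OF Suc.prems])
 also have "\<dots> = list_sum (A i) (map (res i) (map ?f ?c))"
 proof (rule list_sum_hom[OF B.M.abelian_monoid_axioms C.M.abelian_monoid_axioms])
  show "set (map ?f ?c) \<subseteq> carrier (A (Suc i))"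
   by (rule B.pairs_closed[OF B.unital_counital_id B.unital_counital_mult_by c])
 qed (use res_homD(4) ring_hom_add[OF res_homD(1)] ring_hom_zero[OF res_homD(1) B.ring_axioms C.ring_axioms] in auto)
 also have "map (res i) (map ?f ?c) = map ?f' (map (map_prod (res i) (res i)) ?c)"
 proof -
  have "res i (?f z) = ?f' (map_prod (res i) (res i) z)" if "z \<in> set ?c" for z
  proof -
   obtain u w where z: "z = (u, w)" "u \<in> carrier (A (Suc i))" "w \<in> carrier (A (Suc i))"
    using c \<open>z \<in> set ?c\<close> by auto
   thus ?thesis using Suc.IH[OF z(3)] ring_hom_mult[OF res_homD(1) z(2) mB[OF z(3)]] res_homD(4) by simp
  qed
  thus ?thesis by auto
 qed
 also have "list_sum (A i) \<dots> = list_sum (A i) (map ?f' (comult (A i) (res i x)))"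
  by (rule C.convolution_tensor_eq[OF C.unital_counital_id C.unital_counital_mult_by res_homD(3)[OF Suc.prems]])
 also have "\<dots> = mult_by (A i) (Suc m) (res i x)"
  by (simp add: C.convolution_sum[OF rx])
 finally show ?case .
qed

text \<open>Multiplication by \<open>p ^ i\<close> is trivial on the \<open>p ^ i\<close>-torsion:
  lift \<open>x\<close> along \<open>res i\<close> to the augmentation ideal of the next level;
  there the image of \<open>[p ^ i]\<close> lies in the kernel of \<open>res i\<close>.\<close>

lemma p_power_kills:
 assumes x: "x \<in> aug_ideal R (A i)"
 shows "nat_in R (p ^ i) \<odot>\<^bsub>omega_fin R (A i)\<^esub> acls i x = acls i \<zero>\<^bsub>A i\<^esub>"
proof -
 interpret B: comm_hopf_algebra R "A (Suc i)" by (rule hopf)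
 interpret C: comm_hopf_algebra R "A i" by (rule hopf)
 have "x \<in> carrier (A i)" using x by (auto simp: aug_ideal_def)
 then obtain x' where x': "x' \<in> carrier (A (Suc i))" "x = res i x'"
  using res_surj[of i] by blast
 have "x' \<in> B.aug" using x x' res_homD(2)[OF x'(1)] by (simp add: aug_ideal_def)
 moreover have "mult_by (A (Suc i)) (p ^ i) ` B.aug \<subseteq> carrier (A (Suc i))"
  using B.unital_counitalD(1)[OF B.unital_counital_mult_by] B.aug_carrier by blast
 ultimately have "mult_by (A (Suc i)) (p ^ i) x' \<in> a_kernel (A (Suc i)) (A i) (res i)"
  unfolding res_kernel using B.genideal_self by blast
 hence "res i (mult_by (A (Suc i)) (p ^ i) x') = \<zero>\<^bsub>A i\<^esub>"
  by (simp add: a_kernel_def kernel_def)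
 hence "mult_by (A i) (p ^ i) x = \<zero>\<^bsub>A i\<^esub>"
  using res_mult_by[OF x'(1)] x' by simp
 thus ?thesis using C.mult_by_cls[OF x, of "p ^ i"] by simp
qed

text \<open>On level \<open>i\<close> the endomorphism is multiplication by \<open>m i\<close>,
  which differs from \<open>z\<close> by a multiple of \<open>p ^ i\<close>, and
  \<open>p ^ i\<close> kills the conormal module of that level. So the p-adic integers act on the
  differentials through the scalars of \<open>R\<close>.\<close>

lemma omega_map_scalar:
 assumes g: "g \<in> carrier End" and w: "w \<in> carrier \<Omega>" and z: "z \<in> carrier R"
  and gm: "!!i. g i = mult_by (A i) (m i)"
  and zm: "!!i. \<exists>t\<in>carrier R. z = nat_in R (m i) \<oplus>\<^sub>R t \<otimes>\<^sub>R nat_in R (p ^ i)"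
 shows "omega_map R A g w = z \<odot>\<^bsub>\<Omega>\<^esub> w"
proof -
 obtain x where x: "!!i. x i \<in> aug_ideal R (A i)" "!!i. x i \<in> carrier (A i)" "!!i. w i = acls i (x i)"
  using omega_E[OF w] by metis
 have "acls i (g i (x i)) = z \<odot>\<^bsub>omega_fin R (A i)\<^esub> acls i (x i)" for i
 proof -
  interpret C: comm_hopf_algebra R "A i" by (rule hopf)
  obtain t where t: "t \<in> carrier R" "z = nat_in R (m i) \<oplus>\<^sub>R t \<otimes>\<^sub>R nat_in R (p ^ i)"
   using zm by blast
  have n: "nat_in R k \<in> carrier R" for k by simp
  have "C.cls ((t \<otimes>\<^sub>R nat_in R (p ^ i)) \<odot>\<^bsub>A i\<^esub> x i) = t \<odot>\<^bsub>omega_fin R (A i)\<^esub> C.cls (nat_in R (p ^ i) \<odot>\<^bsub>A i\<^esub> x i)"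
   using t n x(2)[of i] by (simp add: C.omega_fin_smult C.smult_assoc1)
  also have "C.cls (nat_in R (p ^ i) \<odot>\<^bsub>A i\<^esub> x i) = C.cls \<zero>\<^bsub>A i\<^esub>"
   using p_power_kills[OF x(1)[of i]] unfolding C.omega_fin_smult[OF n x(2)[of i]] .
  also have "t \<odot>\<^bsub>omega_fin R (A i)\<^esub> C.cls \<zero>\<^bsub>A i\<^esub> = C.cls \<zero>\<^bsub>A i\<^esub>"
   using t by (simp add: C.omega_fin_smult)
  finally have 0: "C.cls ((t \<otimes>\<^sub>R nat_in R (p ^ i)) \<odot>\<^bsub>A i\<^esub> x i) = C.cls \<zero>\<^bsub>A i\<^esub>" .
  have "z \<odot>\<^bsub>omega_fin R (A i)\<^esub> C.cls (x i)
    = C.cls (nat_in R (m i) \<odot>\<^bsub>A i\<^esub> x i \<oplus>\<^bsub>A i\<^esub> (t \<otimes>\<^sub>R nat_in R (p ^ i)) \<odot>\<^bsub>A i\<^esub> x i)"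
   using z t(1) n x(2)[of i] by (simp add: C.omega_fin_smult t(2) C.smult_l_distr)
  also have "\<dots> = C.cls (nat_in R (m i) \<odot>\<^bsub>A i\<^esub> x i) \<oplus>\<^bsub>omega_fin R (A i)\<^esub> C.cls ((t \<otimes>\<^sub>R nat_in R (p ^ i)) \<odot>\<^bsub>A i\<^esub> x i)"
   using t(1) n x(2)[of i] by (simp add: C.omega_fin_add)
  also have "\<dots> = C.cls (nat_in R (m i) \<odot>\<^bsub>A i\<^esub> x i)"
   unfolding 0 using t(1) n x(2)[of i] by (simp add: C.omega_fin_add)
  also have "\<dots> = C.cls (g i (x i))"
   using C.mult_by_cls[OF x(1)] n x(2)[of i] gm by (simp add: C.omega_fin_smult)
  finally show ?thesis by simp
 qed
 thus ?thesis
  by (simp add: omega_ops omega_map_apply[OF g x(2,3)] x(3))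
qed

end

section \<open>Base change from the valuation ring to the field\<close>

lemma tensor_eq_map:
 assumes f: "!!x. x \<in> carrier M ==> f x \<in> carrier M'"
   "!!x x'. x \<in> carrier M ==> x' \<in> carrier M ==> f (x \<oplus>\<^sub>M x') = f x \<oplus>\<^sub>M' f x'"
   "!!r x. r \<in> carrier R ==> x \<in> carrier M ==> f (r \<odot>\<^sub>M x) = r \<odot>\<^sub>M' f x" "f \<zero>\<^sub>M = \<zero>\<^sub>M'"
  and g: "!!x. x \<in> carrier N ==> g x \<in> carrier N'"
   "!!x x'. x \<in> carrier N ==> x' \<in> carrier N ==> g (x \<oplus>\<^sub>N x') = g x \<oplus>\<^sub>N' g x'"
   "!!r x. r \<in> carrier R ==> x \<in> carrier N ==> g (r \<odot>\<^sub>N x) = r \<odot>\<^sub>N' g x"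
  and eq: "tensor_eq R M N xs ys"
 shows "tensor_eq R M' N' (map (\<lambda>(x, y). (f x, g y)) xs) (map (\<lambda>(x, y). (f x, g y)) ys)"
proof -
 have sub: "set (map (\<lambda>(x, y). (f x, g y)) zs) \<subseteq> carrier M' \<times> carrier N'" if "set zs \<subseteq> carrier M \<times> carrier N" for zs
  using that f g by auto
 show ?thesis
  using eq
 proof (induction rule: tensor_eq.induct)
  case (refl xs)
  thus ?case using sub by (intro tensor_eq.refl)
 next
  case (append xs ys us vs)
  thus ?case by (auto intro: tensor_eq.append)
 next
  case (comm xs ys)
  thus ?case using sub by (simp add: tensor_eq.comm)
 next
  case (trans xs ys zs)
  thus ?case by (blast intro: tensor_eq.trans)
 qed (use f g in \<open>auto intro: tensor_eq.intros\<close>)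
qed

locale valued_module = valued_field K v for K :: "('k, 'm) ring_scheme" (structure) and v +
 fixes M :: "('k, 'c, 'n) module_scheme"
 assumes module_M: "module (val_ring K v) M"
begin

abbreviation OK :: "('k, 'm) ring_scheme" where "OK \<equiv> val_ring K v"

lemma OK_simps [simp]:
 "carrier OK = vint" "\<zero>\<^sub>OK = \<zero>" "\<one>\<^sub>OK = \<one>" "x \<oplus>\<^sub>OK y = x \<oplus> y" "x \<otimes>\<^sub>OK y = x \<otimes> y"
 by (simp_all add: val_ring_def)

sublocale Mod: module OK M by (rule module_M)

abbreviation teq :: "('c \<times> 'k) list => ('c \<times> 'k) list => bool" where "teq \<equiv> tensor_eq OK M (self_module K)"
abbreviation tcl :: "('c \<times> 'k) list => ('c \<times> 'k) list set" where "tcl \<equiv> tensor_class OK M (self_module K)"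
abbreviation VM :: "('k, ('c \<times> 'k) list set) module" where "VM \<equiv> base_change OK K M"
abbreviation pairs where "pairs \<equiv> {xs. set xs \<subseteq> carrier M \<times> carrier K}"

lemma self_simps [simp]:
 "carrier (self_module K) = carrier K" "x \<oplus>\<^bsub>self_module K\<^esub> y = x \<oplus> y" "r \<odot>\<^bsub>self_module K\<^esub> y = r \<otimes> y"
 "\<zero>\<^bsub>self_module K\<^esub> = \<zero>"
 by (simp_all add: self_module_def)

lemma teq_lists: "teq xs ys ==> xs \<in> pairs \<and> ys \<in> pairs"
 using tensor_eq_carrier[of M "self_module K" OK xs ys] by (auto simp: self_simps)

lemma teq_refl: "xs \<in> pairs ==> teq xs xs"
 by (intro tensor_eq.refl) simp

lemma pairsD: "xs \<in> pairs ==> (a, b) \<in> set xs ==> a \<in> carrier M \<and> b \<in> carrier K"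
 by auto

lemma scale_pairs: "c \<in> carrier K ==> xs \<in> pairs ==> map (\<lambda>(x, y). (x, c \<otimes> y)) xs \<in> pairs"
 by auto

lemma tcl_eq_iff:
 assumes "xs \<in> pairs" shows "tcl xs = tcl ys \<longleftrightarrow> teq xs ys"
proof
 assume "tcl xs = tcl ys"
 hence "teq ys xs" using teq_refl[OF assms] by (auto simp: tensor_class_def)
 thus "teq xs ys" by (rule tensor_eq.sym)
next
 assume *: "teq xs ys"
 have "teq xs zs \<longleftrightarrow> teq ys zs" for zs
  using tensor_eq.trans[OF *] tensor_eq.trans[OF tensor_eq.sym[OF *]] by blast
 thus "tcl xs = tcl ys" by (simp add: tensor_class_def)
qed

lemma tcl_self: "xs \<in> pairs ==> xs \<in> tcl xs"
 unfolding tensor_class_def using tensor_eq.refl[of xs M "self_module K" OK] by simp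

lemma VM_carrier: "carrier VM = tcl ` pairs"
 by (auto simp: base_change_def tensor_def)

lemma VM_zero: "\<zero>\<^sub>VM = tcl []"
 by (simp add: base_change_def tensor_def)

text \<open>The operations on tensors are unions over representatives. If the operation respects the
  congruence, all members of the union coincide.\<close>

lemma UN_class:
 assumes xs: "xs \<in> pairs" and f: "!!ys. teq xs ys ==> teq (f xs) (f ys)" and fl: "f xs \<in> pairs"
 shows "(\<Union>ys\<in>tcl xs. tcl (f ys)) = tcl (f xs)"
proof -
 have "tcl (f ys) = tcl (f xs)" if "ys \<in> tcl xs" for ys
  using f[of ys] that tcl_eq_iff[OF fl, of "f ys"] by (simp add: tensor_class_def)
 thus ?thesis using tcl_self[OF xs] by blast
qed

lemma VM_add:
 assumes "xs \<in> pairs" "ys \<in> pairs"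
 shows "tcl xs \<oplus>\<^sub>VM tcl ys = tcl (xs @ ys)"
proof -
 have "(\<Union>ys'\<in>tcl ys. tcl (xs' @ ys')) = tcl (xs' @ ys)" if "xs' \<in> pairs" for xs'
  using that assms by (intro UN_class[where f = "\<lambda>ys. xs' @ ys"]) (auto intro!: tensor_eq.append teq_refl)
 hence "tcl xs \<oplus>\<^sub>VM tcl ys = (\<Union>xs'\<in>tcl xs. tcl (xs' @ ys))"
  using teq_lists by (auto simp: base_change_def tensor_def tensor_class_def)
 also have "\<dots> = tcl (xs @ ys)"
  using assms by (intro UN_class[where f = "\<lambda>xs. xs @ ys"]) (auto intro!: tensor_eq.append teq_refl)
 finally show ?thesis .
qed

lemma teq_scale:
 assumes "c \<in> carrier K" "teq xs ys"
 shows "teq (map (\<lambda>(x, y). (x, c \<otimes> y)) xs) (map (\<lambda>(x, y). (x, c \<otimes> y)) ys)"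
 by (rule tensor_eq_map[where f = "\<lambda>x. x", OF _ _ _ _ _ _ _ assms(2)])
  (use assms(1) in \<open>auto simp: r_distr m_lcomm\<close>)

lemma VM_smult:
 assumes "c \<in> carrier K" "xs \<in> pairs"
 shows "c \<odot>\<^sub>VM tcl xs = tcl (map (\<lambda>(x, y). (x, c \<otimes> y)) xs)"
proof -
 have "c \<odot>\<^sub>VM tcl xs = (\<Union>xs'\<in>tcl xs. tcl (map (\<lambda>(x, y). (x, c \<otimes> y)) xs'))"
  by (simp add: base_change_def)
 also have "\<dots> = tcl (map (\<lambda>(x, y). (x, c \<otimes> y)) xs)"
  using assms by (intro UN_class[where f = "map (\<lambda>(x, y). (x, c \<otimes> y))"]) (auto intro: teq_scale)
 finally show ?thesis .
qed

lemma VM_induct [consumes 1, case_names zero add]: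
 assumes "C \<in> carrier VM" "P (tcl [])"
  and "!!x y xs. x \<in> carrier M ==> y \<in> carrier K ==> xs \<in> pairs ==> P (tcl xs) ==> P (tcl ((x, y) # xs))"
 shows "P C"
proof -
 obtain xs where xs: "xs \<in> pairs" "C = tcl xs" using assms(1) unfolding VM_carrier by blast
 have "P (tcl xs)" using xs(1) by (induction xs) (use assms(2,3) in auto)
 thus ?thesis using xs by simp
qed

text \<open>The generating relations mention only a zero on the left; the scalar
  \<open>\<zero>\<close> is moved across from the right.\<close>

lemma teq_zero_right: assumes "x \<in> carrier M" shows "teq [(x, \<zero>)] []"
proof -
 have "teq [(\<zero> \<odot>\<^sub>M x, \<one>)] [(x, \<zero> \<odot>\<^bsub>self_module K\<^esub> \<one>)]"
  using assms by (intro tensor_eq.smult) auto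
 moreover have "\<zero> \<odot>\<^sub>M x = \<zero>\<^sub>M" using Mod.smult_l_null[OF assms] by simp
 ultimately have "teq [(x, \<zero>)] [(\<zero>\<^sub>M, \<one>)]" by (auto intro: tensor_eq.sym)
 moreover have "teq [(\<zero>\<^sub>M, \<one>)] []" by (intro tensor_eq.zero) auto
 ultimately show ?thesis by (rule tensor_eq.trans)
qed

lemma abelian_group_VM: "abelian_group VM"
proof (rule abelian_groupI)
 show "C \<oplus>\<^sub>VM D \<in> carrier VM" if "C \<in> carrier VM" "D \<in> carrier VM" for C D
  using that VM_add by (fastforce simp: VM_carrier)
 show "\<zero>\<^sub>VM \<in> carrier VM" by (auto simp: VM_zero VM_carrier)
 show "C \<oplus>\<^sub>VM D \<oplus>\<^sub>VM E = C \<oplus>\<^sub>VM (D \<oplus>\<^sub>VM E)"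
  if "C \<in> carrier VM" "D \<in> carrier VM" "E \<in> carrier VM" for C D E
  using that by (auto simp: VM_carrier VM_add)
 show "C \<oplus>\<^sub>VM D = D \<oplus>\<^sub>VM C" if "C \<in> carrier VM" "D \<in> carrier VM" for C D
 proof -
  obtain xs ys where x: "xs \<in> pairs" "C = tcl xs" "ys \<in> pairs" "D = tcl ys"
   using \<open>C \<in> carrier VM\<close> \<open>D \<in> carrier VM\<close> unfolding VM_carrier by blast
  have "teq (xs @ ys) (ys @ xs)" using x by (intro tensor_eq.comm) auto
  thus ?thesis using x by (simp add: VM_add tcl_eq_iff)
 qed
 show "\<zero>\<^sub>VM \<oplus>\<^sub>VM C = C" if "C \<in> carrier VM" for C
  using that by (auto simp: VM_carrier VM_zero VM_add)
 show "\<exists>D\<in>carrier VM. D \<oplus>\<^sub>VM C = \<zero>\<^sub>VM" if "C \<in> carrier VM" for C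
  using that
 proof (induction rule: VM_induct)
  case zero
  have "tcl [] \<in> carrier VM" by (simp add: VM_carrier)
  thus ?case using VM_add[of "[]" "[]"] by (auto simp: VM_zero)
 next
  case (add x y xs)
  then obtain zs where zs: "zs \<in> pairs" "tcl (zs @ xs) = tcl []"
   by (auto simp: VM_carrier VM_add VM_zero)
  have e1: "teq [(x, \<ominus> y), (x, y)] [(x, \<zero>)]"
   using tensor_eq.add_right[of x M "\<ominus> y" "self_module K" y OK] add
   by (auto simp: l_neg intro: tensor_eq.sym)
  hence e2: "teq [(x, \<ominus> y), (x, y)] []" using teq_zero_right[OF add(1)] by (blast intro: tensor_eq.trans)
  have "teq ((zs @ [(x, \<ominus> y)]) @ ((x, y) # xs)) (zs @ xs)"
   using tensor_eq.append[OF tensor_eq.append[OF tensor_eq.refl e2] tensor_eq.refl, of zs xs] zs(1) add(3) by simp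
  moreover have "teq (zs @ xs) []" using zs add tcl_eq_iff[of "zs @ xs" "[]"] by auto
  ultimately have "tcl (zs @ [(x, \<ominus> y)]) \<oplus>\<^sub>VM tcl ((x, y) # xs) = \<zero>\<^sub>VM"
   using zs add tcl_eq_iff by (subst VM_add) (auto simp: VM_zero intro: tensor_eq.trans)
  moreover have "tcl (zs @ [(x, \<ominus> y)]) \<in> carrier VM" using zs add by (auto simp: VM_carrier)
  ultimately show ?case by blast
 qed
qed

sublocale VG: abelian_group VM by (rule abelian_group_VM)

lemma tcl_Cons:
 "x \<in> carrier M ==> y \<in> carrier K ==> xs \<in> pairs ==> tcl ((x, y) # xs) = tcl [(x, y)] \<oplus>\<^sub>VM tcl xs"
 using VM_add[of "[(x, y)]" xs] by simp

lemma tcl_closed: "xs \<in> pairs ==> tcl xs \<in> carrier VM"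
 by (simp add: VM_carrier)

lemma module_VM: "module K VM"
proof (rule moduleI)
 show "cring K" by (rule is_cring)
 show "abelian_group VM" by (rule abelian_group_VM)
 show sm: "c \<odot>\<^sub>VM C \<in> carrier VM" if "c \<in> carrier K" "C \<in> carrier VM" for c C
  using that scale_pairs by (fastforce simp: VM_carrier VM_smult)
 show "c \<odot>\<^sub>VM (C \<oplus>\<^sub>VM D) = c \<odot>\<^sub>VM C \<oplus>\<^sub>VM c \<odot>\<^sub>VM D"
  if c: "c \<in> carrier K" and CD: "C \<in> carrier VM" "D \<in> carrier VM" for c C D
 proof -
  obtain xs ys where x: "xs \<in> pairs" "C = tcl xs" and y: "ys \<in> pairs" "D = tcl ys"
   using CD unfolding VM_carrier by blast
  have "map (\<lambda>(x, y). (x, c \<otimes> y)) zs \<in> pairs" if "zs \<in> pairs" for zs using that c by auto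
  thus ?thesis using x y c by (simp add: VM_smult VM_add)
 qed
 show "(c \<oplus> d) \<odot>\<^sub>VM C = c \<odot>\<^sub>VM C \<oplus>\<^sub>VM d \<odot>\<^sub>VM C"
  if cd: "c \<in> carrier K" "d \<in> carrier K" and C: "C \<in> carrier VM" for c d C
  using C
 proof (induction rule: VM_induct)
  case zero
  show ?case using cd VM_add[of "[]" "[]"] by (simp add: VM_smult)
 next
  case (add x y xs)
  have l: "map (\<lambda>(x, y). (x, e \<otimes> y)) xs \<in> pairs" if "e \<in> carrier K" for e using that add by auto
  have m: "e \<odot>\<^sub>VM tcl ((x, y) # xs) = tcl [(x, e \<otimes> y)] \<oplus>\<^sub>VM e \<odot>\<^sub>VM tcl xs" if "e \<in> carrier K" for e
   using that add l by (simp add: VM_smult tcl_Cons[symmetric])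
  have "tcl [(x, (c \<oplus> d) \<otimes> y)] = tcl [(x, c \<otimes> y), (x, d \<otimes> y)]"
   using tensor_eq.add_right[of x M "c \<otimes> y" "self_module K" "d \<otimes> y" OK] add cd
   by (subst tcl_eq_iff) (auto simp: l_distr)
  also have "\<dots> = tcl [(x, c \<otimes> y)] \<oplus>\<^sub>VM tcl [(x, d \<otimes> y)]"
   using add cd by (intro tcl_Cons) auto
  finally have "(c \<oplus> d) \<odot>\<^sub>VM tcl ((x, y) # xs) =
    (tcl [(x, c \<otimes> y)] \<oplus>\<^sub>VM tcl [(x, d \<otimes> y)]) \<oplus>\<^sub>VM (c \<odot>\<^sub>VM tcl xs \<oplus>\<^sub>VM d \<odot>\<^sub>VM tcl xs)"
   using m[of "c \<oplus> d"] cd add by simp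
  also have "\<dots> = (tcl [(x, c \<otimes> y)] \<oplus>\<^sub>VM c \<odot>\<^sub>VM tcl xs) \<oplus>\<^sub>VM (tcl [(x, d \<otimes> y)] \<oplus>\<^sub>VM d \<odot>\<^sub>VM tcl xs)"
  proof -
   have "tcl [(x, c \<otimes> y)] \<in> carrier VM" "tcl [(x, d \<otimes> y)] \<in> carrier VM" "tcl xs \<in> carrier VM"
    using add cd by (auto intro!: tcl_closed)
   thus ?thesis using sm cd by (simp add: VG.a_ac)
  qed
  finally show ?case using m cd by simp
 qed
 show "(c \<otimes> d) \<odot>\<^sub>VM C = c \<odot>\<^sub>VM (d \<odot>\<^sub>VM C)"
  if cd: "c \<in> carrier K" "d \<in> carrier K" and C: "C \<in> carrier VM" for c d C
 proof -
  obtain xs where x: "xs \<in> pairs" "C = tcl xs" using C unfolding VM_carrier by blast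
  have "map (\<lambda>(x, y). (x, d \<otimes> y)) xs \<in> pairs" using x cd by auto
  thus ?thesis using x cd by (auto simp: VM_smult m_assoc dest!: pairsD[OF x(1)] intro!: arg_cong[where f = tcl])
 qed
 show "\<one> \<odot>\<^sub>VM C = C" if C: "C \<in> carrier VM" for C
 proof -
  obtain xs where x: "xs \<in> pairs" "C = tcl xs" using C unfolding VM_carrier by blast
  hence "map (\<lambda>(x, y). (x, \<one> \<otimes> y)) xs = xs" by (intro map_idI) auto
  thus ?thesis using x by (simp add: VM_smult)
 qed
qed

lemma vectorspace_VM: "vectorspace K VM"
 using module_VM field_axioms by (simp add: vectorspace_def)

sublocale VV: vectorspace K VM by (rule vectorspace_VM)

definition emb :: "'c => ('c \<times> 'k) list set" where "emb x = tcl [(x, \<one>)]"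

lemma emb_closed: "x \<in> carrier M ==> emb x \<in> carrier VM"
 unfolding emb_def by (rule tcl_closed) simp

lemma emb_add:
 assumes "x \<in> carrier M" "y \<in> carrier M" shows "emb (x \<oplus>\<^sub>M y) = emb x \<oplus>\<^sub>VM emb y"
proof -
 have "teq [(x \<oplus>\<^sub>M y, \<one>)] [(x, \<one>), (y, \<one>)]" using assms by (intro tensor_eq.add_left) auto
 hence "tcl [(x \<oplus>\<^sub>M y, \<one>)] = tcl [(x, \<one>), (y, \<one>)]" using assms by (subst tcl_eq_iff) auto
 thus ?thesis unfolding emb_def using assms by (subst VM_add) auto
qed

lemma pure_smult:
 assumes "t \<in> vint" "x \<in> carrier M" "y \<in> carrier K"
 shows "tcl [(t \<odot>\<^sub>M x, y)] = t \<odot>\<^sub>VM tcl [(x, y)]"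
proof -
 have "teq [(t \<odot>\<^sub>M x, y)] [(x, t \<odot>\<^bsub>self_module K\<^esub> y)]" using assms by (intro tensor_eq.smult) auto
 hence "tcl [(t \<odot>\<^sub>M x, y)] = tcl [(x, t \<otimes> y)]" using assms by (subst tcl_eq_iff) auto
 thus ?thesis using assms by (simp add: VM_smult)
qed

lemma emb_smult: "t \<in> vint ==> x \<in> carrier M ==> emb (t \<odot>\<^sub>M x) = t \<odot>\<^sub>VM emb x"
 unfolding emb_def by (rule pure_smult) auto

text \<open>A scalar of \<open>K\<close> is integral or has an integral inverse, so each pure tensor
  becomes \<open>x \<otimes> 1\<close> after a nonzero integral scaling; for a sum the scalings are
  multiplied.\<close>

lemma clear_denominators:
 assumes "C \<in> carrier VM"
 shows "\<exists>t\<in>vint. t \<noteq> \<zero> \<and> (\<exists>x\<in>carrier M. t \<odot>\<^sub>VM C = emb x)"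
 using assms
proof (induction rule: VM_induct)
 case zero
 have "emb \<zero>\<^sub>M = tcl []"
  unfolding emb_def by (subst tcl_eq_iff) (auto intro: tensor_eq.zero)
 thus ?case by (intro bexI[of _ \<one>] conjI bexI[of _ "\<zero>\<^sub>M"]) (auto simp: VM_smult)
next
 case (add x y xs)
 then obtain t z where t: "t \<in> vint" "t \<noteq> \<zero>" "z \<in> carrier M" "t \<odot>\<^sub>VM tcl xs = emb z" by blast
 obtain s where s: "s \<in> vint" "s \<noteq> \<zero>" "s \<otimes> y \<in> vint"
 proof (cases "y \<in> vint")
  case True
  thus thesis using that[of \<one>] by simp
 next
  case False
  hence y0: "y \<noteq> \<zero>" by auto
  have "inv y \<in> vint"
   using False add(2) y0 inv_nonzero[OF add(2) y0] v_rv[of y] v_rv[of "inv y"] rv_inv[OF add(2) y0] by auto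
  thus thesis using that[of "inv y"] inv_nonzero[OF add(2) y0] by simp
 qed
 have sty: "t \<otimes> (s \<otimes> y) \<in> vint" "s \<otimes> t \<in> vint" using s t vint_mult by blast+
 have px: "tcl [(x, y)] = y \<odot>\<^sub>VM emb x" using add by (simp add: emb_def VM_smult)
 have ex: "emb x \<in> carrier VM" "tcl xs \<in> carrier VM" using add emb_closed tcl_closed by auto
 have "(s \<otimes> t) \<odot>\<^sub>VM tcl ((x, y) # xs) = (s \<otimes> t) \<odot>\<^sub>VM (y \<odot>\<^sub>VM emb x) \<oplus>\<^sub>VM (s \<otimes> t) \<odot>\<^sub>VM tcl xs"
  using tcl_Cons[OF add(1-3)] px ex s t add by (simp add: VV.smult_r_distr)
 also have "(s \<otimes> t) \<odot>\<^sub>VM (y \<odot>\<^sub>VM emb x) = (t \<otimes> (s \<otimes> y)) \<odot>\<^sub>VM emb x"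
  using s t add ex by (simp add: VV.smult_assoc1[symmetric] m_ac)
 also have "(s \<otimes> t) \<odot>\<^sub>VM tcl xs = s \<odot>\<^sub>VM emb z"
  using s t ex by (simp add: VV.smult_assoc1)
 also have "(t \<otimes> (s \<otimes> y)) \<odot>\<^sub>VM emb x \<oplus>\<^sub>VM s \<odot>\<^sub>VM emb z = emb ((t \<otimes> (s \<otimes> y)) \<odot>\<^sub>M x \<oplus>\<^sub>M s \<odot>\<^sub>M z)"
  using sty s t add by (simp add: emb_smult[symmetric] emb_add)
 finally have "(s \<otimes> t) \<odot>\<^sub>VM tcl ((x, y) # xs) = emb ((t \<otimes> (s \<otimes> y)) \<odot>\<^sub>M x \<oplus>\<^sub>M s \<odot>\<^sub>M z)" .
 moreover have "(t \<otimes> (s \<otimes> y)) \<odot>\<^sub>M x \<oplus>\<^sub>M s \<odot>\<^sub>M z \<in> carrier M"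
  using sty s t add by auto
 moreover have "s \<otimes> t \<noteq> \<zero>" using s t integral by auto
 ultimately show ?case using sty(2) by blast
qed

section \<open>Forms and endomorphisms on the base change\<close>

definition int_form :: "('c => 'k) => bool" where
 "int_form f \<longleftrightarrow> (\<forall>x\<in>carrier M. f x \<in> vint) \<and>
   (\<forall>x\<in>carrier M. \<forall>y\<in>carrier M. f (x \<oplus>\<^sub>M y) = f x \<oplus> f y) \<and>
   (\<forall>t\<in>vint. \<forall>x\<in>carrier M. f (t \<odot>\<^sub>M x) = t \<otimes> f x)"

text \<open>The extension of an integral form to the base change. It is evaluated on a chosen
  representative; \<open>functional_tcl\<close> shows that the choice does not matter.\<close>

definition functional :: "('c => 'k) => ('c \<times> 'k) list set => 'k" where
 "functional f C = list_sum K (map (\<lambda>(x, y). f x \<otimes> y) (SOME xs. xs \<in> C))"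

lemma functional_tcl:
 assumes f: "int_form f" and xs: "xs \<in> pairs"
 shows "functional f (tcl xs) = list_sum K (map (\<lambda>(x, y). f x \<otimes> y) xs)"
proof -
 have "(SOME ys. ys \<in> tcl xs) \<in> tcl xs" using tcl_self[OF xs] by (rule someI)
 hence "teq xs (SOME ys. ys \<in> tcl xs)" by (simp add: tensor_class_def)
 hence "list_sum K (map (\<lambda>(x, y). f x \<otimes> y) xs) = list_sum K (map (\<lambda>(x, y). f x \<otimes> y) (SOME ys. ys \<in> tcl xs))"
  by (rule tensor_eq_bilinear[where R = OK and M = M and N = "self_module K" and P = K, rotated -1])
   (use f in \<open>auto simp: int_form_def l_distr r_distr m_ac Pi_iff intro: abelian_group_axioms\<close>)
 thus ?thesis by (simp add: functional_def)
qed

lemma functional_emb: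
 assumes f: "int_form f" and x: "x \<in> carrier M"
 shows "functional f (emb x) = f x"
 using assms functional_tcl[OF f, of "[(x, \<one>)]"] by (auto simp: emb_def int_form_def)

lemma functional_closed:
 assumes f: "int_form f" and C: "C \<in> carrier VM"
 shows "functional f C \<in> carrier K"
proof -
 obtain xs where x: "xs \<in> pairs" "C = tcl xs" using C unfolding VM_carrier by blast
 have "f a \<otimes> b \<in> carrier K" if "(a, b) \<in> set xs" for a b
  using pairsD[OF x(1) that] f by (auto simp: int_form_def)
 hence "set (map (\<lambda>(x, y). f x \<otimes> y) xs) \<subseteq> carrier K" by auto
 thus ?thesis using x list_sum_closed by (simp add: functional_tcl[OF f])
qed

lemma functional_add:
 assumes f: "int_form f" and CD: "C \<in> carrier VM" "D \<in> carrier VM"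
 shows "functional f (C \<oplus>\<^sub>VM D) = functional f C \<oplus> functional f D"
proof -
 obtain xs ys where x: "xs \<in> pairs" "C = tcl xs" "ys \<in> pairs" "D = tcl ys" using CD unfolding VM_carrier by blast
 have "set (map (\<lambda>(x, y). f x \<otimes> y) zs) \<subseteq> carrier K" if "zs \<in> pairs" for zs
  using that f by (auto simp: int_form_def)
 thus ?thesis using x by (simp add: VM_add functional_tcl[OF f] list_sum_append)
qed

lemma functional_smult:
 assumes f: "int_form f" and c: "c \<in> carrier K" and C: "C \<in> carrier VM"
 shows "functional f (c \<odot>\<^sub>VM C) = c \<otimes> functional f C"
proof -
 obtain xs where x: "xs \<in> pairs" "C = tcl xs" using C unfolding VM_carrier by blast
 have fK: "f x \<in> carrier K" if "x \<in> carrier M" for x using f that by (auto simp: int_form_def)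
 have l: "map (\<lambda>(x, y). (x, c \<otimes> y)) xs \<in> pairs" using x c by auto
 have "functional f (c \<odot>\<^sub>VM C) = list_sum K (map (\<lambda>(x, y). f x \<otimes> y) (map (\<lambda>(x, y). (x, c \<otimes> y)) xs))"
  using x c l by (simp add: VM_smult functional_tcl[OF f])
 also have "map (\<lambda>(x, y). f x \<otimes> y) (map (\<lambda>(x, y). (x, c \<otimes> y)) xs) = map (\<lambda>z. c \<otimes> z) (map (\<lambda>(x, y). f x \<otimes> y) xs)"
  using x c fK by (auto simp: m_lcomm)
 also have "list_sum K \<dots> = c \<otimes> list_sum K (map (\<lambda>(x, y). f x \<otimes> y) xs)"
  by (rule list_sum_hom[symmetric, OF abelian_monoid_axioms abelian_monoid_axioms])
   (use x c fK in \<open>auto simp: r_distr\<close>)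
 finally show ?thesis using x by (simp add: functional_tcl[OF f])
qed

lemma base_change_map_tcl:
 assumes h: "h \<in> Defs.linear_map OK M M" and xs: "xs \<in> pairs"
 shows "base_change_map OK K M h (tcl xs) = tcl (map (\<lambda>(x, y). (h x, y)) xs)"
proof -
 have h0: "h \<zero>\<^sub>M = \<zero>\<^sub>M"
 proof -
  have lin: "h (r \<odot>\<^sub>M x) = r \<odot>\<^sub>M h x" if "r \<in> carrier OK" "x \<in> carrier M" for r x
   using h that unfolding Defs.linear_map_def by blast
  have "h (\<zero> \<odot>\<^sub>M \<zero>\<^sub>M) = \<zero> \<odot>\<^sub>M h \<zero>\<^sub>M" by (rule lin) auto
  moreover have "h \<zero>\<^sub>M \<in> carrier M" using h unfolding Defs.linear_map_def by blast
  ultimately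
  show ?thesis using Mod.smult_l_null[of "\<zero>\<^sub>M"] Mod.smult_l_null[of "h \<zero>\<^sub>M"] by simp
 qed
 show ?thesis
  unfolding base_change_map_def
 proof (rule UN_class[where f = "map (\<lambda>(x, y). (h x, y))", OF xs])
  show "teq (map (\<lambda>(x, y). (h x, y)) xs) (map (\<lambda>(x, y). (h x, y)) ys)" if "teq xs ys" for ys
   by (rule tensor_eq_map[where f = h and g = "\<lambda>x. x" and R = OK and M = M and N = "self_module K"])
    (use h h0 that in \<open>auto simp: Defs.linear_map_def Pi_iff\<close>)
 qed (use xs h in \<open>auto simp: Defs.linear_map_def Pi_iff\<close>)
qed

lemma base_change_map_emb:
 "h \<in> Defs.linear_map OK M M ==> x \<in> carrier M ==> base_change_map OK K M h (emb x) = emb (h x)"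
 unfolding emb_def by (subst base_change_map_tcl) auto

lemma base_change_map_lin_op:
 assumes h: "h \<in> Defs.linear_map OK M M"
 shows "VV.lin_op (base_change_map OK K M h)"
 unfolding VV.lin_op_def
proof (intro conjI ballI)
 have hl: "map (\<lambda>(x, y). (h x, y)) zs \<in> pairs" if "zs \<in> pairs" for zs
  using that h by (auto simp: Defs.linear_map_def Pi_iff)
 fix C assume "C \<in> carrier VM"
 then obtain xs where x: "xs \<in> pairs" "C = tcl xs" unfolding VM_carrier by blast
 show "base_change_map OK K M h C \<in> carrier VM"
  using x hl by (simp add: base_change_map_tcl[OF h] tcl_closed)
 show "base_change_map OK K M h (C \<oplus>\<^sub>VM D) = base_change_map OK K M h C \<oplus>\<^sub>VM base_change_map OK K M h D"
  if "D \<in> carrier VM" for D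
 proof -
  obtain ys where y: "ys \<in> pairs" "D = tcl ys" using \<open>D \<in> carrier VM\<close> unfolding VM_carrier by blast
  show ?thesis using x y hl by (simp add: base_change_map_tcl[OF h] VM_add)
 qed
 show "base_change_map OK K M h (c \<odot>\<^sub>VM C) = c \<odot>\<^sub>VM base_change_map OK K M h C" if c: "c \<in> carrier K" for c
 proof -
  have l: "map (\<lambda>(x, y). (x, c \<otimes> y)) xs \<in> pairs" using x c by auto
  show ?thesis using x c hl l
   by (auto simp: base_change_map_tcl[OF h] VM_smult intro!: arg_cong[where f = tcl])
 qed
qed

end

section \<open>Coordinates on a free module as bounded forms\<close>

locale free_valued_module = valued_module K v M
 for K :: "('k, 'm) ring_scheme" (structure) and v and M :: "('k, 'c, 'n) module_scheme" +
 fixes B :: "'c set"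
 assumes basis_B: "is_basis (val_ring K v) M B"
begin

definition represents :: "('c => 'k) => 'c => bool" where
 "represents c x \<longleftrightarrow> c \<in> B \<rightarrow>\<^sub>E vint \<and> finite {b \<in> B. c b \<noteq> \<zero>} \<and>
   x = (\<Oplus>\<^sub>M b\<in>{b \<in> B. c b \<noteq> \<zero>}. c b \<odot>\<^sub>M b)"

text \<open>The basis vector is the first argument, so that \<open>coord b\<close> is a form on
  \<open>M\<close>. The basis may be infinite, which is why finite supports accompany the
  coordinates throughout.\<close>

definition coord :: "'c => 'c => 'k" where
 "coord b x = (THE c. represents c x) b"

abbreviation supp :: "'c => 'c set" where
 "supp x \<equiv> {b \<in> B. coord b x \<noteq> \<zero>}"

lemma B_carrier: "B \<subseteq> carrier M"
 using basis_B by (simp add: is_basis_def)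

lemma represents_ex1: "x \<in> carrier M ==> \<exists>!c. represents c x"
 using basis_B unfolding is_basis_def represents_def OK_simps by blast

lemma represents_coord: "x \<in> carrier M ==> represents (\<lambda>b. coord b x) x"
 unfolding coord_def by (rule theI'[OF represents_ex1])

lemma coord_vint: "x \<in> carrier M ==> b \<in> B ==> coord b x \<in> vint"
 using represents_coord[of x] PiE_mem unfolding represents_def by fastforce

lemma smult_basis: "t \<in> vint ==> b \<in> B ==> t \<odot>\<^sub>M b \<in> carrier M"
 using B_carrier Mod.smult_closed by auto

lemma finsum_support:
 assumes S: "finite S" "S' \<subseteq> S" "S \<subseteq> B" and c: "!!b. b \<in> B ==> c b \<in> vint" "!!b. b \<in> S - S' ==> c b = \<zero>"
 shows "(\<Oplus>\<^sub>M b\<in>S. c b \<odot>\<^sub>M b) = (\<Oplus>\<^sub>M b\<in>S'. c b \<odot>\<^sub>M b)"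
proof (rule Mod.M.add.finprod_mono_neutral_cong_right[OF S(1,2)])
 show "c b \<odot>\<^sub>M b = \<zero>\<^sub>M" if "b \<in> S - S'" for b
  using c(2)[OF that] that S(3) B_carrier Mod.smult_l_null[of b] by auto
 show "(\<lambda>b. c b \<odot>\<^sub>M b) \<in> S \<rightarrow> carrier M" using smult_basis c(1) S(3) by blast
qed simp

lemma coord_sum:
 assumes x: "x \<in> carrier M" and S: "finite S" "supp x \<subseteq> S" "S \<subseteq> B"
 shows "x = (\<Oplus>\<^sub>M b\<in>S. coord b x \<odot>\<^sub>M b)"
proof -
 have "(\<Oplus>\<^sub>M b\<in>S. coord b x \<odot>\<^sub>M b) = (\<Oplus>\<^sub>M b\<in>supp x. coord b x \<odot>\<^sub>M b)"
  using S(3) coord_vint[OF x] by (intro finsum_support[OF S]) auto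
 thus ?thesis using represents_coord[OF x] unfolding represents_def by simp
qed

lemma coordI:
 assumes S: "finite S" "S \<subseteq> B" and c: "!!b. b \<in> B ==> c b \<in> vint" "!!b. b \<in> B - S ==> c b = \<zero>"
  and x: "x \<in> carrier M" "x = (\<Oplus>\<^sub>M b\<in>S. c b \<odot>\<^sub>M b)" and b: "b \<in> B"
 shows "coord b x = c b"
proof -
 let ?c = "restrict c B" and ?S = "{b \<in> B. c b \<noteq> \<zero>}"
 have sub: "?S \<subseteq> S" using c(2) by blast
 have s: "{b \<in> B. ?c b \<noteq> \<zero>} = ?S" by auto
 have "x = (\<Oplus>\<^sub>M b\<in>?S. c b \<odot>\<^sub>M b)" unfolding x(2) using S c by (intro finsum_support sub) auto
 also have "\<dots> = (\<Oplus>\<^sub>M b\<in>?S. ?c b \<odot>\<^sub>M b)" by (rule Mod.M.finsum_cong') (use smult_basis c(1) in auto)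
 finally have "represents ?c x"
  unfolding represents_def s using c(1) finite_subset[OF sub S(1)] by auto
 thus ?thesis unfolding coord_def using the1_equality[OF represents_ex1[OF x(1)]] b by simp
qed

lemma finite_supp: "x \<in> carrier M ==> finite (supp x)"
 using represents_coord unfolding represents_def by blast

lemma coord_add:
 assumes x: "x \<in> carrier M" and y: "y \<in> carrier M" and b: "b \<in> B"
 shows "coord b (x \<oplus>\<^sub>M y) = coord b x \<oplus> coord b y"
proof (rule coordI[OF _ _ _ _ _ _ b])
 let ?U = "supp x \<union> supp y"
 show U: "finite ?U" "?U \<subseteq> B" using finite_supp x y by auto
 note c = coord_vint[OF x] coord_vint[OF y]
 have "x \<oplus>\<^sub>M y = (\<Oplus>\<^sub>M b\<in>?U. coord b x \<odot>\<^sub>M b) \<oplus>\<^sub>M (\<Oplus>\<^sub>M b\<in>?U. coord b y \<odot>\<^sub>M b)"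
  by (rule arg_cong2[where f = "add M", OF coord_sum[OF x U(1) _ U(2)] coord_sum[OF y U(1) _ U(2)]]) auto
 also have "\<dots> = (\<Oplus>\<^sub>M b\<in>?U. coord b x \<odot>\<^sub>M b \<oplus>\<^sub>M coord b y \<odot>\<^sub>M b)"
  using c smult_basis by (intro Mod.M.finsum_addf[symmetric]) blast+
 also have "\<dots> = (\<Oplus>\<^sub>M b\<in>?U. (coord b x \<oplus> coord b y) \<odot>\<^sub>M b)"
  by (rule Mod.M.finsum_cong'[OF HOL.refl])
   (use c U(2) B_carrier smult_basis[OF vint_add[OF c]] Mod.smult_l_distr[symmetric] in auto)
 finally show "x \<oplus>\<^sub>M y = (\<Oplus>\<^sub>M b\<in>?U. (coord b x \<oplus> coord b y) \<odot>\<^sub>M b)" .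
 show "coord b x \<oplus> coord b y \<in> vint" if "b \<in> B" for b by (rule vint_add[OF coord_vint[OF x that] coord_vint[OF y that]])
qed (use x y in auto)

lemma coord_smult:
 assumes t: "t \<in> vint" and x: "x \<in> carrier M" and b: "b \<in> B"
 shows "coord b (t \<odot>\<^sub>M x) = t \<otimes> coord b x"
proof (rule coordI[OF _ _ _ _ _ _ b])
 show U: "finite (supp x)" "supp x \<subseteq> B" using finite_supp x by auto
 note c = coord_vint[OF x]
 have "t \<odot>\<^sub>M x = t \<odot>\<^sub>M (\<Oplus>\<^sub>M b\<in>supp x. coord b x \<odot>\<^sub>M b)"
  by (rule arg_cong[OF coord_sum[OF x U(1) order_refl U(2)]])
 also have "\<dots> = (\<Oplus>\<^sub>M b\<in>supp x. t \<odot>\<^sub>M (coord b x \<odot>\<^sub>M b))"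
  using t c smult_basis U by (intro Mod.finsum_smult_ldistr) auto
 also have "\<dots> = (\<Oplus>\<^sub>M b\<in>supp x. (t \<otimes> coord b x) \<odot>\<^sub>M b)"
  by (rule Mod.M.finsum_cong'[OF HOL.refl])
   (use t c U(2) B_carrier smult_basis[OF vint_mult[OF t c]] Mod.smult_assoc1[symmetric] in auto)
 finally show "t \<odot>\<^sub>M x = (\<Oplus>\<^sub>M b\<in>supp x. (t \<otimes> coord b x) \<odot>\<^sub>M b)" .
 show "t \<otimes> coord b x \<in> vint" if "b \<in> B" for b by (rule vint_mult[OF t c[OF that]])
qed (use t x Mod.smult_closed in auto)

lemma int_form_coord: "b \<in> B ==> int_form (coord b)"
 using coord_vint coord_add coord_smult unfolding int_form_def by auto

lemma coord_separates:
 assumes x: "x \<in> carrier M" and z: "!!b. b \<in> B ==> coord b x = \<zero>"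
 shows "x = \<zero>\<^sub>M"
 using coord_sum[OF x, of "{}"] z by auto

text \<open>These are the forms \<open>\<Phi>\<close> of \<open>lattice_space\<close>: the
  coordinates, extended to the base change.\<close>

definition forms :: "(('c \<times> 'k) list set => 'k) set" where
 "forms = (\<lambda>b. functional (coord b)) ` B"

lemma emb_zero: "emb \<zero>\<^sub>M = \<zero>\<^sub>VM"
 using emb_add[of "\<zero>\<^sub>M" "\<zero>\<^sub>M"] emb_closed[of "\<zero>\<^sub>M"] by (simp add: VG.add.l_cancel_one)

lemma forms_separate:
 assumes C: "C \<in> carrier VM" and z: "!!\<phi>. \<phi> \<in> forms ==> \<phi> C = \<zero>"
 shows "C = \<zero>\<^sub>VM"
proof -
 obtain t x where t: "t \<in> vint" "t \<noteq> \<zero>" "x \<in> carrier M" "t \<odot>\<^sub>VM C = emb x"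
  using clear_denominators[OF C] by blast
 have "coord b x = \<zero>" if b: "b \<in> B" for b
 proof -
  have "coord b x = functional (coord b) (t \<odot>\<^sub>VM C)"
   using functional_emb[OF int_form_coord[OF b] t(3)] t(4) by simp
  also have "\<dots> = t \<otimes> functional (coord b) C"
   using functional_smult[OF int_form_coord[OF b] _ C] t(1) by simp
  finally show ?thesis using z[of "functional (coord b)"] b t(1) by (simp add: forms_def)
 qed
 hence "t \<odot>\<^sub>VM C = \<zero>\<^sub>VM" using coord_separates[OF t(3)] t(4) emb_zero by simp
 thus ?thesis using VV.smult_cancel[of t C] t C by simp
qed

lemma forms_bounded:
 assumes C: "C \<in> carrier VM"
 shows "\<exists>D::real. \<forall>\<phi>\<in>forms. ereal D \<le> v (\<phi> C)"
proof -
 obtain t x where t: "t \<in> vint" "t \<noteq> \<zero>" "x \<in> carrier M" "t \<odot>\<^sub>VM C = emb x"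
  using clear_denominators[OF C] by blast
 have "ereal (- rv t) \<le> v (functional (coord b) C)" if b: "b \<in> B" for b
 proof -
  have "t \<otimes> functional (coord b) C = coord b x"
   using functional_emb[OF int_form_coord[OF b] t(3)] functional_smult[OF int_form_coord[OF b] _ C, of t] t by simp
  moreover have "0 \<le> v (coord b x)" using int_form_coord[OF b] t(3) by (auto simp: int_form_def)
  moreover have "functional (coord b) C \<in> carrier K" using functional_closed[OF int_form_coord[OF b] C] .
  ultimately have "0 \<le> ereal (rv t) + v (functional (coord b) C)"
   using v_mult[of t "functional (coord b) C"] v_rv[of t] t by simp
  thus ?thesis by (cases "v (functional (coord b) C)") auto
 qed
 thus ?thesis by (auto simp: forms_def)
qed

text \<open>The extended coordinate forms recover all coordinates of \<open>x\<close> from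
  \<open>emb x\<close>.\<close>

lemma emb_inj:
 assumes "x \<in> carrier M" "y \<in> carrier M" "emb x = emb y"
 shows "x = y"
proof -
 have c: "coord b x = coord b y" if b: "b \<in> B" for b
  using functional_emb[OF int_form_coord[OF b] assms(1)] functional_emb[OF int_form_coord[OF b] assms(2)] assms(3) by simp
 hence s: "supp x = supp y" by auto
 have "x = (\<Oplus>\<^sub>M b\<in>supp x. coord b x \<odot>\<^sub>M b)" by (rule coord_sum[OF assms(1) finite_supp[OF assms(1)]]) auto
 also have "\<dots> = (\<Oplus>\<^sub>M b\<in>supp y. coord b y \<odot>\<^sub>M b)"
  by (rule Mod.M.finsum_cong'[OF s]) (use smult_basis coord_vint[OF assms(2)] c in auto)
 also have "\<dots> = y" by (rule coord_sum[OF assms(2) finite_supp[OF assms(2)], symmetric]) auto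
 finally show ?thesis .
qed

lemma lattice_space_image:
 assumes "N \<subseteq> carrier M" "\<zero>\<^sub>M \<in> N" "!!x y. x \<in> N ==> y \<in> N ==> x \<oplus>\<^sub>M y \<in> N"
  "!!t x. t \<in> vint ==> x \<in> N ==> t \<odot>\<^sub>M x \<in> N"
 shows "lattice_space K v VM (emb ` N) forms"
proof (intro lattice_space.intro lattice_space_axioms.intro)
 show "valued_field K v" by (rule valued_field_axioms)
 show "vectorspace K VM" by (rule vectorspace_VM)
 show "emb ` N \<subseteq> carrier VM" using assms(1) emb_closed by auto
 show "\<zero>\<^sub>VM \<in> emb ` N" using assms(2) emb_zero by force
 show "x \<oplus>\<^sub>VM y \<in> emb ` N" if "x \<in> emb ` N" "y \<in> emb ` N" for x y
  using that assms(1,3) by (auto simp: emb_add[symmetric] subset_iff)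
 show "t \<odot>\<^sub>VM x \<in> emb ` N" if "t \<in> vint" "x \<in> emb ` N" for t x
  using that assms(1) assms(4)[OF that(1)] by (auto simp: emb_smult[OF that(1), symmetric] subset_iff)
 show "0 \<le> v (\<phi> x)" if "\<phi> \<in> forms" "x \<in> emb ` N" for \<phi> x
 proof -
  obtain b y where "b \<in> B" "\<phi> = functional (coord b)" "y \<in> N" "x = emb y"
   using \<open>\<phi> \<in> forms\<close> \<open>x \<in> emb ` N\<close> by (auto simp: forms_def)
  thus ?thesis using functional_emb[OF int_form_coord] int_form_coord assms(1) by (auto simp: int_form_def subset_iff)
 qed
 show "x = \<zero>\<^sub>VM" if "x \<in> carrier VM" "!!\<phi>. \<phi> \<in> forms ==> \<phi> x = \<zero>" for x
  using that by (rule forms_separate)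
 show "\<exists>B::real. \<forall>\<phi>\<in>forms. ereal B \<le> v (\<phi> x)" if "x \<in> carrier VM" for x
  by (rule forms_bounded[OF that])
qed (auto simp: forms_def functional_closed functional_add functional_smult int_form_coord)

end

section \<open>The p-adic numbers\<close>

context valued_field
begin

lemma nat_in_closed [simp]: "nat_in K m \<in> carrier K"
 by simp

lemma nat_in_add: "nat_in K (m + n) = nat_in K m \<oplus> nat_in K n"
 by (simp add: add.nat_pow_mult)

lemma nat_in_mult: "nat_in K (m * n) = nat_in K m \<otimes> nat_in K n"
proof -
 have "nat_in K m \<otimes> nat_in K n = [m] \<cdot> (\<one> \<otimes> nat_in K n)"
  by (rule add_pow_ldistr) auto
 also have "\<dots> = nat_in K (m * n)"
  by (simp add: add.nat_pow_pow mult.commute)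
 finally show ?thesis by simp
qed

lemma nat_in_0 [simp]: "nat_in K 0 = \<zero>" and nat_in_1 [simp]: "nat_in K (Suc 0) = \<one>"
 by simp_all

lemma v_nat_in: "0 \<le> v (nat_in K m)"
proof (induction m)
 case (Suc m)
 have "nat_in K (Suc m) = nat_in K m \<oplus> \<one>" by simp
 thus ?case using v_add_ge[of "nat_in K m" \<one> 0] Suc by (simp del: add.nat_pow_Suc)
qed simp

lemma nat_in_pow: "nat_in K (m ^ k) = nat_in K m [^] k"
 by (induction k) (simp_all add: nat_in_mult m_comm del: add.nat_pow_Suc)

lemma v_diff_trans:
 "a \<in> carrier K ==> b \<in> carrier K ==> c \<in> carrier K ==> r \<le> v (a \<ominus> b) ==> r \<le> v (b \<ominus> c) ==> r \<le> v (a \<ominus> c)"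
proof -
 assume c: "a \<in> carrier K" "b \<in> carrier K" "c \<in> carrier K" "r \<le> v (a \<ominus> b)" "r \<le> v (b \<ominus> c)"
 have "a \<ominus> c = (a \<ominus> b) \<oplus> (b \<ominus> c)" using c(1-3) by algebra
 thus ?thesis using v_add_ge[of "a \<ominus> b" "b \<ominus> c" r] c by simp
qed

lemma v_mult_ge:
 "a \<in> carrier K ==> b \<in> carrier K ==> r \<le> v a ==> 0 \<le> v b ==> r \<le> v (a \<otimes> b)"
 using add_mono[of r "v a" 0 "v b"] by (simp add: v_mult)

lemma v_lower:
 assumes "x \<in> carrier K" obtains k :: nat where "0 \<le> ereal (real k) + v x"
proof (cases "x = \<zero>")
 case True thus thesis using that[of 0] by simp
next
 case False
 obtain k :: nat where "- rv x \<le> real k" using real_arch_simple by blast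
 thus thesis using that[of k] v_rv[OF assms False] by (simp add: zero_ereal_def)
qed

lemma v_large_imp_zero:
 assumes "x \<in> carrier K" "!!N::nat. ereal (real N) \<le> v x" shows "x = \<zero>"
proof (rule ccontr)
 assume "x \<noteq> \<zero>"
 moreover obtain N :: nat where "rv x < real N" using reals_Archimedean2 by blast
 ultimately show False using assms(2)[of N] v_rv[OF assms(1)] by simp
qed

section \<open>Closures in the topology of the valuation\<close>

text \<open>\<open>Qp K v\<close> is the closure of the prime field. The lemmas on \<open>cl\<close>
  let the field operations be checked on a dense subset, and for negation and inversion the result
  may already lie in the closure only.\<close>

definition cl :: "'k set => 'k set" where
 "cl D = {x \<in> carrier K. \<forall>N::nat. \<exists>y\<in>D. ereal (real N) \<le> v (x \<ominus> y)}"

lemma clI: "x \<in> carrier K ==> (!!N::nat. \<exists>y\<in>D. ereal (real N) \<le> v (x \<ominus> y)) ==> x \<in> cl D"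
 by (simp add: cl_def)

lemma cl_closed: "x \<in> cl D ==> x \<in> carrier K"
 by (simp add: cl_def)

lemma clE: assumes "x \<in> cl D" obtains y where "y \<in> D" "ereal (real N) \<le> v (x \<ominus> y)"
 using assms unfolding cl_def by blast

lemma cl_mono: "D \<subseteq> D' ==> cl D \<subseteq> cl D'"
 unfolding cl_def by blast

context
 fixes D assumes D: "D \<subseteq> carrier K"
begin

lemma subset_cl: "D \<subseteq> cl D"
proof
 fix x assume x: "x \<in> D"
 hence "v (x \<ominus> x) = \<infinity>" using D by (auto simp: a_minus_def r_neg)
 thus "x \<in> cl D" using x D by (intro clI) (auto intro!: bexI[of _ x])
qed

lemma cl_limit: assumes "x \<in> carrier K" "!!N::nat. \<exists>y\<in>cl D. ereal (real N) \<le> v (x \<ominus> y)" shows "x \<in> cl D"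
proof (rule clI[OF assms(1)])
 fix N
 obtain y where y: "y \<in> cl D" "ereal (real N) \<le> v (x \<ominus> y)" using assms(2) by blast
 obtain z where z: "z \<in> D" "ereal (real N) \<le> v (y \<ominus> z)" using clE[OF y(1)] .
 thus "\<exists>y\<in>D. ereal (real N) \<le> v (x \<ominus> y)" using v_diff_trans[OF assms(1) cl_closed[OF y(1)] _ y(2) z(2)] D by blast
qed

lemma cl_add:
 assumes x: "x \<in> cl D" and y: "y \<in> cl D" and "!!a b. a \<in> D ==> b \<in> D ==> a \<oplus> b \<in> D" shows "x \<oplus> y \<in> cl D"
proof (rule clI)
 note c = cl_closed[OF x] cl_closed[OF y]
 show "x \<oplus> y \<in> carrier K" using c by simp
 fix N
 obtain a where a: "a \<in> D" "ereal (real N) \<le> v (x \<ominus> a)" using clE[OF x] .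
 obtain b where b: "b \<in> D" "ereal (real N) \<le> v (y \<ominus> b)" using clE[OF y] .
 have ab: "a \<in> carrier K" "b \<in> carrier K" using a b D by auto
 have "(x \<oplus> y) \<ominus> (a \<oplus> b) = (x \<ominus> a) \<oplus> (y \<ominus> b)" using c ab by algebra
 thus "\<exists>z\<in>D. ereal (real N) \<le> v (x \<oplus> y \<ominus> z)"
  using assms(3)[OF a(1) b(1)] v_add_ge[of "x \<ominus> a" "y \<ominus> b"] a(2) b(2) c ab by (intro bexI[of _ "a \<oplus> b"]) auto
qed

lemma cl_mult:
 assumes x: "x \<in> cl D" and y: "y \<in> cl D" and "!!a b. a \<in> D ==> b \<in> D ==> a \<otimes> b \<in> D" shows "x \<otimes> y \<in> cl D"
proof (rule clI)
 note c = cl_closed[OF x] cl_closed[OF y]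
 show "x \<otimes> y \<in> carrier K" using c by simp
 fix N
 obtain k l :: nat where kl: "0 \<le> ereal (real k) + v x" "0 \<le> ereal (real l) + v y" using v_lower c by meson
 \<comment> \<open>The valuation of \<open>x\<close> is at least -k, and that of \<open>y\<close>,
   hence of its approximation \<open>b\<close>, at least -l. Errors of order N + l in
   \<open>x\<close> and N + k + l in \<open>y\<close> therefore leave an error of order N in the
   product.\<close>
 obtain a where a: "a \<in> D" "ereal (real (N + l)) \<le> v (x \<ominus> a)" using clE[OF x] .
 obtain b where b: "b \<in> D" "ereal (real (N + k + l)) \<le> v (y \<ominus> b)" using clE[OF y] .
 have ab: "a \<in> carrier K" "b \<in> carrier K" using a b D by auto
 have "ereal (- real l) \<le> v y" using kl(2) by (cases "v y") auto
 moreover have "ereal (- real l) \<le> v (y \<ominus> b)" by (rule order_trans[OF _ b(2)]) simp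
 moreover have "y \<ominus> (y \<ominus> b) = b" using c ab by algebra
 ultimately have vb: "ereal (- real l) \<le> v b" using v_diff_ge[of y "y \<ominus> b" "ereal (- real l)"] c ab by simp
 have "ereal (real N) \<le> v ((x \<ominus> a) \<otimes> b)"
  using add_mono[OF a(2) vb] c ab by (simp add: v_mult)
 moreover have "ereal (- real k) \<le> v x" using kl(1) by (cases "v x") auto
 hence "ereal (real N) \<le> v (x \<otimes> (y \<ominus> b))"
  using add_mono[OF _ b(2), of "ereal (- real k)" "v x"] c ab order_trans[of "ereal (real N)" "ereal (real (N + l))"]
  by (simp add: v_mult)
 moreover have "x \<otimes> y \<ominus> a \<otimes> b = (x \<ominus> a) \<otimes> b \<oplus> x \<otimes> (y \<ominus> b)" using c ab by algebra
 ultimately show "\<exists>z\<in>D. ereal (real N) \<le> v (x \<otimes> y \<ominus> z)"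
  using assms(3)[OF a(1) b(1)] v_add_ge[of "(x \<ominus> a) \<otimes> b" "x \<otimes> (y \<ominus> b)"] c ab by (intro bexI[of _ "a \<otimes> b"]) auto
qed

lemma cl_neg:
 assumes x: "x \<in> cl D" and "!!a. a \<in> D ==> \<ominus> a \<in> cl D" shows "\<ominus> x \<in> cl D"
proof (rule cl_limit)
 note c = cl_closed[OF x]
 show "\<ominus> x \<in> carrier K" using c by simp
 fix N
 obtain a where a: "a \<in> D" "ereal (real N) \<le> v (x \<ominus> a)" using clE[OF x] .
 have "\<ominus> x \<ominus> \<ominus> a = \<ominus> (x \<ominus> a)" using a D c by (auto simp: a_minus_def minus_add)
 thus "\<exists>z\<in>cl D. ereal (real N) \<le> v (\<ominus> x \<ominus> z)" using assms(2)[OF a(1)] a D c by (intro bexI[of _ "\<ominus> a"]) auto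
qed

lemma cl_inv:
 assumes x: "x \<in> cl D" "x \<noteq> \<zero>" and "!!a. a \<in> D ==> a \<noteq> \<zero> ==> inv a \<in> cl D" shows "inv x \<in> cl D"
proof (rule cl_limit)
 note c = cl_closed[OF x(1)]
 note ix = inv_nonzero[OF c x(2)]
 show "inv x \<in> carrier K" by (rule ix)
 fix N :: nat
 \<comment> \<open>The difference of the inverses of \<open>x\<close> and \<open>a\<close> is
   \<open>a - x\<close> divided by their product, which costs twice the valuation of
   \<open>x\<close>; and an error of order above that of \<open>x\<close> gives \<open>a\<close> the
   same valuation as \<open>x\<close>.\<close>
 obtain M :: nat where "max (rv x) (real N + 2 * rv x) < real M" using reals_Archimedean2 by blast
 hence M: "rv x < real M" "real N + 2 * rv x \<le> real M" by auto
 obtain a where a: "a \<in> D" "ereal (real M) \<le> v (x \<ominus> a)" using clE[OF x(1)] .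
 have aK: "a \<in> carrier K" using a D by blast
 have "v x < v (\<ominus> (x \<ominus> a))"
  using M(1) a(2) c aK v_rv[OF c x(2)] less_le_trans[of "ereal (rv x)" "ereal (real M)"] by simp
 hence "v (x \<oplus> \<ominus> (x \<ominus> a)) = v x" using c aK by (intro v_add_eq) auto
 moreover have "x \<oplus> \<ominus> (x \<ominus> a) = a" using c aK by algebra
 ultimately have va: "v a = ereal (rv x)" using v_rv[OF c x(2)] by simp
 hence a0: "a \<noteq> \<zero>" by auto
 note ia = inv_nonzero[OF aK a0]
 have "inv x \<ominus> inv a = inv x \<otimes> inv a \<otimes> \<ominus> (x \<ominus> a)"
 proof -
  have "inv x \<otimes> inv a \<otimes> \<ominus> (x \<ominus> a) = inv x \<otimes> (inv a \<otimes> a) \<ominus> inv a \<otimes> (inv x \<otimes> x)" using c aK ix(1) ia(1) by algebra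
  thus ?thesis using ix ia by simp
 qed
 moreover have "v (inv a) = ereal (- rv x)" "v (inv x) = ereal (- rv x)"
  using v_rv[OF ia(1,2)] v_rv[OF ix(1,2)] rv_inv[OF aK a0] rv_inv[OF c x(2)] va by (simp_all add: rv_def)
 ultimately have "v (inv x \<ominus> inv a) = ereal (- 2 * rv x) + v (x \<ominus> a)" using c aK ix(1) ia(1) by (simp add: v_mult)
 also have "ereal (real N) \<le> \<dots>" using add_left_mono[OF a(2), of "ereal (- 2 * rv x)"] M(2)
  by (intro order_trans[OF _ add_left_mono[OF a(2)]]) simp
 finally show "\<exists>z\<in>cl D. ereal (real N) \<le> v (inv x \<ominus> z)" using assms(3)[OF a(1) a0] by blast
qed

end

end

locale padic_field = valued_field K v for K :: "('k, 'm) ring_scheme" (structure) and v +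
 fixes p :: nat
 assumes prime_p: "Factorial_Ring.prime p" and v_p: "v (nat_in K p) = 1"
begin

abbreviation pp :: 'k where "pp \<equiv> nat_in K p"

lemma pp_nonzero: "pp \<noteq> \<zero>"
 using v_p by auto

lemma v_pp_pow: "v (pp [^] (k::nat)) = ereal (real k)"
 using v_pow[of pp k] v_p by (simp add: one_ereal_def)

lemma pp_pow_nonzero: "pp [^] (k::nat) \<noteq> \<zero>"
 using v_pp_pow[of k] by auto

lemma pp_inv: "inv (pp [^] (k::nat)) \<in> carrier K" "pp [^] k \<otimes> inv (pp [^] k) = \<one>"
  "v (inv (pp [^] k)) = ereal (- real k)"
proof -
 note i = inv_nonzero[OF nat_pow_closed[OF nat_in_closed] pp_pow_nonzero, of k]
 show "inv (pp [^] k) \<in> carrier K" "pp [^] k \<otimes> inv (pp [^] k) = \<one>" using i by auto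
 hence "v (pp [^] k) + v (inv (pp [^] k)) = 0" using v_mult[of "pp [^] k" "inv (pp [^] k)"] by simp
 thus "v (inv (pp [^] k)) = ereal (- real k)"
  unfolding v_pp_pow by (cases "v (inv (pp [^] k))") (auto simp: zero_ereal_def)
qed

text \<open>Bezout in the natural numbers, with the subtraction moved to the other side, since
  \<open>nat_in\<close> takes natural numbers.\<close>

lemma nat_inverse_mod_pow:
 assumes "\<not> p dvd m"
 obtains w b where "nat_in K m \<otimes> nat_in K w = pp [^] (N::nat) \<otimes> nat_in K b \<oplus> \<one>"
proof -
 have "coprime m (p ^ N)" using assms prime_imp_coprime[OF prime_p] by (simp add: coprime_commute)
 moreover have "m \<noteq> 0" using assms by (cases m) auto
 ultimately obtain w b where "m * w = p ^ N * b + 1" using bezout_nat[of m "p ^ N"] by auto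
 hence "nat_in K m \<otimes> nat_in K w = pp [^] N \<otimes> nat_in K b \<oplus> \<one>"
  by (metis nat_in_add nat_in_mult nat_in_pow One_nat_def nat_in_1)
 thus thesis by (rule that)
qed

text \<open>For N = 1 the product \<open>m w\<close> is 1 plus a multiple of \<open>p\<close>, so it
  has valuation 0, and both factors have nonnegative valuation.\<close>

lemma v_nat_in_unit: assumes "\<not> p dvd m" shows "v (nat_in K m) = 0"
proof -
 obtain w b where w: "nat_in K m \<otimes> nat_in K w = pp [^] (1::nat) \<otimes> nat_in K b \<oplus> \<one>"
  by (rule nat_inverse_mod_pow[OF assms])
 have "1 \<le> v (pp [^] (1::nat) \<otimes> nat_in K b)" using v_mult_ge[of pp "nat_in K b" 1] v_p v_nat_in by simp
 hence "v \<one> < v (pp [^] (1::nat) \<otimes> nat_in K b)" by (simp add: less_le_trans[of 0 1])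
 hence "v (\<one> \<oplus> pp [^] (1::nat) \<otimes> nat_in K b) = v \<one>" by (intro v_add_eq) auto
 hence "v (nat_in K m) + v (nat_in K w) = 0"
  using v_mult[of "nat_in K m" "nat_in K w"] w by (simp add: a_comm)
 thus ?thesis using v_nat_in[of m] v_nat_in[of w]
  by (cases "v (nat_in K m)"; cases "v (nat_in K w)") auto
qed

lemma p_dvd_of_v_pos: "0 < v (nat_in K m) ==> p dvd m"
 using v_nat_in_unit[of m] by (metis less_irrefl)

lemma p_pow_dvd: "ereal (real k) \<le> v (nat_in K m) ==> p ^ k dvd m"
proof (induction k arbitrary: m)
 case (Suc k)
 have "0 < v (nat_in K m)" by (rule less_le_trans[OF _ Suc.prems]) simp
 then obtain l where l: "m = p * l" using p_dvd_of_v_pos by blast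
 have "ereal (real k) \<le> v (nat_in K l)"
  using Suc.prems v_p unfolding l nat_in_mult v_mult[OF nat_in_closed nat_in_closed]
  by (cases "v (nat_in K l)") (auto simp: one_ereal_def)
 thus ?case using Suc.IH l by simp
qed simp

section \<open>A dense subset of the p-adic numbers\<close>

text \<open>Natural numbers divided by powers of \<open>p\<close>. The set is closed under sums and
  products, it is dense in the p-adic numbers, and its integral members are natural numbers, the
  elements for which \<open>endomorphism_structure\<close> prescribes the action.\<close>

definition pfrac :: "'k set" where
 "pfrac = {nat_in K m \<otimes> inv (pp [^] (k::nat)) | m k. True}"

lemma pfracI: "nat_in K m \<otimes> inv (pp [^] (k::nat)) \<in> pfrac"
 by (auto simp: pfrac_def)

lemma pfracE: assumes "x \<in> pfrac" obtains m and k :: nat where "x = nat_in K m \<otimes> inv (pp [^] k)" "pp [^] k \<otimes> x = nat_in K m"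
proof -
 obtain m and k :: nat where x: "x = nat_in K m \<otimes> inv (pp [^] k)" using assms unfolding pfrac_def by blast
 thus thesis using that[OF x] pp_inv[of k] by (simp add: m_lcomm)
qed

lemma pfrac_closed: "pfrac \<subseteq> carrier K"
 using pp_inv(1) by (auto simp: pfrac_def)

lemma pfrac_eqI: assumes "x \<in> carrier K" "pp [^] (k::nat) \<otimes> x = nat_in K m" shows "x \<in> pfrac"
proof -
 have "x = (pp [^] k \<otimes> inv (pp [^] k)) \<otimes> x" using assms(1) pp_inv[of k] by simp
 also have "\<dots> = nat_in K m \<otimes> inv (pp [^] k)"
  unfolding assms(2)[symmetric] using assms(1) pp_inv(1)[of k] by (simp add: m_ac)
 finally show ?thesis using pfracI by simp
qed

lemma nat_in_pfrac: "nat_in K m \<in> pfrac"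
 by (rule pfrac_eqI[of _ 0]) auto

lemma pfrac_add: assumes "x \<in> pfrac" "y \<in> pfrac" shows "x \<oplus> y \<in> pfrac"
proof -
 obtain m k where x: "pp [^] (k::nat) \<otimes> x = nat_in K m" using pfracE[OF assms(1)] by blast
 obtain n l where y: "pp [^] (l::nat) \<otimes> y = nat_in K n" using pfracE[OF assms(2)] by blast
 have c: "x \<in> carrier K" "y \<in> carrier K" using assms pfrac_closed by auto
 have "pp [^] (k + l) \<otimes> (x \<oplus> y) = pp [^] l \<otimes> (pp [^] k \<otimes> x) \<oplus> pp [^] k \<otimes> (pp [^] l \<otimes> y)"
  unfolding nat_pow_mult[OF nat_in_closed, symmetric] using c nat_pow_closed[OF nat_in_closed] by algebra
 also have "\<dots> = nat_in K (p ^ l * m + p ^ k * n)" unfolding x y by (simp only: nat_in_add nat_in_mult nat_in_pow)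
 finally show ?thesis using c by (intro pfrac_eqI[of _ "k + l"]) auto
qed

lemma pfrac_mult: assumes "x \<in> pfrac" "y \<in> pfrac" shows "x \<otimes> y \<in> pfrac"
proof -
 obtain m k where x: "pp [^] (k::nat) \<otimes> x = nat_in K m" using pfracE[OF assms(1)] by blast
 obtain n l where y: "pp [^] (l::nat) \<otimes> y = nat_in K n" using pfracE[OF assms(2)] by blast
 have c: "x \<in> carrier K" "y \<in> carrier K" using assms pfrac_closed by auto
 have "pp [^] (k + l) \<otimes> (x \<otimes> y) = (pp [^] k \<otimes> x) \<otimes> (pp [^] l \<otimes> y)"
  using c by (simp add: nat_pow_mult[symmetric] m_ac del: add.nat_pow_Suc)
 also have "\<dots> = nat_in K (m * n)" unfolding x y by (simp only: nat_in_mult)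
 finally show ?thesis using c by (intro pfrac_eqI[of _ "k + l"]) auto
qed

text \<open>\<open>p ^ M - 1\<close> tends to -1, so \<open>(p ^ M - 1) x\<close> tends to
  \<open>\<ominus> x\<close>.\<close>

lemma pfrac_neg: assumes "x \<in> pfrac" shows "\<ominus> x \<in> cl pfrac"
proof (rule clI)
 have c: "x \<in> carrier K" using assms pfrac_closed by blast
 thus "\<ominus> x \<in> carrier K" by simp
 fix N
 obtain k :: nat where k: "0 \<le> ereal (real k) + v x" using v_lower[OF c] .
 have "p ^ (N + k) > 0" using prime_gt_1_nat[OF prime_p] by simp
 hence "nat_in K (p ^ (N + k) - 1) \<oplus> \<one> = pp [^] (N + k)"
  using nat_in_add[of "p ^ (N + k) - 1" 1] by (simp add: nat_in_pow del: add.nat_pow_Suc)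
 moreover have "\<ominus> x \<ominus> nat_in K (p ^ (N + k) - 1) \<otimes> x = \<ominus> ((nat_in K (p ^ (N + k) - 1) \<oplus> \<one>) \<otimes> x)"
  using c nat_in_closed[of "p ^ (N + k) - 1"] by algebra
 ultimately have "v (\<ominus> x \<ominus> nat_in K (p ^ (N + k) - 1) \<otimes> x) = ereal (real (N + k)) + v x"
  using c by (simp add: v_mult v_pp_pow del: add.nat_pow_Suc)
 moreover have "ereal (real N) \<le> ereal (real (N + k)) + v x" using k by (cases "v x") auto
 ultimately have "ereal (real N) \<le> v (\<ominus> x \<ominus> nat_in K (p ^ (N + k) - 1) \<otimes> x)" by simp
 thus "\<exists>y\<in>pfrac. ereal (real N) \<le> v (\<ominus> x \<ominus> y)" using pfrac_mult[OF nat_in_pfrac assms] by blast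
qed

text \<open>Write \<open>x\<close> as \<open>p ^ l q / p ^ k\<close> with \<open>q\<close> prime to
  \<open>p\<close>. If \<open>w\<close> inverts \<open>q\<close> modulo a high power of
  \<open>p\<close>, then \<open>q w / x\<close> is a member of \<open>pfrac\<close>, and it is close
  to the inverse of \<open>x\<close>.\<close>

lemma pfrac_inv: assumes "x \<in> pfrac" "x \<noteq> \<zero>" shows "inv x \<in> cl pfrac"
proof -
 obtain m k where x: "pp [^] (k::nat) \<otimes> x = nat_in K m" using pfracE[OF assms(1)] by blast
 have c: "x \<in> carrier K" using assms pfrac_closed by blast
 note ix = inv_nonzero[OF c assms(2)]
 have "nat_in K m \<noteq> \<zero>" unfolding x[symmetric] using integral[of "pp [^] k" x] c assms(2) pp_pow_nonzero by auto
 hence m0: "m \<noteq> 0" by (cases m) auto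
 have "p > 1" using prime_gt_1_nat[OF prime_p] .
 then obtain l q where q: "m = p ^ l * q" "\<not> p dvd q"
  using multiplicity_decompose'[of m p] m0 prime_p by (metis not_prime_unit)
 have qx: "pp [^] l \<otimes> nat_in K q = pp [^] k \<otimes> x" unfolding x q(1) by (simp only: nat_in_mult nat_in_pow)
 show ?thesis
 proof (rule clI[OF ix(1)])
  fix N
  obtain s :: nat where s: "0 \<le> ereal (real s) + v (inv x)" using v_lower[OF ix(1)] .
  obtain w b where w: "nat_in K q \<otimes> nat_in K w = pp [^] (N + s) \<otimes> nat_in K b \<oplus> \<one>"
   by (rule nat_inverse_mod_pow[OF q(2)])
  let ?y = "nat_in K q \<otimes> nat_in K w \<otimes> inv x"
  have "pp [^] l \<otimes> ?y = (pp [^] l \<otimes> nat_in K q) \<otimes> (nat_in K w \<otimes> inv x)" using ix by (simp add: m_assoc)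
  also have "\<dots> = pp [^] k \<otimes> nat_in K w \<otimes> (x \<otimes> inv x)" unfolding qx using c ix(1) by (simp add: m_ac)
  also have "\<dots> = nat_in K (p ^ k * w)" using ix by (simp add: nat_in_mult nat_in_pow)
  finally have y: "?y \<in> pfrac" using ix by (intro pfrac_eqI[of _ l]) auto
  have "inv x \<ominus> ?y = \<ominus> (pp [^] (N + s) \<otimes> nat_in K b \<otimes> inv x)"
   unfolding w using ix(1) nat_pow_closed[OF nat_in_closed] nat_in_closed[of b] by algebra
  hence "v (inv x \<ominus> ?y) = v (pp [^] (N + s) \<otimes> inv x \<otimes> nat_in K b)" using ix(1) by (simp add: m_ac del: add.nat_pow_Suc)
  moreover have "ereal (real N) \<le> v (pp [^] (N + s) \<otimes> inv x)"
   using s ix(1) by (cases "v (inv x)") (auto simp: v_mult v_pp_pow simp del: add.nat_pow_Suc)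
  hence "ereal (real N) \<le> v (pp [^] (N + s) \<otimes> inv x \<otimes> nat_in K b)"
   using v_mult_ge[of "pp [^] (N + s) \<otimes> inv x" "nat_in K b"] ix(1) v_nat_in[of b] by simp
  ultimately have "ereal (real N) \<le> v (inv x \<ominus> ?y)" by simp
  thus "\<exists>y\<in>pfrac. ereal (real N) \<le> v (inv x \<ominus> y)" using y by blast
 qed
qed

lemma cl_pfrac_subfield: "subfield (cl pfrac) K"
proof (rule subfieldI')
 note D = pfrac_closed
 have one: "\<one> \<in> cl pfrac" using subset_cl[OF D] nat_in_pfrac[of 1] by auto
 show "subring (cl pfrac) K"
  by (rule subringI) (blast intro: one cl_closed cl_add[OF D _ _ pfrac_add] cl_mult[OF D _ _ pfrac_mult] cl_neg[OF D _ pfrac_neg])+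
 show "inv k \<in> cl pfrac" if "k \<in> cl pfrac - {\<zero>}" for k
  using cl_inv[OF D _ _ pfrac_inv, of k] that by auto
qed

lemma nat_in_prime_field: "nat_in K m \<in> generate_field K {}"
proof (induction m)
 case 0 show ?case using zero_in_generate by simp
next
 case (Suc m)
 show ?case using generate_field.eng_add[OF Suc generate_field.one[of K "{}"]] by simp
qed

text \<open>The closure of \<open>pfrac\<close> is a subfield, so it contains the prime field and,
  being closed, the closure of the prime field. Conversely \<open>pfrac\<close> lies in the prime
  field.\<close>

lemma Qp_eq: "Qp K v = cl pfrac"
proof -
 have "generate_field K {} \<subseteq> cl pfrac" by (rule generate_field_min_subfield1[OF _ cl_pfrac_subfield]) auto
 moreover have "pfrac \<subseteq> generate_field K {}"
  unfolding pfrac_def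
  using generate_field.eng_mult[OF nat_in_prime_field generate_field.m_inv[OF nat_in_prime_field]] pp_pow_nonzero
  by (auto simp: nat_in_pow[symmetric] simp del: add.nat_pow_Suc)
 moreover have "Qp K v = cl (generate_field K {})" by (simp add: Qp_def cl_def)
 moreover have "cl (cl pfrac) \<subseteq> cl pfrac"
  by (rule subsetI, rule cl_limit[OF pfrac_closed cl_closed]) (auto simp: cl_def)
 ultimately show ?thesis using cl_mono[of "generate_field K {}" "cl pfrac"] cl_mono[of pfrac "generate_field K {}"] by blast
qed

lemma Qp_subfield: "subfield (Qp K v) K"
 unfolding Qp_eq by (rule cl_pfrac_subfield)

lemma Qp_closed: "x \<in> Qp K v ==> x \<in> carrier K"
 by (simp add: Qp_def)

lemma nat_in_Qp: "nat_in K m \<in> Qp K v"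
 unfolding Qp_eq using nat_in_pfrac subset_cl[OF pfrac_closed] by blast

lemma pp_inv_Qp: "inv (pp [^] (k::nat)) \<in> Qp K v"
 using subfield_m_inv(1)[OF Qp_subfield, of "pp [^] k"] nat_in_Qp[of "p ^ k"] pp_pow_nonzero
 by (simp add: nat_in_pow del: add.nat_pow_Suc)

lemma Zp_carrier: "z \<in> Zp K v ==> z \<in> carrier K"
 and Zp_Qp: "z \<in> Zp K v ==> z \<in> Qp K v"
 and Zp_v: "z \<in> Zp K v ==> 0 \<le> v z"
 using Qp_closed by (auto simp: Zp_def)

lemma Zp_subring: "subring (Zp K v) K"
proof -
 have "Zp K v = Qp K v \<inter> vint" using Qp_closed by (auto simp: Zp_def)
 thus ?thesis using subring_inter[OF subfieldE(1)[OF Qp_subfield] subring_vint] by simp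
qed

lemma nat_in_Zp: "nat_in K m \<in> Zp K v"
 using nat_in_Qp v_nat_in by (simp add: Zp_def)

lemma Zp_pp_pow: "z \<in> Zp K v ==> pp [^] (k::nat) \<otimes> z \<in> Zp K v"
 using subringE(6)[OF Zp_subring nat_in_Zp[of "p ^ k"]] by (simp add: nat_in_pow)

lemma Zp_unit_inv: assumes "z \<in> Zp K v" "v z = 0" shows "inv z \<in> Zp K v"
proof -
 have z: "z \<in> carrier K" "z \<noteq> \<zero>" using assms Zp_carrier by auto
 have "v (inv z) = 0" using v_mult[OF z(1) inv_nonzero(1)[OF z]] inv_nonzero(3)[OF z] assms(2) by simp
 thus ?thesis using subfield_m_inv(1)[OF Qp_subfield, of z] Zp_Qp[OF assms(1)] z(2) by (simp add: Zp_def)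
qed

lemma Zp_limit: assumes z: "z \<in> carrier K" "!!N::nat. \<exists>y\<in>Zp K v. ereal (real N) \<le> v (z \<ominus> y)" shows "z \<in> Zp K v"
proof -
 obtain y where y: "y \<in> Zp K v" "ereal (real 0) \<le> v (z \<ominus> y)" using z(2) by blast
 have "z = (z \<ominus> y) \<oplus> y" using z(1) Zp_carrier[OF y(1)] by algebra
 hence "0 \<le> v z" using v_add_ge[of "z \<ominus> y" y 0] z(1) Zp_carrier[OF y(1)] Zp_v[OF y(1)] y(2) by (simp add: zero_ereal_def)
 moreover have "z \<in> Qp K v" unfolding Qp_eq
  by (rule cl_limit[OF pfrac_closed z(1)]) (use z(2) Zp_Qp in \<open>auto simp: Qp_eq[symmetric] intro: bexI\<close>)
 ultimately show ?thesis by (simp add: Zp_def)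
qed

text \<open>A member of \<open>pfrac\<close> close to a p-adic integer is integral, so its numerator
  is divisible by its denominator.\<close>

lemma Zp_approx: assumes z: "z \<in> Zp K v" obtains m where "ereal (real N) \<le> v (z \<ominus> nat_in K m)"
proof -
 note zK = Zp_carrier[OF z]
 obtain y where y: "y \<in> pfrac" "ereal (real N) \<le> v (z \<ominus> y)" using clE[of z pfrac] Zp_Qp[OF z] unfolding Qp_eq by blast
 have yK: "y \<in> carrier K" using y(1) pfrac_closed by blast
 obtain m k where m: "pp [^] (k::nat) \<otimes> y = nat_in K m" using pfracE[OF y(1)] by blast
 have "0 \<le> v (z \<ominus> y)" by (rule order_trans[OF _ y(2)]) simp
 moreover have "z \<ominus> (z \<ominus> y) = y" using zK yK by algebra
 ultimately have "0 \<le> v y" using v_diff_ge[of z "z \<ominus> y" 0] Zp_v[OF z] zK yK by simp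
 hence "ereal (real k) \<le> v (nat_in K m)"
  unfolding m[symmetric] using v_mult_ge[of "pp [^] k" y] yK by (simp add: v_pp_pow)
 then obtain l where l: "m = p ^ k * l" using p_pow_dvd by blast
 have "pp [^] k \<otimes> y = pp [^] k \<otimes> nat_in K l" unfolding m l by (simp only: nat_in_mult nat_in_pow)
 hence "y = nat_in K l" using m_lcancel[OF pp_pow_nonzero, of k y "nat_in K l"] yK by simp
 thus thesis using that y(2) by blast
qed

text \<open>The valuation is discrete on the p-adic integers, although it need not be on
  \<open>K\<close>: an approximating natural number of positive valuation is divisible by
  \<open>p\<close>.\<close>

lemma Zp_v_ge_one: assumes z: "z \<in> Zp K v" "0 < v z" shows "1 \<le> v z"
proof -
 note zK = Zp_carrier[OF z(1)]
 obtain m where m: "ereal (real 1) \<le> v (z \<ominus> nat_in K m)" using Zp_approx[OF z(1)] .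
 have eq: "z \<ominus> (z \<ominus> nat_in K m) = nat_in K m" "(z \<ominus> nat_in K m) \<oplus> nat_in K m = z"
  using zK nat_in_closed[of m] by algebra+
 have "0 < v (z \<ominus> nat_in K m)" by (rule less_le_trans[OF _ m]) simp
 hence "0 < v (nat_in K m)"
  using v_diff[of z "z \<ominus> nat_in K m"] z(2) zK eq(1) by (auto simp: min_def split: if_splits)
 then obtain l where "m = p * l" using p_dvd_of_v_pos by blast
 hence "1 \<le> v (nat_in K m)" using v_mult_ge[of pp "nat_in K l" 1] v_p v_nat_in[of l] by (simp add: nat_in_mult)
 thus ?thesis using v_add_ge[of "z \<ominus> nat_in K m" "nat_in K m" 1] m zK eq(2) by (simp add: one_ereal_def)
qed

lemma Zp_p_divides:
 assumes z: "z \<in> Zp K v" "0 < v z" obtains y where "y \<in> Zp K v" "z = pp \<otimes> y"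
proof -
 let ?y = "inv (pp [^] (1::nat)) \<otimes> z"
 note zK = Zp_carrier[OF z(1)] and i = pp_inv[of 1]
 have "v ?y = ereal (- 1) + v z" using i zK by (simp add: v_mult)
 hence "0 \<le> v ?y" using Zp_v_ge_one[OF z] by (cases "v z") (auto simp: one_ereal_def)
 moreover have "?y \<in> Qp K v" by (rule subringE(6)[OF subfieldE(1)[OF Qp_subfield] pp_inv_Qp Zp_Qp[OF z(1)]])
 moreover have "z = pp \<otimes> ?y" using i zK by (simp add: m_assoc[symmetric])
 ultimately show thesis using that by (simp add: Zp_def)
qed

lemma Qp_clear: assumes x: "x \<in> Qp K v" obtains k :: nat where "pp [^] k \<otimes> x \<in> Zp K v"
proof -
 obtain k :: nat where k: "0 \<le> ereal (real k) + v x" using v_lower[OF Qp_closed[OF x]] .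
 have "pp [^] k \<otimes> x \<in> Qp K v"
  using subringE(6)[OF subfieldE(1)[OF Qp_subfield] nat_in_Qp[of "p ^ k"] x] by (simp add: nat_in_pow)
 thus thesis using that[of k] k Qp_closed[OF x] by (simp add: Zp_def v_mult v_pp_pow)
qed

end

section \<open>Conjugates and rings of integers\<close>

context cring
begin

primrec root_step :: "'a => 'a => 'a list => 'a list" where
 "root_step y q [] = [\<ominus> (y \<otimes> q)]"
| "root_step y q (c # cs) = (c \<ominus> y \<otimes> q) # root_step y c cs"

text \<open>The coefficients, leading one first, of the product of the \<open>X - y\<close> for \<open>y\<close> in the list \<open>ys\<close>:
 \<open>root_step y \<zero>\<close> multiplies by \<open>X - y\<close>, its second argument being the previous coefficient.\<close>

definition root_poly :: "'a list => 'a list" where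
 "root_poly ys = List.fold (\<lambda>y. root_step y \<zero>) ys [\<one>]"

lemma root_step_closed:
 "y \<in> carrier R ==> q \<in> carrier R ==> set cs \<subseteq> carrier R ==> set (root_step y q cs) \<subseteq> carrier R"
 by (induction cs arbitrary: q) auto

lemma root_step_not_Nil [simp]: "root_step y q cs \<noteq> []"
 by (cases cs) auto

lemma length_root_step [simp]: "length (root_step y q cs) = Suc (length cs)"
 by (induction cs arbitrary: q) auto

text \<open>Commutation is generalised to arbitrary carried coefficients, because the recursion
  changes them: after a step for \<open>z\<close> the carried coefficient is \<open>d - z q\<close>,
  where \<open>q\<close> is the coefficient before \<open>d\<close>.\<close>

lemma root_step_commute_aux:
 assumes "y \<in> carrier R" "z \<in> carrier R" "q \<in> carrier R" "d \<in> carrier R" "set cs \<subseteq> carrier R"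
 shows "root_step y (d \<ominus> z \<otimes> q) (root_step z d cs) = root_step z (d \<ominus> y \<otimes> q) (root_step y d cs)"
 using assms(3-5)
proof (induction cs arbitrary: q d)
 case Nil
 have "\<ominus> (z \<otimes> d) \<ominus> y \<otimes> (d \<ominus> z \<otimes> q) = \<ominus> (y \<otimes> d) \<ominus> z \<otimes> (d \<ominus> y \<otimes> q)"
  "\<ominus> (y \<otimes> \<ominus> (z \<otimes> d)) = \<ominus> (z \<otimes> \<ominus> (y \<otimes> d))"
  using assms(1,2) Nil by algebra+
 thus ?case by simp
next
 case (Cons e es)
 have "e \<ominus> z \<otimes> d \<ominus> y \<otimes> (d \<ominus> z \<otimes> q) = e \<ominus> y \<otimes> d \<ominus> z \<otimes> (d \<ominus> y \<otimes> q)"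
  using assms(1,2) Cons.prems by simp algebra
 thus ?case using Cons.IH[of d e] Cons.prems by simp
qed

lemma root_step_commute:
 assumes "y \<in> carrier R" "z \<in> carrier R" "set cs \<subseteq> carrier R"
 shows "root_step y \<zero> (root_step z \<zero> cs) = root_step z \<zero> (root_step y \<zero> cs)"
 using root_step_commute_aux[OF assms(1,2) zero_closed zero_closed assms(3)] assms(1,2) by (simp add: a_minus_def)

lemma root_poly_mset:
 assumes "set ys \<subseteq> carrier R" "mset ys = mset zs" shows "root_poly ys = root_poly zs"
 unfolding root_poly_def
proof (rule fold_permuted_eq[where P = "\<lambda>cs. set cs \<subseteq> carrier R", OF assms(2)])
 fix x cs assume "x \<in> set ys" "set cs \<subseteq> carrier R"
 thus "set (root_step x \<zero> cs) \<subseteq> carrier R" using assms(1) by (intro root_step_closed) auto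
next
 fix x y cs assume "x \<in> set ys" "y \<in> set ys" "set cs \<subseteq> carrier R"
 thus "root_step x \<zero> (root_step y \<zero> cs) = root_step y \<zero> (root_step x \<zero> cs)"
  using assms(1) by (intro root_step_commute) auto
qed simp

lemma root_poly_monic: "set ys \<subseteq> carrier R ==> root_poly ys \<noteq> [] \<and> hd (root_poly ys) = \<one>"
proof -
 have "cs \<noteq> [] ==> hd cs = \<one> ==> set ys \<subseteq> carrier R ==>
  List.fold (\<lambda>y. root_step y \<zero>) ys cs \<noteq> [] \<and> hd (List.fold (\<lambda>y. root_step y \<zero>) ys cs) = \<one>" for cs
 proof (induction ys arbitrary: cs)
  case (Cons y ys)
  have "hd (root_step y \<zero> cs) = \<one>" using Cons.prems by (cases cs) (auto simp: a_minus_def)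
  thus ?case using Cons by simp
 qed simp
 thus "set ys \<subseteq> carrier R ==> ?thesis" unfolding root_poly_def by simp
qed

lemma root_step_subset:
 assumes S: "subring S R" and "y \<in> S" "q \<in> S" "set cs \<subseteq> S"
 shows "set (root_step y q cs) \<subseteq> S"
 using assms(3,4)
 by (induction cs arbitrary: q) (auto simp: a_minus_def intro!: subringE(5,6,7)[OF S] assms(2))

lemma root_poly_subset:
 assumes S: "subring S R" and "set ys \<subseteq> S" shows "set (root_poly ys) \<subseteq> S"
proof -
 have "set cs \<subseteq> S ==> set ys \<subseteq> S ==> set (List.fold (\<lambda>y. root_step y \<zero>) ys cs) \<subseteq> S" for cs
  by (induction ys arbitrary: cs) (simp_all add: root_step_subset[OF S] subringE(2)[OF S])
 thus ?thesis unfolding root_poly_def using assms subringE(3)[OF S] by simp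
qed

text \<open>\<open>h\<close> is a homomorphism on a subring only, as it will be an automorphism of a
  Galois subfield of \<open>K\<close> and not of \<open>K\<close> itself.\<close>

lemma map_root_poly:
 assumes S: "subring S R" and h: "!!a b. a \<in> S ==> b \<in> S ==> h (a \<oplus> b) = h a \<oplus> h b"
   "!!a b. a \<in> S ==> b \<in> S ==> h (a \<otimes> b) = h a \<otimes> h b" "!!a. a \<in> S ==> h (\<ominus> a) = \<ominus> h a"
   "h \<zero> = \<zero>" "h \<one> = \<one>"
  and "set ys \<subseteq> S"
 shows "map h (root_poly ys) = root_poly (map h ys)"
proof -
 note Sc = subringE(2,5,6,7)[OF S]
 have step: "map h (root_step y q cs) = root_step (h y) (h q) (map h cs)"
  if "y \<in> S" "q \<in> S" "set cs \<subseteq> S" for y q cs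
  using that(2,3) by (induction cs arbitrary: q) (auto simp: a_minus_def h Sc \<open>y \<in> S\<close>)
 have "set cs \<subseteq> S ==> set ys \<subseteq> S ==> map h (List.fold (\<lambda>y. root_step y \<zero>) ys cs) =
   List.fold (\<lambda>y. root_step y \<zero>) (map h ys) (map h cs)" for cs
  by (induction ys arbitrary: cs) (simp_all add: step root_step_subset[OF S] Sc h)
 from this[of "[\<one>]"] show ?thesis unfolding root_poly_def using assms subringE(3)[OF S] by simp
qed

lemma eval_root_step:
 assumes "y \<in> carrier R" "x \<in> carrier R" "q \<in> carrier R" "set cs \<subseteq> carrier R"
 shows "eval (root_step y q cs) x = x \<otimes> eval cs x \<ominus> y \<otimes> (q \<otimes> x [^] length cs \<oplus> eval cs x)"
 using assms(3,4)
proof (induction cs arbitrary: q)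
 case Nil thus ?case using assms(1,2) by (simp add: a_minus_def r_minus)
next
 case (Cons c cs)
 let ?e = "eval cs x" and ?l = "x [^] length cs"
 have e: "?e \<in> carrier R" "?l \<in> carrier R" "c \<in> carrier R" using Cons.prems assms by (auto simp: eval_in_carrier)
 have "(c \<ominus> y \<otimes> q) \<otimes> (?l \<otimes> x) \<oplus> (x \<otimes> ?e \<ominus> y \<otimes> (c \<otimes> ?l \<oplus> ?e)) =
   x \<otimes> (c \<otimes> ?l \<oplus> ?e) \<ominus> y \<otimes> (q \<otimes> (?l \<otimes> x) \<oplus> (c \<otimes> ?l \<oplus> ?e))"
  using e assms Cons.prems(1) by algebra
 thus ?case using Cons by simp
qed

lemma eval_hom_list:
 assumes R': "ring R'" and S: "subring S R" and h: "!!a b. a \<in> S ==> b \<in> S ==> h (a \<oplus> b) = h a \<oplus>\<^sub>R' h b"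
   "!!a b. a \<in> S ==> b \<in> S ==> h (a \<otimes> b) = h a \<otimes>\<^sub>R' h b" "h \<zero> = \<zero>\<^sub>R'" "h \<one> = \<one>\<^sub>R'"
  and "set cs \<subseteq> S" "x \<in> S"
 shows "h (eval cs x) = ring.eval R' (map h cs) (h x)" "eval cs x \<in> S"
proof -
 interpret S: subring S R by fact
 have pow: "x [^] (n::nat) \<in> S \<and> h (x [^] n) = h x [^]\<^sub>R' n" for n
  by (induction n) (auto simp: h \<open>x \<in> S\<close> subringE(3,6)[OF S])
 have "eval cs x \<in> S \<and> h (eval cs x) = ring.eval R' (map h cs) (h x)"
  using assms(7)
  by (induction cs) (auto simp: h ring.eval.simps[OF R'] pow subringE(2,6,7)[OF S])
 thus "h (eval cs x) = ring.eval R' (map h cs) (h x)" "eval cs x \<in> S" by auto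
qed

end

context domain
begin

lemma eval_root_step_zero:
 assumes "y \<in> carrier R" "x \<in> carrier R" "set cs \<subseteq> carrier R"
 shows "eval (root_step y \<zero> cs) x = \<zero> \<longleftrightarrow> x = y \<or> eval cs x = \<zero>"
proof -
 have e: "eval cs x \<in> carrier R" by (rule eval_in_carrier) fact+
 have "eval (root_step y \<zero> cs) x = (x \<ominus> y) \<otimes> eval cs x"
  using eval_root_step[OF assms(1,2) zero_closed assms(3)] assms e by simp algebra
 thus ?thesis using integral_iff[of "x \<ominus> y" "eval cs x"] assms e r_right_minus_eq[of x y] by simp
qed

lemma eval_root_poly:
 assumes "set ys \<subseteq> carrier R" "x \<in> carrier R"
 shows "eval (root_poly ys) x = \<zero> \<longleftrightarrow> x \<in> set ys"
proof -
 have "set cs \<subseteq> carrier R ==> set ys \<subseteq> carrier R ==>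
  eval (List.fold (\<lambda>y. root_step y \<zero>) ys cs) x = \<zero> \<longleftrightarrow> x \<in> set ys \<or> eval cs x = \<zero>" for cs
  by (induction ys arbitrary: cs) (auto simp: eval_root_step_zero root_step_closed assms(2))
 from this[of "[\<one>]"] show ?thesis unfolding root_poly_def using assms by simp
qed

end

text \<open>\<open>P\<close> evaluates a list of coefficients at \<open>T\<close>, applied to
  \<open>x\<close>. It is given by its recursion equations, so that any concrete evaluation function
  can be inserted. A \<open>root_step\<close> for \<open>y\<close> corresponds to applying
  \<open>T - y\<close>.\<close>

lemma (in vectorspace) poly_op_root_poly:
 assumes T: "lin_op T" and ys: "set ys \<subseteq> carrier K" and x: "x \<in> carrier V"
  and P: "!!c cs. P (c # cs) = c \<odot>\<^sub>V (T ^^ length cs) x \<oplus>\<^sub>V P cs" "P [] = \<zero>\<^sub>V"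
 shows "P (root_poly ys) = op_prod T ys x"
proof -
 have pow: "(T ^^ n) x \<in> carrier V" for n by (induction n) (auto simp: x lin_opD(1)[OF T])
 have Pc: "set cs \<subseteq> carrier K ==> P cs \<in> carrier V" for cs
  by (induction cs) (auto simp: P pow)
 have step: "P (root_step y q cs) = T (P cs) \<ominus>\<^sub>V y \<odot>\<^sub>V (q \<odot>\<^sub>V (T ^^ length cs) x \<oplus>\<^sub>V P cs)"
  if y: "y \<in> carrier K" and "q \<in> carrier K" "set cs \<subseteq> carrier K" for y q cs
  using \<open>q \<in> carrier K\<close> \<open>set cs \<subseteq> carrier K\<close>
 proof (induction cs arbitrary: q)
  case Nil
  thus ?case using y x by (simp add: P lin_op_zero[OF T] smult_l_minus smult_assoc1 a_minus_def)
 next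
  case (Cons c cs)
  let ?e = "P cs" and ?l = "(T ^^ length cs) x"
  have e: "?e \<in> carrier V" "?l \<in> carrier V" "T ?e \<in> carrier V" "T ?l \<in> carrier V" "c \<in> carrier K"
   using Cons.prems pow lin_opD(1)[OF T] Pc by auto
  have "P (root_step y q (c # cs)) =
   (c \<ominus>\<^sub>K y \<otimes>\<^sub>K q) \<odot>\<^sub>V T ?l \<oplus>\<^sub>V (T ?e \<ominus>\<^sub>V y \<odot>\<^sub>V (c \<odot>\<^sub>V ?l \<oplus>\<^sub>V ?e))"
   using Cons.IH[of c] Cons.prems by (simp add: P)
  also have "\<dots> = T (P (c # cs)) \<ominus>\<^sub>V y \<odot>\<^sub>V (q \<odot>\<^sub>V (T ^^ length (c # cs)) x \<oplus>\<^sub>V P (c # cs))"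
   using e y Cons.prems(1)
   by (simp add: P lin_opD[OF T] smult_l_diff smult_l_distr smult_l_minus smult_r_distr smult_assoc1 a_minus_def minus_add a_ac)
  finally show ?case .
 qed
 have "P (List.fold (\<lambda>y. root_step y \<zero>\<^sub>K) ys cs) = op_prod T ys (P cs)"
  if "set cs \<subseteq> carrier K" for cs
  using that ys
 proof (induction ys arbitrary: cs)
  case (Cons y ys)
  have "P (root_step y \<zero>\<^sub>K cs) = T (P cs) \<ominus>\<^sub>V y \<odot>\<^sub>V P cs"
   using step[of y "\<zero>\<^sub>K" cs] Cons.prems Pc[of cs] pow by simp
  thus ?case using Cons root_step_closed[of y "\<zero>\<^sub>K" cs] by simp
 qed simp
 from this[of "[\<one>\<^sub>K]"] show ?thesis using x unfolding root_poly_def by (simp add: P)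
qed

section \<open>Embeddings of a finite extension and their conjugates\<close>

locale padic_extension = padic_field K v p for K :: "('k, 'm) ring_scheme" (structure) and v p +
 fixes F :: "'f ring" and j :: "'k => 'f" and d :: nat
 assumes complete: "complete_valued_field K v"
  and extension: "finite_extension_of_Qp K v F j d"
  and galois: "contains_galois_closure K v F j"
begin

sublocale FF: field F
 using extension unfolding finite_extension_of_Qp_def by simp

abbreviation Emb :: "'f set => ('f => 'k) set" where
 "Emb E \<equiv> embeddings K v F j E (carrier K)"

lemmas Qp_ops = subringE(2,3,5,6,7)[OF subfieldE(1)[OF Qp_subfield]]

lemma j_hom: "j \<in> ring_hom (K\<lparr>carrier := Qp K v\<rparr>) F"
 using extension unfolding finite_extension_of_Qp_def by simp

lemma j_closed: "x \<in> Qp K v ==> j x \<in> carrier F"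
 and j_add: "x \<in> Qp K v ==> y \<in> Qp K v ==> j (x \<oplus> y) = j x \<oplus>\<^sub>F j y"
 and j_mult: "x \<in> Qp K v ==> y \<in> Qp K v ==> j (x \<otimes> y) = j x \<otimes>\<^sub>F j y"
 and j_one: "j \<one> = \<one>\<^sub>F"
 using ring_hom_closed[OF j_hom] ring_hom_add[OF j_hom] ring_hom_mult[OF j_hom] ring_hom_one[OF j_hom] by simp_all

lemma j_zero: "j \<zero> = \<zero>\<^sub>F"
 using j_add[OF Qp_ops(1,1)] j_closed[OF Qp_ops(1)] by simp

lemma embD:
 assumes t: "\<tau> \<in> Emb E" and E: "subring E F"
 shows "b \<in> E ==> \<tau> b \<in> carrier K"
  and "a \<in> E ==> b \<in> E ==> \<tau> (a \<oplus>\<^sub>F b) = \<tau> a \<oplus> \<tau> b"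
  and "a \<in> E ==> b \<in> E ==> \<tau> (a \<otimes>\<^sub>F b) = \<tau> a \<otimes> \<tau> b"
  and "\<tau> \<one>\<^sub>F = \<one>" and "\<tau> \<zero>\<^sub>F = \<zero>"
  and "a \<in> E ==> \<tau> (\<ominus>\<^sub>F a) = \<ominus> \<tau> a"
  and "x \<in> Qp K v ==> \<tau> (j x) = x"
proof -
 have h: "\<tau> \<in> ring_hom (F\<lparr>carrier := E\<rparr>) K" using t by (simp add: embeddings_def)
 show c: "b \<in> E ==> \<tau> b \<in> carrier K" for b using ring_hom_closed[OF h, of b] by simp
 show a: "a \<in> E ==> b \<in> E ==> \<tau> (a \<oplus>\<^sub>F b) = \<tau> a \<oplus> \<tau> b" for a b using ring_hom_add[OF h, of a b] by simp
 show "a \<in> E ==> b \<in> E ==> \<tau> (a \<otimes>\<^sub>F b) = \<tau> a \<otimes> \<tau> b" using ring_hom_mult[OF h, of a b] by simp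
 show "\<tau> \<one>\<^sub>F = \<one>" using ring_hom_one[OF h] by simp
 show z: "\<tau> \<zero>\<^sub>F = \<zero>" using a[of "\<zero>\<^sub>F" "\<zero>\<^sub>F"] c[of "\<zero>\<^sub>F"] subringE(2)[OF E] by simp
 show "a \<in> E ==> \<tau> (\<ominus>\<^sub>F a) = \<ominus> \<tau> a"
 proof -
  assume e: "a \<in> E"
  hence "\<tau> (\<ominus>\<^sub>F a) \<oplus> \<tau> a = \<zero>"
   using a[of "\<ominus>\<^sub>F a" a] subringE(1,5)[OF E] z by (simp add: FF.l_neg subset_iff)
  thus ?thesis using minus_equality[of "\<tau> (\<ominus>\<^sub>F a)" "\<tau> a"] c e subringE(5)[OF E] by simp
 qed
 show "x \<in> Qp K v ==> \<tau> (j x) = x" using t by (simp add: embeddings_def)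
qed

lemma subring_F: "subring (carrier F) F"
 by (rule FF.carrier_is_subring)

lemmas EmbD = embD[OF _ subring_F]

lemma emb_inj:
 assumes t: "\<tau> \<in> Emb E" and E: "subfield E F" and b: "b \<in> E" "\<tau> b = \<zero>"
 shows "b = \<zero>\<^sub>F"
proof (rule ccontr)
 assume b0: "b \<noteq> \<zero>\<^sub>F"
 have i: "inv\<^bsub>F\<^esub> b \<in> E" "b \<otimes>\<^sub>F inv\<^bsub>F\<^esub> b = \<one>\<^sub>F" using FF.subfield_m_inv[OF E, of b] b b0 by auto
 note D = embD[OF t subfieldE(1)[OF E]]
 have "\<zero> = \<one>" using D(3)[OF b(1) i(1)] D(4) i(2) b(2) D(1)[OF i(1)] by simp
 thus False by simp
qed

lemma emb_diff:
 "\<tau> \<in> Emb E ==> subring E F ==> a \<in> E ==> b \<in> E ==> \<tau> (a \<ominus>\<^sub>F b) = \<tau> a \<ominus> \<tau> b"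
 by (simp add: a_minus_def embD subringE(5))

lemma emb_nat: "\<tau> \<in> Emb E ==> subring E F ==> nat_in F m \<in> E \<and> \<tau> (nat_in F m) = nat_in K m"
 by (induction m) (auto simp: embD subringE(2,3,7))

lemma emb_pow: "\<tau> \<in> Emb E ==> subring E F ==> b \<in> E ==> b [^]\<^sub>F (m::nat) \<in> E \<and> \<tau> (b [^]\<^sub>F m) = \<tau> b [^] m"
 by (induction m) (auto simp: embD subringE(3,6))

lemma emb_eval:
 assumes t: "\<tau> \<in> Emb E" and E: "subring E F" "j ` Qp K v \<subseteq> E" and "set cs \<subseteq> Qp K v" "b \<in> E"
 shows "\<tau> (FF.eval (map j cs) b) = eval cs (\<tau> b)" "FF.eval (map j cs) b \<in> E"
proof -
 note D = embD[OF t E(1)]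
 have s: "set (map j cs) \<subseteq> E" using assms by auto
 have "map \<tau> (map j cs) = cs" using assms(4) D(7) by (simp add: map_idI subset_iff)
 thus "\<tau> (FF.eval (map j cs) b) = eval cs (\<tau> b)"
  using FF.eval_hom_list(1)[OF ring_axioms E(1), of \<tau> "map j cs" b] D s assms(5) by simp
 show "FF.eval (map j cs) b \<in> E"
  using FF.eval_hom_list(2)[OF ring_axioms E(1), of \<tau> "map j cs" b] D s assms(5) by simp
qed

abbreviation conj_set :: "'f => 'k set" where
 "conj_set b \<equiv> (\<lambda>\<tau>. \<tau> b) ` Emb (carrier F)"

lemma j_image: "j ` Qp K v \<subseteq> carrier F"
 using j_closed by auto

end

context padic_extension
begin

text \<open>All the \<open>g x\<close> are roots of one nonzero polynomial over the p-adic numbers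
  that annihilates \<open>x\<close>.\<close>

lemma finite_orbit:
 assumes L: "finite_dimension (Qp K v) L" "subring L K" and x: "x \<in> L"
  and G: "!!g. g \<in> G ==> g \<in> ring_hom (K\<lparr>carrier := L\<rparr>) (K\<lparr>carrier := L\<rparr>)"
   "!!g y. g \<in> G ==> y \<in> Qp K v ==> g y = y"
  and QL: "Qp K v \<subseteq> L"
 shows "finite ((\<lambda>g. g x) ` G)"
proof -
 have LK: "L \<subseteq> carrier K" by (rule subringE(1)[OF L(2)])
 have xK: "x \<in> carrier K" using x LK by blast
 have "(algebraic over (Qp K v)) x"
  by (rule finite_dimension_imp_algebraic[OF Qp_subfield L(2,1) x])
 then obtain q where q: "q \<in> carrier ((Qp K v)[X])" "q \<noteq> []" "eval q x = \<zero>"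
  using algebraicE[OF subfieldE(1)[OF Qp_subfield] xK] by blast
 have sq: "set q \<subseteq> Qp K v" using q(1,2) unfolding univ_poly_carrier[symmetric] polynomial_def by auto
 have qK: "q \<in> carrier (poly_ring K)"
  using carrier_polynomial_shell[OF subfieldE(1)[OF Qp_subfield] q(1)] .
 have "(\<lambda>g. g x) ` G \<subseteq> {y. is_root q y}"
 proof
  fix y assume "y \<in> (\<lambda>g. g x) ` G"
  then obtain g where g: "g \<in> G" "y = g x" by blast
  note gh = ring_hom_closed[OF G(1)[OF g(1)]] ring_hom_add[OF G(1)[OF g(1)]]
   ring_hom_mult[OF G(1)[OF g(1)]] ring_hom_one[OF G(1)[OF g(1)]]
  have "g (eval q x) = eval (map g q) (g x)"
  proof (rule eval_hom_list(1)[OF ring_axioms L(2)])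
   show "g \<zero> = \<zero>" using G(2)[OF g(1) Qp_ops(1)] .
   show "set q \<subseteq> L" using sq QL by blast
  qed (use gh x in auto)
  moreover have "map g q = q" using sq G(2)[OF g(1)] by (simp add: map_idI subset_iff)
  ultimately have "eval q y = \<zero>" using q(3) g(2) G(2)[OF g(1) Qp_ops(1)] by simp
  moreover have "y \<in> carrier K" using gh(1)[of x] x g(2) LK by auto
  ultimately show "y \<in> {y. is_root q y}" using q(2) by (simp add: is_root_def)
 qed
 thus ?thesis using finite_number_of_roots[OF qK] finite_subset by blast
qed

text \<open>The conjugates of \<open>b\<close> are the orbit of its image in the Galois extension, so the coefficients
 of the polynomial having them as roots are fixed by the Galois group.\<close>

lemma conjugate_polynomial:
 assumes b: "b \<in> carrier F"
 obtains ys where "distinct ys" "set ys = conj_set b" "set ys \<subseteq> carrier K"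
  "set (root_poly ys) \<subseteq> Qp K v" "FF.eval (map j (root_poly ys)) b = \<zero>\<^sub>F"
proof -
 obtain L s where s: "s \<in> Emb (carrier F)" and L: "galois_over K (Qp K v) L" "s ` carrier F \<subseteq> L"
  using galois unfolding contains_galois_closure_def by blast
 let ?KL = "K\<lparr>carrier := L\<rparr>"
 define G where "G = {g \<in> ring_iso ?KL ?KL. \<forall>y\<in>Qp K v. g y = y}"
 have sL: "subring L K" and QL: "Qp K v \<subseteq> L" and fL: "finite_dimension (Qp K v) L"
  and fixed: "{x \<in> L. \<forall>g\<in>G. g x = x} = Qp K v"
  using L(1) subfieldE(1) unfolding galois_over_def finite_dimension_def G_def by auto
 have LK: "L \<subseteq> carrier K" by (rule subringE(1)[OF sL])
 have Gh: "g \<in> ring_hom ?KL ?KL" "bij_betw g L L" "!!y. y \<in> Qp K v ==> g y = y" if "g \<in> G" for g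
  using that unfolding G_def ring_iso_def by auto
 have gc: "g x \<in> L" "x' \<in> L ==> g (x \<oplus> x') = g x \<oplus> g x'" "x' \<in> L ==> g (x \<otimes> x') = g x \<otimes> g x'"
  if "g \<in> G" "x \<in> L" for g x x'
  using ring_hom_closed[OF Gh(1)[OF that(1)], of x] ring_hom_add[OF Gh(1)[OF that(1)], of x x']
   ring_hom_mult[OF Gh(1)[OF that(1)], of x x'] that by auto
 have g01: "g \<zero> = \<zero>" "g \<one> = \<one>" if "g \<in> G" for g
  using Gh(3)[OF that] Qp_ops(1,2) by auto
 have gneg: "g (\<ominus> x) = \<ominus> g x" if "g \<in> G" "x \<in> L" for g x
 proof -
  have "g (\<ominus> x) \<oplus> g x = \<zero>"
   using gc(2)[OF that(1), of "\<ominus> x" x] that subringE(5)[OF sL] g01[OF that(1)] LK by (auto simp: l_neg subset_iff)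
  thus ?thesis
   using minus_equality[of "g (\<ominus> x)" "g x"] gc(1)[OF that(1)] that(2) LK subringE(5)[OF sL] by (auto simp: subset_iff)
 qed
 have idG: "(\<lambda>x. x) \<in> G"
  unfolding G_def ring_iso_def using bij_betw_id[of L] by (auto intro!: ring_hom_memI simp: id_def)
 have compG: "(\<lambda>x. g (h x)) \<in> G" if "g \<in> G" "h \<in> G" for g h
 proof -
  have "bij_betw (\<lambda>x. g (h x)) L L"
   using bij_betw_trans[OF Gh(2)[OF that(2)] Gh(2)[OF that(1)]] by (simp add: o_def)
  moreover have "(\<lambda>x. g (h x)) \<in> ring_hom ?KL ?KL"
   by (rule ring_hom_memI) (use gc[OF that(1)] gc[OF that(2)] g01[OF that(1)] g01[OF that(2)] in auto)
  ultimately show ?thesis using Gh(3)[OF that(1)] Gh(3)[OF that(2)] by (simp add: G_def ring_iso_def)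
 qed
 define x where "x = s b"
 have xL: "x \<in> L" using L(2) b by (auto simp: x_def)
 define orb where "orb = (\<lambda>g. g x) ` G"
 have finorb: "finite orb" unfolding orb_def by (rule finite_orbit[OF fL sL xL _ _ QL]) (use Gh in auto)
 have OL: "orb \<subseteq> L" using gc(1) xL by (auto simp: orb_def)
 obtain ys where ys: "set ys = orb" "distinct ys" using finite_distinct_list[OF finorb] by blast
 have ysK: "set ys \<subseteq> carrier K" using ys OL LK by blast
 have coeffs: "set (root_poly ys) \<subseteq> Qp K v"
 proof
  fix c assume c: "c \<in> set (root_poly ys)"
  have "g c = c" if g: "g \<in> G" for g
  proof -
   have inj: "inj_on g L" using Gh(2)[OF g] by (rule bij_betw_imp_inj_on)
   have "g ` orb \<subseteq> orb"
   proof
    fix y assume "y \<in> g ` orb"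
    then obtain h where "h \<in> G" "y = g (h x)" by (auto simp: orb_def)
    thus "y \<in> orb" unfolding orb_def using compG[OF g \<open>h \<in> G\<close>] by (intro image_eqI[of _ _ "\<lambda>x. g (h x)"]) auto
   qed
   hence "g ` orb = orb" using endo_inj_surj[OF finorb] inj_on_subset[OF inj OL] by blast
   \<comment> \<open>\<open>g\<close> permutes the finite orbit and \<open>root_poly\<close> depends
     only on the multiset of its roots, so \<open>g\<close> fixes every coefficient.\<close>
   hence "mset ys = mset (map g ys)"
    using ys inj_on_subset[OF inj OL] by (intro set_eq_iff_mset_eq_distinct[THEN iffD1]) (auto simp: distinct_map)
   hence "root_poly (map g ys) = root_poly ys" by (rule root_poly_mset[OF ysK, symmetric])
   moreover have "map g (root_poly ys) = root_poly (map g ys)"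
    by (rule map_root_poly[OF sL]) (use gc gneg g01 g ys OL in auto)
   ultimately have "map g (root_poly ys) = map (\<lambda>x. x) (root_poly ys)" by simp
   thus "g c = c" using c unfolding map_eq_conv by blast
  qed
  moreover have "c \<in> L" using root_poly_subset[OF sL, of ys] ys(1) OL c by blast
  ultimately show "c \<in> Qp K v" using fixed by blast
 qed
 have xO: "x \<in> set ys" unfolding ys orb_def using idG by (intro image_eqI[of _ _ "\<lambda>x. x"]) auto
 have ev: "FF.eval (map j (root_poly ys)) b = \<zero>\<^sub>F"
 proof (rule emb_inj[OF s FF.carrier_is_subfield])
  note e = emb_eval[OF s subring_F j_image coeffs b]
  show "FF.eval (map j (root_poly ys)) b \<in> carrier F" by (rule e(2))
  show "s (FF.eval (map j (root_poly ys)) b) = \<zero>"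
   unfolding e(1) using eval_root_poly[OF ysK, of x] xO ysK by (auto simp: x_def)
 qed
 have "set ys = conj_set b"
 proof
  show "set ys \<subseteq> conj_set b"
  proof
   fix y assume "y \<in> set ys"
   then obtain g where g: "g \<in> G" "y = g (s b)" unfolding ys orb_def x_def by blast
   have sF: "a \<in> carrier F ==> s a \<in> L" for a using L(2) by blast
   \<comment> \<open>The embedding \<open>s\<close> followed by \<open>g\<close> is again an
     embedding of \<open>F\<close>, and its value at \<open>b\<close> is \<open>y\<close>; hence
     each member of the orbit is a conjugate.\<close>
   have "restrict (\<lambda>a. g (s a)) (carrier F) \<in> Emb (carrier F)"
    unfolding embeddings_def
    using gc[OF g(1) sF] sF g01[OF g(1)] Gh(3)[OF g(1)] EmbD[OF s] LK j_closed
    by (auto intro!: ring_hom_memI simp: subset_iff)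
   thus "y \<in> conj_set b" using g(2) b by (intro image_eqI) auto
  qed
  show "conj_set b \<subseteq> set ys"
  proof
   fix y assume "y \<in> conj_set b"
   then obtain t where t: "t \<in> Emb (carrier F)" "y = t b" by blast
   have "eval (root_poly ys) (t b) = \<zero>"
    using emb_eval(1)[OF t(1) subring_F j_image coeffs b] ev EmbD(5)[OF t(1)] by simp
   thus "y \<in> set ys" using eval_root_poly[OF ysK, of "t b"] EmbD(1)[OF t(1) b] t(2) by simp
  qed
 qed
 thus thesis using that ys ysK coeffs ev by blast
qed

text \<open>An embedding of the subfield \<open>E\<close> sends \<open>b\<close> to a root of the
  polynomial of the conjugates, so its value at \<open>b\<close> is already taken by an embedding of
  the whole field \<open>F\<close>.\<close>

lemma emb_conjugate:
 assumes t: "\<tau> \<in> Emb E" and E: "subring E F" "j ` Qp K v \<subseteq> E" and b: "b \<in> E"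
 shows "\<tau> b \<in> conj_set b"
proof -
 have bF: "b \<in> carrier F" using subringE(1)[OF E(1)] b by blast
 obtain ys where "distinct ys" and ys: "set ys = conj_set b" "set ys \<subseteq> carrier K"
  "set (root_poly ys) \<subseteq> Qp K v" "FF.eval (map j (root_poly ys)) b = \<zero>\<^sub>F"
  using conjugate_polynomial[OF bF] .
 have "eval (root_poly ys) (\<tau> b) = \<zero>"
  using emb_eval(1)[OF t E ys(3) b] ys(4) embD(5)[OF t E(1)] by simp
 thus ?thesis using eval_root_poly[OF ys(2), of "\<tau> b"] embD(1)[OF t E(1) b] ys(1) by simp
qed

lemma finite_conj_set: "b \<in> carrier F ==> finite (conj_set b)"
proof -
 assume "b \<in> carrier F"
 from conjugate_polynomial[OF this] obtain ys where "set ys = conj_set b" by metis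
 thus ?thesis using List.finite_set[of ys] by simp
qed

lemma Emb_nonempty: "Emb (carrier F) \<noteq> {}"
 using galois unfolding contains_galois_closure_def by blast

lemma jQp_subfield: "subfield (j ` Qp K v) F"
proof (rule FF.subfieldI')
 show "subring (j ` Qp K v) F"
 proof (rule FF.subringI[OF j_image])
  show "\<one>\<^sub>F \<in> j ` Qp K v" using j_one Qp_ops(2) by (metis imageI)
  show "\<ominus>\<^sub>F h \<in> j ` Qp K v" if "h \<in> j ` Qp K v" for h
  proof -
   obtain x where x: "x \<in> Qp K v" "h = j x" using \<open>h \<in> _\<close> by blast
   have "j (\<ominus> x) \<oplus>\<^sub>F j x = \<zero>\<^sub>F"
    using j_add[of "\<ominus> x" x] x Qp_ops(3) Qp_closed[of x] j_zero by (simp add: l_neg)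
   hence "\<ominus>\<^sub>F h = j (\<ominus> x)"
    using FF.minus_equality[of "j (\<ominus> x)" "j x"] j_closed x Qp_ops(3) by simp
   thus ?thesis using Qp_ops(3)[OF x(1)] by blast
  qed
 qed (auto simp: j_add[symmetric] j_mult[symmetric] Qp_ops)
 fix h assume h: "h \<in> j ` Qp K v - {\<zero>\<^sub>F}"
 then obtain x where x: "x \<in> Qp K v" "h = j x" "x \<noteq> \<zero>" using j_zero by auto
 have ix: "inv x \<in> Qp K v" "x \<otimes> inv x = \<one>"
  using subfield_m_inv[OF Qp_subfield, of x] x by auto
 have "h \<otimes>\<^sub>F j (inv x) = \<one>\<^sub>F" using j_mult[OF x(1) ix(1)] ix(2) j_one x(2) by simp
 hence "inv\<^bsub>F\<^esub> h = j (inv x)"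
  using FF.comm_inv_char[of h "j (inv x)"] j_closed ix x by simp
 thus "inv\<^bsub>F\<^esub> h \<in> j ` Qp K v" using ix by blast
qed

lemma finite_dimension_F: "FF.dimension d (j ` Qp K v) (carrier F)"
 using extension unfolding finite_extension_of_Qp_def by simp

text \<open>An embedding is determined by its values on a basis over the p-adic numbers, and each
  value lies in a finite set of conjugates.\<close>

lemma finite_emb:
 assumes E: "subfield E F" "j ` Qp K v \<subseteq> E"
 shows "finite (Emb E)"
proof -
 note sE = subfieldE(1)[OF E(1)]
 have EF: "E \<subseteq> carrier F" by (rule subringE(1)[OF sE])
 have "subalgebra (j ` Qp K v) E F"
  by (rule subalgebra.intro)
    (use E(2) subringE[OF sE] subring.axioms(1)[OF sE] in \<open>auto simp: subalgebra_axioms_def\<close>)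
 hence "FF.finite_dimension (j ` Qp K v) E"
  using FF.subalbegra_incl_imp_finite_dimension[OF jQp_subfield FF.finite_dimensionI[OF finite_dimension_F]] EF by simp
 then obtain m where "FF.dimension m (j ` Qp K v) E" unfolding FF.finite_dimension_def by blast
 then obtain Us where Us: "set Us \<subseteq> carrier F" "FF.Span (j ` Qp K v) Us = E"
  using FF.exists_base[OF jQp_subfield] by blast
 have UE: "set Us \<subseteq> E" using FF.Span_base_incl[OF jQp_subfield Us(1)] Us(2) by simp
 have comb: "t (FF.combine Ks Us) = t' (FF.combine Ks Us)"
  if "t \<in> Emb E" "t' \<in> Emb E" "\<forall>u\<in>set Us. t u = t' u" "set Ks \<subseteq> j ` Qp K v" for t t' Ks
 proof -
  note D = embD[OF that(1) sE] and D' = embD[OF that(2) sE]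
  have "set Vs \<subseteq> E ==> (\<forall>u\<in>set Vs. t u = t' u) ==> set Ls \<subseteq> j ` Qp K v ==>
   FF.combine Ls Vs \<in> E \<and> t (FF.combine Ls Vs) = t' (FF.combine Ls Vs)" for Ls Vs
  proof (induction Ls Vs rule: FF.combine.induct)
   case (1 k Ks u Us)
   then obtain z where z: "z \<in> Qp K v" "k = j z" by auto
   have "k \<in> E" using z E(2) by blast
   thus ?case using 1 D(2,3,7) D'(2,3,7) z subringE(6,7)[OF sE] by auto
  qed (auto simp: D(5) D'(5) subringE(2)[OF sE])
  from this[of Us Ks] show ?thesis using UE that by blast
 qed
 have "inj_on (\<lambda>t. restrict t (set Us)) (Emb E)"
 proof (rule inj_onI)
  fix t t' assume t: "t \<in> Emb E" "t' \<in> Emb E" "restrict t (set Us) = restrict t' (set Us)"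
  have eq: "\<forall>u\<in>set Us. t u = t' u" using t(3) by (metis restrict_apply)
  have ext: "t \<in> extensional E" "t' \<in> extensional E" using t by (auto simp: embeddings_def)
  show "t = t'"
  proof (rule extensionalityI[OF ext])
   fix x assume "x \<in> E"
   then obtain Ks where "set Ks \<subseteq> j ` Qp K v" "x = FF.combine Ks Us"
    unfolding Us(2)[symmetric] FF.Span_eq_combine_set[OF jQp_subfield Us(1)] by blast
   thus "t x = t' x" using comb[OF t(1,2) eq] by simp
  qed
 qed
 moreover have "(\<lambda>t. restrict t (set Us)) ` Emb E \<subseteq> (\<Pi>\<^sub>E u\<in>set Us. conj_set u)"
  using emb_conjugate[OF _ sE E(2)] UE by (auto simp: subset_iff simp del: image_iff)
 moreover have "finite (\<Pi>\<^sub>E u\<in>set Us. conj_set u)"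
  using Us(1) finite_conj_set by (intro finite_PiE) auto
 ultimately show ?thesis using finite_subset finite_imageD by blast
qed

end

section \<open>Integral elements and their conjugates\<close>

text \<open>For an element of negative valuation the monomial of highest degree has the smallest
  valuation, and the degree is at most the length minus 1. For the empty list the value is zero and
  the bound is trivial.\<close>

lemma (in valued_field) v_eval_ge:
 assumes x: "x \<in> carrier K" "x \<noteq> \<zero>" "rv x < 0" and "set cs \<subseteq> vint"
 shows "ereal ((real (length cs) - 1) * rv x) \<le> v (eval cs x)"
 using assms(4)
proof (induction cs)
 case (Cons c cs)
 let ?n = "real (length cs)"
 have c: "c \<in> carrier K" "0 \<le> v c" "set cs \<subseteq> carrier K" using Cons.prems by auto
 have "v (c \<otimes> x [^] length cs) = v c + ereal (?n * rv x)"
  using c x by (simp add: v_mult v_pow v_rv)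
 hence 1: "ereal (?n * rv x) \<le> v (c \<otimes> x [^] length cs)"
  using c(2) add_mono[of 0 "v c" "ereal (?n * rv x)" "ereal (?n * rv x)"] by simp
 have "?n * rv x \<le> (?n - 1) * rv x" using x(3) by (intro mult_right_mono_neg) auto
 hence 2: "ereal (?n * rv x) \<le> v (eval cs x)"
  using Cons.IH Cons.prems order_trans[of "ereal (?n * rv x)" "ereal ((?n - 1) * rv x)"] by simp
 have "ereal (?n * rv x) \<le> v (c \<otimes> x [^] length cs \<oplus> eval cs x)"
  using 1 2 c x by (intro v_add_ge) (auto simp: eval_in_carrier)
 thus ?case by simp
qed simp

text \<open>If the valuation of \<open>x\<close> were negative, the leading term would have strictly
  smaller valuation than the rest, and the two could not cancel.\<close>

lemma (in valued_field) monic_root_integral: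
 assumes x: "x \<in> carrier K" and "set cs \<subseteq> vint" "eval (\<one> # cs) x = \<zero>"
 shows "0 \<le> v x"
proof (rule ccontr)
 assume neg: "\<not> 0 \<le> v x"
 have x0: "x \<noteq> \<zero>" using neg by auto
 hence r: "rv x < 0" using v_rv[OF x x0] neg by (simp add: zero_ereal_def)
 have cs: "set cs \<subseteq> carrier K" using assms(2) by auto
 let ?n = "length cs"
 have "x [^] ?n = \<ominus> eval cs x"
  using assms(3) x cs eval_in_carrier[OF cs x] minus_equality[of "x [^] ?n" "eval cs x"] by simp
 hence "v (eval cs x) = ereal (real ?n * rv x)"
  using v_neg[OF eval_in_carrier[OF cs x]] v_pow[of x ?n] v_rv[OF x x0] x by simp
 hence "(real ?n - 1) * rv x \<le> real ?n * rv x" using v_eval_ge[OF x x0 r assms(2)] by simp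
 thus False using r by (simp add: algebra_simps)
qed

context padic_extension
begin

abbreviation OE :: "'f set => 'f ring" where "OE E \<equiv> int_ring K v F j E"

text \<open>An integral equation holds for every conjugate, so all conjugates are integral in
  \<open>K\<close>. Conversely the polynomial whose roots are the conjugates has coefficients in the
  p-adic numbers, and these are integral when the roots are.\<close>

lemma int_ring_mem:
 assumes "E \<subseteq> carrier F"
 shows "b \<in> carrier (OE E) \<longleftrightarrow> b \<in> E \<and> (\<forall>\<tau>\<in>Emb (carrier F). 0 \<le> v (\<tau> b))"
proof
 assume "b \<in> carrier (OE E)"
 then obtain q where b: "b \<in> E" and q: "q \<noteq> []" "set q \<subseteq> j ` Zp K v" "hd q = \<one>\<^sub>F" "FF.eval q b = \<zero>\<^sub>F"
  unfolding integral_closure_def by auto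
 have "q \<in> lists (j ` Zp K v)" using q(2) by (simp add: in_lists_conv_set subset_iff)
 then obtain cs where "cs \<in> lists (Zp K v)" and cs2: "q = map j cs" unfolding lists_image by (rule imageE)
 hence cs: "set cs \<subseteq> Zp K v" "q = map j cs" by (simp_all add: in_lists_conv_set subset_iff)
 have csQ: "set cs \<subseteq> Qp K v" and csv: "set cs \<subseteq> vint" using cs(1) Qp_closed by (auto simp: Zp_def)
 have "0 \<le> v (\<tau> b)" if t: "\<tau> \<in> Emb (carrier F)" for \<tau>
 proof (rule monic_root_integral)
  have bF: "b \<in> carrier F" using b assms by blast
  show "\<tau> b \<in> carrier K" by (rule EmbD(1)[OF t bF])
  obtain c ds where c: "cs = c # ds" using q(1) cs(2) by (cases cs) auto
  hence "c = \<one>" using q(3) cs(2) EmbD(7)[OF t, of c] EmbD(4)[OF t] csQ by simp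
  moreover have "eval cs (\<tau> b) = \<zero>"
   using emb_eval(1)[OF t subring_F j_image csQ bF] q(4) cs(2) EmbD(5)[OF t] by simp
  ultimately show "eval (\<one> # tl cs) (\<tau> b) = \<zero>" using c by simp
  show "set (tl cs) \<subseteq> vint" using csv c by simp
 qed
 thus "b \<in> E \<and> (\<forall>\<tau>\<in>Emb (carrier F). 0 \<le> v (\<tau> b))" using b by blast
next
 assume b: "b \<in> E \<and> (\<forall>\<tau>\<in>Emb (carrier F). 0 \<le> v (\<tau> b))"
 hence bF: "b \<in> carrier F" using assms by blast
 obtain ys where "distinct ys" and ys: "set ys = conj_set b" "set ys \<subseteq> carrier K"
  "set (root_poly ys) \<subseteq> Qp K v" "FF.eval (map j (root_poly ys)) b = \<zero>\<^sub>F"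
  using conjugate_polynomial[OF bF] .
 have "set ys \<subseteq> vint" using b ys(1,2) by auto
 hence "set (root_poly ys) \<subseteq> vint" by (rule root_poly_subset[OF subring_vint])
 hence "set (map j (root_poly ys)) \<subseteq> j ` Zp K v" using ys(3) by (auto simp: Zp_def)
 moreover have "map j (root_poly ys) \<noteq> [] \<and> hd (map j (root_poly ys)) = \<one>\<^sub>F"
  using root_poly_monic[OF ys(2)] j_one by (simp add: hd_map)
 ultimately show "b \<in> carrier (OE E)"
  using b ys(4) unfolding integral_closure_def by (auto intro!: exI[of _ "map j (root_poly ys)"])
qed

lemma int_ring_simps [simp]:
 "monoid.mult (OE E) = monoid.mult F" "ring.add (OE E) = ring.add F"
 "monoid.one (OE E) = monoid.one F" "ring.zero (OE E) = ring.zero F"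
 by (simp_all add: integral_closure_def)

lemma int_ring_eq: "OE E = F\<lparr>carrier := carrier (OE E)\<rparr>"
 by (simp add: integral_closure_def)

lemma int_subring:
 assumes E: "subring E F" shows "subring (carrier (OE E)) F"
proof -
 note m = int_ring_mem[OF subringE(1)[OF E]]
 have EF: "x \<in> E ==> x \<in> carrier F" for x using subringE(1)[OF E] by blast
 have I: "x \<in> carrier (OE E)" if "x \<in> E" "!!\<tau>. \<tau> \<in> Emb (carrier F) ==> 0 \<le> v (\<tau> x)" for x
  using that m by blast
 have D: "x \<in> E" "x \<in> carrier F" "\<tau> \<in> Emb (carrier F) ==> 0 \<le> v (\<tau> x)" if "x \<in> carrier (OE E)" for x \<tau>
  using that m EF by blast+
 show ?thesis
 proof (rule FF.subringI)
  show "carrier (OE E) \<subseteq> carrier F" using D(2) by blast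
  show "\<one>\<^sub>F \<in> carrier (OE E)" by (rule I[OF subringE(3)[OF E]]) (simp add: EmbD(4))
  fix x assume x: "x \<in> carrier (OE E)"
  show "\<ominus>\<^sub>F x \<in> carrier (OE E)"
   by (rule I[OF subringE(5)[OF E D(1)[OF x]]]) (simp add: EmbD(1,6) D(2,3)[OF x])
  fix y assume y: "y \<in> carrier (OE E)"
  note c = D(2)[OF x] D(2)[OF y]
  show "x \<otimes>\<^sub>F y \<in> carrier (OE E)"
   by (rule I[OF subringE(6)[OF E D(1)[OF x] D(1)[OF y]]]) (simp add: EmbD(1,3) c D(3)[OF x] D(3)[OF y] v_mult)
  show "x \<oplus>\<^sub>F y \<in> carrier (OE E)"
   by (rule I[OF subringE(7)[OF E D(1)[OF x] D(1)[OF y]]]) (simp add: EmbD(1,2) c D(3)[OF x] D(3)[OF y] v_add_ge)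
 qed
qed

abbreviation OF :: "'f ring" where "OF \<equiv> OE (carrier F)"

lemmas OF_mem = int_ring_mem[OF order_refl]
lemmas OF_subring = int_subring[OF subring_F]
lemmas OF_ops = subringE(2,3,5,6,7)[OF OF_subring]

lemma OF_closed: "b \<in> carrier OF ==> b \<in> carrier F"
 using subringE(1)[OF OF_subring] by blast

lemma OF_nat: "nat_in F m \<in> carrier OF"
 by (induction m) (auto intro: OF_ops)

lemma OF_pow: "b \<in> carrier OF ==> b [^]\<^sub>F (m::nat) \<in> carrier OF"
 by (induction m) (auto intro: OF_ops)

lemma j_Zp_OF: "z \<in> Zp K v ==> j z \<in> carrier OF"
proof -
 assume z: "z \<in> Zp K v"
 have "0 \<le> v (\<tau> (j z))" if "\<tau> \<in> Emb (carrier F)" for \<tau> using z EmbD(7)[OF that, of z] by (simp add: Zp_def)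
 thus ?thesis unfolding OF_mem using z j_closed by (auto simp: Zp_def)
qed

text \<open>An embedding \<theta> is supplied so that the condition on all embeddings is not empty;
  it rules out \<open>b = \<zero>\<^sub>F\<close>.\<close>

lemma int_ring_units:
 assumes E: "subfield E F" and b: "b \<in> carrier (OE E)" and s: "\<theta> \<in> Emb (carrier F)"
 shows "b \<in> Units (OE E) \<longleftrightarrow> (\<forall>\<tau>\<in>Emb (carrier F). v (\<tau> b) = 0)"
proof
 note sE = subfieldE(1)[OF E]
 note m = int_ring_mem[OF subringE(1)[OF sE]]
 have EF: "x \<in> E ==> x \<in> carrier F" for x using subringE(1)[OF sE] by blast
 have bE: "b \<in> E" "b \<in> carrier F" using b m EF by auto
 {
  assume "b \<in> Units (OE E)"
  then obtain c where c: "c \<in> carrier (OE E)" "b \<otimes>\<^sub>F c = \<one>\<^sub>F" unfolding Units_def by auto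
  have cF: "c \<in> carrier F" using c m EF by blast
  show "\<forall>\<tau>\<in>Emb (carrier F). v (\<tau> b) = 0"
  proof
   fix \<tau> assume t: "\<tau> \<in> Emb (carrier F)"
   have "\<tau> b \<otimes> \<tau> c = \<one>" using EmbD(3)[OF t bE(2) cF] c(2) EmbD(4)[OF t] by simp
   hence "v (\<tau> b) + v (\<tau> c) = 0" using v_mult[OF EmbD(1)[OF t bE(2)] EmbD(1)[OF t cF]] by simp
   moreover have "0 \<le> v (\<tau> b)" "0 \<le> v (\<tau> c)" using b c(1) t m by auto
   ultimately show "v (\<tau> b) = 0" by (cases "v (\<tau> b)"; cases "v (\<tau> c)") auto
  qed
 next
  assume vb: "\<forall>\<tau>\<in>Emb (carrier F). v (\<tau> b) = 0"
  have b0: "b \<noteq> \<zero>\<^sub>F"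
  proof
   assume "b = \<zero>\<^sub>F"
   thus False using vb s EmbD(5)[OF s] by force
  qed
  let ?c = "inv\<^bsub>F\<^esub> b"
  have i: "?c \<in> E" "b \<otimes>\<^sub>F ?c = \<one>\<^sub>F" using FF.subfield_m_inv[OF E, of b] bE b0 by auto
  have "0 \<le> v (\<tau> ?c)" if t: "\<tau> \<in> Emb (carrier F)" for \<tau>
  proof -
   have "\<tau> b \<otimes> \<tau> ?c = \<one>" using EmbD(3)[OF t bE(2) EF[OF i(1)]] i(2) EmbD(4)[OF t] by simp
   thus ?thesis using v_mult[OF EmbD(1)[OF t bE(2)] EmbD(1)[OF t EF[OF i(1)]]] vb t by simp
  qed
  hence "?c \<in> carrier (OE E)" using i(1) m by blast
  thus "b \<in> Units (OE E)"
   unfolding Units_def using b i(2) FF.m_comm[OF bE(2) EF[OF i(1)]] by auto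
 }
qed

text \<open>There are finitely many embeddings, so one power of \<open>p\<close> makes all
  conjugates integral.\<close>

lemma clear_p_denominator:
 assumes b: "b \<in> carrier F"
 obtains m :: nat where "nat_in F (p ^ m) \<otimes>\<^sub>F b \<in> carrier OF"
proof -
 have fin: "finite (Emb (carrier F))" by (rule finite_emb[OF FF.carrier_is_subfield j_image])
 have "\<exists>m::nat. \<tau> \<in> Emb (carrier F) \<longrightarrow> 0 \<le> ereal (real m) + v (\<tau> b)" for \<tau>
  using v_lower[OF EmbD(1)[OF _ b]] by metis
 then obtain M :: "('f => 'k) => nat" where M: "!!\<tau>. \<tau> \<in> Emb (carrier F) ==> 0 \<le> ereal (real (M \<tau>)) + v (\<tau> b)"
  by metis
 define m where "m = Max (M ` Emb (carrier F))"
 have "nat_in F (p ^ m) \<otimes>\<^sub>F b \<in> carrier OF"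
  unfolding OF_mem
 proof (intro conjI ballI)
  fix \<tau> assume t: "\<tau> \<in> Emb (carrier F)"
  have "M \<tau> \<le> m" unfolding m_def using fin t by (intro Max_ge) auto
  hence "ereal (real (M \<tau>)) + v (\<tau> b) \<le> ereal (real m) + v (\<tau> b)" by (intro add_right_mono) simp
  hence "0 \<le> ereal (real m) + v (\<tau> b)" using M[OF t] order_trans by blast
  thus "0 \<le> v (\<tau> (nat_in F (p ^ m) \<otimes>\<^sub>F b))"
   using b EmbD(1,3)[OF t] emb_nat[OF t subring_F, of "p ^ m"]
   by (simp add: v_mult nat_in_pow v_pp_pow del: add.nat_pow_Suc)
 qed (use b in simp)
 thus thesis by (rule that)
qed

end

section \<open>Uniformisers and the valuation of the extension field\<close>

locale padic_uniformiser = padic_extension K v p F j d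
 for K :: "('k, 'm) ring_scheme" (structure) and v p and F :: "'f ring" and j d +
 fixes \<pi> :: 'f and e :: nat
 assumes uniformiser: "is_uniformiser K v F j \<pi>"
  and ramification: "ramification_index p K v F j \<pi> e"
begin

text \<open>A fixed embedding that transports the valuation to \<open>F\<close>; by
  \<open>v_emb_eq\<close> the valuations do not depend on the choice.\<close>

definition \<theta> :: "'f => 'k" where "\<theta> = (SOME \<tau>. \<tau> \<in> Emb (carrier F))"

lemma theta: "\<theta> \<in> Emb (carrier F)"
 unfolding \<theta>_def using Emb_nonempty some_in_eq by blast

lemma pi_OF: "\<pi> \<in> carrier OF"
 using uniformiser unfolding is_uniformiser_def Let_def by simp

lemma pi_F: "\<pi> \<in> carrier F"
 by (rule OF_closed[OF pi_OF])

lemma nonunits_OF: "nonunits OF = {x \<otimes>\<^sub>F \<pi> | x. x \<in> carrier OF}"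
 using uniformiser unfolding is_uniformiser_def Let_def cgenideal_def by simp

text \<open>The two ideals being equal, \<open>p\<close> and the e-th power of \<open>\<pi>\<close>
  divide each other among the integers, and every embedding gives them the same valuation 1. An
  exponent 0 would give valuation 0.\<close>

lemma v_pi:
 assumes t: "\<tau> \<in> Emb (carrier F)" shows "v (\<tau> \<pi>) = ereal (1 / real e)" "e > 0"
proof -
 let ?P = "\<pi> [^]\<^sub>F e"
 have PO: "?P \<in> carrier OF" by (rule OF_pow[OF pi_OF])
 have id: "{x \<otimes>\<^sub>F nat_in F p | x. x \<in> carrier OF} = {x \<otimes>\<^sub>F ?P | x. x \<in> carrier OF}"
  using ramification unfolding ramification_index_def Let_def cgenideal_def by simp
 have "nat_in F p = \<one>\<^sub>F \<otimes>\<^sub>F nat_in F p" "?P = \<one>\<^sub>F \<otimes>\<^sub>F ?P" using pi_F by auto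
 hence "nat_in F p \<in> {x \<otimes>\<^sub>F ?P | x. x \<in> carrier OF}" "?P \<in> {x \<otimes>\<^sub>F nat_in F p | x. x \<in> carrier OF}"
  using OF_ops(2) unfolding id[symmetric] by blast (use id OF_ops(2) \<open>?P = \<one>\<^sub>F \<otimes>\<^sub>F ?P\<close> in blast)
 then obtain x y where x: "x \<in> carrier OF" "nat_in F p = x \<otimes>\<^sub>F ?P" and y: "y \<in> carrier OF" "?P = y \<otimes>\<^sub>F nat_in F p"
  by blast
 have vx: "0 \<le> v (\<tau> x)" "0 \<le> v (\<tau> y)" "0 \<le> v (\<tau> \<pi>)" using x y pi_OF t OF_mem by auto
 have P: "\<tau> ?P = \<tau> \<pi> [^] e" using emb_pow[OF t subring_F pi_F] by simp
 have vP: "v (\<tau> ?P) = ereal (real e) * v (\<tau> \<pi>)"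
  unfolding P using v_pow[OF EmbD(1)[OF t pi_F], of e] by simp
 have "\<tau> (nat_in F p) = pp" using emb_nat[OF t subring_F] by simp
 hence "pp = \<tau> x \<otimes> \<tau> ?P" "\<tau> ?P = \<tau> y \<otimes> pp"
  using x(2) y(2) EmbD(3)[OF t] OF_closed[OF x(1)] OF_closed[OF y(1)] OF_closed[OF PO] OF_closed[OF OF_nat]
  by metis+
 hence "1 = v (\<tau> x) + v (\<tau> ?P)" "v (\<tau> ?P) = v (\<tau> y) + 1"
  using v_mult v_p EmbD(1)[OF t] OF_closed x(1) y(1) PO nat_in_closed by metis+
 hence "v (\<tau> ?P) = 1"
  using vx by (cases "v (\<tau> x)"; cases "v (\<tau> y)"; cases "v (\<tau> ?P)") (auto simp: one_ereal_def)
 hence *: "ereal (real e) * v (\<tau> \<pi>) = 1" using vP by simp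
 show "e > 0" using * by (cases e) (auto simp: zero_ereal_def[symmetric])
 thus "v (\<tau> \<pi>) = ereal (1 / real e)" using * by (cases "v (\<tau> \<pi>)") (auto simp: field_simps one_ereal_def)
qed

lemmas e_pos = v_pi(2)[OF theta]

lemma OF_nonunit:
 assumes x: "x \<in> carrier OF" "x \<notin> Units OF"
 obtains y where "y \<in> carrier OF" "x = y \<otimes>\<^sub>F \<pi>"
proof -
 have "x \<in> nonunits OF" using x by (simp add: nonunits_def)
 thus thesis using that unfolding nonunits_OF by blast
qed

text \<open>A nonunit is divisible by \<open>\<pi>\<close>, and division lowers the valuation by
  1/e. The induction runs over an upper bound n/e of the valuation.\<close>

lemma OF_factor:
 assumes x: "x \<in> carrier OF" "x \<noteq> \<zero>\<^sub>F"
 obtains k :: nat and u where "u \<in> Units OF" "x = u \<otimes>\<^sub>F \<pi> [^]\<^sub>F k"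
proof -
 have *: "x \<in> carrier OF ==> x \<noteq> \<zero>\<^sub>F ==> v (\<theta> x) \<le> ereal (real n / real e) ==>
   \<exists>u k. u \<in> Units OF \<and> x = u \<otimes>\<^sub>F \<pi> [^]\<^sub>F (k::nat)" for n x
 proof (induction n arbitrary: x)
  case 0
  note xF = OF_closed[OF 0(1)]
  show ?case
  proof (cases "x \<in> Units OF")
   case True thus ?thesis using xF by (intro exI[of _ x] exI[of _ 0]) simp
  next
   case False
   then obtain y where y: "y \<in> carrier OF" "x = y \<otimes>\<^sub>F \<pi>" using OF_nonunit[OF 0(1)] by blast
   have "v (\<theta> x) = v (\<theta> y) + ereal (1 / real e)"
    using y(2) EmbD(1,3)[OF theta] OF_closed[OF y(1)] pi_F by (simp add: v_mult v_pi[OF theta])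
   moreover have "0 \<le> v (\<theta> y)" using y OF_mem theta by blast
   moreover have "0 < 1 / real e" using e_pos by simp
   ultimately have False using 0(3) by (cases "v (\<theta> y)") (simp_all del: zero_less_divide_1_iff)
   thus ?thesis ..
  qed
 next
  case (Suc n)
  note xF = OF_closed[OF Suc.prems(1)]
  show ?case
  proof (cases "x \<in> Units OF")
   case True thus ?thesis using xF by (intro exI[of _ x] exI[of _ 0]) simp
  next
   case False
   then obtain y where y: "y \<in> carrier OF" "x = y \<otimes>\<^sub>F \<pi>" using OF_nonunit[OF Suc.prems(1)] by blast
   note yF = OF_closed[OF y(1)]
   have "v (\<theta> x) = v (\<theta> y) + ereal (1 / real e)"
    using y(2) EmbD(1,3)[OF theta] yF pi_F by (simp add: v_mult v_pi[OF theta])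
   hence "v (\<theta> y) \<le> ereal (real n / real e)"
    using Suc.prems(3) by (cases "v (\<theta> y)") (auto simp: add_divide_distrib)
   moreover have "y \<noteq> \<zero>\<^sub>F" using y Suc.prems(2) pi_F by auto
   ultimately obtain u k where u: "u \<in> Units OF" "y = u \<otimes>\<^sub>F \<pi> [^]\<^sub>F (k::nat)"
    using Suc.IH[OF y(1)] by blast
   have "u \<in> carrier F" using u(1) OF_closed by (auto simp: Units_def)
   hence "x = u \<otimes>\<^sub>F \<pi> [^]\<^sub>F Suc k" using y(2) u(2) pi_F by (simp add: FF.m_assoc)
   thus ?thesis using u(1) by blast
  qed
 qed
 obtain n :: nat where "rv (\<theta> x) * real e \<le> real n" using real_arch_simple by blast
 moreover have "\<theta> x \<noteq> \<zero>"
  using emb_inj[OF theta FF.carrier_is_subfield OF_closed[OF x(1)]] x(2) by blast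
 hence "v (\<theta> x) = ereal (rv (\<theta> x))" by (rule v_rv[OF EmbD(1)[OF theta OF_closed[OF x(1)]]])
 ultimately have "v (\<theta> x) \<le> ereal (real n / real e)"
  using e_pos by (simp only: ereal_less_eq) (simp add: pos_le_divide_eq)
 with * show thesis using x that by blast
qed

text \<open>Uniqueness of the extended valuation, read off from the factorisation: units have
  valuation 0 under every embedding, and \<open>\<pi>\<close> has valuation 1/e.\<close>

lemma v_emb_eq:
 assumes t: "\<tau> \<in> Emb (carrier F)" and x: "x \<in> carrier F" shows "v (\<tau> x) = v (\<theta> x)"
proof -
 have int: "v (\<tau> y) = v (\<theta> y)" if y: "y \<in> carrier OF" for y
 proof (cases "y = \<zero>\<^sub>F")
  case True thus ?thesis by (simp add: EmbD(5)[OF t] EmbD(5)[OF theta])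
 next
  case False
  then obtain k :: nat and u where u: "u \<in> Units OF" "y = u \<otimes>\<^sub>F \<pi> [^]\<^sub>F k" by (rule OF_factor[OF y])
  have uO: "u \<in> carrier OF" using u(1) by (simp add: Units_def)
  note uF = OF_closed[OF uO]
  have "v (\<tau>' y) = ereal (real k) * ereal (1 / real e)" if t': "\<tau>' \<in> Emb (carrier F)" for \<tau>'
   using u(2) EmbD(1,3)[OF t'] uF pi_F emb_pow[OF t' subring_F pi_F, of k] v_pow[of "\<tau>' \<pi>" k] v_pi(1)[OF t']
    int_ring_units[OF FF.carrier_is_subfield uO theta] u(1) t'
   by (simp add: v_mult)
  thus ?thesis using t theta by simp
 qed
 obtain m where m: "nat_in F (p ^ m) \<otimes>\<^sub>F x \<in> carrier OF" using clear_p_denominator[OF x] .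
 have "v (\<tau>' (nat_in F (p ^ m) \<otimes>\<^sub>F x)) = ereal (real m) + v (\<tau>' x)" if t': "\<tau>' \<in> Emb (carrier F)" for \<tau>'
  using x EmbD(1,3)[OF t'] emb_nat[OF t' subring_F, of "p ^ m"]
  by (simp add: v_mult nat_in_pow v_pp_pow del: add.nat_pow_Suc)
 hence "ereal (real m) + v (\<tau> x) = ereal (real m) + v (\<theta> x)" using int[OF m] t theta by simp
 thus ?thesis by (cases "v (\<tau> x)"; cases "v (\<theta> x)") auto
qed

lemma OF_iff: "x \<in> carrier OF \<longleftrightarrow> x \<in> carrier F \<and> 0 \<le> v (\<theta> x)"
proof -
 have "(\<forall>\<tau>\<in>Emb (carrier F). 0 \<le> v (\<tau> x)) \<longleftrightarrow> 0 \<le> v (\<theta> x)" if "x \<in> carrier F"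
 proof
  assume "0 \<le> v (\<theta> x)"
  show "\<forall>\<tau>\<in>Emb (carrier F). 0 \<le> v (\<tau> x)"
  proof
   fix \<tau> assume "\<tau> \<in> Emb (carrier F)"
   from v_emb_eq[OF this \<open>x \<in> carrier F\<close>] \<open>0 \<le> v (\<theta> x)\<close> show "0 \<le> v (\<tau> x)" by simp
  qed
 qed (rule bspec[OF _ theta])
 thus ?thesis unfolding OF_mem by blast
qed

lemma OF_div_pi:
 assumes x: "x \<in> carrier F" "0 < v (\<theta> x)"
 obtains y where "y \<in> carrier OF" "x = y \<otimes>\<^sub>F \<pi>"
proof (rule OF_nonunit)
 show xO: "x \<in> carrier OF" using x OF_iff[of x] by simp
 show "x \<notin> Units OF"
 proof
  assume "x \<in> Units OF"
  hence "v (\<theta> x) = 0" using int_ring_units[OF FF.carrier_is_subfield xO theta] theta by blast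
  thus False using x(2) by simp
 qed
qed (rule that)

lemma OF_unit_iff:
 assumes x: "x \<in> carrier OF" shows "x \<in> Units OF \<longleftrightarrow> v (\<theta> x) = 0"
proof
 assume "v (\<theta> x) = 0"
 hence "v (\<tau> x) = 0" if "\<tau> \<in> Emb (carrier F)" for \<tau>
  using v_emb_eq[OF that OF_closed[OF x]] by simp
 thus "x \<in> Units OF" using int_ring_units[OF FF.carrier_is_subfield x theta] by blast
qed (use int_ring_units[OF FF.carrier_is_subfield x theta] theta in blast)

lemma nonunits_OF_iff: "x \<in> nonunits OF \<longleftrightarrow> x \<in> carrier F \<and> 0 < v (\<theta> x)"
proof
 assume "x \<in> nonunits OF"
 hence x: "x \<in> carrier OF" "x \<notin> Units OF" unfolding nonunits_def by blast+
 have "v (\<theta> x) \<noteq> 0" "0 \<le> v (\<theta> x)" using x(2) OF_unit_iff[OF x(1)] iffD1[OF OF_iff x(1)] by blast+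
 hence "0 < v (\<theta> x)" by simp
 thus "x \<in> carrier F \<and> 0 < v (\<theta> x)" using OF_closed[OF x(1)] by blast
next
 assume x: "x \<in> carrier F \<and> 0 < v (\<theta> x)"
 hence "x \<in> carrier F \<and> 0 \<le> v (\<theta> x)" using less_imp_le by blast
 hence xO: "x \<in> carrier OF" by (rule iffD2[OF OF_iff])
 moreover have "v (\<theta> x) \<noteq> 0" using x by force
 hence "x \<notin> Units OF" using OF_unit_iff[OF xO] by blast
 ultimately show "x \<in> nonunits OF" unfolding nonunits_def by blast
qed

end

section \<open>The residue field and lifts of its basis\<close>

context ring
begin

lemma combine_map_add:
 "(!!l. l \<in> set ls ==> a l \<in> carrier R \<and> b l \<in> carrier R \<and> u l \<in> carrier R) ==>
  combine (map (\<lambda>l. a l \<oplus> b l) ls) (map u ls) = combine (map a ls) (map u ls) \<oplus> combine (map b ls) (map u ls)"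
proof (induction ls)
 case (Cons l ls)
 have "combine (map a ls) (map u ls) \<in> carrier R" "combine (map b ls) (map u ls) \<in> carrier R"
  using Cons.prems by (auto intro!: combine_in_carrier)
 thus ?case using Cons by (simp add: l_distr a_ac)
qed simp

lemma combine_map_mult:
 "set Ks \<subseteq> carrier R ==> set Us \<subseteq> carrier R ==> x \<in> carrier R ==>
  (!!k. k \<in> set Ks ==> k \<otimes> x = x \<otimes> k) ==> combine Ks (map (\<lambda>u. x \<otimes> u) Us) = x \<otimes> combine Ks Us"
proof (induction Ks Us rule: combine.induct)
 case (1 k Ks u Us)
 have "k \<otimes> (x \<otimes> u) = x \<otimes> (k \<otimes> u)" using 1 by (simp add: m_assoc[symmetric])
 thus ?case using 1 by (simp add: r_distr)
qed auto

lemma combine_subset: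
 assumes S: "subring S R" shows "set Ks \<subseteq> S ==> set Us \<subseteq> S ==> combine Ks Us \<in> S"
 by (induction Ks Us rule: combine.induct) (auto intro: subringE(2,6,7)[OF S])

end

lemma (in valued_field) v_combine_ge:
 assumes "0 \<le> r" "set us \<subseteq> vint" "set zs \<subseteq> carrier K" "!!z. z \<in> set zs ==> r \<le> v z"
 shows "r \<le> v (combine zs us)"
 using assms(2-4)
proof (induction zs us rule: combine.induct)
 case (1 z zs u us)
 have "r \<le> v (z \<otimes> u)" using 1(2-4) add_mono[of r "v z" 0 "v u"] by (simp add: v_mult)
 moreover have "combine zs us \<in> carrier K" using 1(2,3) by (intro combine_in_carrier) auto
 ultimately show ?case using 1 by (simp add: v_add_ge)
qed simp_all

context padic_uniformiser
begin

lemma OF_domain: "domain OF"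
 using FF.subring_is_domain[OF OF_subring] int_ring_eq[of "carrier F"] by simp

lemma theta_hom: "ring_hom_ring OF K \<theta>"
proof (rule ring_hom_ringI2[OF _ ring_axioms])
 show "ring OF" using OF_domain by (simp add: domain_def cring_def)
 show "\<theta> \<in> ring_hom OF K"
  by (rule ring_hom_memI) (use EmbD(1-4)[OF theta] OF_closed in auto)
qed

text \<open>The basis of the residue field of \<open>F\<close> over the prime field is lifted to \<open>OF\<close> and embedded
 in \<open>K\<close>.\<close>

lemma residue_basis:
 assumes "inertia_degree K v F j f"
 obtains us and q :: nat where "length us = f" "set us \<subseteq> \<theta> ` carrier OF"
  "!!x. x \<in> \<theta> ` carrier OF ==> \<exists>zs. length zs = f \<and> set zs \<subseteq> Zp K v \<and> 0 < v (x \<ominus> combine zs us)"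
  "!!zs. length zs = f ==> set zs \<subseteq> Zp K v ==> 0 < v (combine zs us) ==> \<forall>z\<in>set zs. 0 < v z"
  "p dvd q" "0 < q" "!!b. b \<in> carrier OF ==> 0 < v (\<theta> b [^] q \<ominus> \<theta> b)"
proof -
 interpret B: domain OF by (rule OF_domain)
 interpret T: ring_hom_ring OF K \<theta> by (rule theta_hom)
 let ?m = "nonunits OF"
 have "?m = PIdl\<^bsub>OF\<^esub> \<pi>" using uniformiser unfolding is_uniformiser_def Let_def by simp
 hence "ideal ?m OF" using B.cgenideal_ideal[OF pi_OF] by simp
 then interpret m: ideal ?m OF .
 define Q where "Q = OF Quot ?m"
 define h where "h = (\<lambda>z. ?m +>\<^bsub>OF\<^esub> z)"
 interpret Q: cring Q unfolding Q_def by (rule m.quotient_is_cring[OF B.is_cring])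
 interpret H: ring_hom_ring OF Q h unfolding Q_def h_def by (rule m.rcos_ring_hom_ring)
 have h0: "h x = \<zero>\<^sub>Q \<longleftrightarrow> 0 < v (\<theta> x)" if x: "x \<in> carrier OF" for x
 proof -
  have "h x = \<zero>\<^sub>Q \<longleftrightarrow> x \<in> ?m"
   unfolding h_def Q_def FactRing_def
   using B.a_coset_join1[OF _ x m.a_subgroup] B.a_coset_join2[OF x m.a_subgroup] by auto
  thus ?thesis using nonunits_OF_iff[of x] OF_closed[OF x] by blast
 qed
 define Kb where "Kb = h ` (j ` Zp K v)"
 have dim: "Q.dimension f Kb (carrier Q)"
  using assms unfolding inertia_degree_def Let_def Q_def Kb_def h_def .
 have jZ: "j ` Zp K v \<subseteq> carrier OF" using j_Zp_OF by blast
 have th_j: "\<theta> (j z) = z" if "z \<in> Zp K v" for z using EmbD(7)[OF theta Zp_Qp[OF that]] .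
 have one: "\<one>\<^sub>Q \<noteq> \<zero>\<^sub>Q" using h0[OF B.one_closed] T.hom_one by (simp add: H.hom_one[symmetric] del: H.hom_one)
 \<comment> \<open>The image of the p-adic integers is the ring of integers in the image of the
   p-adic numbers; this makes it a subring of \<open>OF\<close>.\<close>
 have "(\<forall>\<tau>\<in>Emb (carrier F). 0 \<le> v (\<tau> (j z))) \<longleftrightarrow> 0 \<le> v z" if "z \<in> Qp K v" for z
  by (metis EmbD(7) theta that)
 hence "x \<in> j ` Zp K v \<longleftrightarrow> x \<in> carrier (OE (j ` Qp K v))" for x
  unfolding int_ring_mem[OF j_image] by (auto simp: Zp_def)
 hence "j ` Zp K v = carrier (OE (j ` Qp K v))" by blast
 hence "ring (F\<lparr>carrier := j ` Zp K v\<rparr>)"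
  using FF.subring_is_ring[OF int_subring[OF subfieldE(1)[OF jQp_subfield]]] by simp
 hence sub: "subring (j ` Zp K v) OF"
  using B.ring_incl_imp_subring[OF jZ] by (simp add: integral_closure_def)
 have cQ: "carrier Q = h ` carrier OF" unfolding Q_def h_def FactRing_def by (auto simp: A_RCOSETS_def')
 interpret Q: field Q
 proof (rule Q.field_intro2)
  show "\<zero>\<^sub>Q \<noteq> \<one>\<^sub>Q" using one by simp
  fix k assume k: "k \<in> carrier Q - {\<zero>\<^sub>Q}"
  then obtain x where x: "x \<in> carrier OF" "k = h x" unfolding cQ by blast
  have "\<not> 0 < v (\<theta> x)" using h0[OF x(1)] k x(2) by blast
  moreover have "0 \<le> v (\<theta> x)" using iffD1[OF OF_iff x(1)] by blast
  ultimately have "v (\<theta> x) = 0" by simp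
  hence "x \<in> Units OF" using OF_unit_iff[OF x(1)] by blast
  then obtain y where y: "y \<in> carrier OF" "x \<otimes>\<^sub>OF y = \<one>\<^sub>OF" unfolding Units_def by blast
  hence "k \<otimes>\<^sub>Q h y = \<one>\<^sub>Q" using H.hom_mult[OF x(1) y(1)] x(2) by (simp only: H.hom_one)
  moreover from this have "h y \<otimes>\<^sub>Q k = \<one>\<^sub>Q" using Q.m_comm[of "h y" k] k H.hom_closed[OF y(1)] by simp
  ultimately show "k \<in> Units Q" unfolding Units_def using k H.hom_closed[OF y(1)] by blast
 qed
 have Kb: "subfield Kb Q"
 proof (rule Q.subfieldI'[OF H.img_is_subring[OF sub, folded Kb_def]])
  fix k assume k: "k \<in> Kb - {\<zero>\<^sub>Q}"
  then obtain z where z: "z \<in> Zp K v" "k = h (j z)" unfolding Kb_def by blast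
  have "\<not> 0 < v z" using h0[OF j_Zp_OF[OF z(1)]] th_j[OF z(1)] k z(2) by simp
  hence vz: "v z = 0" using Zp_v[OF z(1)] by simp
  note iz = Zp_unit_inv[OF z(1) vz]
  have "z \<noteq> \<zero>" using vz by auto
  hence "z \<otimes> inv z = \<one>" using inv_nonzero[OF Zp_carrier[OF z(1)]] by simp
  hence "j z \<otimes>\<^sub>OF j (inv z) = \<one>\<^sub>OF" using j_mult[OF Zp_Qp[OF z(1)] Zp_Qp[OF iz]] j_one by simp
  hence "h (j z) \<otimes>\<^sub>Q h (j (inv z)) = \<one>\<^sub>Q"
   using H.hom_mult[OF j_Zp_OF[OF z(1)] j_Zp_OF[OF iz]] H.hom_one by simp
  hence "inv\<^bsub>Q\<^esub> k = h (j (inv z))"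
   unfolding z(2) by (rule Q.comm_inv_char[OF H.hom_closed[OF j_Zp_OF[OF z(1)]] H.hom_closed[OF j_Zp_OF[OF iz]]])
  thus "inv\<^bsub>Q\<^esub> k \<in> Kb" using iz unfolding Kb_def by blast
 qed
 obtain Vs where Vs: "set Vs \<subseteq> carrier Q" "Q.independent Kb Vs" "length Vs = f" "Q.Span Kb Vs = carrier Q"
  using Q.exists_base[OF Kb dim] by blast
 have "Vs \<in> lists (h ` carrier OF)" using Vs(1) unfolding cQ by (simp add: in_lists_conv_set subset_iff)
 then obtain us where "us \<in> lists (carrier OF)" and hus: "Vs = map h us" unfolding lists_image by (rule imageE)
 hence us: "set us \<subseteq> carrier OF" by (simp add: in_lists_conv_set subset_iff)
 have comb: "set (map j zs) \<subseteq> carrier OF" "B.combine (map j zs) us \<in> carrier OF"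
   "\<theta> (B.combine (map j zs) us) = combine zs (map \<theta> us)"
   "h (B.combine (map j zs) us) = Q.combine (map (\<lambda>z. h (j z)) zs) Vs"
  if zs: "set zs \<subseteq> Zp K v" for zs
 proof -
  show 1: "set (map j zs) \<subseteq> carrier OF" using zs j_Zp_OF by auto
  thus "B.combine (map j zs) us \<in> carrier OF" by (rule B.combine_in_carrier[OF _ us])
  have "map \<theta> (map j zs) = zs" using zs th_j by (simp add: map_idI subset_iff)
  thus "\<theta> (B.combine (map j zs) us) = combine zs (map \<theta> us)" using T.combine_hom[OF 1 us] by simp
  show "h (B.combine (map j zs) us) = Q.combine (map (\<lambda>z. h (j z)) zs) Vs"
   using H.combine_hom[OF 1 us] hus by (simp add: o_def)
 qed
 have Kb_closed: "Kb \<subseteq> carrier Q" by (rule subfieldE(3)[OF Kb])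
 \<comment> \<open>The prime field consists of the classes of 0, ..., p - 1, as a p-adic integer is
   congruent to a natural number modulo \<open>p\<close>. The residue field, finite-dimensional over
   it, is therefore finite.\<close>
 have "Kb \<subseteq> (\<lambda>m. h (j (nat_in K m))) ` {..<p}"
 proof
  fix k assume "k \<in> Kb"
  then obtain z where z: "z \<in> Zp K v" "k = h (j z)" unfolding Kb_def by blast
  obtain m where m: "ereal (real 1) \<le> v (z \<ominus> nat_in K m)" using Zp_approx[OF z(1)] .
  have cancel: "(a \<oplus> b) \<ominus> a = b" if "a \<in> carrier K" "b \<in> carrier K" for a b using that by algebra
  have eq: "nat_in K m = nat_in K (m mod p) \<oplus> pp \<otimes> nat_in K (m div p)"
   by (metis nat_in_add nat_in_mult mod_mult_div_eq)
  have e: "nat_in K m \<ominus> nat_in K (m mod p) = pp \<otimes> nat_in K (m div p)"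
   by (subst eq) (rule cancel[OF nat_in_closed m_closed[OF nat_in_closed nat_in_closed]])
  have "1 \<le> v (nat_in K m \<ominus> nat_in K (m mod p))"
   unfolding e using v_mult_ge[of pp "nat_in K (m div p)" 1] v_p v_nat_in by simp
  hence "1 \<le> v (z \<ominus> nat_in K (m mod p))"
   using v_diff_trans[OF Zp_carrier[OF z(1)] nat_in_closed nat_in_closed, of 1] m by (simp add: one_ereal_def)
  hence pos: "0 < v (z \<ominus> nat_in K (m mod p))" using less_le_trans[of 0 "1::ereal"] by simp
  let ?n = "nat_in K (m mod p)"
  have zO: "j z \<in> carrier OF" and nO: "j ?n \<in> carrier OF" using j_Zp_OF[OF z(1)] j_Zp_OF[OF nat_in_Zp] .
  have "\<theta> (j z \<ominus>\<^sub>OF j ?n) = z \<ominus> ?n"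
   using zO nO th_j[OF z(1)] th_j[OF nat_in_Zp] by (simp add: a_minus_def del: int_ring_simps add.nat_pow_Suc)
  hence "h (j z \<ominus>\<^sub>OF j ?n) = \<zero>\<^sub>Q" using h0[of "j z \<ominus>\<^sub>OF j ?n"] zO nO pos by simp
  hence "h (j z) \<ominus>\<^sub>Q h (j ?n) = \<zero>\<^sub>Q" using zO nO by (simp add: a_minus_def del: int_ring_simps)
  hence hz: "h (j z) = h (j ?n)" using Q.r_right_minus_eq H.hom_closed[OF zO] H.hom_closed[OF nO] by blast
  have "m mod p \<in> {..<p}" using prime_gt_0_nat[OF prime_p] by simp
  thus "k \<in> (\<lambda>m. h (j (nat_in K m))) ` {..<p}" unfolding z(2) hz by (rule imageI)
 qed
 hence finKb: "finite Kb" by (rule finite_subset) simp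
 have "carrier Q \<subseteq> (\<lambda>Ks. Q.combine Ks Vs) ` {Ks. set Ks \<subseteq> Kb \<and> length Ks = f}"
  unfolding Vs(4)[symmetric] Q.Span_eq_combine_set_length_version[OF Kb Vs(1)] using Vs(3) by blast
 hence finQ: "finite (carrier Q)" by (rule finite_subset) (simp add: finite_lists_length_eq[OF finKb])
 \<comment> \<open>The order of the residue field. As a scalar it vanishes there, so
   \<open>p\<close> divides it; and x^q = x in a field with \<open>q\<close> elements, which is the
   source of the Frobenius congruence.\<close>
 define q where "q = card (carrier Q)"
 have q0: "0 < q" unfolding q_def card_gt_0_iff using finQ Q.zero_closed by blast
 have "[q] \<cdot>\<^sub>Q \<one>\<^sub>Q = \<zero>\<^sub>Q"
  using group.pow_order_eq_1[OF Q.add.is_group, of "\<one>\<^sub>Q"] unfolding q_def order_def add_pow_def by simp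
 moreover have nat: "h (nat_in OF m) = nat_in Q m \<and> nat_in OF m \<in> carrier OF \<and> \<theta> (nat_in OF m) = nat_in K m" for m
  by (induction m) (simp_all del: int_ring_simps)
 ultimately have "0 < v (nat_in K q)" using h0[of "nat_in OF q"] nat[of q] by simp
 hence pq: "p dvd q" by (rule p_dvd_of_v_pos)
 have frob: "x [^]\<^sub>Q q = x" if x: "x \<in> carrier Q" for x
 proof (cases "x = \<zero>\<^sub>Q")
  case True thus ?thesis using q0 Q.nat_pow_zero[of q] by simp
 next
  case False
  hence u: "x \<in> Units Q" using x Q.field_Units by blast
  have "x [^]\<^sub>Q card (Units Q) = \<one>\<^sub>Q"
   using Q.units_power_order_eq_one[of x] finite_subset[OF _ finQ, of "Units Q"] Q.field_Units u by blast
  moreover have "q = Suc (card (Units Q))"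
   unfolding q_def Q.field_Units using card.remove[OF finQ Q.zero_closed] by simp
  ultimately show ?thesis using x by simp
 qed
 show thesis
 proof (rule that[of "map \<theta> us" q])
  show "p dvd q" "0 < q" by fact+
  fix b assume b: "b \<in> carrier OF"
  have "h (b [^]\<^sub>OF q \<ominus>\<^sub>OF b) = h b [^]\<^sub>Q q \<ominus>\<^sub>Q h b"
   using b H.hom_nat_pow[OF b, of q] by (simp add: a_minus_def del: int_ring_simps)
  also have "\<dots> = \<zero>\<^sub>Q" unfolding frob[OF H.hom_closed[OF b]] using H.hom_closed[OF b] by (simp add: Q.r_neg a_minus_def)
  finally have "0 < v (\<theta> (b [^]\<^sub>OF q \<ominus>\<^sub>OF b))" using h0[of "b [^]\<^sub>OF q \<ominus>\<^sub>OF b"] b by simp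
  moreover have "\<theta> (b [^]\<^sub>OF q \<ominus>\<^sub>OF b) = \<theta> b [^] q \<ominus> \<theta> b"
   using b T.hom_nat_pow[OF b, of q] by (simp add: a_minus_def del: int_ring_simps)
  ultimately show "0 < v (\<theta> b [^] q \<ominus> \<theta> b)" by simp
 next
  show "length (map \<theta> us) = f" using Vs(3) hus by simp
  show "set (map \<theta> us) \<subseteq> \<theta> ` carrier OF" using us by auto
 next
  fix x assume "x \<in> \<theta> ` carrier OF"
  then obtain b where b: "b \<in> carrier OF" "x = \<theta> b" by blast
  have "h b \<in> Q.Span Kb Vs" using b(1) Vs(4) by simp
  then obtain Ks where Ks: "length Ks = f" "set Ks \<subseteq> Kb" "h b = Q.combine Ks Vs"
   unfolding Q.Span_eq_combine_set_length_version[OF Kb Vs(1)] using Vs(3) by auto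
  have "Ks \<in> lists ((\<lambda>z. h (j z)) ` Zp K v)"
   using Ks(2) unfolding Kb_def image_image by (simp add: in_lists_conv_set subset_iff)
  then obtain zs where "zs \<in> lists (Zp K v)" and zs1: "Ks = map (\<lambda>z. h (j z)) zs" unfolding lists_image by (rule imageE)
  hence zs: "set zs \<subseteq> Zp K v" by (simp add: in_lists_conv_set subset_iff)
  let ?c = "B.combine (map j zs) us"
  have "h (b \<ominus>\<^sub>OF ?c) = h b \<ominus>\<^sub>Q h ?c" using b(1) comb(2)[OF zs] by (simp add: a_minus_def del: int_ring_simps)
  also have "\<dots> = \<zero>\<^sub>Q"
   using Ks(3) comb(4)[OF zs] zs1 H.hom_closed[OF b(1)] by (simp add: Q.r_neg a_minus_def)
  finally have "0 < v (\<theta> (b \<ominus>\<^sub>OF ?c))" using h0[of "b \<ominus>\<^sub>OF ?c"] b(1) comb(2)[OF zs] by simp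
  moreover have "\<theta> (b \<ominus>\<^sub>OF ?c) = x \<ominus> combine zs (map \<theta> us)"
   using b comb(2,3)[OF zs] by (simp add: a_minus_def del: int_ring_simps)
  ultimately show "\<exists>zs. length zs = f \<and> set zs \<subseteq> Zp K v \<and> 0 < v (x \<ominus> combine zs (map \<theta> us))"
   using zs Ks(1) zs1 by auto
 next
  fix zs assume zs: "length zs = f" "set zs \<subseteq> Zp K v" "0 < v (combine zs (map \<theta> us))"
  have "Q.combine (map (\<lambda>z. h (j z)) zs) Vs = \<zero>\<^sub>Q"
   using h0[OF comb(2)[OF zs(2)]] comb(3,4)[OF zs(2)] zs(3) by simp
  moreover have "set (map (\<lambda>z. h (j z)) zs) \<subseteq> Kb" using zs(2) unfolding Kb_def by auto
  ultimately have "set (take (length Vs) (map (\<lambda>z. h (j z)) zs)) \<subseteq> {\<zero>\<^sub>Q}"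
   using Q.independent_imp_trivial_combine[OF Kb Vs(2)] by blast
  hence *: "\<forall>z\<in>set zs. h (j z) = \<zero>\<^sub>Q" using zs(1) Vs(3) by auto
  show "\<forall>z\<in>set zs. 0 < v z"
  proof
   fix z assume "z \<in> set zs"
   hence "z \<in> Zp K v" "h (j z) = \<zero>\<^sub>Q" using * zs(2) by auto
   thus "0 < v z" using h0[OF j_Zp_OF] th_j by fastforce
  qed
 qed
qed

end

section \<open>A basis over the p-adic numbers and the degree formula d = e f\<close>

context padic_uniformiser
begin

text \<open>The products of the members of \<open>us\<close> with the powers of
  \<open>\<theta> \<pi>\<close> of exponent below \<open>i\<close>. For i = e this becomes a basis
  of the embedded ring of integers over the p-adic integers.\<close>

primrec pow_basis :: "'k list => nat => 'k list" where
 "pow_basis us 0 = []"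
| "pow_basis us (Suc i) = us @ map (\<lambda>u. \<theta> \<pi> \<otimes> u) (pow_basis us i)"

lemma length_pow_basis: "length (pow_basis us i) = i * length us"
 by (induction i) auto

abbreviation TF :: "'k set" where "TF \<equiv> \<theta> ` carrier F"
abbreviation TO :: "'k set" where "TO \<equiv> \<theta> ` carrier OF"

lemma F_hom: "ring_hom_ring F K \<theta>"
proof (rule ring_hom_ringI2[OF FF.ring_axioms ring_axioms])
 show "\<theta> \<in> ring_hom F K" by (rule ring_hom_memI) (use EmbD(1-4)[OF theta] in auto)
qed

lemma TF_subfield: "subfield TF K"
proof (rule subfieldI')
 show "subring TF K" by (rule ring_hom_ring.img_is_subring[OF F_hom subring_F])
 fix k assume "k \<in> TF - {\<zero>}"
 then obtain b where b: "b \<in> carrier F" "k = \<theta> b" "k \<noteq> \<zero>" by blast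
 hence "b \<noteq> \<zero>\<^sub>F" using EmbD(5)[OF theta] by auto
 hence i: "inv\<^bsub>F\<^esub> b \<in> carrier F" "b \<otimes>\<^sub>F inv\<^bsub>F\<^esub> b = \<one>\<^sub>F"
  using FF.subfield_m_inv[OF FF.carrier_is_subfield, of b] b by auto
 have "k \<otimes> \<theta> (inv\<^bsub>F\<^esub> b) = \<one>" using EmbD(3)[OF theta b(1) i(1)] i(2) EmbD(4)[OF theta] b(2) by simp
 hence "inv k = \<theta> (inv\<^bsub>F\<^esub> b)"
  using comm_inv_char[of k "\<theta> (inv\<^bsub>F\<^esub> b)"] EmbD(1)[OF theta] b i by simp
 thus "inv k \<in> TF" using i(1) by blast
qed

lemma TF_closed: "x \<in> TF ==> x \<in> carrier K"
 using EmbD(1)[OF theta] by blast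

lemma TO_iff: "x \<in> TO \<longleftrightarrow> x \<in> TF \<and> 0 \<le> v x"
proof
 assume "x \<in> TO"
 then obtain b where "b \<in> carrier OF" "x = \<theta> b" by blast
 thus "x \<in> TF \<and> 0 \<le> v x" using iffD1[OF OF_iff] by blast
next
 assume "x \<in> TF \<and> 0 \<le> v x"
 then obtain b where "b \<in> carrier F" "x = \<theta> b" "0 \<le> v (\<theta> b)" by blast
 thus "x \<in> TO" using iffD2[OF OF_iff] by blast
qed

lemma TO_subring: "subring TO K"
proof -
 have "TO = TF \<inter> vint" using TO_iff TF_closed by blast
 thus ?thesis using subring_inter[OF subfieldE(1)[OF TF_subfield] subring_vint] by simp
qed

lemma Qp_TF: "Qp K v \<subseteq> TF"
proof
 fix x assume x: "x \<in> Qp K v"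
 have "\<theta> (j x) = x" by (rule EmbD(7)[OF theta x])
 thus "x \<in> TF" using j_closed[OF x] by (metis imageI)
qed

lemma TO_closed: "x \<in> TO ==> x \<in> carrier K" "x \<in> TO ==> 0 \<le> v x"
 using TO_iff[of x] TF_closed by blast+

lemma Zp_TO: "Zp K v \<subseteq> TO"
 using Qp_TF TO_iff unfolding Zp_def by blast

lemma P_TO: "\<theta> \<pi> \<in> TO"
 using pi_OF by blast

lemma TO_div_P:
 assumes "x \<in> TF" "0 < v x" obtains y where "y \<in> TO" "x = \<theta> \<pi> \<otimes> y"
proof -
 obtain b where b: "b \<in> carrier F" "x = \<theta> b" using assms(1) by blast
 obtain c where c: "c \<in> carrier OF" "b = c \<otimes>\<^sub>F \<pi>" using OF_div_pi[OF b(1)] assms(2) b(2) by blast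
 have "x = \<theta> \<pi> \<otimes> \<theta> c"
  using b(2) c(2) EmbD(3)[OF theta OF_closed[OF c(1)] pi_F] m_comm EmbD(1)[OF theta] OF_closed[OF c(1)] pi_F by simp
 thus thesis using that c(1) by blast
qed

lemma TO_div_pow:
 assumes "x \<in> TF" "ereal (real k) \<le> v x" obtains y where "y \<in> TO" "x = pp [^] k \<otimes> y"
proof -
 note i = pp_inv[of k]
 have y: "inv (pp [^] k) \<otimes> x \<in> TF" using assms(1) pp_inv_Qp[of k] Qp_TF subringE(6)[OF subfieldE(1)[OF TF_subfield]] by blast
 have x: "x = pp [^] k \<otimes> (inv (pp [^] k) \<otimes> x)" using i TF_closed[OF assms(1)] by (simp add: m_assoc[symmetric])
 have "v x = ereal (real k) + v (inv (pp [^] k) \<otimes> x)"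
  using x v_mult[of "pp [^] k" "inv (pp [^] k) \<otimes> x"] TF_closed[OF y] by (simp add: v_pp_pow)
 hence "0 \<le> v (inv (pp [^] k) \<otimes> x)" using assms(2) by (cases "v (inv (pp [^] k) \<otimes> x)") auto
 thus thesis using that y x TO_iff by blast
qed

context
 fixes us :: "'k list" and f :: nat
 assumes us: "length us = f" "set us \<subseteq> TO"
  and us_span: "!!x. x \<in> TO ==> \<exists>zs. length zs = f \<and> set zs \<subseteq> Zp K v \<and> 0 < v (x \<ominus> combine zs us)"
  and us_indep: "!!zs. length zs = f ==> set zs \<subseteq> Zp K v ==> 0 < v (combine zs us) ==> \<forall>z\<in>set zs. 0 < v z"
begin

lemma pow_basis_TO: "set (pow_basis us i) \<subseteq> TO"
 by (induction i) (use us subringE(6)[OF TO_subring P_TO] in auto)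

lemma comb_TO: "set zs \<subseteq> Zp K v ==> set vs \<subseteq> TO ==> combine zs vs \<in> TO"
 by (rule combine_subset[OF TO_subring]) (use Zp_TO in auto)

lemma pow_basis_combine:
 assumes "length zs = f" "set zs \<subseteq> carrier K" "set ws \<subseteq> carrier K"
 shows "combine (zs @ ws) (pow_basis us (Suc i)) = combine zs us \<oplus> \<theta> \<pi> \<otimes> combine ws (pow_basis us i)"
proof -
 let ?U = "pow_basis us i"
 have cl: "set us \<subseteq> carrier K" "set ?U \<subseteq> carrier K" "\<theta> \<pi> \<in> carrier K"
  using us(2) pow_basis_TO[of i] P_TO TO_closed(1) by blast+
 have m: "set (map (\<lambda>u. \<theta> \<pi> \<otimes> u) ?U) \<subseteq> carrier K" using cl(2,3) by auto
 have "k \<otimes> \<theta> \<pi> = \<theta> \<pi> \<otimes> k" if "k \<in> set ws" for k using m_comm[of k "\<theta> \<pi>"] that assms(3) cl(3) by blast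
 hence "combine ws (map (\<lambda>u. \<theta> \<pi> \<otimes> u) ?U) = \<theta> \<pi> \<otimes> combine ws ?U"
  by (rule combine_map_mult[OF assms(3) cl(2,3)])
 thus ?thesis using combine_append[OF _ assms(2) cl(1) assms(3) m] assms(1) us(1) by simp
qed

text \<open>Digits with respect to the uniformiser: subtract a combination of the \<open>us\<close>
  with the same residue, divide the difference by \<open>\<theta> \<pi>\<close>, and continue with
  the quotient.\<close>

lemma pow_basis_approx:
 assumes "x \<in> TO"
 shows "\<exists>zs y. length zs = i * f \<and> set zs \<subseteq> Zp K v \<and> y \<in> TO \<and>
  x = combine zs (pow_basis us i) \<oplus> \<theta> \<pi> [^] i \<otimes> y"
 using assms
proof (induction i arbitrary: x)
 case 0
 thus ?case using TO_closed by (intro exI[of _ "[]"] exI[of _ x]) auto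
next
 case (Suc i)
 let ?P = "\<theta> \<pi>" and ?U = "pow_basis us i"
 obtain zs where zs: "length zs = f" "set zs \<subseteq> Zp K v" "0 < v (x \<ominus> combine zs us)" using us_span[OF Suc.prems] by blast
 have c: "combine zs us \<in> TO" by (rule comb_TO[OF zs(2) us(2)])
 hence "x \<ominus> combine zs us \<in> TF"
  unfolding a_minus_def using Suc.prems subringE(5,7)[OF TO_subring] TO_iff by blast
 then obtain x1 where x1: "x1 \<in> TO" "x \<ominus> combine zs us = ?P \<otimes> x1" using TO_div_P zs(3) by blast
 obtain ws y where ws: "length ws = i * f" "set ws \<subseteq> Zp K v" "y \<in> TO"
  "x1 = combine ws ?U \<oplus> ?P [^] i \<otimes> y" using Suc.IH[OF x1(1)] by blast
 have cl: "set zs \<subseteq> carrier K" "set ws \<subseteq> carrier K" "set us \<subseteq> carrier K" "set ?U \<subseteq> carrier K" "?P \<in> carrier K"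
  "y \<in> carrier K" "combine ws ?U \<in> carrier K" "combine zs us \<in> carrier K" "x \<in> carrier K"
  using zs(2) ws(2,3) us(2) pow_basis_TO[of i] P_TO TO_closed(1) Zp_carrier comb_TO[OF ws(2) pow_basis_TO] c Suc.prems
  by (auto simp: subset_iff simp del: image_iff)
 have "x = combine zs us \<oplus> (x \<ominus> combine zs us)" using cl by algebra
 also have "\<dots> = (combine zs us \<oplus> ?P \<otimes> combine ws ?U) \<oplus> ?P [^] Suc i \<otimes> y"
  unfolding x1(2) ws(4) using cl by (simp add: r_distr a_assoc m_assoc m_comm[of ?P "?P [^] i"] m_lcomm)
 also have "combine zs us \<oplus> ?P \<otimes> combine ws ?U = combine (zs @ ws) (pow_basis us (Suc i))"
  by (rule pow_basis_combine[OF zs(1) cl(1,2), symmetric])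
 finally have "x = combine (zs @ ws) (pow_basis us (Suc i)) \<oplus> ?P [^] Suc i \<otimes> y" .
 thus ?case using zs(1,2) ws(1-3) by (intro exI[of _ "zs @ ws"] exI[of _ y]) simp
qed

text \<open>After \<open>e\<close> digits the remainder is divisible by \<open>p\<close>, because
  the e-th power of \<open>\<theta> \<pi>\<close> has valuation 1.\<close>

lemma pow_basis_step:
 assumes "x \<in> TO"
 shows "\<exists>zs y. length zs = e * f \<and> set zs \<subseteq> Zp K v \<and> y \<in> TO \<and>
  x = combine zs (pow_basis us e) \<oplus> pp \<otimes> y"
proof -
 obtain zs y where zs: "length zs = e * f" "set zs \<subseteq> Zp K v" "y \<in> TO"
  "x = combine zs (pow_basis us e) \<oplus> \<theta> \<pi> [^] e \<otimes> y" using pow_basis_approx[OF assms] by blast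
 have P: "\<theta> \<pi> \<in> carrier K" "y \<in> carrier K" "0 \<le> v y" using P_TO zs(3) TO_closed by blast+
 have "v (\<theta> \<pi> [^] e) = 1" using v_pow[OF P(1), of e] v_pi[OF theta] e_pos by (simp add: one_ereal_def)
 hence "ereal (real 1) \<le> v (\<theta> \<pi> [^] e \<otimes> y)" using P v_mult_ge[of "\<theta> \<pi> [^] e" y 1] by (simp add: one_ereal_def)
 moreover have "\<theta> \<pi> [^] (n::nat) \<in> TO" for n
  by (induction n) (use subringE(3,6)[OF TO_subring] P_TO in auto)
 hence "\<theta> \<pi> [^] e \<otimes> y \<in> TF" using zs(3) subringE(6)[OF TO_subring] TO_iff by blast
 ultimately obtain y' where "y' \<in> TO" "\<theta> \<pi> [^] e \<otimes> y = pp [^] (1::nat) \<otimes> y'" using TO_div_pow by blast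
 thus ?thesis using zs by (intro exI[of _ zs] exI[of _ y']) simp
qed

text \<open>Independence in the residue field makes the leading block of coefficients divisible by
  \<open>p\<close>. This block then contributes valuation at least 1, which is not below the
  required bound because \<open>i \<le> e\<close>; it can be subtracted before dividing by
  \<open>\<theta> \<pi>\<close>.\<close>

lemma pow_basis_primitive:
 assumes "i \<le> e" "length zs = i * f" "set zs \<subseteq> Zp K v" "ereal (real i / real e) \<le> v (combine zs (pow_basis us i))"
 shows "\<forall>z\<in>set zs. 0 < v z"
 using assms
proof (induction i arbitrary: zs)
 case (Suc i)
 let ?P = "\<theta> \<pi>" and ?U = "pow_basis us i"
 define ys ws where "ys = take f zs" and "ws = drop f zs"
 have zs: "zs = ys @ ws" by (simp add: ys_def ws_def)
 have y: "length ys = f" "length ws = i * f" "set ys \<subseteq> Zp K v" "set ws \<subseteq> Zp K v"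
  using Suc.prems(2,3) set_take_subset[of f zs] set_drop_subset[of f zs] by (auto simp: ys_def ws_def)
 have cy: "combine ys us \<in> TO" "combine ws ?U \<in> TO"
  by (rule comb_TO[OF y(3) us(2)], rule comb_TO[OF y(4) pow_basis_TO])
 have cl: "set ys \<subseteq> carrier K" "set ws \<subseteq> carrier K" "set us \<subseteq> carrier K" "set ?U \<subseteq> carrier K" "?P \<in> carrier K"
  "combine ws ?U \<in> carrier K" "combine ys us \<in> carrier K"
  using y(3,4) us(2) pow_basis_TO[of i] P_TO TO_closed(1) Zp_carrier cy by blast+
 have eq: "combine zs (pow_basis us (Suc i)) = combine ys us \<oplus> ?P \<otimes> combine ws ?U"
  unfolding zs by (rule pow_basis_combine[OF y(1) cl(1,2)])
 let ?r = "real (Suc i) / real e"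
 have r: "1 / real e \<le> ?r" "?r \<le> 1" "0 < 1 / real e" using Suc.prems(1) e_pos by (auto simp: field_simps)
 have cancel: "(a \<oplus> b) \<ominus> b = a" "(a \<oplus> b) \<ominus> a = b" if "a \<in> carrier K" "b \<in> carrier K" for a b using that by algebra+
 have vP: "v ?P = ereal (1 / real e)" by (rule v_pi[OF theta])
 have "ereal (1 / real e) \<le> v (?P \<otimes> combine ws ?U)"
  using v_mult_ge[OF cl(5,6)] vP TO_closed(2)[OF cy(2)] by simp
 moreover have "ereal (1 / real e) \<le> v (combine zs (pow_basis us (Suc i)))"
  using Suc.prems(4) r(1) order_trans[of "ereal (1 / real e)" "ereal ?r"] by simp
 ultimately have "ereal (1 / real e) \<le> v (combine ys us)"
  using cancel(1)[of "combine ys us" "?P \<otimes> combine ws ?U"] cl eq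
   v_diff_ge[of "combine zs (pow_basis us (Suc i))" "?P \<otimes> combine ws ?U" "ereal (1 / real e)"] by simp
 hence "0 < v (combine ys us)" using r(3) less_le_trans[of 0 "ereal (1 / real e)"] by (simp del: zero_less_divide_1_iff)
 hence ys: "\<forall>z\<in>set ys. 0 < v z" by (rule us_indep[OF y(1,3)])
 have "1 \<le> v (combine ys us)"
  by (rule v_combine_ge) (use ys y(3) us(2) TO_closed Zp_carrier Zp_v_ge_one in \<open>auto simp: subset_iff simp del: image_iff\<close>)
 hence "ereal ?r \<le> v (combine ys us)" using r(2) order_trans[of "ereal ?r" 1] by (simp add: one_ereal_def)
 hence "ereal ?r \<le> v (?P \<otimes> combine ws ?U)"
  using cancel(2)[of "combine ys us" "?P \<otimes> combine ws ?U"] cl eq Suc.prems(4)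
   v_diff_ge[of "combine zs (pow_basis us (Suc i))" "combine ys us" "ereal ?r"] by simp
 hence "ereal (real i / real e) \<le> v (combine ws ?U)"
  unfolding v_mult[OF cl(5,6)] vP by (cases "v (combine ws ?U)") (auto simp: add_divide_distrib)
 hence "\<forall>z\<in>set ws. 0 < v z" using Suc.IH[OF _ y(2,4)] Suc.prems(1) by simp
 thus ?case using ys zs by auto
qed simp

text \<open>A relation with integral coefficients has all coefficients divisible by
  \<open>p\<close>; dividing and repeating makes them divisible by every power of \<open>p\<close>,
  hence zero.\<close>

lemma pow_basis_independent: "independent (Qp K v) (pow_basis us e)"
proof (rule ccontr)
 let ?U = "pow_basis us e"
 have UK: "set ?U \<subseteq> carrier K" using pow_basis_TO TO_closed(1) by blast
 have zero: "\<forall>z\<in>set zs. ereal (real N) \<le> v z"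
  if "length zs = e * f" "set zs \<subseteq> Zp K v" "combine zs ?U = \<zero>" for zs N
  using that
 proof (induction N arbitrary: zs)
  case 0 thus ?case using Zp_v by (auto simp: zero_ereal_def[symmetric])
 next
  case (Suc N)
  have "\<forall>z\<in>set zs. 0 < v z" by (rule pow_basis_primitive[of e]) (use Suc.prems in auto)
  hence "\<forall>z\<in>set zs. \<exists>y. y \<in> Zp K v \<and> z = pp \<otimes> y" using Zp_p_divides Suc.prems(2) by blast
  then obtain g where g: "!!z. z \<in> set zs ==> g z \<in> Zp K v \<and> z = pp \<otimes> g z" by metis
  let ?ys = "map g zs"
  have ys: "set ?ys \<subseteq> Zp K v" using g by auto
  hence ysK: "set ?ys \<subseteq> carrier K" using Zp_carrier by blast
  have "map ((\<otimes>) pp) ?ys = map (\<lambda>z. z) zs" unfolding map_map o_def by (rule map_cong) (use g in auto)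
  hence "pp \<otimes> combine ?ys ?U = \<zero>" using combine_r_distr[OF ysK UK nat_in_closed] Suc.prems(3) by simp
  hence "combine ?ys ?U = \<zero>" using integral[of pp "combine ?ys ?U"] combine_in_carrier[OF ysK UK] pp_nonzero by blast
  hence IH: "\<forall>y\<in>set ?ys. ereal (real N) \<le> v y" using Suc.IH[of ?ys] Suc.prems(1) ys by simp
  show ?case
  proof
   fix z assume z: "z \<in> set zs"
   hence "v z = 1 + v (g z)" using g[OF z] v_mult[OF nat_in_closed Zp_carrier] v_p by metis
   thus "ereal (real (Suc N)) \<le> v z" using IH z by (cases "v (g z)") (auto simp: one_ereal_def)
  qed
 qed
 assume "\<not> independent (Qp K v) ?U"
 then obtain zs where zs: "length zs = length ?U" "combine zs ?U = \<zero>" "set zs \<subseteq> Qp K v" "set zs \<noteq> {\<zero>}"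
  using dependent_imp_non_trivial_combine[OF Qp_subfield UK] by blast
 have len: "length zs = e * f" using zs(1) us(1) by (simp add: length_pow_basis)
 have zsK: "set zs \<subseteq> carrier K" using zs(3) Qp_closed by blast
 have "\<exists>k::nat. \<forall>z\<in>set ys. 0 \<le> ereal (real k) + v z" if "set ys \<subseteq> carrier K" for ys
  using that
 proof (induction ys)
  case (Cons y ys)
  then obtain k :: nat where k: "\<forall>z\<in>set ys. 0 \<le> ereal (real k) + v z" by auto
  obtain l :: nat where l: "0 \<le> ereal (real l) + v y" using v_lower[of y] Cons.prems by auto
  have "0 \<le> ereal (real (k + l)) + t" if "0 \<le> ereal (real k) + t \<or> 0 \<le> ereal (real l) + t" for t
   using that by (cases t) auto
  thus ?case using k l by (intro exI[of _ "k + l"]) auto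
 qed simp
 then obtain k :: nat where k: "\<forall>z\<in>set zs. 0 \<le> ereal (real k) + v z" using zsK by blast
 have k: "\<forall>z\<in>set zs. pp [^] k \<otimes> z \<in> Zp K v"
  using k zs(3) zsK subringE(6)[OF subfieldE(1)[OF Qp_subfield] nat_in_Qp[of "p ^ k"]]
  by (auto simp: Zp_def v_mult v_pp_pow nat_in_pow subset_iff)
 let ?ys = "map ((\<otimes>) (pp [^] k)) zs"
 have "combine ?ys ?U = \<zero>" using combine_r_distr[OF zsK UK, of "pp [^] k"] zs(2) by simp
 hence N: "!!N. \<forall>y\<in>set ?ys. ereal (real N) \<le> v y" using zero[of ?ys] len k by auto
 have "z = \<zero>" if z: "z \<in> set zs" for z
 proof -
  have zK: "z \<in> carrier K" using z zsK by blast
  have "pp [^] k \<otimes> z = \<zero>" by (rule v_large_imp_zero) (use N z zK in auto)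
  thus ?thesis using integral[of "pp [^] k" z] zK pp_pow_nonzero[of k] by auto
 qed
 hence "set zs \<subseteq> {\<zero>}" by blast
 hence "zs = []" using zs(4) by (cases zs) auto
 hence "?U = []" using zs(1) by simp
 thus False using \<open>\<not> independent (Qp K v) ?U\<close> by simp
qed

text \<open>The \<open>rec_nat\<close> term is the partial sum of the first N terms of a p-adic
  series. Completeness of \<open>K\<close> supplies the limit, and the p-adic integers are
  closed.\<close>

lemma Zp_series_limit:
 assumes g: "!!k. g k \<in> Zp K v"
 obtains z where "z \<in> Zp K v" "!!N. ereal (real N) \<le> v (rec_nat \<zero> (\<lambda>k s. s \<oplus> pp [^] k \<otimes> g k) N \<ominus> z)"
proof -
 define c where "c = rec_nat \<zero> (\<lambda>k s. s \<oplus> pp [^] k \<otimes> g k)"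
 have c0: "c 0 = \<zero>" and cS: "!!N. c (Suc N) = c N \<oplus> pp [^] N \<otimes> g N" by (simp_all add: c_def)
 have t: "pp [^] k \<otimes> g k \<in> Zp K v" for k by (rule Zp_pp_pow[OF g])
 have cZ: "c N \<in> Zp K v" for N
  by (induction N) (auto simp: c0 cS intro!: subringE(2,7)[OF Zp_subring] t)
 have cK: "c N \<in> carrier K" for N by (rule Zp_carrier[OF cZ])
 have tv: "ereal (real k) \<le> v (pp [^] k \<otimes> g k)" for k
  using v_mult_ge[of "pp [^] k" "g k" "ereal (real k)"] v_pp_pow[of k] Zp_v[OF g] Zp_carrier[OF g] by simp
 have step: "ereal (real N) \<le> v (c (N + m) \<ominus> c N)" for N m
 proof (induction m)
  case 0 show ?case using cK[of N] by (simp add: a_minus_def r_neg)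
 next
  case (Suc m)
  have "c (N + Suc m) \<ominus> c N = (c (N + m) \<ominus> c N) \<oplus> pp [^] (N + m) \<otimes> g (N + m)"
   using cK[of "N + m"] cK[of N] Zp_carrier[OF t, of "N + m"] by (simp add: cS a_minus_def a_ac)
  moreover have "ereal (real N) \<le> v (pp [^] (N + m) \<otimes> g (N + m))"
   using tv[of "N + m"] order_trans[of "ereal (real N)" "ereal (real (N + m))"] by simp
  ultimately show ?case using Suc cK Zp_carrier[OF t] by (simp add: v_add_ge)
 qed
 have step': "ereal (real N) \<le> v (c i \<ominus> c N)" if "N \<le> i" for N i
  using step[of N "i - N"] that by simp
 have "\<forall>N::nat. \<exists>M. \<forall>i\<ge>M. \<forall>j\<ge>M. ereal (real N) \<le> v (c i \<ominus> c j)"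
 proof (intro allI exI impI)
  fix N i k :: nat assume "N \<le> i" "N \<le> k"
  thus "ereal (real N) \<le> v (c i \<ominus> c k)"
   using v_diff_trans[OF cK cK cK, of "ereal (real N)" i N k] step'[of N i] step'[of N k] v_minus_commute[OF cK cK, of k N] by simp
 qed
 hence "\<exists>l\<in>carrier K. \<forall>N::nat. \<exists>M. \<forall>i\<ge>M. ereal (real N) \<le> v (c i \<ominus> l)"
  using complete cK unfolding complete_valued_field_def by blast
 then obtain z where z: "z \<in> carrier K" "!!N::nat. \<exists>M. \<forall>i\<ge>M. ereal (real N) \<le> v (c i \<ominus> z)" by blast
 have lim: "ereal (real N) \<le> v (c N \<ominus> z)" for N
 proof -
  obtain M where M: "\<forall>i\<ge>M. ereal (real N) \<le> v (c i \<ominus> z)" using z(2) by blast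
  let ?i = "max M N"
  have "ereal (real N) \<le> v (c N \<ominus> c ?i)" using step'[of N ?i] v_minus_commute[OF cK cK, of ?i N] by simp
  moreover have "ereal (real N) \<le> v (c ?i \<ominus> z)" using M by simp
  ultimately show ?thesis by (rule v_diff_trans[OF cK cK z(1)])
 qed
 have "z \<in> Zp K v"
  by (rule Zp_limit[OF z(1)]) (use cZ lim v_minus_commute[OF z(1) cK] in metis)
 thus thesis using that lim unfolding c_def by blast
qed

text \<open>Digits with respect to \<open>p\<close>: \<open>G\<close> gives the coefficients and
  \<open>r\<close> the remainder of one division, iterated along \<open>xi\<close>. The digits
  belonging to one basis vector form a p-adic series, whose limit is the coefficient sought.\<close>

lemma pow_basis_span_TO:
 assumes x: "x \<in> TO"
 obtains zs where "set zs \<subseteq> Zp K v" "x = combine zs (pow_basis us e)"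
proof -
 let ?U = "pow_basis us e"
 have UK: "set ?U \<subseteq> carrier K" and Uv: "set ?U \<subseteq> vint" using pow_basis_TO[of e] TO_closed by blast+
 have len: "length ?U = e * f" using us(1) by (simp add: length_pow_basis)
 \<comment> \<open>\<open>L\<close> lists the positions in the basis. Coefficient lists are turned
   into functions of the position, so that a limit can be taken at each position separately.\<close>
 define L where "L = [0..<e * f]"
 have U: "map (\<lambda>l. ?U ! l) L = ?U" unfolding L_def len[symmetric] by (rule map_nth)
 have Ul: "?U ! l \<in> carrier K" if "l \<in> set L" for l
 proof -
  have "?U ! l \<in> set ?U" using that len by (simp add: L_def)
  thus ?thesis using UK by blast
 qed
 have "\<forall>y. \<exists>g r. y \<in> TO \<longrightarrow> (\<forall>l. g l \<in> Zp K v) \<and> r \<in> TO \<and> y = combine (map g L) ?U \<oplus> pp \<otimes> r"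
 proof
  fix y
  show "\<exists>g r. y \<in> TO \<longrightarrow> (\<forall>l. g l \<in> Zp K v) \<and> r \<in> TO \<and> y = combine (map g L) ?U \<oplus> pp \<otimes> r"
  proof (cases "y \<in> TO")
   case True
   then obtain zs r where zs: "length zs = e * f" "set zs \<subseteq> Zp K v" "r \<in> TO" "y = combine zs ?U \<oplus> pp \<otimes> r"
    using pow_basis_step by blast
   define g where "g l = (if l < length zs then zs ! l else \<zero>)" for l
   have "map g L = zs" unfolding L_def zs(1)[symmetric] by (rule nth_equalityI) (auto simp: g_def)
   moreover have "g l \<in> Zp K v" for l using zs(2) nth_mem[of l zs] subringE(2)[OF Zp_subring] by (auto simp: g_def)
   ultimately show ?thesis using zs(3,4) by (intro exI[of _ g] exI[of _ r]) simp
  qed blast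
 qed
 then obtain G where "\<forall>y. \<exists>r. y \<in> TO \<longrightarrow> (\<forall>l. G y l \<in> Zp K v) \<and> r \<in> TO \<and> y = combine (map (G y) L) ?U \<oplus> pp \<otimes> r"
  by (rule choice[THEN exE])
 then obtain r where "\<forall>y. y \<in> TO \<longrightarrow> (\<forall>l. G y l \<in> Zp K v) \<and> r y \<in> TO \<and> y = combine (map (G y) L) ?U \<oplus> pp \<otimes> r y"
  by (rule choice[THEN exE])
 hence Gr: "!!y l. y \<in> TO ==> G y l \<in> Zp K v" "!!y. y \<in> TO ==> r y \<in> TO"
   "!!y. y \<in> TO ==> y = combine (map (G y) L) ?U \<oplus> pp \<otimes> r y" by auto
 define xi where "xi k = (r ^^ k) x" for k
 have XT: "xi k \<in> TO" for k by (induction k) (auto simp: xi_def x Gr(2))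
 have XS: "xi (Suc k) = r (xi k)" for k by (simp add: xi_def)
 have XK: "xi k \<in> carrier K" for k by (rule TO_closed(1)[OF XT])
 define c where "c l = rec_nat \<zero> (\<lambda>k s. s \<oplus> pp [^] k \<otimes> G (xi k) l)" for l
 have c0: "c l 0 = \<zero>" and cS: "c l (Suc N) = c l N \<oplus> pp [^] N \<otimes> G (xi N) l" for l N by (simp_all add: c_def)
 have GZ: "G (xi k) l \<in> Zp K v" "G (xi k) l \<in> carrier K" for k l using Gr(1)[OF XT] Zp_carrier by blast+
 have cK: "c l N \<in> carrier K" for l N by (induction N) (auto simp: c0 cS GZ)
 have rewr: "combine (map a L) ?U = combine (map a L) (map (\<lambda>l. ?U ! l) L)" for a using U by simp
 have cm: "combine (map a L) ?U \<in> carrier K" if "!!l. a l \<in> carrier K" for a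
  by (rule combine_in_carrier[OF _ UK]) (use that in auto)
 have part: "x = combine (map (\<lambda>l. c l N) L) ?U \<oplus> pp [^] N \<otimes> xi N" for N
 proof (induction N)
  case 0
  have "combine (map (\<lambda>l. \<zero>) M) V = \<zero>" if "set V \<subseteq> carrier K" for M :: "nat list" and V
   using that by (induction "map (\<lambda>l. \<zero>) M" V arbitrary: M rule: combine.induct) auto
  thus ?case using UK TO_closed(1)[OF x] by (simp add: c0 xi_def)
 next
  case (Suc N)
  let ?a = "\<lambda>l. pp [^] N \<otimes> G (xi N) l"
  have "combine (map (\<lambda>l. c l (Suc N)) L) ?U = combine (map (\<lambda>l. c l N) L) ?U \<oplus> combine (map ?a L) ?U"
   unfolding rewr cS by (rule combine_map_add) (use cK GZ Ul in auto)
  moreover have "combine (map ?a L) ?U = pp [^] N \<otimes> combine (map (G (xi N)) L) ?U"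
  proof -
   have "set (map (G (xi N)) L) \<subseteq> carrier K" using GZ(2) by auto
   from combine_r_distr[OF this UK, of "pp [^] N"] show ?thesis by (simp add: o_def)
  qed
  moreover have "xi N = combine (map (G (xi N)) L) ?U \<oplus> pp \<otimes> xi (Suc N)"
   unfolding XS by (rule Gr(3)[OF XT])
  hence "pp [^] N \<otimes> xi N = pp [^] N \<otimes> (combine (map (G (xi N)) L) ?U \<oplus> pp \<otimes> xi (Suc N))" by (rule arg_cong)
  hence "pp [^] N \<otimes> xi N = pp [^] N \<otimes> combine (map (G (xi N)) L) ?U \<oplus> pp [^] Suc N \<otimes> xi (Suc N)"
   using cm[of "G (xi N)"] GZ XK by (simp add: r_distr m_assoc)
  ultimately show ?case
   using Suc.IH cm[of "\<lambda>l. c l N"] cm[of "G (xi N)"] cK GZ XK[of "Suc N"] by (simp add: a_assoc)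
 qed
 have "\<forall>l. \<exists>z. z \<in> Zp K v \<and> (\<forall>N. ereal (real N) \<le> v (c l N \<ominus> z))"
 proof
  fix l
  obtain z where "z \<in> Zp K v" "!!N. ereal (real N) \<le> v (c l N \<ominus> z)"
   using Zp_series_limit[of "\<lambda>k. G (xi k) l"] GZ(1) unfolding c_def by blast
  thus "\<exists>z. z \<in> Zp K v \<and> (\<forall>N. ereal (real N) \<le> v (c l N \<ominus> z))" by blast
 qed
 then obtain z where z: "!!l. z l \<in> Zp K v" "!!l N. ereal (real N) \<le> v (c l N \<ominus> z l)" by metis
 have zK: "z l \<in> carrier K" for l by (rule Zp_carrier[OF z(1)])
 let ?y = "combine (map z L) ?U"
 have yK: "?y \<in> carrier K" using cm zK by blast
 have close: "ereal (real N) \<le> v (x \<ominus> ?y)" for N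
 proof -
  let ?d = "combine (map (\<lambda>l. c l N \<ominus> z l) L) ?U"
  have "combine (map (\<lambda>l. (c l N \<ominus> z l) \<oplus> z l) L) ?U = ?d \<oplus> ?y"
   unfolding rewr by (rule combine_map_add) (use cK zK Ul in auto)
  moreover have "(\<lambda>l. (c l N \<ominus> z l) \<oplus> z l) = (\<lambda>l. c l N)"
   using cK zK by (auto simp: a_minus_def a_assoc l_neg)
  ultimately have e: "combine (map (\<lambda>l. c l N) L) ?U = ?d \<oplus> ?y" by simp
  have dK: "?d \<in> carrier K" by (rule cm) (use cK zK in auto)
  have tK: "pp [^] N \<otimes> xi N \<in> carrier K" using XK by simp
  have cancel: "(a \<oplus> b \<oplus> t) \<ominus> b = a \<oplus> t" if "a \<in> carrier K" "b \<in> carrier K" "t \<in> carrier K" for a b t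
   using that by algebra
  have "(?d \<oplus> ?y \<oplus> pp [^] N \<otimes> xi N) \<ominus> ?y = ?d \<oplus> pp [^] N \<otimes> xi N"
   by (rule cancel[OF dK yK tK])
  hence "x \<ominus> ?y = ?d \<oplus> pp [^] N \<otimes> xi N" using part[of N] e by simp
  moreover have "ereal (real N) \<le> v ?d"
   by (rule v_combine_ge[OF _ Uv]) (use cK zK z(2) in auto)
  moreover have "ereal (real N) \<le> v (pp [^] N \<otimes> xi N)"
   using v_mult_ge[of "pp [^] N" "xi N" "ereal (real N)"] v_pp_pow[of N] XK TO_closed(2)[OF XT] by simp
  ultimately show ?thesis using v_add_ge[OF dK tK] by simp
 qed
 have "x \<ominus> ?y = \<zero>" by (rule v_large_imp_zero[OF _ close]) (use TO_closed(1)[OF x] yK in simp)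
 hence "x = ?y" using r_right_minus_eq TO_closed(1)[OF x] yK by blast
 moreover have "set (map z L) \<subseteq> Zp K v" using z(1) by auto
 ultimately show thesis using that by blast
qed

lemma pow_basis_span: "Span (Qp K v) (pow_basis us e) = TF"
proof
 let ?U = "pow_basis us e"
 have UF: "set ?U \<subseteq> TF" using pow_basis_TO[of e] TO_iff by blast
 have UK: "set ?U \<subseteq> carrier K" using UF TF_closed by blast
 show "Span (Qp K v) ?U \<subseteq> TF"
  unfolding Span_eq_combine_set[OF Qp_subfield UK]
  using combine_subset[OF subfieldE(1)[OF TF_subfield] _ UF] Qp_TF by blast
 show "TF \<subseteq> Span (Qp K v) ?U"
 proof
  fix x assume x: "x \<in> TF"
  note xK = TF_closed[OF x]
  obtain k :: nat where k: "0 \<le> ereal (real k) + v x" using v_lower[OF xK] .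
  have ppQ: "pp [^] k \<in> Qp K v" using nat_in_Qp[of "p ^ k"] by (simp add: nat_in_pow)
  have "pp [^] k \<otimes> x \<in> TF" using subringE(6)[OF subfieldE(1)[OF TF_subfield]] ppQ Qp_TF x by blast
  moreover have "0 \<le> v (pp [^] k \<otimes> x)" using k xK v_mult[of "pp [^] k" x] by (simp add: v_pp_pow)
  ultimately have "pp [^] k \<otimes> x \<in> TO" using TO_iff by blast
  then obtain zs where zs: "set zs \<subseteq> Zp K v" "pp [^] k \<otimes> x = combine zs ?U" by (rule pow_basis_span_TO)
  hence "pp [^] k \<otimes> x \<in> Span (Qp K v) ?U"
   unfolding Span_eq_combine_set[OF Qp_subfield UK] using Zp_Qp by blast
  moreover have "pp [^] k \<in> Qp K v - {\<zero>}" using ppQ pp_pow_nonzero by blast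
  ultimately show "x \<in> Span (Qp K v) ?U"
   using Span_m_inv_simprule[OF Qp_subfield UK _ xK] by blast
 qed
qed

text \<open>The basis has e f members and spans the image of \<open>F\<close> under
  \<open>\<theta>\<close>, which has the same dimension as \<open>F\<close> because \<theta> is
  injective and fixes the p-adic numbers.\<close>

lemma degree_eq: "d = e * f"
proof -
 interpret T: ring_hom_ring F K \<theta> by (rule F_hom)
 have "inj_on \<theta> (carrier F)"
 proof (rule inj_onI)
  fix a b assume a: "a \<in> carrier F" "b \<in> carrier F" "\<theta> a = \<theta> b"
  hence "\<theta> (a \<ominus>\<^sub>F b) = \<zero>" using EmbD(1)[OF theta a(2)] by (simp add: a_minus_def r_neg)
  hence "a \<ominus>\<^sub>F b = \<zero>\<^sub>F" using emb_inj[OF theta FF.carrier_is_subfield] a by simp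
  thus "a = b" using FF.r_right_minus_eq a by blast
 qed
 moreover have "\<one> \<noteq> \<zero>" by simp
 moreover have jth: "\<theta> ` (j ` Qp K v) = Qp K v"
  unfolding image_image using EmbD(7)[OF theta] by simp
 ultimately have "dimension d (Qp K v) TF"
  using T.inj_hom_dimension[OF jQp_subfield] finite_dimension_F by simp
 moreover have "dimension (length (pow_basis us e)) (Qp K v) TF"
  by (rule dimensionI[OF Qp_subfield pow_basis_independent pow_basis_span])
 ultimately show ?thesis
  using dimension_is_inj[OF Qp_subfield] us(1) by (simp add: length_pow_basis)
qed

end

theorem degree_eq_ramification_inertia:
 assumes "inertia_degree K v F j f" shows "d = e * f"
proof -
 obtain us and q :: nat where "length us = f" "set us \<subseteq> TO"
  "!!x. x \<in> TO ==> \<exists>zs. length zs = f \<and> set zs \<subseteq> Zp K v \<and> 0 < v (x \<ominus> combine zs us)"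
  "!!zs. length zs = f ==> set zs \<subseteq> Zp K v ==> 0 < v (combine zs us) ==> \<forall>z\<in>set zs. 0 < v z"
  using residue_basis[OF assms] by metis
 thus ?thesis by (rule degree_eq)
qed

end

section \<open>Frobenius approximation and integers of unramified subextensions\<close>

context valued_field
begin

text \<open>The cofactor \<open>s\<close> of \<open>x - y\<close> is the sum of the m + 1 monomials
  of degree \<open>m\<close> in \<open>x\<close> and \<open>y\<close>, and each of them is congruent
  to the m-th power of \<open>y\<close> modulo \<open>x - y\<close>.\<close>

lemma pow_diff_factor:
 assumes x: "x \<in> vint" "y \<in> vint" and r: "0 \<le> r" "r \<le> v (x \<ominus> y)"
 shows "\<exists>s\<in>vint. x [^] Suc m \<ominus> y [^] Suc m = (x \<ominus> y) \<otimes> s \<and> r \<le> v (s \<ominus> nat_in K (Suc m) \<otimes> y [^] m)"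
proof (induction m)
 case 0
 show ?case using x by (intro bexI[of _ \<one>]) (auto simp: a_minus_def r_neg)
next
 case (Suc m)
 then obtain s where s: "s \<in> vint" "x [^] Suc m \<ominus> y [^] Suc m = (x \<ominus> y) \<otimes> s"
  "r \<le> v (s \<ominus> nat_in K (Suc m) \<otimes> y [^] m)" by blast
 let ?A = "x [^] Suc m" and ?B = "y [^] m" and ?n = "nat_in K (Suc m)"
 have cl: "x \<in> carrier K" "y \<in> carrier K" "s \<in> carrier K" "?A \<in> carrier K" "?B \<in> carrier K" "?n \<in> carrier K"
  using x s(1) by (auto simp del: add.nat_pow_Suc)
 have vB: "0 \<le> v ?B" "0 \<le> v (y [^] Suc m)" "0 \<le> v ?n"
  using x(2) v_pow[of y m] v_pow[of y "Suc m"] v_nat_in[of "Suc m"] by auto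
 let ?s = "x \<otimes> s \<oplus> y [^] Suc m"
 have alg1: "a \<otimes> x \<ominus> b \<otimes> y = (x \<ominus> y) \<otimes> (x \<otimes> s) \<oplus> (x \<ominus> y) \<otimes> b"
  if "a \<in> carrier K" "b \<in> carrier K" "a \<ominus> b = (x \<ominus> y) \<otimes> s" for a b
 proof -
  have "a \<otimes> x \<ominus> b \<otimes> y = (a \<ominus> b) \<otimes> x \<oplus> (x \<ominus> y) \<otimes> b" using that(1,2) cl(1,2) by algebra
  also have "\<dots> = (x \<ominus> y) \<otimes> (x \<otimes> s) \<oplus> (x \<ominus> y) \<otimes> b" unfolding that(3) using that(2) cl(1-3) by algebra
  finally show ?thesis .
 qed
 have "x [^] Suc (Suc m) \<ominus> y [^] Suc (Suc m) = (x \<ominus> y) \<otimes> ?s"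
  using alg1[OF cl(4) _ s(2)] cl by (simp add: r_distr)
 moreover have "?s \<in> vint" using x s(1) vB cl by (auto simp: v_mult intro!: v_add_ge)
 moreover have "r \<le> v (?s \<ominus> nat_in K (Suc (Suc m)) \<otimes> y [^] Suc m)"
 proof -
  have alg2: "x \<otimes> s \<oplus> b \<otimes> y \<ominus> (n \<oplus> \<one>) \<otimes> (b \<otimes> y) = x \<otimes> (s \<ominus> n \<otimes> b) \<oplus> (x \<ominus> y) \<otimes> (n \<otimes> b)"
   if "n \<in> carrier K" "b \<in> carrier K" for n b using that cl(1-3) by algebra
  have "nat_in K (Suc (Suc m)) = ?n \<oplus> \<one>" by simp
  hence e: "?s \<ominus> nat_in K (Suc (Suc m)) \<otimes> y [^] Suc m = x \<otimes> (s \<ominus> ?n \<otimes> ?B) \<oplus> (x \<ominus> y) \<otimes> (?n \<otimes> ?B)"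
   using alg2[OF cl(6,5)] by simp
  have "r \<le> v (x \<otimes> (s \<ominus> ?n \<otimes> ?B))"
   using v_mult[OF cl(1), of "s \<ominus> ?n \<otimes> ?B"] cl s(3) x(1) add_mono[of 0 "v x" r "v (s \<ominus> ?n \<otimes> ?B)"]
   by (simp del: add.nat_pow_Suc)
  moreover have "r \<le> v ((x \<ominus> y) \<otimes> (?n \<otimes> ?B))"
   using v_mult[of "x \<ominus> y" "?n \<otimes> ?B"] v_mult[OF cl(6,5)] cl r(2) vB add_mono[of r "v (x \<ominus> y)" 0 "v (?n \<otimes> ?B)"]
   by (simp del: add.nat_pow_Suc)
  ultimately show ?thesis unfolding e using cl by (intro v_add_ge) (auto simp del: add.nat_pow_Suc)
 qed
 ultimately show ?case by blast
qed

lemma v_pow_diff_ge: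
 assumes x: "x \<in> vint" "y \<in> vint" and r: "0 \<le> r" "r \<le> v (x \<ominus> y)"
 shows "r \<le> v (x [^] (n::nat) \<ominus> y [^] n)"
proof (cases n)
 case (Suc m)
 obtain s where s: "s \<in> vint" "x [^] Suc m \<ominus> y [^] Suc m = (x \<ominus> y) \<otimes> s"
  using pow_diff_factor[OF assms] by blast
 thus ?thesis
  unfolding Suc s(2) using x r v_mult[of "x \<ominus> y" s] add_mono[of r "v (x \<ominus> y)" 0 "v s"] by simp
qed (use r x in \<open>simp add: a_minus_def r_neg\<close>)

end

context padic_field
begin

text \<open>The cofactor of \<open>x - y\<close> is congruent to \<open>p\<close> times a power of
  \<open>y\<close>, so its valuation is at least the minimum of 1 and \<open>r\<close>, hence at
  least \<mu>.\<close>

lemma v_pow_p_diff: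
 assumes x: "x \<in> vint" "y \<in> vint" and r: "0 \<le> \<mu>" "\<mu> \<le> 1" "\<mu> \<le> r" "ereal r \<le> v (x \<ominus> y)"
 shows "ereal (r + \<mu>) \<le> v (x [^] p \<ominus> y [^] p)"
proof -
 have p: "p = Suc (p - 1)" using prime_gt_0_nat[OF prime_p] by simp
 have r': "0 \<le> ereal r" using r by simp
 obtain s where s: "s \<in> vint" "x [^] p \<ominus> y [^] p = (x \<ominus> y) \<otimes> s" "ereal r \<le> v (s \<ominus> pp \<otimes> y [^] (p - 1))"
  using pow_diff_factor[OF x r' r(4), of "p - 1"]
  unfolding p[symmetric] by blast
 have cl: "x \<in> carrier K" "y \<in> carrier K" "s \<in> carrier K" using x s(1) by auto
 let ?t = "pp \<otimes> y [^] (p - 1)"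
 have "0 \<le> v (y [^] (p - 1))" using v_pow[OF cl(2), of "p - 1"] x(2) by simp
 hence "1 \<le> v ?t" using v_mult_ge[of pp "y [^] (p - 1)" 1] cl v_p by simp
 hence "ereal \<mu> \<le> v ?t" using r(2) order_trans[of "ereal \<mu>" 1] by (simp add: one_ereal_def)
 moreover have "ereal \<mu> \<le> v (s \<ominus> ?t)" using s(3) r(3) order_trans[of "ereal \<mu>" "ereal r"] by simp
 moreover have "s = (s \<ominus> ?t) \<oplus> ?t" using cl by (simp add: a_minus_def a_assoc l_neg)
 ultimately have "ereal \<mu> \<le> v s" using v_add_ge[of "s \<ominus> ?t" ?t "ereal \<mu>"] cl by simp
 hence "ereal r + ereal \<mu> \<le> v (x \<ominus> y) + v s" using r(4) by (intro add_mono)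
 thus ?thesis unfolding s(2) using v_mult[of "x \<ominus> y" s] cl by simp
qed

text \<open>Each q-th power contains a p-th power, which gains \<mu>, while the remaining exponent
  q/p does not lower the valuation of the difference.\<close>

lemma v_pow_q_diff:
 assumes x: "x \<in> vint" "y \<in> vint" and r: "0 \<le> \<mu>" "\<mu> \<le> 1" "ereal \<mu> \<le> v (x \<ominus> y)" and q: "p dvd q"
 shows "ereal (\<mu> + real N * \<mu>) \<le> v (x [^] (q ^ N) \<ominus> y [^] (q ^ N))"
proof (induction N)
 case (Suc N)
 obtain k where k: "q = p * k" using q by blast
 let ?x = "x [^] (q ^ N * k)" and ?y = "y [^] (q ^ N * k)"
 let ?r = "\<mu> + real N * \<mu>"
 have pw: "z [^] (n::nat) \<in> vint" if "z \<in> vint" for z n using that v_pow[of z n] by simp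
 have "ereal ?r \<le> v ((x [^] (q ^ N)) [^] k \<ominus> (y [^] (q ^ N)) [^] k)"
  by (rule v_pow_diff_ge[OF pw[OF x(1)] pw[OF x(2)] _ Suc.IH]) (use r in simp)
 hence "ereal ?r \<le> v (?x \<ominus> ?y)" using x by (simp add: nat_pow_pow)
 hence "ereal (?r + \<mu>) \<le> v (?x [^] p \<ominus> ?y [^] p)"
  by (rule v_pow_p_diff[OF pw[OF x(1)] pw[OF x(2)] r(1,2), rotated]) (use r in simp)
 moreover have e: "q ^ N * k * p = q ^ Suc N" using k by simp
 have "?x [^] p = x [^] (q ^ Suc N)" "?y [^] p = y [^] (q ^ Suc N)"
  using x nat_pow_pow[of x "q ^ N * k" p] nat_pow_pow[of y "q ^ N * k" p] unfolding e by blast+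
 moreover have "?r + \<mu> = \<mu> + real (Suc N) * \<mu>" by (simp add: algebra_simps)
 ultimately show ?case by simp
qed (use r x in simp)

end

context padic_uniformiser
begin

text \<open>Among the integers of \<open>E\<close> the nonunits are the multiples of
  \<open>p\<close>, so c^q - c, which vanishes in the residue field, is p times an integer of
  \<open>E\<close>; the same holds for the exponents q^N. If \<open>w\<close> in \<open>W\<close>
  has the residue of \<tau> c, its power with exponent q^N approaches that of \<tau> c, which is
  \<tau> c + p \<tau> x. So \<tau> c is known up to p \<tau> x; repeating the argument for the
  integer -x approximates \<tau> c by \<open>W\<close> to any order, and \<open>W\<close> is
  p-adically complete.\<close>

lemma unramified_in_witt:
 assumes inertia: "inertia_degree K v F j f" and W: "is_witt_subring p K v W"
  and E: "unramified_subextension p K v F j E" and t: "\<tau> \<in> Emb (carrier F)" and b: "b \<in> carrier (OE E)"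
 shows "\<tau> b \<in> W"
proof -
 have Wr: "subring W K" and Wv: "W \<subseteq> vint"
  and Wres: "!!x. x \<in> vint ==> \<exists>w\<in>W. 0 < v (x \<ominus> w)"
  and Wp: "!!w. w \<in> W ==> 0 < v w ==> \<exists>u\<in>W. w = pp \<otimes> u"
  and Wlim: "!!s. (!!i::nat. s i \<in> W) ==> (!!i. \<exists>w\<in>W. s (Suc i) \<ominus> s i = nat_in K (p ^ i) \<otimes> w) ==>
    \<exists>l\<in>W. \<forall>i. \<exists>w\<in>W. l \<ominus> s i = nat_in K (p ^ i) \<otimes> w"
  using W unfolding is_witt_subring_def val_ring_def val_ideal_def by (auto simp: set_eq_iff)
 have WK: "w \<in> carrier K" "0 \<le> v w" if "w \<in> W" for w using that Wv by auto
 note Wops = subringE(2,3,5,6,7)[OF Wr]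
 have Wpow: "w [^] (n::nat) \<in> W" if "w \<in> W" for w n by (induction n) (auto intro: Wops that)
 have ppW: "pp \<in> W" using subringE(2,3,7)[OF Wr] by (induction p) auto
 have sE: "subfield E F" and nonu: "nonunits (OE E) = {x \<otimes>\<^sub>F nat_in F p | x. x \<in> carrier (OE E)}"
  using E unfolding unramified_subextension_def subextension_def cgenideal_def by auto
 note rE = subfieldE(1)[OF sE]
 note Eops = subringE(2,3,5,6,7)[OF int_subring[OF rE]]
 have EF: "x \<in> carrier F" if "x \<in> carrier (OE E)" for x using that subringE(1)[OF int_subring[OF rE]] by blast
 have EO: "x \<in> carrier OF" if "x \<in> carrier (OE E)" for x
  using that int_ring_mem[OF subringE(1)[OF rE]] OF_mem EF by blast
 have Epow: "x [^]\<^sub>F (n::nat) \<in> carrier (OE E)" if "x \<in> carrier (OE E)" for x n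
  by (induction n) (auto intro: Eops that)
 obtain q :: nat where q: "p dvd q" "!!b. b \<in> carrier OF ==> 0 < v (\<theta> b [^] q \<ominus> \<theta> b)"
 proof (rule residue_basis[OF inertia])
  fix us :: "'k list" and q :: nat
  assume "p dvd q" and "!!b. b \<in> carrier OF ==> 0 < v (\<theta> b [^] q \<ominus> \<theta> b)"
  thus thesis by (rule that)
 qed
 have frob: "\<exists>x\<in>carrier (OE E). c [^]\<^sub>F q = c \<oplus>\<^sub>F nat_in F p \<otimes>\<^sub>F x" if c: "c \<in> carrier (OE E)" for c
 proof -
  let ?y = "c [^]\<^sub>F q \<ominus>\<^sub>F c"
  have y: "?y \<in> carrier (OE E)" unfolding a_minus_def by (rule Eops(5)[OF Epow[OF c] Eops(3)[OF c]])
  have "\<theta> ?y = \<theta> c [^] q \<ominus> \<theta> c"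
   using emb_diff[OF theta subring_F EF[OF Epow[OF c]] EF[OF c]] emb_pow[OF theta subring_F EF[OF c], of q] by simp
  hence "0 < v (\<theta> ?y)" using q(2)[OF EO[OF c]] by simp
  hence "v (\<theta> ?y) \<noteq> 0" by simp
  hence "\<not> (\<forall>\<tau>\<in>Emb (carrier F). v (\<tau> ?y) = 0)" using theta by blast
  hence "?y \<notin> Units (OE E)" using int_ring_units[OF sE y theta] by blast
  hence "?y \<in> nonunits (OE E)" using y unfolding nonunits_def by blast
  then obtain x where x: "x \<in> carrier (OE E)" "?y = x \<otimes>\<^sub>F nat_in F p" unfolding nonu by blast
  have cF: "c [^]\<^sub>F q \<in> carrier F" "c \<in> carrier F" "x \<in> carrier F" using EF[OF Epow[OF c]] EF[OF c] EF[OF x(1)] by blast+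
  have "c [^]\<^sub>F q = c \<oplus>\<^sub>F ?y" using cF by (simp add: a_minus_def FF.a_lcomm[of c] FF.r_neg)
  also have "?y = nat_in F p \<otimes>\<^sub>F x" unfolding x(2) using cF by (simp add: FF.m_comm)
  finally show ?thesis using x(1) by blast
 qed
 have frobN: "\<exists>x\<in>carrier (OE E). c [^]\<^sub>F (q ^ N) = c \<oplus>\<^sub>F nat_in F p \<otimes>\<^sub>F x" if c: "c \<in> carrier (OE E)" for c N
 proof (induction N)
  case 0 show ?case using EF[OF c] Eops(1) by (intro bexI[of _ "\<zero>\<^sub>F"]) auto
 next
  case (Suc N)
  then obtain x where x: "x \<in> carrier (OE E)" "c [^]\<^sub>F (q ^ N) = c \<oplus>\<^sub>F nat_in F p \<otimes>\<^sub>F x" by blast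
  obtain y where y: "y \<in> carrier (OE E)" "(c [^]\<^sub>F (q ^ N)) [^]\<^sub>F q = c [^]\<^sub>F (q ^ N) \<oplus>\<^sub>F nat_in F p \<otimes>\<^sub>F y"
   using frob[OF Epow[OF c]] by blast
  have "c [^]\<^sub>F (q ^ Suc N) = c \<oplus>\<^sub>F nat_in F p \<otimes>\<^sub>F (x \<oplus>\<^sub>F y)"
  proof -
   have "c [^]\<^sub>F (q ^ Suc N) = (c [^]\<^sub>F (q ^ N)) [^]\<^sub>F q"
    using FF.nat_pow_pow[OF EF[OF c], of "q ^ N" q] by (simp add: mult.commute)
   also have "\<dots> = (c \<oplus>\<^sub>F nat_in F p \<otimes>\<^sub>F x) \<oplus>\<^sub>F nat_in F p \<otimes>\<^sub>F y"
    using y(2) by (simp only: x(2)[symmetric])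
   also have "\<dots> = c \<oplus>\<^sub>F nat_in F p \<otimes>\<^sub>F (x \<oplus>\<^sub>F y)"
    using EF[OF c] EF[OF x(1)] EF[OF y(1)] by (simp add: FF.r_distr FF.a_assoc)
   finally show ?thesis .
  qed
  thus ?case using Eops(5)[OF x(1) y(1)] by blast
 qed
 note D = EmbD[OF t]
 have tv: "\<tau> c \<in> vint" if "c \<in> carrier (OE E)" for c
  using D(1)[OF EF[OF that]] EO[OF that] OF_mem t by blast
 have approx1: "\<exists>w\<in>W. \<exists>x\<in>carrier (OE E). ereal (real M) \<le> v (\<tau> c \<ominus> (w \<oplus> pp \<otimes> \<tau> x))"
  if c: "c \<in> carrier (OE E)" for c M
 proof -
  obtain w where w: "w \<in> W" "0 < v (\<tau> c \<ominus> w)" using Wres[OF tv[OF c]] by blast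
  have wK: "w \<in> vint" using WK[OF w(1)] by blast
  \<comment> \<open>A positive real bound not exceeding 1 is extracted, because the valuation of the
    difference may be larger than 1 or infinite.\<close>
  obtain \<mu> :: real where mu: "0 < \<mu>" "\<mu> \<le> 1" "ereal \<mu> \<le> v (\<tau> c \<ominus> w)"
  proof (cases "v (\<tau> c \<ominus> w)")
   case (real r) thus thesis using that[of "min 1 r"] w(2) by auto
  next
   case PInf thus thesis using that[of 1] by auto
  qed (use w(2) in auto)
  obtain N :: nat where N: "real M / \<mu> \<le> real N" using real_arch_simple by blast
  have "ereal (\<mu> + real N * \<mu>) \<le> v (\<tau> c [^] (q ^ N) \<ominus> w [^] (q ^ N))"
   by (rule v_pow_q_diff[OF tv[OF c] wK _ mu(2,3) q(1)]) (use mu in simp)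
  moreover have "real M \<le> \<mu> + real N * \<mu>" using N mu(1) by (simp add: field_simps)
  ultimately have *: "ereal (real M) \<le> v (\<tau> c [^] (q ^ N) \<ominus> w [^] (q ^ N))"
   using order_trans[of "ereal (real M)" "ereal (\<mu> + real N * \<mu>)"] by simp
  obtain x where x: "x \<in> carrier (OE E)" "c [^]\<^sub>F (q ^ N) = c \<oplus>\<^sub>F nat_in F p \<otimes>\<^sub>F x" using frobN[OF c] by blast
  have xF: "x \<in> carrier F" "c \<in> carrier F" using EF[OF x(1)] EF[OF c] by blast+
  have "\<tau> c [^] (q ^ N) = \<tau> c \<oplus> pp \<otimes> \<tau> x"
   using x(2) D(2,3) xF emb_pow[OF t subring_F xF(2), of "q ^ N"] emb_nat[OF t subring_F, of p] by simp
  moreover have "\<tau> (\<ominus>\<^sub>F x) = \<ominus> \<tau> x" by (rule D(6)[OF xF(1)])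
  moreover have alg: "a \<oplus> pp \<otimes> b \<ominus> u = a \<ominus> (u \<oplus> pp \<otimes> (\<ominus> b))" if "a \<in> carrier K" "b \<in> carrier K" "u \<in> carrier K" for a b u
   using that by (simp add: a_minus_def minus_add r_minus a_ac)
  ultimately have "ereal (real M) \<le> v (\<tau> c \<ominus> (w [^] (q ^ N) \<oplus> pp \<otimes> \<tau> (\<ominus>\<^sub>F x)))"
   using * alg[of "\<tau> c" "\<tau> x" "w [^] (q ^ N)"] D(1) xF wK by simp
  thus ?thesis using Wpow[OF w(1)] Eops(3)[OF x(1)] by blast
 qed
 \<comment> \<open>\<open>approx1\<close> expresses \<tau> c through \<open>W\<close> up to p times
   a value of the same kind. The induction hypothesis applies to that value, and the factor
   \<open>p\<close> raises the order from M to M + 1.\<close>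
 have approx: "\<exists>w\<in>W. ereal (real M) \<le> v (\<tau> c \<ominus> w)" if c: "c \<in> carrier (OE E)" for c M
  using c
 proof (induction M arbitrary: c)
  case 0
  thus ?case using tv[of c] Wops(1) by (intro bexI[of _ \<zero>]) (auto simp: a_minus_def zero_ereal_def[symmetric])
 next
  case (Suc M)
  obtain w x where w: "w \<in> W" "x \<in> carrier (OE E)" "ereal (real (Suc M)) \<le> v (\<tau> c \<ominus> (w \<oplus> pp \<otimes> \<tau> x))"
   using approx1[OF Suc.prems] by blast
  obtain w1 where w1: "w1 \<in> W" "ereal (real M) \<le> v (\<tau> x \<ominus> w1)" using Suc.IH[OF w(2)] by blast
  have cl: "\<tau> c \<in> carrier K" "\<tau> x \<in> carrier K" "w \<in> carrier K" "w1 \<in> carrier K"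
   using tv[OF Suc.prems] tv[OF w(2)] WK w(1) w1(1) by auto
  have alg: "a \<ominus> (w \<oplus> u \<otimes> w1) = (a \<ominus> (w \<oplus> u \<otimes> b)) \<oplus> u \<otimes> (b \<ominus> w1)"
   if "a \<in> carrier K" "b \<in> carrier K" "u \<in> carrier K" for a b u using that cl(3,4) by algebra
  have "v (pp \<otimes> (\<tau> x \<ominus> w1)) = 1 + v (\<tau> x \<ominus> w1)" using cl v_p by (simp add: v_mult)
  hence "ereal (real (Suc M)) \<le> v (pp \<otimes> (\<tau> x \<ominus> w1))"
   using w1(2) by (cases "v (\<tau> x \<ominus> w1)") (auto simp: one_ereal_def)
  hence "ereal (real (Suc M)) \<le> v (\<tau> c \<ominus> (w \<oplus> pp \<otimes> w1))"
   unfolding alg[OF cl(1,2) nat_in_closed] using w(3) cl by (intro v_add_ge) auto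
  moreover have "w \<oplus> pp \<otimes> w1 \<in> W" by (rule Wops(5)[OF w(1) Wops(4)[OF ppW w1(1)]])
  ultimately show ?case by blast
 qed
 \<comment> \<open>This turns closeness for \<open>v\<close> into divisibility inside
   \<open>W\<close>, the form in which the completeness of \<open>W\<close> is available.\<close>
 have Wdiv: "\<exists>w\<in>W. u = nat_in K (p ^ i) \<otimes> w" if "u \<in> W" "ereal (real i) \<le> v u" for u i
  using that
 proof (induction i arbitrary: u)
  case 0 thus ?case using WK by (intro bexI[of _ u]) auto
 next
  case (Suc i)
  have "0 < v u" using Suc.prems(2) less_le_trans[of 0 "ereal (real (Suc i))"] by simp
  then obtain y where y: "y \<in> W" "u = pp \<otimes> y" using Wp[OF Suc.prems(1)] by blast
  have "v u = 1 + v y" using y WK v_p by (simp add: v_mult)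
  hence "ereal (real i) \<le> v y" using Suc.prems(2) by (cases "v y") (auto simp: one_ereal_def)
  then obtain w where w: "w \<in> W" "y = nat_in K (p ^ i) \<otimes> w" using Suc.IH[OF y(1)] by blast
  have "u = nat_in K (p ^ Suc i) \<otimes> w"
   unfolding y(2) w(2) power_Suc nat_in_mult using WK(1)[OF w(1)] by (simp add: m_assoc)
  thus ?case using w(1) by blast
 qed
 obtain s where s: "!!i. s i \<in> W" "!!i. ereal (real i) \<le> v (\<tau> b \<ominus> s i)"
  using approx[OF b] by metis
 have tb: "\<tau> b \<in> carrier K" using tv[OF b] by blast
 have sK: "s i \<in> carrier K" for i using WK(1)[OF s(1)] .
 have step: "ereal (real i) \<le> v (s (Suc i) \<ominus> s i)" for i
 proof (rule v_diff_trans[OF sK tb sK _ s(2)])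
  show "ereal (real i) \<le> v (s (Suc i) \<ominus> \<tau> b)"
   using s(2)[of "Suc i"] v_minus_commute[OF tb sK, of "Suc i"] order_trans[of "ereal (real i)" "ereal (real (Suc i))"] by simp
 qed
 have "s (Suc i) \<ominus> s i \<in> W" for i unfolding a_minus_def by (rule Wops(5)[OF s(1) Wops(3)[OF s(1)]])
 hence "\<exists>w\<in>W. s (Suc i) \<ominus> s i = nat_in K (p ^ i) \<otimes> w" for i using Wdiv step by blast
 from Wlim[OF s(1) this] obtain l where l: "l \<in> W" "!!i. \<exists>w\<in>W. l \<ominus> s i = nat_in K (p ^ i) \<otimes> w" by blast
 have lK: "l \<in> carrier K" by (rule WK(1)[OF l(1)])
 have "ereal (real i) \<le> v (\<tau> b \<ominus> l)" for i
 proof (rule v_diff_trans[OF tb sK lK s(2)])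
  obtain w where w: "w \<in> W" "l \<ominus> s i = nat_in K (p ^ i) \<otimes> w" using l(2) by blast
  have "ereal (real i) \<le> v (l \<ominus> s i)"
   unfolding w(2) nat_in_pow using v_mult_ge[of "pp [^] i" w "ereal (real i)"] WK[OF w(1)] v_pp_pow[of i] by simp
  thus "ereal (real i) \<le> v (s i \<ominus> l)" using v_minus_commute[OF lK sK, of i] by simp
 qed
 note close = this
 have "\<tau> b \<ominus> l = \<zero>" by (rule v_large_imp_zero[OF _ close]) (use tb lK in simp)
 hence "\<tau> b = l" using r_right_minus_eq tb lK by blast
 thus ?thesis using l(1) by simp
qed

text \<open>A power of \<open>p\<close> makes an element of \<open>E\<close> integral, so its image
  is a quotient of two elements of \<open>W\<close>. This places the restrictions in the index set
  of the integral Hodge polygon.\<close>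

theorem restrict_emb_unramified:
 assumes inertia: "inertia_degree K v F j f" and W: "is_witt_subring p K v W"
  and E: "unramified_subextension p K v F j E" and t: "\<tau> \<in> Emb (carrier F)"
 shows "restrict \<tau> E \<in> embeddings K v F j E (fractions_in K W)"
proof -
 have sE: "subfield E F" and jE: "j ` Qp K v \<subseteq> E"
  using E unfolding unramified_subextension_def subextension_def by auto
 note rE = subfieldE(1)[OF sE]
 have EF: "x \<in> carrier F" if "x \<in> E" for x using that subringE(1)[OF rE] by blast
 have Wr: "subring W K" using W unfolding is_witt_subring_def by blast
 have natW: "nat_in K m \<in> W" for m by (induction m) (auto intro: subringE(2,3,7)[OF Wr])
 note D = EmbD[OF t]
 have frac: "\<tau> b \<in> fractions_in K W" if b: "b \<in> E" for b
 proof -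
  obtain m where m: "nat_in F (p ^ m) \<otimes>\<^sub>F b \<in> carrier OF" by (rule clear_p_denominator[OF EF[OF b]])
  have nE: "nat_in F l \<in> E" for l by (induction l) (auto intro: subringE(2,3,7)[OF rE])
  have "nat_in F (p ^ m) \<otimes>\<^sub>F b \<in> carrier (OE E)"
   unfolding int_ring_mem[OF subringE(1)[OF rE]] using m OF_mem subringE(6)[OF rE nE b] by blast
  hence w: "\<tau> (nat_in F (p ^ m) \<otimes>\<^sub>F b) \<in> W" by (rule unramified_in_witt[OF assms])
  have "\<tau> (nat_in F (p ^ m) \<otimes>\<^sub>F b) = pp [^] m \<otimes> \<tau> b"
   using D(3)[OF EF[OF nE] EF[OF b]] emb_nat[OF t subring_F, of "p ^ m"] by (simp add: nat_in_pow)
  hence "\<tau> b = \<tau> (nat_in F (p ^ m) \<otimes>\<^sub>F b) \<otimes> inv (pp [^] m)"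
  proof -
   have "pp [^] m \<otimes> \<tau> b \<otimes> inv (pp [^] m) = \<tau> b \<otimes> (pp [^] m \<otimes> inv (pp [^] m))"
    using pp_inv(1)[of m] D(1)[OF EF[OF b]] by (simp add: m_ac)
   thus ?thesis
    using \<open>\<tau> (nat_in F (p ^ m) \<otimes>\<^sub>F b) = pp [^] m \<otimes> \<tau> b\<close> pp_inv(2)[of m] D(1)[OF EF[OF b]] by simp
  qed
  moreover have "pp [^] m \<in> W - {\<zero>}" using natW[of "p ^ m"] pp_pow_nonzero by (simp add: nat_in_pow)
  ultimately show ?thesis using w unfolding fractions_in_def by blast
 qed
 have "restrict \<tau> E \<in> ring_hom (F\<lparr>carrier := E\<rparr>) (K\<lparr>carrier := fractions_in K W\<rparr>)"
  by (rule ring_hom_memI) (use frac D(2-4) EF subringE(3,6,7)[OF rE] in auto)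
 moreover have "restrict \<tau> E (j x) = x" if "x \<in> Qp K v" for x using D(7)[OF that] that jE by auto
 ultimately show ?thesis unfolding embeddings_def by auto
qed

end

section \<open>Dimensions and quotient modules\<close>

context vectorspace
begin

lemma lincomb_support:
 assumes "finite B" "B \<subseteq> carrier V" "c \<in> B \<rightarrow> carrier K"
 shows "(\<Oplus>\<^sub>V b\<in>{b \<in> B. c b \<noteq> \<zero>\<^sub>K}. c b \<odot>\<^sub>V b) = lincomb c B"
 unfolding lincomb_def
 by (intro M.add.finprod_mono_neutral_cong_left) (use assms in auto)

lemma lincomb_diff_eq:
 assumes "finite B" "B \<subseteq> carrier V" "c \<in> B \<rightarrow> carrier K" "d \<in> B \<rightarrow> carrier K" "lincomb c B = lincomb d B"
 shows "lincomb (\<lambda>b. c b \<ominus>\<^sub>K d b) B = \<zero>\<^sub>V"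
proof -
 let ?m = "\<lambda>b. \<ominus>\<^sub>K \<one>\<^sub>K \<otimes>\<^sub>K d b"
 have "lincomb ?m B = \<ominus>\<^sub>K \<one>\<^sub>K \<odot>\<^sub>V lincomb d B"
  by (rule lincomb_smult) (use assms in auto)
 moreover have "lincomb d B \<in> carrier V" using assms by (intro lincomb_closed) auto
 moreover have "lincomb (\<lambda>b. c b \<oplus>\<^sub>K ?m b) B = lincomb c B \<oplus>\<^sub>V lincomb ?m B"
  by (rule lincomb_sum) (use assms in auto)
 moreover have "lincomb (\<lambda>b. c b \<oplus>\<^sub>K ?m b) B = lincomb (\<lambda>b. c b \<ominus>\<^sub>K d b) B"
  unfolding lincomb_def by (intro M.finsum_cong') (use assms in \<open>auto simp: a_minus_def l_minus Pi_iff\<close>)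
 ultimately show ?thesis using assms(5) by (simp add: smult_l_minus M.r_neg)
qed

text \<open>Unique finitely supported coefficients, as in the definition of freeness, are translated
  into independence and spanning. The coefficient functions there are extensional, hence the
  restrictions to \<open>B\<close>.\<close>

lemma is_basis_iff:
 assumes B: "finite B" "B \<subseteq> carrier V"
 shows "is_basis K V B \<longleftrightarrow> lin_indpt B \<and> carrier V \<subseteq> span B"
proof -
 let ?s = "\<lambda>c. {b \<in> B. c b \<noteq> \<zero>\<^sub>K}"
 let ?e = "\<lambda>c x. c \<in> B \<rightarrow>\<^sub>E carrier K \<and> finite (?s c) \<and> x = (\<Oplus>\<^sub>V b\<in>?s c. c b \<odot>\<^sub>V b)"
 show ?thesis
 proof
 assume b: "is_basis K V B"
 have ex: "\<exists>!c. ?e c x" if "x \<in> carrier V" for x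
  using b that unfolding is_basis_def by blast
 have "lin_indpt B"
 proof (rule finite_lin_indpt2[OF B])
  fix c assume c: "c \<in> B \<rightarrow> carrier K" "lincomb c B = \<zero>\<^sub>V"
  let ?c = "restrict c B" and ?z = "\<lambda>b\<in>B. \<zero>\<^sub>K"
  have "lincomb ?c B = lincomb c B" unfolding lincomb_def
   by (intro M.finsum_cong') (use B c(1) in auto)
  moreover have cr: "?c \<in> B \<rightarrow> carrier K" using c(1) by auto
  ultimately have 1: "\<zero>\<^sub>V = (\<Oplus>\<^sub>V b\<in>?s ?c. ?c b \<odot>\<^sub>V b)"
   unfolding lincomb_support[OF B cr] using c(2) by simp
  have "?s ?z = {}" by auto
  hence 2: "\<zero>\<^sub>V = (\<Oplus>\<^sub>V b\<in>?s ?z. ?z b \<odot>\<^sub>V b)" by (simp only: M.finsum_empty)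
  have uniq: "g = h" if "\<exists>!x. P x" "P g" "P h" for P :: "('c => 'a) => bool" and g h using that by blast
  have "?c = ?z"
  proof (rule uniq[OF ex[OF M.zero_closed]], intro conjI 1)
   show "finite (?s ?c)" using B(1) by simp
   show "?c \<in> B \<rightarrow>\<^sub>E carrier K" using c(1) by auto
   show "?e ?z \<zero>\<^sub>V"
    by (intro conjI 2) (use B(1) in auto)
  qed
  thus "\<forall>b\<in>B. c b = \<zero>\<^sub>K" by (metis restrict_apply')
 qed
 moreover have "x \<in> span B" if x: "x \<in> carrier V" for x
 proof -
  obtain c where c: "c \<in> B \<rightarrow>\<^sub>E carrier K" "x = (\<Oplus>\<^sub>V b\<in>{b \<in> B. c b \<noteq> \<zero>\<^sub>K}. c b \<odot>\<^sub>V b)"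
   using ex1_implies_ex[OF ex[OF x]] by blast
  hence "x = lincomb c B" using lincomb_support[OF B, of c] unfolding PiE_def by blast
  thus ?thesis using finite_span[OF B] c(1) by auto
 qed
 ultimately show "lin_indpt B \<and> carrier V \<subseteq> span B" by blast
next
 assume b: "lin_indpt B \<and> carrier V \<subseteq> span B"
 show "is_basis K V B"
  unfolding is_basis_def
 proof (intro conjI ballI B(2))
  fix x assume "x \<in> carrier V"
  then obtain a where a: "a \<in> B \<rightarrow> carrier K" "lincomb a B = x"
   using finite_in_span[OF B] b by blast
  let ?a = "restrict a B"
  have "lincomb ?a B = lincomb a B" unfolding lincomb_def
   by (intro M.finsum_cong') (use B a(1) in auto)
  moreover have ar: "?a \<in> B \<rightarrow> carrier K" using a(1) by auto
  ultimately have 1: "x = (\<Oplus>\<^sub>V b\<in>?s ?a. ?a b \<odot>\<^sub>V b)"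
   unfolding lincomb_support[OF B ar] using a(2) by simp
  show "\<exists>!c. ?e c x"
  proof (intro ex1I[of _ ?a] conjI)
   fix c assume c: "?e c x"
   have cK: "c \<in> B \<rightarrow> carrier K" using c by auto
   have "lincomb c B = lincomb a B" using lincomb_support[OF B cK] c a(2) by simp
   hence z: "lincomb (\<lambda>b. c b \<ominus>\<^sub>K a b) B = \<zero>\<^sub>V" by (rule lincomb_diff_eq[OF B cK a(1)])
   have "c b = a b" if "b \<in> B" for b
   proof (rule ccontr)
    assume "c b \<noteq> a b"
    hence "c b \<ominus>\<^sub>K a b \<noteq> \<zero>\<^sub>K" using r_right_minus_eq cK a(1) \<open>b \<in> B\<close> by (auto simp: Pi_iff)
    moreover have "(\<lambda>b. c b \<ominus>\<^sub>K a b) \<in> B \<rightarrow> carrier K" using cK a(1) by auto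
    ultimately have "lin_dep B" using lin_dep_crit[OF B(1) order_refl _ \<open>b \<in> B\<close> _ z] by blast
    thus False using b by blast
   qed
   thus "c = ?a" using c by (intro extensionalityI[of _ B]) (auto simp: PiE_def)
  qed (use a B 1 in auto)
 qed
qed
qed

text \<open>The definite description in \<open>vdim\<close> denotes something because any two finite
  bases have the same size.\<close>

lemma vdim_eq:
 assumes B: "finite B" "B \<subseteq> carrier V" "lin_indpt B" "carrier V \<subseteq> span B"
 shows "vdim K V = card B"
 unfolding vdim_def
proof (rule the_equality)
 show "free_of_rank K V (card B)"
  unfolding free_of_rank_def using B is_basis_iff[OF B(1,2)] module_axioms by blast
 fix r assume "free_of_rank K V r"
 then obtain B' where B': "is_basis K V B'" "finite B'" "card B' = r" unfolding free_of_rank_def by blast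
 have BV: "B' \<subseteq> carrier V" using B'(1) unfolding is_basis_def by blast
 hence "lin_indpt B'" "carrier V \<subseteq> span B'" using is_basis_iff[OF B'(2) BV] B'(1) by auto
 hence "card B' \<le> card B" "card B \<le> card B'"
  using card_le_of_indpt[of B' B] card_le_of_indpt[of B B'] B B' BV by blast+
 thus "r = card B" using B'(3) by simp
qed

lemma vdim_submodule:
 assumes U: "submodule K U V" and B: "finite B" "B \<subseteq> U" "lin_indpt B" "U \<subseteq> span B"
 shows "vdim K (V\<lparr>carrier := U\<rparr>) = card B"
proof -
 interpret U: module K "V\<lparr>carrier := U\<rparr>" by (rule submodule_is_module[OF U])
 interpret U: vectorspace K "V\<lparr>carrier := U\<rparr>" ..
 have "U.span B = span B" "U.lin_dep B = lin_dep B" using span_li_not_depend[OF B(2) U] by auto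
 thus ?thesis using U.vdim_eq[OF B(1)] B by simp
qed

text \<open>The bound provides an independent set of greatest size, and a vector outside its span
  would enlarge it.\<close>

lemma exists_basis_of_bounded:
 assumes UV: "U \<subseteq> carrier V" and bound: "!!W. finite W ==> W \<subseteq> U ==> lin_indpt W ==> card W \<le> n"
 obtains W where "finite W" "W \<subseteq> U" "lin_indpt W" "U \<subseteq> span W"
proof -
 let ?P = "\<lambda>W. finite W \<and> W \<subseteq> U \<and> lin_indpt W"
 have "?P {}" by (auto simp: lin_dep_def)
 moreover have "\<forall>W. ?P W \<longrightarrow> card W < Suc n" using bound by (simp add: less_Suc_eq_le)
 ultimately have "\<exists>W. ?P W \<and> (\<forall>W'. ?P W' \<longrightarrow> card W' \<le> card W)"
  by (rule ex_has_greatest_nat)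
 then obtain W where W: "?P W" "\<forall>W'. ?P W' \<longrightarrow> card W' \<le> card W" by blast
 have WV: "W \<subseteq> carrier V" using W(1) UV by blast
 have "x \<in> span W" if x: "x \<in> U" for x
 proof (rule ccontr)
  assume nx: "x \<notin> span W"
  hence "x \<notin> W" using in_own_span[OF WV] by blast
  have "lin_indpt (W \<union> {x})"
   using lin_dep_iff_in_span[OF WV _ _ \<open>x \<notin> W\<close>] W(1) nx x UV by blast
  hence "?P (W \<union> {x})" using W(1) x by simp
  hence "card (W \<union> {x}) \<le> card W" by (rule W(2)[rule_format])
  thus False using \<open>x \<notin> W\<close> W(1) by simp
 qed
 thus thesis using that W(1) by blast
qed

end

lemma quot_module_facts:
 assumes M: "abelian_group M" and S: "additive_subgroup S M"
 shows "carrier (quot_module M S) = (\<lambda>x. S +>\<^bsub>M\<^esub> x) ` carrier M"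
  and "x \<in> carrier M ==> y \<in> carrier M ==>
   (S +>\<^bsub>M\<^esub> x) \<oplus>\<^bsub>quot_module M S\<^esub> (S +>\<^bsub>M\<^esub> y) = S +>\<^bsub>M\<^esub> (x \<oplus>\<^sub>M y)"
  and "x \<in> carrier M ==> S +>\<^bsub>M\<^esub> x = S \<longleftrightarrow> x \<in> S"
  and "x \<in> carrier M ==> (!!y. y \<in> carrier M ==> r \<odot>\<^sub>M y \<in> carrier M) ==>
   (!!y z. y \<in> carrier M ==> z \<in> carrier M ==> r \<odot>\<^sub>M (y \<oplus>\<^sub>M z) = r \<odot>\<^sub>M y \<oplus>\<^sub>M r \<odot>\<^sub>M z) ==>
   (!!y. y \<in> S ==> r \<odot>\<^sub>M y \<in> S) ==> r \<odot>\<^bsub>quot_module M S\<^esub> (S +>\<^bsub>M\<^esub> x) = S +>\<^bsub>M\<^esub> (r \<odot>\<^sub>M x)"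
proof -
 interpret M: abelian_group M by (rule M)
 interpret S: abelian_subgroup S M by (rule abelian_subgroupI3[OF S M])
 show "carrier (quot_module M S) = (\<lambda>x. S +>\<^bsub>M\<^esub> x) ` carrier M"
  by (auto simp: quot_module_def A_RCOSETS_def')
 show "x \<in> carrier M ==> y \<in> carrier M ==>
   (S +>\<^bsub>M\<^esub> x) \<oplus>\<^bsub>quot_module M S\<^esub> (S +>\<^bsub>M\<^esub> y) = S +>\<^bsub>M\<^esub> (x \<oplus>\<^sub>M y)"
  by (simp add: quot_module_def S.a_rcos_sum)
 show zero: "x \<in> carrier M ==> S +>\<^bsub>M\<^esub> x = S \<longleftrightarrow> x \<in> S" for x
  using M.a_coset_join1[OF _ _ S.a_subgroup] M.a_coset_join2[OF _ S.a_subgroup] by blast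
 assume x: "x \<in> carrier M" and r: "!!y. y \<in> carrier M ==> r \<odot>\<^sub>M y \<in> carrier M"
  "!!y z. y \<in> carrier M ==> z \<in> carrier M ==> r \<odot>\<^sub>M (y \<oplus>\<^sub>M z) = r \<odot>\<^sub>M y \<oplus>\<^sub>M r \<odot>\<^sub>M z"
  "!!y. y \<in> S ==> r \<odot>\<^sub>M y \<in> S"
 have "S +>\<^bsub>M\<^esub> (r \<odot>\<^sub>M y) = S +>\<^bsub>M\<^esub> (r \<odot>\<^sub>M x)" if "y \<in> S +>\<^bsub>M\<^esub> x" for y
 proof -
  obtain s where s: "s \<in> S" "y = s \<oplus>\<^sub>M x"
   using \<open>y \<in> S +>\<^bsub>M\<^esub> x\<close> by (auto simp: a_r_coset_def')
  have sM: "s \<in> carrier M" using s(1) S.a_subset by blast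
  have "S +>\<^bsub>M\<^esub> (r \<odot>\<^sub>M y) = (S +>\<^bsub>M\<^esub> (r \<odot>\<^sub>M s)) +>\<^bsub>M\<^esub> (r \<odot>\<^sub>M x)"
   using s(2) sM x r(1,2) S.a_subset by (simp add: M.a_coset_add_assoc)
  also have "S +>\<^bsub>M\<^esub> (r \<odot>\<^sub>M s) = S" using zero[OF r(1)[OF sM]] r(3)[OF s(1)] by blast
  finally show ?thesis .
 qed
 moreover have "S +>\<^bsub>M\<^esub> x \<noteq> {}" using S.zero_closed unfolding a_r_coset_def' by blast
 ultimately have "(\<Union>y\<in>S +>\<^bsub>M\<^esub> x. S +>\<^bsub>M\<^esub> (r \<odot>\<^sub>M y)) = S +>\<^bsub>M\<^esub> (r \<odot>\<^sub>M x)"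
  by (intro SUP_eq_const)
 thus "r \<odot>\<^bsub>quot_module M S\<^esub> (S +>\<^bsub>M\<^esub> x) = S +>\<^bsub>M\<^esub> (r \<odot>\<^sub>M x)"
  by (simp add: quot_module_def)
qed

section \<open>Actions of the ring of integers on free modules\<close>

text \<open>An abstract form of the action of the ring of integers on omega_H: linear over the
  valuation ring, with the p-adic integers acting as scalars. From here on group schemes enter only
  through an instance of this locale.\<close>

locale lattice_action = padic_uniformiser K v p F j d \<pi> e + free_valued_module K v M B
 for K :: "('k, 'm) ring_scheme" (structure) and v p and F :: "'f ring" and j d \<pi> e
  and M :: "('k, 'c, 'n) module_scheme" and B +
 fixes act :: "'f => 'c => 'c"
 assumes act_closed: "b \<in> carrier OF ==> x \<in> carrier M ==> act b x \<in> carrier M"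
  and act_add: "b \<in> carrier OF ==> x \<in> carrier M ==> y \<in> carrier M ==>
   act b (x \<oplus>\<^sub>M y) = act b x \<oplus>\<^sub>M act b y"
  and act_smult: "b \<in> carrier OF ==> t \<in> vint ==> x \<in> carrier M ==> act b (t \<odot>\<^sub>M x) = t \<odot>\<^sub>M act b x"
  and act_plus: "a \<in> carrier OF ==> b \<in> carrier OF ==> x \<in> carrier M ==>
   act (a \<oplus>\<^sub>F b) x = act a x \<oplus>\<^sub>M act b x"
  and act_mult: "a \<in> carrier OF ==> b \<in> carrier OF ==> x \<in> carrier M ==>
   act (a \<otimes>\<^sub>F b) x = act a (act b x)"
  and act_Zp: "z \<in> Zp K v ==> x \<in> carrier M ==> act (j z) x = z \<odot>\<^sub>M x"
begin

abbreviation iop :: "'f => ('c \<times> 'k) list set => ('c \<times> 'k) list set" where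
 "iop b \<equiv> base_change_map OK K M (act b)"

lemma act_linear: "b \<in> carrier OF ==> act b \<in> Defs.linear_map OK M M"
 unfolding Defs.linear_map_def using act_closed act_add act_smult by auto

lemma iop_lin: "b \<in> carrier OF ==> VV.lin_op (iop b)"
 by (rule base_change_map_lin_op[OF act_linear])

lemma iop_emb: "b \<in> carrier OF ==> x \<in> carrier M ==> iop b (emb x) = emb (act b x)"
 by (rule base_change_map_emb[OF act_linear])

lemmas iop_closed = VV.lin_opD(1)[OF iop_lin]
lemmas iop_add = VV.lin_opD(2)[OF iop_lin]
lemmas iop_smult = VV.lin_opD(3)[OF iop_lin]

text \<open>Every tensor becomes an element of the image of \<open>M\<close> after a nonzero
  scaling, so operators may be compared there.\<close>

lemma lin_op_ext:
 assumes S: "VV.lin_op S" "VV.lin_op S'" and eq: "!!x. x \<in> carrier M ==> S (emb x) = S' (emb x)"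
  and C: "C \<in> carrier VM"
 shows "S C = S' C"
proof -
 obtain t x where t: "t \<in> vint" "t \<noteq> \<zero>" "x \<in> carrier M" "t \<odot>\<^sub>VM C = emb x"
  using clear_denominators[OF C] by blast
 have tK: "t \<in> carrier K" using t(1) by simp
 note SC = VV.lin_opD(1)[OF S(1) C] VV.lin_opD(1)[OF S(2) C]
 have "t \<odot>\<^sub>VM S C = t \<odot>\<^sub>VM S' C"
  using VV.lin_opD(3)[OF S(1) tK C] VV.lin_opD(3)[OF S(2) tK C] eq[OF t(3)] t(4) by simp
 thus ?thesis by (rule VV.smult_left_cancel[OF tK t(2) SC])
qed

lemma iop_plus:
 assumes "a \<in> carrier OF" "b \<in> carrier OF" "C \<in> carrier VM"
 shows "iop (a \<oplus>\<^sub>F b) C = iop a C \<oplus>\<^sub>VM iop b C"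
proof (rule lin_op_ext[OF iop_lin _ _ assms(3)])
 show ab: "a \<oplus>\<^sub>F b \<in> carrier OF" by (rule OF_ops(5)[OF assms(1,2)])
 show "VV.lin_op (\<lambda>C. iop a C \<oplus>\<^sub>VM iop b C)"
  unfolding VV.lin_op_def using assms(1,2)
  by (auto simp: iop_closed iop_add iop_smult VG.a_ac VV.smult_r_distr)
 show "iop (a \<oplus>\<^sub>F b) (emb x) = iop a (emb x) \<oplus>\<^sub>VM iop b (emb x)" if "x \<in> carrier M" for x
  using that assms(1,2) ab by (simp add: iop_emb act_plus emb_add act_closed)
qed

lemma iop_mult:
 assumes "a \<in> carrier OF" "b \<in> carrier OF" "C \<in> carrier VM"
 shows "iop (a \<otimes>\<^sub>F b) C = iop a (iop b C)"
proof (rule lin_op_ext[OF iop_lin _ _ assms(3)])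
 show ab: "a \<otimes>\<^sub>F b \<in> carrier OF" by (rule OF_ops(4)[OF assms(1,2)])
 show "VV.lin_op (\<lambda>C. iop a (iop b C))"
  unfolding VV.lin_op_def using assms(1,2) by (auto simp: iop_closed iop_add iop_smult)
 show "iop (a \<otimes>\<^sub>F b) (emb x) = iop a (iop b (emb x))" if "x \<in> carrier M" for x
  using that assms(1,2) ab by (simp add: iop_emb act_mult act_closed)
qed

lemma iop_Zp:
 assumes z: "z \<in> Zp K v" and C: "C \<in> carrier VM"
 shows "iop (j z) C = z \<odot>\<^sub>VM C"
proof (rule lin_op_ext[OF iop_lin[OF j_Zp_OF[OF z]] _ _ C])
 show "VV.lin_op (\<lambda>C. z \<odot>\<^sub>VM C)"
  unfolding VV.lin_op_def using Zp_carrier[OF z] by (auto simp: VV.smult_r_distr VV.smult_assoc1[symmetric] m_comm)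
 show "iop (j z) (emb x) = z \<odot>\<^sub>VM emb x" if "x \<in> carrier M" for x
  using that iop_emb[OF j_Zp_OF[OF z] that] act_Zp[OF z that] emb_smult[of z x] Zp_carrier[OF z] Zp_v[OF z] by simp
qed

section \<open>The action of the field on the base change\<close>

abbreviation pF :: "nat => 'f" where "pF k \<equiv> nat_in F (p ^ k)"

lemma j_nat: "j (nat_in K m) = nat_in F m"
proof (induction m)
 case (Suc m)
 thus ?case using j_add[OF nat_in_Qp[of m] Qp_ops(2)] j_one by simp
qed (simp add: j_zero)

lemma iop_p_pow:
 assumes "b \<in> carrier OF" "C \<in> carrier VM"
 shows "iop (pF k \<otimes>\<^sub>F b) C = pp [^] k \<odot>\<^sub>VM iop b C"
 using iop_Zp[OF nat_in_Zp[of "p ^ k"] iop_closed[OF assms]] iop_mult[OF OF_nat assms, of "p ^ k"]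
 unfolding j_nat by (simp add: nat_in_pow)

text \<open>The action of the field \<open>F\<close> on \<open>M \<otimes> K\<close>, as in \<open>omega_K_act\<close>.\<close>

definition dexp :: "'f => nat" where
 "dexp b = (LEAST m. pF m \<otimes>\<^sub>F b \<in> carrier OF)"

definition op :: "'f => ('c \<times> 'k) list set => ('c \<times> 'k) list set" where
 "op b C = inv (nat_in K (p ^ dexp b)) \<odot>\<^sub>VM iop (pF (dexp b) \<otimes>\<^sub>F b) C"

lemma pF_dexp: "b \<in> carrier F ==> pF (dexp b) \<otimes>\<^sub>F b \<in> carrier OF"
 unfolding dexp_def using clear_p_denominator[of b] by (metis (mono_tags, lifting) LeastI)

lemma pF_closed: "pF k \<in> carrier F"
 by simp

lemma pF_add: "x \<in> carrier F ==> pF (k + m) \<otimes>\<^sub>F x = pF k \<otimes>\<^sub>F (pF m \<otimes>\<^sub>F x)"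
proof -
 assume "x \<in> carrier F"
 moreover have "pF (k + m) = pF k \<otimes>\<^sub>F pF m"
  unfolding j_nat[symmetric] power_add nat_in_mult by (rule j_mult[OF nat_in_Qp nat_in_Qp])
 ultimately show ?thesis by (simp add: FF.m_assoc)
qed

lemma op_lin: assumes b: "b \<in> carrier F" shows "VV.lin_op (op b)"
proof -
 let ?i = "inv (nat_in K (p ^ dexp b))" and ?b = "pF (dexp b) \<otimes>\<^sub>F b"
 have "?i \<in> carrier K" using pp_inv(1)[of "dexp b"] by (simp add: nat_in_pow)
 thus ?thesis
  unfolding VV.lin_op_def op_def using pF_dexp[OF b]
  by (auto simp: iop_closed iop_add iop_smult VV.smult_r_distr VV.smult_assoc1[symmetric] m_comm)
qed

lemmas op_closed = VV.lin_opD(1)[OF op_lin]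
lemmas op_add = VV.lin_opD(2)[OF op_lin]
lemmas op_smult = VV.lin_opD(3)[OF op_lin]

text \<open>Every power of \<open>p\<close> that clears the denominator of \<open>b\<close> gives
  the same operator; \<open>dexp\<close> is just the least exponent.\<close>

lemma op_eq:
 assumes b: "b \<in> carrier F" "pF k \<otimes>\<^sub>F b \<in> carrier OF" and C: "C \<in> carrier VM"
 shows "pp [^] k \<odot>\<^sub>VM op b C = iop (pF k \<otimes>\<^sub>F b) C"
proof -
 define m where "m = dexp b"
 note mO = pF_dexp[OF b(1), folded m_def] and i = pp_inv[of m]
 have "pp [^] k \<odot>\<^sub>VM iop (pF m \<otimes>\<^sub>F b) C = pp [^] m \<odot>\<^sub>VM iop (pF k \<otimes>\<^sub>F b) C"
  using iop_p_pow[OF mO C, of k] iop_p_pow[OF b(2) C, of m] pF_add[OF b(1), of k m] pF_add[OF b(1), of m k]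
  by (simp add: add.commute)
 hence "inv (pp [^] m) \<odot>\<^sub>VM (pp [^] k \<odot>\<^sub>VM iop (pF m \<otimes>\<^sub>F b) C) = iop (pF k \<otimes>\<^sub>F b) C"
  using i iop_closed[OF b(2) C] by (simp add: VV.smult_assoc1[symmetric] m_comm)
 thus ?thesis
  unfolding op_def m_def[symmetric] using i iop_closed[OF mO C]
  by (simp add: nat_in_pow VV.smult_assoc1[symmetric] m_comm del: add.nat_pow_Suc)
qed

text \<open>Identities between the operators \<open>op\<close> can be checked after multiplication
  by a denominator common to all the elements involved.\<close>

lemma op_unique:
 assumes b: "b \<in> carrier F" "pF k \<otimes>\<^sub>F b \<in> carrier OF" and C: "C \<in> carrier VM" "D \<in> carrier VM"
  and "iop (pF k \<otimes>\<^sub>F b) C = pp [^] k \<odot>\<^sub>VM D"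
 shows "op b C = D"
 by (rule VV.smult_left_cancel[OF _ pp_pow_nonzero[of k] op_closed[OF b(1) C(1)] C(2)])
   (use op_eq[OF b C(1)] assms(5) in simp_all)

lemma op_emb: "b \<in> carrier OF ==> x \<in> carrier M ==> op b (emb x) = emb (act b x)"
 by (rule op_unique[of b 0]) (auto simp: OF_closed emb_closed act_closed iop_emb)

lemma op_plus:
 assumes "a \<in> carrier F" "b \<in> carrier F" and C: "C \<in> carrier VM"
 shows "op (a \<oplus>\<^sub>F b) C = op a C \<oplus>\<^sub>VM op b C"
proof -
 define k where "k = dexp b + dexp a"
 have O: "pF k \<otimes>\<^sub>F a \<in> carrier OF" "pF k \<otimes>\<^sub>F b \<in> carrier OF"
  using pF_add[OF assms(1), of "dexp b" "dexp a"] pF_add[OF assms(2), of "dexp a" "dexp b"]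
   OF_ops(4)[OF OF_nat pF_dexp] assms(1,2) by (simp_all add: k_def add.commute)
 have s: "pF k \<otimes>\<^sub>F (a \<oplus>\<^sub>F b) = pF k \<otimes>\<^sub>F a \<oplus>\<^sub>F pF k \<otimes>\<^sub>F b"
  using assms(1,2) by (simp add: FF.r_distr)
 show ?thesis
 proof (rule op_unique[of _ k])
  show "iop (pF k \<otimes>\<^sub>F (a \<oplus>\<^sub>F b)) C = pp [^] k \<odot>\<^sub>VM (op a C \<oplus>\<^sub>VM op b C)"
   unfolding s using iop_plus[OF O C] op_eq[OF assms(1) O(1) C] op_eq[OF assms(2) O(2) C] op_closed assms
   by (simp add: VV.smult_r_distr)
  show "pF k \<otimes>\<^sub>F (a \<oplus>\<^sub>F b) \<in> carrier OF" unfolding s by (rule OF_ops(5)[OF O])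
 qed (use assms op_closed in auto)
qed

lemma op_mult:
 assumes "a \<in> carrier F" "b \<in> carrier F" and C: "C \<in> carrier VM"
 shows "op (a \<otimes>\<^sub>F b) C = op a (op b C)"
proof -
 define k l where "k = dexp a" and "l = dexp b"
 have O: "pF k \<otimes>\<^sub>F a \<in> carrier OF" "pF l \<otimes>\<^sub>F b \<in> carrier OF" using pF_dexp assms by (auto simp: k_def l_def)
 have s: "pF (k + l) \<otimes>\<^sub>F (a \<otimes>\<^sub>F b) = (pF k \<otimes>\<^sub>F a) \<otimes>\<^sub>F (pF l \<otimes>\<^sub>F b)"
  using pF_add[of "a \<otimes>\<^sub>F b" k l] assms(1,2) pF_closed by (simp add: FF.m_ac del: FF.add.nat_pow_Suc)
 show ?thesis
 proof (rule op_unique[of _ "k + l"])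
  have "iop ((pF k \<otimes>\<^sub>F a) \<otimes>\<^sub>F (pF l \<otimes>\<^sub>F b)) C = iop (pF k \<otimes>\<^sub>F a) (pp [^] l \<odot>\<^sub>VM op b C)"
   using iop_mult[OF O C] op_eq[OF assms(2) O(2) C] by simp
  also have "\<dots> = pp [^] l \<odot>\<^sub>VM (pp [^] k \<odot>\<^sub>VM op a (op b C))"
   using op_closed assms iop_smult[OF O(1), of "pp [^] l" "op b C"] op_eq[OF assms(1) O(1), of "op b C"] by simp
  also have "\<dots> = pp [^] (k + l) \<odot>\<^sub>VM op a (op b C)"
   using op_closed assms by (simp add: VV.smult_assoc1[symmetric] nat_pow_mult add.commute)
  finally show "iop (pF (k + l) \<otimes>\<^sub>F (a \<otimes>\<^sub>F b)) C = pp [^] (k + l) \<odot>\<^sub>VM op a (op b C)" unfolding s .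
  show "pF (k + l) \<otimes>\<^sub>F (a \<otimes>\<^sub>F b) \<in> carrier OF" unfolding s by (rule OF_ops(4)[OF O])
 qed (use assms op_closed in auto)
qed

lemma op_commute:
 "a \<in> carrier F ==> b \<in> carrier F ==> C \<in> carrier VM ==> op a (op b C) = op b (op a C)"
 using op_mult[of a b C] op_mult[of b a C] FF.m_comm[of a b] by simp

lemma op_j: assumes x: "x \<in> Qp K v" and C: "C \<in> carrier VM" shows "op (j x) C = x \<odot>\<^sub>VM C"
proof -
 obtain k :: nat where k: "pp [^] k \<otimes> x \<in> Zp K v" using Qp_clear[OF x] .
 have e: "pF k \<otimes>\<^sub>F j x = j (pp [^] k \<otimes> x)"
  using j_mult[OF nat_in_Qp x, of "p ^ k"] unfolding j_nat by (simp add: nat_in_pow)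
 show ?thesis
  by (rule op_unique[of _ k], unfold e iop_Zp[OF k C])
    (use x C Qp_closed j_closed j_Zp_OF[OF k] in \<open>auto simp: VV.smult_assoc1\<close>)
qed

lemma op_pow: "b \<in> carrier F ==> C \<in> carrier VM ==> op (b [^]\<^sub>F n) C = (op b ^^ n) C \<and> (op b ^^ n) C \<in> carrier VM"
proof (induction n)
 case 0
 thus ?case using op_j[OF Qp_ops(2), of C] by (simp add: j_one)
next
 case (Suc n)
 have "op (b [^]\<^sub>F Suc n) C = op b (op (b [^]\<^sub>F n) C)"
  using op_mult[of b "b [^]\<^sub>F n" C] FF.m_comm Suc.prems by simp
 thus ?case using Suc op_closed by simp
qed

text \<open>\<open>b\<close> is a root of the polynomial of its conjugates, and \<open>op\<close> is
  an action of \<open>F\<close> extending the scalars of the p-adic numbers, so \<open>op b\<close>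
  satisfies this polynomial as well. Its roots are distinct, hence \<open>op b\<close> can be
  diagonalised.\<close>

lemma op_annihilated:
 assumes b: "b \<in> carrier F"
 obtains ys where "distinct ys" "set ys = conj_set b" "set ys \<subseteq> carrier K"
  "\<forall>C\<in>carrier VM. VV.op_prod (op b) ys C = \<zero>\<^sub>VM"
proof -
 obtain ys where ys: "distinct ys" "set ys = conj_set b" "set ys \<subseteq> carrier K"
  "set (root_poly ys) \<subseteq> Qp K v" "FF.eval (map j (root_poly ys)) b = \<zero>\<^sub>F"
  using conjugate_polynomial[OF b] .
 have "VV.op_prod (op b) ys C = \<zero>\<^sub>VM" if C: "C \<in> carrier VM" for C
 proof -
  define P where "P = rec_list \<zero>\<^sub>VM (\<lambda>c cs r. c \<odot>\<^sub>VM (op b ^^ length cs) C \<oplus>\<^sub>VM r)"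
  have P: "P (c # cs) = c \<odot>\<^sub>VM (op b ^^ length cs) C \<oplus>\<^sub>VM P cs" "P [] = \<zero>\<^sub>VM" for c cs
   by (simp_all add: P_def)
  have zero: "op \<zero>\<^sub>F C = \<zero>\<^sub>VM" using op_j[OF Qp_ops(1) C] C by (simp add: j_zero)
  have "FF.eval (map j cs) b \<in> carrier F \<and> P cs = op (FF.eval (map j cs) b) C" if "set cs \<subseteq> Qp K v" for cs
   using that
  proof (induction cs)
   case Nil thus ?case using zero by (simp add: P)
  next
   case (Cons c cs)
   have c: "c \<in> Qp K v" "j c \<in> carrier F" using Cons.prems j_closed by auto
   have "op (j c \<otimes>\<^sub>F b [^]\<^sub>F length cs) C = c \<odot>\<^sub>VM (op b ^^ length cs) C"
    using op_mult[OF c(2) _ C, of "b [^]\<^sub>F length cs"] op_pow[OF b C, of "length cs"] op_j[OF c(1)] b by simp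
   thus ?case using Cons op_plus[OF _ _ C, of "j c \<otimes>\<^sub>F b [^]\<^sub>F length cs" "FF.eval (map j cs) b"] c b by (simp add: P)
  qed
  from this[OF ys(4)] have "P (root_poly ys) = \<zero>\<^sub>VM" using ys(5) zero by simp
  moreover have "P (root_poly ys) = VV.op_prod (op b) ys C"
   by (rule VV.poly_op_root_poly[where P = P, OF op_lin[OF b] ys(3) C P])
  ultimately show ?thesis by simp
 qed
 hence "\<forall>C\<in>carrier VM. VV.op_prod (op b) ys C = \<zero>\<^sub>VM" by blast
 thus thesis by (rule that[OF ys(1-3)])
qed

definition eig :: "('f => 'k) => ('c \<times> 'k) list set set" where
 "eig \<tau> = {C \<in> carrier VM. \<forall>b\<in>carrier F. op b C = \<tau> b \<odot>\<^sub>VM C}"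

text \<open>The elements of \<open>F\<close> that act on \<open>y\<close> by a scalar form a
  subalgebra over the p-adic numbers; it contains a basis, so it is all of \<open>F\<close>. As
  \<open>y\<close> is nonzero the scalars are unique, and uniqueness makes them a ring
  homomorphism.\<close>

lemma joint_eigenvector:
 assumes y: "y \<in> carrier VM" "y \<noteq> \<zero>\<^sub>VM"
  and us: "set us \<subseteq> carrier F" "FF.Span (j ` Qp K v) us = carrier F"
  and ev: "!!u. u \<in> set us ==> \<exists>c\<in>carrier K. op u y = c \<odot>\<^sub>VM y"
 shows "\<exists>\<tau>\<in>Emb (carrier F). y \<in> eig \<tau>"
proof -
 define A where "A = {x \<in> carrier F. \<exists>c\<in>carrier K. op x y = c \<odot>\<^sub>VM y}"
 have add: "op (x \<oplus>\<^sub>F x') y = (c \<oplus> c') \<odot>\<^sub>VM y" and mult: "op (x \<otimes>\<^sub>F x') y = (c \<otimes> c') \<odot>\<^sub>VM y"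
  if "x \<in> carrier F" "x' \<in> carrier F" "c \<in> carrier K" "c' \<in> carrier K" "op x y = c \<odot>\<^sub>VM y" "op x' y = c' \<odot>\<^sub>VM y" for x x' c c'
  using that op_plus[of x x' y] op_mult[of x x' y] op_smult[of x c' y] y(1)
  by (simp_all add: VV.smult_l_distr VV.smult_assoc1[symmetric] m_comm)
 have jA: "j x \<in> A" if "x \<in> Qp K v" for x
  using op_j[OF that y(1)] j_closed[OF that] Qp_closed[OF that] by (auto simp: A_def)
 have "FF.combine Ks us \<in> A" if "set Ks \<subseteq> j ` Qp K v" for Ks
 proof -
  have A: "x \<oplus>\<^sub>F x' \<in> A" "x \<otimes>\<^sub>F x' \<in> A" if "x \<in> A" "x' \<in> A" for x x'
   using that add mult unfolding A_def by (auto 4 4)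
  have "\<zero>\<^sub>F \<in> A" using jA[OF Qp_ops(1)] j_zero by simp
  moreover have "set us \<subseteq> A" using ev us(1) by (auto simp: A_def)
  ultimately show ?thesis using that jA by (induction Ks us rule: FF.combine.induct) (auto intro!: A)
 qed
 hence all: "\<exists>c\<in>carrier K. op x y = c \<odot>\<^sub>VM y" if "x \<in> carrier F" for x
  using that us(2) FF.Span_eq_combine_set[OF jQp_subfield us(1)] unfolding A_def by auto
 define \<tau> where "\<tau> = (\<lambda>x\<in>carrier F. SOME c. c \<in> carrier K \<and> op x y = c \<odot>\<^sub>VM y)"
 have tau: "\<tau> x \<in> carrier K" "op x y = \<tau> x \<odot>\<^sub>VM y" if "x \<in> carrier F" for x
  using someI_ex[of "\<lambda>c. c \<in> carrier K \<and> op x y = c \<odot>\<^sub>VM y"] all[OF that] that unfolding \<tau>_def by auto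
 have uniq: "\<tau> x = c" if "x \<in> carrier F" "c \<in> carrier K" "op x y = c \<odot>\<^sub>VM y" for x c
  using VV.smult_right_cancel[OF tau(1) _ y] tau(2) that by simp
 have j: "\<tau> (j x) = x" if "x \<in> Qp K v" for x
  by (rule uniq[OF j_closed[OF that] Qp_closed[OF that] op_j[OF that y(1)]])
 have "\<tau> \<in> ring_hom F K"
 proof (rule ring_hom_memI)
  show "\<tau> \<one>\<^sub>F = \<one>" using j[OF Qp_ops(2)] by (simp add: j_one)
  show "\<tau> x \<in> carrier K" if "x \<in> carrier F" for x by (rule tau(1)[OF that])
  fix x x' assume x: "x \<in> carrier F" "x' \<in> carrier F"
  note t = x tau(1)[OF x(1)] tau(1)[OF x(2)] tau(2)[OF x(1)] tau(2)[OF x(2)]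
  show "\<tau> (x \<otimes>\<^sub>F x') = \<tau> x \<otimes> \<tau> x'" "\<tau> (x \<oplus>\<^sub>F x') = \<tau> x \<oplus> \<tau> x'"
   by (rule uniq; use x t mult[OF t] add[OF t] in simp)+
 qed
 hence "\<tau> \<in> Emb (carrier F)" using j unfolding embeddings_def \<tau>_def by simp
 thus ?thesis using y(1) tau(2) unfolding eig_def by blast
qed

end

section \<open>Simultaneous diagonalisation and the eigenspaces of the embeddings\<close>

lemma (in vectorspace) span_subset_span:
 assumes "S \<subseteq> span S'" "S' \<subseteq> carrier V" shows "span S \<subseteq> span S'"
 by (rule span_is_subset[OF assms(1) span_is_submodule[OF assms(2)]])

context lattice_action
begin

definition stable :: "('c \<times> 'k) list set set => bool" where
 "stable U \<longleftrightarrow> submodule K U VM \<and> (\<forall>b\<in>carrier F. \<forall>x\<in>U. op b x \<in> U)"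

lemma stable_carrier: "stable U ==> U \<subseteq> carrier VM"
 by (simp add: stable_def submodule_def)

text \<open>The part of a stable subspace where the operators \<open>op b\<close> for \<open>b\<close> in \<open>A\<close> act through given scalars.\<close>

lemma stable_eigen:
 assumes U: "stable U" and "A \<subseteq> carrier F" "!!b. b \<in> A ==> c b \<in> carrier K"
 shows "stable {y \<in> U. \<forall>b\<in>A. op b y = c b \<odot>\<^sub>VM y}" (is "stable ?W")
proof -
 have s: "submodule K U VM" and st: "!!b x. b \<in> carrier F ==> x \<in> U ==> op b x \<in> U"
  using U by (auto simp: stable_def)
 have sub: "\<zero>\<^sub>VM \<in> U" "!!x y. x \<in> U ==> y \<in> U ==> x \<oplus>\<^sub>VM y \<in> U"
  "!!k x. k \<in> carrier K ==> x \<in> U ==> k \<odot>\<^sub>VM x \<in> U"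
  using s by (auto simp: submodule_def)
 have UV: "x \<in> carrier VM" if "x \<in> U" for x using that stable_carrier[OF U] by blast
 have b: "b \<in> carrier F" "c b \<in> carrier K" if "b \<in> A" for b using that assms(2,3) by auto
 have 1: "\<zero>\<^sub>VM \<in> ?W" using sub(1) b VV.lin_op_zero[OF op_lin] by simp
 have 2: "x \<oplus>\<^sub>VM y \<in> ?W" if "x \<in> ?W" "y \<in> ?W" for x y
  using that b sub(2) UV by (simp add: op_add VV.smult_r_distr)
 have 3: "k \<odot>\<^sub>VM x \<in> ?W" if k: "k \<in> carrier K" and x: "x \<in> ?W" for k x
 proof -
  have "op b (k \<odot>\<^sub>VM x) = c b \<odot>\<^sub>VM (k \<odot>\<^sub>VM x)" if "b \<in> A" for b
   using b[OF that] k x that UV op_smult[of b k x] m_comm[of k "c b"] by (simp add: VV.smult_assoc1[symmetric])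
  thus ?thesis using sub(3)[OF k] x by simp
 qed
 have "submodule K ?W VM"
  by (rule submodule.intro[OF module_VM _ 2 1 3]) (use UV in auto)
 moreover have "op a x \<in> ?W" if a: "a \<in> carrier F" and x: "x \<in> ?W" for a x
 proof -
  have "op b (op a x) = c b \<odot>\<^sub>VM op a x" if "b \<in> A" for b
   using op_commute[OF b(1)[OF that] a UV, of x] op_smult[OF a b(2)[OF that] UV, of x] x that by simp
  thus ?thesis using st[OF a] x by simp
 qed
 ultimately show ?thesis by (simp add: stable_def)
qed

text \<open>The operators commute, so the eigenspaces of one of them in a stable subspace are stable
  again and the remaining ones can be diagonalised inside them.\<close>

lemma joint_span:
 assumes "stable U" "set bs \<subseteq> carrier F"
 shows "U \<subseteq> VV.span {y \<in> U. \<forall>b\<in>set bs. \<exists>c\<in>carrier K. op b y = c \<odot>\<^sub>VM y}"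
 using assms
proof (induction bs arbitrary: U)
 case Nil
 thus ?case using VV.in_own_span[of U] stable_carrier by simp
next
 case (Cons b bs)
 note UV = stable_carrier[OF Cons.prems(1)]
 have b: "b \<in> carrier F" "set bs \<subseteq> carrier F" using Cons.prems by auto
 let ?S = "\<lambda>U bs. {y \<in> U. \<forall>b\<in>set bs. \<exists>c\<in>carrier K. op b y = c \<odot>\<^sub>VM y}"
 have SV: "?S U (b # bs) \<subseteq> carrier VM" using UV by blast
 show ?case
 proof
  fix x assume x: "x \<in> U"
  hence xV: "x \<in> carrier VM" using UV by blast
  obtain ys where ys: "distinct ys" "set ys = conj_set b" "set ys \<subseteq> carrier K"
   "\<forall>C\<in>carrier VM. VV.op_prod (op b) ys C = \<zero>\<^sub>VM"
   by (rule op_annihilated[OF b(1)])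
  have "submodule K U VM" "!!x. x \<in> U ==> op b x \<in> U" using Cons.prems(1) b(1) by (auto simp: stable_def)
  from VV.eigen_decomposition[OF op_lin[OF b(1)] this ys(1,3) x bspec[OF ys(4) xV]]
  obtain f where f: "!!c. c \<in> set ys ==> f c \<in> U \<and> op b (f c) = c \<odot>\<^sub>VM f c" "x = (\<Oplus>\<^sub>VM c\<in>set ys. f c)"
   by metis
  have "f c \<in> VV.span (?S U (b # bs))" if c: "c \<in> set ys" for c
  proof -
   let ?Uc = "{y \<in> U. \<forall>b'\<in>{b}. op b' y = c \<odot>\<^sub>VM y}"
   have cK: "c \<in> carrier K" using c ys(3) by blast
   have "stable ?Uc" using stable_eigen[OF Cons.prems(1), of "{b}" "\<lambda>_. c"] b(1) cK by simp
   from Cons.IH[OF this b(2)] have "f c \<in> VV.span (?S ?Uc bs)" using f(1)[OF c] by blast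
   moreover have "?S ?Uc bs \<subseteq> ?S U (b # bs)" using cK by auto
   ultimately show ?thesis using VV.span_is_monotone by blast
  qed
  thus "x \<in> VV.span (?S U (b # bs))"
   unfolding f(2) by (intro VV.submodule_finsum[OF VV.span_is_submodule[OF SV]]) auto
 qed
qed

text \<open>Diagonalising the finite list of operators given by a basis of \<open>F\<close>
  suffices, since its joint eigenvectors already belong to embeddings.\<close>

lemma span_eig:
 assumes U: "stable U" shows "U \<subseteq> VV.span (\<Union>\<tau>\<in>Emb (carrier F). eig \<tau> \<inter> U)" (is "_ \<subseteq> VV.span ?E")
proof -
 obtain us where us: "set us \<subseteq> carrier F" "FF.Span (j ` Qp K v) us = carrier F"
  using FF.exists_base[OF jQp_subfield finite_dimension_F] by blast
 have EV: "?E \<subseteq> carrier VM" using stable_carrier[OF U] by blast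
 have "y \<in> VV.span ?E" if y: "y \<in> U" "\<forall>b\<in>set us. \<exists>c\<in>carrier K. op b y = c \<odot>\<^sub>VM y" for y
 proof (cases "y = \<zero>\<^sub>VM")
  case True
  thus ?thesis using VV.span_is_submodule[OF EV] by (simp add: submodule_def)
 next
  case False
  have "y \<in> carrier VM" using y(1) stable_carrier[OF U] by blast
  then obtain \<tau> where "\<tau> \<in> Emb (carrier F)" "y \<in> eig \<tau>" using joint_eigenvector[OF _ False us] y(2) by blast
  thus ?thesis using VV.in_own_span[OF EV] y(1) by blast
 qed
 hence "{y \<in> U. \<forall>b\<in>set us. \<exists>c\<in>carrier K. op b y = c \<odot>\<^sub>VM y} \<subseteq> VV.span ?E" by blast
 from VV.span_subset_span[OF this EV] show ?thesis using joint_span[OF U us(1)] by blast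
qed

lemma stable_carrier_VM: "stable (carrier VM)"
 unfolding stable_def submodule_def using op_closed module_VM by auto

lemma eig_stable: assumes "\<tau> \<in> Emb (carrier F)" shows "stable (eig \<tau>)"
 using stable_eigen[OF stable_carrier_VM order_refl, of \<tau>] EmbD(1)[OF assms]
 by (simp add: eig_def)

end

section \<open>The piece of the lattice above one unramified embedding\<close>

lemma self_module_simps [simp]:
 "carrier (self_module R) = carrier R" "ring.add (self_module R) = ring.add R"
 "ring.zero (self_module R) = ring.zero R" "module.smult (self_module R) = monoid.mult R"
 by (simp_all add: self_module_def)

lemma (in cring) self_module_group: "abelian_group (self_module R)"
 by (rule abelian_groupI) (auto simp: a_ac intro!: bexI[of _ "\<ominus> _"] l_neg)

lemma (in cring) self_module_subgroup:
 assumes I: "additive_subgroup I R" shows "additive_subgroup I (self_module R)"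
proof -
 interpret I: additive_subgroup I R by (rule I)
 interpret S: abelian_group "self_module R" by (rule self_module_group)
 show ?thesis
  unfolding additive_subgroup_def
 proof (rule group.subgroupI[OF S.a_group])
  show "I \<subseteq> carrier (add_monoid (self_module R))" using I.a_subset by simp
  show "I \<noteq> {}" using I.zero_closed by blast
  show "x \<otimes>\<^bsub>add_monoid (self_module R)\<^esub> y \<in> I" if "x \<in> I" "y \<in> I" for x y
   using I.a_closed[OF \<open>x \<in> I\<close> \<open>y \<in> I\<close>] by simp
  show "inv\<^bsub>add_monoid (self_module R)\<^esub> x \<in> I" if "x \<in> I" for x
  proof -
   have "x \<in> carrier R" using \<open>x \<in> I\<close> I.a_subset by blast
   hence "\<ominus>\<^bsub>self_module R\<^esub> x = \<ominus> x" using S.minus_equality[of "\<ominus> x" x] by (simp add: l_neg)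
   thus ?thesis using I.a_inv_closed[OF \<open>x \<in> I\<close>] by (simp add: a_inv_def)
  qed
 qed
qed

text \<open>\<open>N\<close> is the part of the lattice where the integers of \<open>E\<close> act
  through \<upsilon>, and \<open>h\<close> is an isomorphism from its quotient by the image of
  \<open>\<pi>\<close> to the direct sum, as provided by \<open>hdg_int_tuple\<close>.\<close>

locale graded_piece = lattice_action K v p F j d \<pi> e M B act
 for K :: "('k, 'm) ring_scheme" (structure) and v p and F :: "'f ring" and j d \<pi> e
  and M :: "('k, 'c, 'n) module_scheme" and B act +
 fixes E :: "'f set" and \<upsilon> :: "'f => 'k" and n :: nat and a :: "nat => 'k" and N :: "'c set"
  and h :: "'c set => nat => 'k set"
 assumes E: "subfield E F" "j ` Qp K v \<subseteq> E" and upsilon: "\<upsilon> \<in> Emb E"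
  and N_def: "N = {x \<in> carrier M. \<forall>b\<in>carrier (OE E). act b x = \<upsilon> b \<odot>\<^sub>M x}"
  and a_vint: "i \<in> {1..n} ==> a i \<in> vint \<and> a i \<noteq> \<zero>"
  and h_linear: "h \<in> Defs.linear_map OK (quot_module (M\<lparr>carrier := N\<rparr>) (act \<pi> ` N))
    (fin_direct_sum {1..n} (\<lambda>i. quot_module (self_module OK) (PIdl\<^bsub>OK\<^esub> (a i))))"
  and h_bij: "bij_betw h (carrier (quot_module (M\<lparr>carrier := N\<rparr>) (act \<pi> ` N)))
    (carrier (fin_direct_sum {1..n} (\<lambda>i. quot_module (self_module OK) (PIdl\<^bsub>OK\<^esub> (a i)))))"
begin

lemma OE_OF: "b \<in> carrier (OE E) ==> b \<in> carrier OF" "b \<in> carrier (OE E) ==> b \<in> E"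
 "b \<in> carrier (OE E) ==> b \<in> carrier F"
proof -
 note m = int_ring_mem[OF subringE(1)[OF subfieldE(1)[OF E(1)]]]
 assume b: "b \<in> carrier (OE E)"
 thus "b \<in> E" using m by blast
 thus bO: "b \<in> carrier OF" using b m OF_mem subringE(1)[OF subfieldE(1)[OF E(1)]] by blast
 show "b \<in> carrier F" by (rule OF_closed[OF bO])
qed

text \<open>By \<open>emb_conjugate\<close> the value is also taken by an embedding of
  \<open>F\<close>, and all of these are integral at \<open>b\<close>.\<close>

lemma upsilon_vint: assumes b: "b \<in> carrier (OE E)" shows "\<upsilon> b \<in> vint"
proof -
 have "\<upsilon> b \<in> conj_set b" by (rule emb_conjugate[OF upsilon subfieldE(1)[OF E(1)] E(2) OE_OF(2)[OF b]])
 then obtain t where t: "t \<in> Emb (carrier F)" "\<upsilon> b = t b" by blast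
 have "0 \<le> v (t b)" using iffD1[OF OF_mem OE_OF(1)[OF b]] t(1) by blast
 thus ?thesis using t(2) EmbD(1)[OF t(1) OF_closed[OF OE_OF(1)[OF b]]] by simp
qed

lemma upsilon_K: "b \<in> carrier (OE E) ==> \<upsilon> b \<in> carrier K"
 using upsilon_vint by blast

text \<open>By \<open>emb_U_iff\<close> and \<open>U_scaled\<close> this is the
  \<open>K\<close>-span of the image of \<open>N\<close>.\<close>

definition U :: "('c \<times> 'k) list set set" where
 "U = {C \<in> carrier VM. \<forall>b\<in>carrier (OE E). op b C = \<upsilon> b \<odot>\<^sub>VM C}"

lemma stable_U: "stable U"
 using stable_eigen[OF stable_carrier_VM, of "carrier (OE E)" \<upsilon>] OE_OF(3) upsilon_K
 unfolding U_def by blast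

lemma emb_U_iff: assumes x: "x \<in> carrier M" shows "emb x \<in> U \<longleftrightarrow> x \<in> N"
proof -
 have "op b (emb x) = \<upsilon> b \<odot>\<^sub>VM emb x \<longleftrightarrow> act b x = \<upsilon> b \<odot>\<^sub>M x" if b: "b \<in> carrier (OE E)" for b
 proof -
  have 1: "op b (emb x) = emb (act b x)" by (rule op_emb[OF OE_OF(1)[OF b] x])
  have 2: "\<upsilon> b \<odot>\<^sub>VM emb x = emb (\<upsilon> b \<odot>\<^sub>M x)" using emb_smult[OF upsilon_vint[OF b] x] by simp
  have 3: "act b x \<in> carrier M" "\<upsilon> b \<odot>\<^sub>M x \<in> carrier M"
   using act_closed[OF OE_OF(1)[OF b] x] Mod.smult_closed[of "\<upsilon> b" x] upsilon_vint[OF b] x by auto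
  show ?thesis unfolding 1 2 using emb_inj[OF 3] by metis
 qed
 thus ?thesis using x emb_closed[OF x] unfolding U_def N_def by blast
qed

lemma N_carrier: "N \<subseteq> carrier M"
 unfolding N_def by blast

lemma U_scaled: assumes "C \<in> U" obtains t where "t \<in> vint" "t \<noteq> \<zero>" "t \<odot>\<^sub>VM C \<in> emb ` N"
proof -
 have C: "C \<in> carrier VM" using assms stable_carrier[OF stable_U] by blast
 obtain t x where t: "t \<in> vint" "t \<noteq> \<zero>" "x \<in> carrier M" "t \<odot>\<^sub>VM C = emb x"
  using clear_denominators[OF C] by blast
 have "t \<odot>\<^sub>VM C \<in> U" using stable_U assms t(1) by (auto simp: stable_def submodule_def)
 hence "x \<in> N" using emb_U_iff[OF t(3)] t(4) by simp
 thus thesis using that[OF t(1,2)] t(4) by blast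
qed

lemma N_closed:
 "\<zero>\<^sub>M \<in> N" "x \<in> N ==> y \<in> N ==> x \<oplus>\<^sub>M y \<in> N" "t \<in> vint ==> x \<in> N ==> t \<odot>\<^sub>M x \<in> N"
 "b \<in> carrier OF ==> x \<in> N ==> act b x \<in> N"
proof -
 have s: "submodule K U VM" and st: "!!b x. b \<in> carrier OF ==> x \<in> U ==> op b x \<in> U"
  using stable_U OF_closed by (auto simp: stable_def)
 have NM: "x \<in> carrier M" if "x \<in> N" for x using that N_carrier by blast
 have eU: "emb x \<in> U" if "x \<in> N" for x using emb_U_iff[OF NM[OF that]] that by blast
 show "\<zero>\<^sub>M \<in> N" using emb_U_iff[of "\<zero>\<^sub>M"] emb_zero s by (simp add: submodule_def)
 show "x \<in> N ==> y \<in> N ==> x \<oplus>\<^sub>M y \<in> N"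
  using emb_U_iff[of "x \<oplus>\<^sub>M y"] emb_add[of x y] NM eU s by (simp add: submodule_def)
 show "t \<in> vint ==> x \<in> N ==> t \<odot>\<^sub>M x \<in> N"
  using emb_U_iff[of "t \<odot>\<^sub>M x"] emb_smult[of t x] NM eU s Mod.smult_closed[of t x] by (simp add: submodule_def)
 show "b \<in> carrier OF ==> x \<in> N ==> act b x \<in> N"
  using emb_U_iff[of "act b x"] op_emb[of b x] act_closed[of b x] NM st[of b "emb x"] eU by simp
qed

abbreviation N' :: "('k, 'c, 'n) module_scheme" where "N' \<equiv> M\<lparr>carrier := N\<rparr>"
abbreviation S :: "'c set" where "S \<equiv> act \<pi> ` N"
abbreviation I :: "nat => 'k set" where "I i \<equiv> PIdl\<^bsub>OK\<^esub> (a i)"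

lemma module_N': "module OK N'"
 by (rule Mod.submodule_is_module, rule submodule.intro[OF module_M N_carrier N_closed(2) N_closed(1)])
   (use N_closed(3) in simp_all)

lemma S_N: "S \<subseteq> N"
 using N_closed(4)[OF pi_OF] by blast

lemma cring_OK: "cring OK"
 using module_M by (simp add: module_def)

lemma subgroup_S: "additive_subgroup S N'"
proof -
 interpret N': module OK N' by (rule module_N')
 have NM: "x \<in> carrier M" if "x \<in> N" for x using that N_carrier by blast
 show ?thesis
  unfolding additive_subgroup_def
 proof (rule group.subgroupI[OF N'.M.a_group])
  show "S \<subseteq> carrier (add_monoid N')" using S_N by simp
  show "S \<noteq> {}" using N_closed(1) by blast
  show "x \<otimes>\<^bsub>add_monoid N'\<^esub> y \<in> S" if "x \<in> S" "y \<in> S" for x y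
  proof -
   obtain x' y' where xy: "x' \<in> N" "y' \<in> N" "x = act \<pi> x'" "y = act \<pi> y'"
    using \<open>x \<in> S\<close> \<open>y \<in> S\<close> by blast
   have "x \<oplus>\<^sub>M y = act \<pi> (x' \<oplus>\<^sub>M y')" using act_add[OF pi_OF NM NM] xy by simp
   thus ?thesis using N_closed(2)[OF xy(1,2)] by simp
  qed
  show "inv\<^bsub>add_monoid N'\<^esub> x \<in> S" if "x \<in> S" for x
  proof -
   obtain x' where x: "x' \<in> N" "x = act \<pi> x'" using \<open>x \<in> S\<close> by blast
   have xN: "x \<in> N" using S_N \<open>x \<in> S\<close> by blast
   let ?m = "\<ominus>\<^sub>OK \<one>\<^sub>OK"
   have m: "?m \<in> carrier OK" using cring.cring_simprules(3)[OF cring_OK Mod.one_closed] .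
   have "\<ominus>\<^sub>N' x = ?m \<odot>\<^sub>N' x"
    using N'.smult_l_minus[of "\<one>\<^sub>OK" x] N'.smult_one[of x] xN Mod.one_closed by (simp del: OK_simps)
   also have "\<dots> = act \<pi> (?m \<odot>\<^sub>M x')" using act_smult[OF pi_OF _ NM[OF x(1)], of ?m] m x by simp
   finally have "\<ominus>\<^sub>N' x \<in> S" using N_closed(3)[OF _ x(1), of ?m] m by simp
   thus ?thesis by (simp add: a_inv_def)
  qed
 qed
qed

abbreviation Q where "Q \<equiv> quot_module N' S"
abbreviation Scl :: "'c => 'c set" where "Scl y \<equiv> S +>\<^bsub>N'\<^esub> y"
abbreviation D where "D i \<equiv> quot_module (self_module OK) (I i)"
abbreviation dcl :: "nat => 'k => 'k set" where "dcl i z \<equiv> I i +>\<^bsub>self_module OK\<^esub> z"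

lemma Q_facts:
 "carrier Q = Scl ` N" "x \<in> N ==> y \<in> N ==> Scl x \<oplus>\<^sub>Q Scl y = Scl (x \<oplus>\<^sub>M y)"
 "x \<in> N ==> Scl x = S \<longleftrightarrow> x \<in> S" "t \<in> vint ==> x \<in> N ==> t \<odot>\<^sub>Q Scl x = Scl (t \<odot>\<^sub>M x)"
proof -
 interpret N': module OK N' by (rule module_N')
 note q = quot_module_facts[OF N'.M.abelian_group_axioms subgroup_S]
 show "carrier Q = Scl ` N" using q(1) by simp
 show "x \<in> N ==> y \<in> N ==> Scl x \<oplus>\<^sub>Q Scl y = Scl (x \<oplus>\<^sub>M y)" using q(2)[of x y] by simp
 show "x \<in> N ==> Scl x = S \<longleftrightarrow> x \<in> S" using q(3)[of x] by simp
 assume t: "t \<in> vint" and x: "x \<in> N"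
 have tO: "t \<in> carrier OK" using t by simp
 have "t \<odot>\<^sub>M y \<in> S" if "y \<in> S" for y
 proof -
  obtain y' where y: "y' \<in> N" "y = act \<pi> y'" using \<open>y \<in> S\<close> by blast
  have "t \<odot>\<^sub>M y = act \<pi> (t \<odot>\<^sub>M y')" using act_smult[OF pi_OF t, of y'] y N_carrier by auto
  thus ?thesis using N_closed(3)[OF t y(1)] by simp
 qed
 thus "t \<odot>\<^sub>Q Scl x = Scl (t \<odot>\<^sub>M x)"
  using q(4)[of x t] x N'.smult_closed[OF tO] N'.smult_r_distr[OF tO] by simp
qed

lemma I_iff: "i \<in> {1..n} ==> z \<in> I i \<longleftrightarrow> (\<exists>t\<in>vint. z = t \<otimes> a i)"
 by (auto simp: cgenideal_def)

lemma D_facts: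
 assumes i: "i \<in> {1..n}"
 shows "carrier (D i) = dcl i ` vint" "x \<in> vint ==> y \<in> vint ==> dcl i x \<oplus>\<^bsub>D i\<^esub> dcl i y = dcl i (x \<oplus> y)"
  "x \<in> vint ==> dcl i x = I i \<longleftrightarrow> x \<in> I i" "t \<in> vint ==> x \<in> vint ==> t \<odot>\<^bsub>D i\<^esub> dcl i x = dcl i (t \<otimes> x)"
proof -
 have aO: "a i \<in> carrier OK" using a_vint[OF i] by simp
 interpret J: ideal "I i" OK by (rule Mod.cgenideal_ideal[OF aO])
 note q = quot_module_facts[OF Mod.self_module_group Mod.self_module_subgroup[OF J.additive_subgroup_axioms]]
 show "carrier (D i) = dcl i ` vint" using q(1) by simp
 show "x \<in> vint ==> y \<in> vint ==> dcl i x \<oplus>\<^bsub>D i\<^esub> dcl i y = dcl i (x \<oplus> y)" using q(2)[of x y] by simp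
 show "x \<in> vint ==> dcl i x = I i \<longleftrightarrow> x \<in> I i" using q(3)[of x] by simp
 assume t: "t \<in> vint" and x: "x \<in> vint"
 have tO: "t \<in> carrier OK" using t by simp
 show "t \<odot>\<^bsub>D i\<^esub> dcl i x = dcl i (t \<otimes> x)"
  using q(4)[of x t] x Mod.m_closed[OF tO] Mod.r_distr[OF _ _ tO] J.I_l_closed[OF _ tO] by simp
qed

abbreviation DS where "DS \<equiv> fin_direct_sum {1..n} D"
abbreviation dcls :: "(nat => 'k) => nat => 'k set" where "dcls z \<equiv> (\<lambda>i\<in>{1..n}. dcl i (z i))"

definition coeffs :: "(nat => 'k) => bool" where
 "coeffs z \<longleftrightarrow> (\<forall>i. z i \<in> vint) \<and> (\<forall>i. i \<notin> {1..n} \<longrightarrow> z i = \<zero>)"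

text \<open>A relation and not a map, since \<open>z\<close> is a representative in the valuation
  ring of the class that \<open>h\<close> assigns to \<open>y\<close>, and is determined only modulo
  the \<open>a i\<close>.\<close>

definition \<rho> :: "('c \<times> 'k) list set => (nat => 'k) => bool" where
 "\<rho> x z \<longleftrightarrow> coeffs z \<and> (\<exists>y\<in>N. x = emb y \<and> h (Scl y) = dcls z)"

lemma dcls_carrier: "coeffs z ==> dcls z \<in> carrier DS"
 unfolding fin_direct_sum_def coeffs_def using D_facts(1) by auto

lemma dcls_surj: assumes "w \<in> carrier DS" obtains z where "coeffs z" "w = dcls z"
proof -
 have w: "w \<in> (\<Pi>\<^sub>E i\<in>{1..n}. carrier (D i))" using assms by (simp add: fin_direct_sum_def)
 have "\<forall>i\<in>{1..n}. \<exists>z\<in>vint. w i = dcl i z"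
 proof
  fix i assume i: "i \<in> {1..n}"
  have "w i \<in> carrier (D i)" by (rule PiE_mem[OF w i])
  thus "\<exists>z\<in>vint. w i = dcl i z" unfolding D_facts(1)[OF i] by blast
 qed
 then obtain z where z: "!!i. i \<in> {1..n} ==> z i \<in> vint \<and> w i = dcl i (z i)" by metis
 let ?z = "\<lambda>i. if i \<in> {1..n} then z i else \<zero>"
 have "coeffs ?z" using z by (auto simp: coeffs_def)
 moreover have "w = dcls ?z"
  by (rule extensionalityI[of _ "{1..n}"]) (use w z in \<open>auto simp: PiE_iff\<close>)
 ultimately show thesis by (rule that)
qed

lemma h_cl:
 assumes "y \<in> N" shows "h (Scl y) \<in> carrier DS"
 using h_linear Q_facts(1) assms unfolding Defs.linear_map_def by blast

lemma h_lin:
 "x \<in> N ==> y \<in> N ==> h (Scl (x \<oplus>\<^sub>M y)) = h (Scl x) \<oplus>\<^sub>DS h (Scl y)"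
 "t \<in> vint ==> x \<in> N ==> h (Scl (t \<odot>\<^sub>M x)) = t \<odot>\<^sub>DS h (Scl x)"
proof -
 have h: "!!C C'. C \<in> carrier Q ==> C' \<in> carrier Q ==> h (C \<oplus>\<^sub>Q C') = h C \<oplus>\<^sub>DS h C'"
  "!!t C. t \<in> carrier OK ==> C \<in> carrier Q ==> h (t \<odot>\<^sub>Q C) = t \<odot>\<^sub>DS h C"
  using h_linear unfolding Defs.linear_map_def by blast+
 have c: "Scl x \<in> carrier Q" if "x \<in> N" for x using that Q_facts(1) by blast
 show "x \<in> N ==> y \<in> N ==> h (Scl (x \<oplus>\<^sub>M y)) = h (Scl x) \<oplus>\<^sub>DS h (Scl y)"
  using h(1)[OF c c, of x y] Q_facts(2)[of x y] by simp
 show "t \<in> vint ==> x \<in> N ==> h (Scl (t \<odot>\<^sub>M x)) = t \<odot>\<^sub>DS h (Scl x)"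
  using h(2)[OF _ c, of t x] Q_facts(4)[of t x] by simp
qed

lemma dcls_ops:
 "coeffs z ==> coeffs z' ==> dcls z \<oplus>\<^sub>DS dcls z' = dcls (\<lambda>i. z i \<oplus> z' i)"
 "t \<in> vint ==> coeffs z ==> t \<odot>\<^sub>DS dcls z = dcls (\<lambda>i. t \<otimes> z i)"
 unfolding coeffs_def fin_direct_sum_def by (auto intro!: restrict_ext simp: D_facts(2,4))

lemma rho_add: assumes "\<rho> x z" "\<rho> y z'" shows "\<rho> (x \<oplus>\<^sub>VM y) (\<lambda>i. z i \<oplus> z' i)"
proof -
 obtain u w where u: "u \<in> N" "x = emb u" "h (Scl u) = dcls z" and w: "w \<in> N" "y = emb w" "h (Scl w) = dcls z'"
  and c: "coeffs z" "coeffs z'"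
  using assms unfolding \<rho>_def by blast
 have "coeffs (\<lambda>i. z i \<oplus> z' i)" using c v_add_ge[of _ _ 0] by (auto simp: coeffs_def)
 moreover have "x \<oplus>\<^sub>VM y = emb (u \<oplus>\<^sub>M w)" using emb_add[of u w] u w N_carrier by auto
 ultimately show ?thesis
  unfolding \<rho>_def using h_lin(1)[OF u(1) w(1)] u(3) w(3) dcls_ops(1)[OF c] N_closed(2)[OF u(1) w(1)] by auto
qed

lemma rho_smult: assumes t: "t \<in> vint" and "\<rho> x z" shows "\<rho> (t \<odot>\<^sub>VM x) (\<lambda>i. t \<otimes> z i)"
proof -
 obtain u where u: "u \<in> N" "x = emb u" "h (Scl u) = dcls z" and c: "coeffs z"
  using assms unfolding \<rho>_def by blast
 have "coeffs (\<lambda>i. t \<otimes> z i)" using c vint_mult[OF t] t by (auto simp: coeffs_def)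
 moreover have "t \<odot>\<^sub>VM x = emb (t \<odot>\<^sub>M u)" using emb_smult[OF t, of u] u N_carrier by auto
 ultimately show ?thesis
  unfolding \<rho>_def using h_lin(2)[OF t u(1)] u(3) dcls_ops(2)[OF t c] N_closed(3)[OF t u(1)] by auto
qed

lemma rho_total: assumes "x \<in> emb ` N" shows "\<exists>z. \<rho> x z"
proof -
 obtain y where y: "y \<in> N" "x = emb y" using assms by blast
 obtain z where "coeffs z" "h (Scl y) = dcls z" by (rule dcls_surj[OF h_cl[OF y(1)]])
 thus ?thesis using y unfolding \<rho>_def by blast
qed

lemma rho_surj: assumes "coeffs z" shows "\<exists>x. \<rho> x z"
proof -
 have "dcls z \<in> h ` (Scl ` N)" unfolding Q_facts(1)[symmetric] using dcls_carrier[OF assms] h_bij by (simp add: bij_betw_def)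
 then obtain y where "y \<in> N" "h (Scl y) = dcls z" by (metis (no_types, lifting) imageE)
 hence "\<rho> (emb y) z" unfolding \<rho>_def using assms by blast
 thus ?thesis ..
qed

lemma rho_zero_zero: "\<rho> \<zero>\<^sub>VM (\<lambda>_. \<zero>)"
proof -
 obtain z where z: "\<rho> (emb \<zero>\<^sub>M) z" using rho_total N_closed(1) by blast
 have 0: "\<zero> \<in> vint" by simp
 have "\<zero> \<odot>\<^sub>VM emb \<zero>\<^sub>M = \<zero>\<^sub>VM" using emb_zero by simp
 moreover have "(\<lambda>i. \<zero> \<otimes> z i) = (\<lambda>_. \<zero>)" using z by (auto simp: \<rho>_def coeffs_def)
 ultimately show ?thesis using rho_smult[OF 0 z] by simp
qed

lemma emb_N_inj: "y \<in> N ==> y' \<in> N ==> emb y = emb y' ==> y = y'"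
 using emb_inj N_carrier by blast

lemma h_cl_zero: "h (Scl \<zero>\<^sub>M) = dcls (\<lambda>_. \<zero>)"
 using rho_zero_zero emb_N_inj[OF N_closed(1)] unfolding \<rho>_def emb_zero[symmetric] by blast

lemma zero_S: "\<zero>\<^sub>M \<in> S"
proof -
 have "act \<pi> \<zero>\<^sub>M \<oplus>\<^sub>M act \<pi> \<zero>\<^sub>M = act \<pi> \<zero>\<^sub>M" using act_add[OF pi_OF, of "\<zero>\<^sub>M" "\<zero>\<^sub>M"] by simp
 hence "act \<pi> \<zero>\<^sub>M = \<zero>\<^sub>M" using act_closed[OF pi_OF, of "\<zero>\<^sub>M"] by simp
 thus ?thesis using N_closed(1) by force
qed

lemma rho_ker: "\<rho> x (\<lambda>_. \<zero>) \<longleftrightarrow> x \<in> op \<pi> ` emb ` N"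
proof
 assume "\<rho> x (\<lambda>_. \<zero>)"
 then obtain y where y: "y \<in> N" "x = emb y" "h (Scl y) = h (Scl \<zero>\<^sub>M)" unfolding \<rho>_def h_cl_zero by blast
 have "Scl y = Scl \<zero>\<^sub>M"
  using y(1,3) h_bij N_closed(1) unfolding bij_betw_def inj_on_def Q_facts(1) by blast
 hence "y \<in> S" using Q_facts(3)[OF y(1)] Q_facts(3)[OF N_closed(1)] zero_S by blast
 then obtain y' where y': "y' \<in> N" "y = act \<pi> y'" by blast
 hence "x = op \<pi> (emb y')" using y(2) op_emb[OF pi_OF, of y'] N_carrier by blast
 thus "x \<in> op \<pi> ` emb ` N" using y'(1) by blast
next
 assume "x \<in> op \<pi> ` emb ` N"
 then obtain y where y: "y \<in> N" "x = op \<pi> (emb y)" by blast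
 have "act \<pi> y \<in> N" "act \<pi> y \<in> S" using y(1) N_closed(4)[OF pi_OF] by auto
 moreover have "x = emb (act \<pi> y)" using y op_emb[OF pi_OF] N_carrier by auto
 moreover have "Scl (act \<pi> y) = Scl \<zero>\<^sub>M" using calculation Q_facts(3) N_closed(1) zero_S by blast
 moreover have "coeffs (\<lambda>_. \<zero>)" by (simp add: coeffs_def)
 ultimately show "\<rho> x (\<lambda>_. \<zero>)" unfolding \<rho>_def using h_cl_zero by metis
qed

lemma rho_zero:
 assumes z: "coeffs z" shows "\<rho> \<zero>\<^sub>VM z \<longleftrightarrow> (\<forall>i\<in>{1..n}. \<exists>t\<in>vint. z i = t \<otimes> a i)"
proof -
 have restr: "restrict f A = restrict g A \<longleftrightarrow> (\<forall>x\<in>A. f x = g x)" for f g :: "nat => 'k set" and A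
  by (auto simp: restrict_def fun_eq_iff)
 have "\<rho> \<zero>\<^sub>VM z \<longleftrightarrow> h (Scl \<zero>\<^sub>M) = dcls z"
  unfolding \<rho>_def emb_zero[symmetric] using z N_closed(1) emb_N_inj[OF N_closed(1)] by blast
 also have "\<dots> \<longleftrightarrow> (\<forall>i\<in>{1..n}. dcl i \<zero> = dcl i (z i))"
  unfolding h_cl_zero by (rule restr)
 also have "\<dots> \<longleftrightarrow> (\<forall>i\<in>{1..n}. z i \<in> I i)"
 proof (intro ball_cong HOL.refl)
  fix i assume i: "i \<in> {1..n}"
  have "\<zero> = \<zero> \<otimes> a i" "\<zero> \<in> vint" using a_vint[OF i] by simp_all
  hence "\<zero> \<in> I i" unfolding I_iff[OF i] by blast
  hence "dcl i \<zero> = I i" using D_facts(3)[OF i, of \<zero>] by simp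
  moreover have "z i \<in> vint" using z unfolding coeffs_def by blast
  ultimately show "dcl i \<zero> = dcl i (z i) \<longleftrightarrow> z i \<in> I i" using D_facts(3)[OF i, of "z i"] by auto
 qed
 finally show ?thesis using I_iff by simp
qed

text \<open>The operator \<open>T\<close> is the action of \<open>\<pi>\<close>, its roots
  \<open>ms\<close> are the conjugates of \<open>\<pi>\<close>, and \<open>\<epsilon>\<close> is
  their common valuation 1/e.\<close>

lemma elementary_divisors_rho:
 assumes ms: "distinct ms" "set ms = conj_set \<pi>" "\<forall>C\<in>carrier VM. VV.op_prod (op \<pi>) ms C = \<zero>\<^sub>VM"
 shows "elementary_divisors K v VM (emb ` N) forms (op \<pi>) ms (1 / real e) n a \<rho>"
proof (intro elementary_divisors.intro elementary_divisors_axioms.intro)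
 show "lattice_space K v VM (emb ` N) forms" by (rule lattice_space_image[OF N_carrier N_closed(1-3)])
 show "VV.lin_op (op \<pi>)" by (rule op_lin[OF pi_F])
 show "op \<pi> x \<in> emb ` N" if "x \<in> emb ` N" for x
  using that op_emb[OF pi_OF] N_closed(4)[OF pi_OF] N_carrier by auto
 show "m \<in> carrier K \<and> m \<noteq> \<zero> \<and> rv m = 1 / real e" if "m \<in> set ms" for m
 proof -
  obtain t where t: "t \<in> Emb (carrier F)" "m = t \<pi>" using \<open>m \<in> set ms\<close> ms(2) by auto
  thus ?thesis using EmbD(1)[OF t(1) pi_F] v_pi(1)[OF t(1)] by (auto simp: rv_def)
 qed
 show "0 < 1 / real e" using v_pi(2)[OF theta] by simp
 show "VV.op_prod (op \<pi>) ms x = \<zero>\<^sub>VM" if "x \<in> emb ` N" for x using that ms(3) emb_closed N_carrier by auto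
 show "x \<in> emb ` N \<and> (\<forall>i. z i \<in> vint) \<and> (\<forall>i. i \<notin> {1..n} \<longrightarrow> z i = \<zero>)" if "\<rho> x z" for x z
  using that by (auto simp: \<rho>_def coeffs_def)
 show "\<exists>x. \<rho> x z" if "!!i. z i \<in> vint" "!!i. i \<notin> {1..n} ==> z i = \<zero>" for z
  by (rule rho_surj) (use that in \<open>auto simp: coeffs_def\<close>)
 show "\<rho> \<zero>\<^sub>VM z \<longleftrightarrow> (\<forall>i\<in>{1..n}. \<exists>t\<in>vint. z i = t \<otimes> a i)"
  if "!!i. z i \<in> vint" "!!i. i \<notin> {1..n} ==> z i = \<zero>" for z
  by (rule rho_zero) (use that in \<open>auto simp: coeffs_def\<close>)
qed (use a_vint ms(1) rho_add rho_smult rho_total rho_ker in auto)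

abbreviation Over :: "('f => 'k) set" where "Over \<equiv> {\<tau> \<in> Emb (carrier F). restrict \<tau> E = \<upsilon>}"

lemma eig_carrier: "eig \<tau> \<subseteq> carrier VM"
 by (auto simp: eig_def)

lemma E_carrier: "b \<in> E ==> b \<in> carrier F"
 using subringE(1)[OF subfieldE(1)[OF E(1)]] by blast

lemma eig_U: assumes "\<tau> \<in> Over" shows "eig \<tau> \<subseteq> U"
proof -
 have "\<tau> b = \<upsilon> b" if "b \<in> E" for b using assms that by auto
 thus ?thesis unfolding U_def eig_def using OE_OF(2,3) by auto
qed

text \<open>On a nonzero vector of both spaces an integer of \<open>E\<close> acts by \<tau> and by
  \<upsilon>, so the two agree on integers; an arbitrary element of \<open>E\<close> becomes
  integral after multiplication by a power of \<open>p\<close>.\<close>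

lemma eig_over:
 assumes t: "\<tau> \<in> Emb (carrier F)" and x: "x \<in> eig \<tau>" "x \<in> U" "x \<noteq> \<zero>\<^sub>VM" shows "\<tau> \<in> Over"
proof -
 have xV: "x \<in> carrier VM" using x(1) eig_carrier by blast
 have sE: "subring E F" by (rule subfieldE(1)[OF E(1)])
 have eq: "\<tau> b = \<upsilon> b" if b: "b \<in> E" for b
 proof -
  have bF: "b \<in> carrier F" by (rule E_carrier[OF b])
  obtain m :: nat where m: "nat_in F (p ^ m) \<otimes>\<^sub>F b \<in> carrier OF" by (rule clear_p_denominator[OF bF])
  let ?c = "nat_in F (p ^ m) \<otimes>\<^sub>F b"
  have nE: "nat_in F k \<in> E" for k by (induction k) (use subringE(2,3,7)[OF sE] in auto)
  have cE: "?c \<in> E" using subringE(6)[OF sE nE b] .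
  have "?c \<in> carrier (OE E)"
   using int_ring_mem[OF subringE(1)[OF sE]] cE iffD1[OF OF_mem m] by blast
  hence "op ?c x = \<upsilon> ?c \<odot>\<^sub>VM x" "op ?c x = \<tau> ?c \<odot>\<^sub>VM x"
   using x OF_closed[OF m] by (auto simp: U_def eig_def)
  moreover have cK: "\<upsilon> ?c \<in> carrier K" "\<tau> ?c \<in> carrier K"
   using embD(1)[OF upsilon sE cE] EmbD(1)[OF t OF_closed[OF m]] .
  ultimately have "\<tau> ?c = \<upsilon> ?c" using VV.smult_right_cancel[of "\<tau> ?c" "\<upsilon> ?c" x] xV x(3) by simp
  hence "pp [^] m \<otimes> \<tau> b = pp [^] m \<otimes> \<upsilon> b"
   using EmbD(3)[OF t _ bF, of "nat_in F (p ^ m)"] embD(3)[OF upsilon sE nE b, of "p ^ m"]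
    emb_nat[OF t subring_F, of "p ^ m"] emb_nat[OF upsilon sE, of "p ^ m"]
   by (simp add: nat_in_pow del: add.nat_pow_Suc)
  thus ?thesis
   using m_lcancel[OF pp_pow_nonzero, of m "\<tau> b" "\<upsilon> b"] EmbD(1)[OF t bF] embD(1)[OF upsilon sE b] by simp
 qed
 have "\<upsilon> \<in> extensional E" using upsilon by (simp add: embeddings_def)
 thus ?thesis using t eq by (auto simp: extensional_def fun_eq_iff)
qed

text \<open>\<open>partial_sum_le\<close> speaks of eigenvalues of \<open>\<pi>\<close> and is
  translated here into embeddings above \<upsilon>. The eigenspace of such an embedding lies in an
  eigenspace of \<open>\<pi>\<close>, so its dimension is at most \<open>n\<close>, and together
  these eigenspaces span \<open>U\<close>.\<close>

lemma piece_basis: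
 obtains r where "!!\<tau>. \<tau> \<in> Over ==> r \<tau> = vdim K (VM\<lparr>carrier := eig \<tau>\<rparr>)" "!!\<tau>. \<tau> \<in> Over ==> r \<tau> \<le> n"
  and "!!m. m \<le> n ==> (\<Sum>i=1..m. rv (a i)) \<le> 1 / real e * (\<Sum>\<tau>\<in>Over. real (min m (r \<tau>)))"
  and "(\<Sum>i=1..n. rv (a i)) = 1 / real e * (\<Sum>\<tau>\<in>Over. real (r \<tau>))"
proof -
 obtain ms where ms: "distinct ms" "set ms = conj_set \<pi>" "\<forall>C\<in>carrier VM. VV.op_prod (op \<pi>) ms C = \<zero>\<^sub>VM"
  by (rule op_annihilated[OF pi_F])
 interpret ED: elementary_divisors K v VM "emb ` N" forms "op \<pi>" ms "1 / real e" n a \<rho>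
  by (rule elementary_divisors_rho[OF ms])
 have UL: "U \<subseteq> ED.Lspan"
 proof
  fix x assume x: "x \<in> U"
  then obtain t where "t \<in> vint" "t \<noteq> \<zero>" "t \<odot>\<^sub>VM x \<in> emb ` N" by (rule U_scaled)
  thus "x \<in> ED.Lspan" using ED.LspanI[of x t] stable_carrier[OF stable_U] x by blast
 qed
 have LU: "ED.Lspan \<subseteq> U"
 proof
  fix x assume "x \<in> ED.Lspan"
  then obtain t where t: "x \<in> carrier VM" "t \<in> vint" "t \<noteq> \<zero>" "t \<odot>\<^sub>VM x \<in> emb ` N" by (rule ED.LspanE)
  have "t \<odot>\<^sub>VM x \<in> U" using t(4) emb_U_iff N_carrier by auto
  hence "inv t \<odot>\<^sub>VM (t \<odot>\<^sub>VM x) \<in> U"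
   using stable_U inv_nonzero[of t] t by (auto simp: stable_def submodule_def)
  thus "x \<in> U" using inv_nonzero[of t] t by (simp add: VV.smult_assoc1[symmetric] m_comm)
 qed
 have fin: "finite Over" using finite_emb[OF FF.carrier_is_subfield j_image] by simp
 have fin': "finite {\<tau> \<in> Over. \<tau> \<pi> = k}" for k by (rule finite_subset[OF _ fin]) blast
 have ev: "\<tau> \<pi> \<in> set ms" if "\<tau> \<in> Over" for \<tau> using that ms(2) by auto
 have eE: "eig \<tau> \<subseteq> ED.eigenspace (\<tau> \<pi>)" if "\<tau> \<in> Over" for \<tau>
  using eig_U[OF that] UL pi_F by (auto simp: ED.eigenspace_def eig_def)
 have "\<exists>W. finite W \<and> W \<subseteq> eig \<tau> \<and> VV.lin_indpt W \<and> eig \<tau> \<subseteq> VV.span W" if t: "\<tau> \<in> Over" for \<tau>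
 proof (rule VV.exists_basis_of_bounded[OF eig_carrier])
  show "card W \<le> n" if "finite W" "W \<subseteq> eig \<tau>" "VV.lin_indpt W" for W
   by (rule ED.eigenspace_card_le[OF ev[OF t] that(1) _ that(3)]) (use eE[OF t] that(2) in blast)
 qed blast
 hence "\<forall>\<tau>\<in>Over. \<exists>W. finite W \<and> W \<subseteq> eig \<tau> \<and> VV.lin_indpt W \<and> eig \<tau> \<subseteq> VV.span W" by blast
 from bchoice[OF this] obtain W where
  W': "\<forall>\<tau>\<in>Over. finite (W \<tau>) \<and> W \<tau> \<subseteq> eig \<tau> \<and> VV.lin_indpt (W \<tau>) \<and> eig \<tau> \<subseteq> VV.span (W \<tau>)" ..
 have W: "finite (W \<tau>)" "W \<tau> \<subseteq> eig \<tau>" "VV.lin_indpt (W \<tau>)" "eig \<tau> \<subseteq> VV.span (W \<tau>)" if "\<tau> \<in> Over" for \<tau>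
  using bspec[OF W' that] by blast+
 have sub: "submodule K (eig \<tau>) VM" if "\<tau> \<in> Over" for \<tau> using eig_stable[of \<tau>] that by (simp add: stable_def)
 have dim: "card (W \<tau>) = vdim K (VM\<lparr>carrier := eig \<tau>\<rparr>)" if "\<tau> \<in> Over" for \<tau>
  using VV.vdim_submodule[OF sub W] that by simp
 have Wn: "card (W \<tau>) \<le> n" if "\<tau> \<in> Over" for \<tau>
  by (rule ED.eigenspace_card_le[OF ev W(1) _ W(3)]) (use that W(2)[OF that] eE[OF that] in auto)
 \<comment> \<open>Used with \<open>U'\<close> an eigenspace of \<open>\<pi>\<close> inside
   \<open>U\<close>, and with \<open>U'\<close> equal to \<open>U\<close>; \<open>T\<close> contains
   all embeddings that have a nonzero eigenvector in \<open>U'\<close>.\<close>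
 have span: "U' \<subseteq> VV.span (\<Union>\<tau>\<in>T. W \<tau>)"
  if U': "stable U'" "U' \<subseteq> U" and T: "T \<subseteq> Over" "!!\<tau> x. \<tau> \<in> Over ==> x \<in> eig \<tau> ==> x \<in> U' ==> x \<noteq> \<zero>\<^sub>VM ==> \<tau> \<in> T" for U' T
 proof -
  let ?W = "\<Union>\<tau>\<in>T. W \<tau>"
  have WV: "?W \<subseteq> carrier VM" using W(2) T(1) eig_carrier by blast
  have "(\<Union>\<tau>\<in>Emb (carrier F). eig \<tau> \<inter> U') \<subseteq> VV.span ?W"
  proof
   fix x assume "x \<in> (\<Union>\<tau>\<in>Emb (carrier F). eig \<tau> \<inter> U')"
   then obtain \<tau> where x: "\<tau> \<in> Emb (carrier F)" "x \<in> eig \<tau>" "x \<in> U'" by blast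
   show "x \<in> VV.span ?W"
   proof (cases "x = \<zero>\<^sub>VM")
    case True thus ?thesis using VV.span_is_submodule[OF WV] by (simp add: submodule_def)
   next
    case False
    hence o: "\<tau> \<in> Over" using eig_over[OF x(1,2)] x(3) U'(2) by blast
    hence "\<tau> \<in> T" using T(2) x False by blast
    hence "VV.span (W \<tau>) \<subseteq> VV.span ?W" by (intro VV.span_is_monotone) blast
    thus ?thesis using W(4)[OF o] x(2) by blast
   qed
  qed
  from VV.span_subset_span[OF this WV] show ?thesis using span_eig[OF U'(1)] by blast
 qed
 \<comment> \<open>A bound for the eigenspace of \<open>\<pi>\<close> at \<open>k\<close>: the
   embeddings above \<upsilon> with value \<open>k\<close> at \<open>\<pi>\<close> are counted
   together.\<close>
 define r where "r k = (\<Sum>\<tau>\<in>{\<tau> \<in> Over. \<tau> \<pi> = k}. card (W \<tau>))" for k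
 show thesis
 proof (rule that[of "\<lambda>\<tau>. card (W \<tau>)"])
  fix m assume m: "m \<le> n"
  have "(\<Sum>i=1..m. rv (a i)) \<le> 1 / real e * (\<Sum>k\<in>set ms. real (min m (r k)))"
  proof (rule ED.partial_sum_le[OF _ m])
   fix k Y assume k: "k \<in> set ms" and Y: "finite Y" "Y \<subseteq> ED.eigenspace k" "VV.lin_indpt Y"
   let ?T = "{\<tau> \<in> Over. \<tau> \<pi> = k}" and ?U = "{x \<in> U. \<forall>b\<in>{\<pi>}. op b x = k \<odot>\<^sub>VM x}"
   have kK: "k \<in> carrier K" using k ED.ms_carrier by blast
   have "stable ?U" using stable_eigen[OF stable_U, of "{\<pi>}" "\<lambda>_. k"] pi_F kK by simp
   moreover have "\<tau> \<in> ?T" if t: "\<tau> \<in> Over" and x: "x \<in> eig \<tau>" "x \<in> ?U" "x \<noteq> \<zero>\<^sub>VM" for \<tau> x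
   proof -
    have "\<tau> \<pi> \<odot>\<^sub>VM x = k \<odot>\<^sub>VM x" "x \<in> carrier VM" using x pi_F by (auto simp: eig_def)
    moreover have "\<tau> \<pi> \<in> carrier K" using t EmbD(1)[OF _ pi_F, of \<tau>] by simp
    ultimately have "\<tau> \<pi> = k" using VV.smult_right_cancel[OF _ kK _ x(3)] by blast
    thus ?thesis using t by simp
   qed
   ultimately have "?U \<subseteq> VV.span (\<Union>\<tau>\<in>?T. W \<tau>)" by (intro span) auto
   moreover have "Y \<subseteq> ?U" using Y(2) LU by (auto simp: ED.eigenspace_def)
   moreover have "finite (\<Union>\<tau>\<in>?T. W \<tau>)" using fin' W(1) by (intro finite_UN_I) auto
   moreover have "(\<Union>\<tau>\<in>?T. W \<tau>) \<subseteq> carrier VM" using W(2) eig_carrier by blast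
   ultimately have "card Y \<le> card (\<Union>\<tau>\<in>?T. W \<tau>)"
    by - (rule VV.card_le_of_indpt[OF Y(1) _ _ Y(3)], assumption+, rule order_trans)
   also have "\<dots> \<le> r k" unfolding r_def by (rule card_UN_le[OF fin'])
   finally show "card Y \<le> r k" .
  qed
  \<comment> \<open>Truncation at \<open>m\<close> is subadditive, so splitting an eigenvalue into
    its embeddings can only enlarge the bound.\<close>
  also have "(\<Sum>k\<in>set ms. real (min m (r k))) \<le> (\<Sum>k\<in>set ms. \<Sum>\<tau>\<in>{\<tau> \<in> Over. \<tau> \<pi> = k}. real (min m (card (W \<tau>))))"
  proof (rule sum_mono)
   fix k
   have "min m (sum g A) \<le> (\<Sum>\<tau>\<in>A. min m (g \<tau>))" if "finite A" for A and g :: "('f => 'k) => nat"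
    using that by (induction A rule: finite_induct) auto
   from of_nat_mono[OF this[of "{\<tau> \<in> Over. \<tau> \<pi> = k}" "\<lambda>\<tau>. card (W \<tau>)", OF fin']]
   show "real (min m (r k)) \<le> (\<Sum>\<tau>\<in>{\<tau> \<in> Over. \<tau> \<pi> = k}. real (min m (card (W \<tau>))))"
    unfolding r_def of_nat_sum by simp
  qed
  also have "\<dots> = (\<Sum>\<tau>\<in>Over. real (min m (card (W \<tau>))))"
   by (rule sum.group[OF fin]) (use ev in auto)
  finally show "(\<Sum>i=1..m. rv (a i)) \<le> 1 / real e * (\<Sum>\<tau>\<in>Over. real (min m (card (W \<tau>))))"
   using ED.eps_pos by (simp add: divide_right_mono)
 next
  let ?W = "\<Union>\<tau>\<in>Over. W \<tau>"
  \<comment> \<open>Two distinct embeddings differ at some element of \<open>F\<close>, and the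
    operator of that element separates their eigenspaces.\<close>
  have dir: "\<forall>\<tau>\<in>Over. f \<tau> = \<zero>\<^sub>VM"
   if f: "!!\<tau>. \<tau> \<in> Over ==> f \<tau> \<in> eig \<tau>" "(\<Oplus>\<^sub>VM \<tau>\<in>Over. f \<tau>) = \<zero>\<^sub>VM" for f
  proof (rule VV.eigenvectors_direct[OF fin, where Ops = "carrier F" and P = op and ev = "\<lambda>\<tau>. \<tau>"])
   fix s t assume st: "s \<in> Over" "t \<in> Over" "s \<noteq> t"
   show "\<exists>b\<in>carrier F. s b \<noteq> t b"
   proof (rule ccontr)
    assume "\<not> (\<exists>b\<in>carrier F. s b \<noteq> t b)"
    hence "s = t" using st by (intro extensionalityI[of _ "carrier F"]) (auto simp: embeddings_def)
    thus False using st(3) by simp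
   qed
  next
   fix \<tau> b assume tb: "\<tau> \<in> Over" "b \<in> carrier F"
   show "\<tau> b \<in> carrier K" using tb EmbD(1)[OF _ tb(2), of \<tau>] by simp
   show "op b (f \<tau>) = \<tau> b \<odot>\<^sub>VM f \<tau>" using f(1)[OF tb(1)] tb(2) by (simp add: eig_def)
  qed (use f eig_carrier op_lin in auto)
  have Wf: "finite ?W" "?W \<subseteq> ED.Lspan"
   using finite_UN_I[OF fin, of W] W(1) apply blast
   using W(2) eig_U UL by blast
  have ind: "VV.lin_indpt ?W" "card ?W = (\<Sum>\<tau>\<in>Over. card (W \<tau>))"
   by (rule VV.lin_indpt_UN[OF fin sub dir W(1-3)]; assumption)+
  have "\<forall>w\<in>?W. \<exists>k. k \<in> set ms \<and> op \<pi> w = k \<odot>\<^sub>VM w"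
   using W(2) ev pi_F unfolding eig_def by blast
  from bchoice[OF this] obtain g where "\<forall>w\<in>?W. g w \<in> set ms \<and> op \<pi> w = g w \<odot>\<^sub>VM w" ..
  note g = bspec[OF this]
  have "emb ` N \<subseteq> VV.span ?W" using span[OF stable_U order_refl, of Over] emb_U_iff N_carrier by auto
  from ED.total_sum[OF Wf ind(1) g this]
  show "(\<Sum>i=1..n. rv (a i)) = 1 / real e * (\<Sum>\<tau>\<in>Over. real (card (W \<tau>)))"
   using ind(2) by simp
 qed (use dim Wn in auto)
qed

end

lemma nat_in_val_ring: "nat_in (val_ring K v) m = nat_in K m"
 by (induction m) (simp_all add: add_pow_def nat_pow_def val_ring_def)

text \<open>The condition on p-adic integers in \<open>endomorphism_structure\<close> is formulated
  with natural numbers congruent to \<open>z\<close>; density of the natural numbers supplies one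
  for each level, and \<open>omega_map_scalar\<close> combines the levels.\<close>

lemma (in padic_uniformiser) lattice_action_omega:
 assumes pd: "p_divisible_group (val_ring K v) p h A res"
  and en: "endomorphism_structure K v F j A res \<iota>"
  and B: "module (val_ring K v) (omega (val_ring K v) A res)" "is_basis (val_ring K v) (omega (val_ring K v) A res) B"
 shows "lattice_action K v p F j d \<pi> e (omega (val_ring K v) A res) B (\<lambda>b. omega_map (val_ring K v) A (\<iota> b))"
proof -
 interpret G: pdiv_group "val_ring K v" p h A res by (rule pdiv_group.intro[OF pd])
 interpret fm: free_valued_module K v "omega (val_ring K v) A res" B
  by (intro free_valued_module.intro valued_module.intro valued_module_axioms.intro free_valued_module_axioms.intro valued_field_axioms B)
 have hom: "\<iota> \<in> ring_hom OF G.End" and Z: "!!z i m. z \<in> Zp K v ==> ereal (real i) \<le> v (z \<ominus> nat_in K m) ==>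
    \<iota> (j z) i = mult_by (A i) m" using en unfolding endomorphism_structure_def by blast+
 have c: "\<iota> b \<in> carrier G.End" if "b \<in> carrier OF" for b using ring_hom_closed[OF hom that] .
 have OFp: "x \<oplus>\<^sub>OF y = x \<oplus>\<^sub>F y" "x \<otimes>\<^sub>OF y = x \<otimes>\<^sub>F y" for x y by (simp_all add: integral_closure_def)
 show ?thesis
 proof (intro lattice_action.intro lattice_action_axioms.intro)
  fix b x assume b: "b \<in> carrier OF" and x: "x \<in> carrier G.\<Omega>"
  show "omega_map (val_ring K v) A (\<iota> b) x \<in> carrier G.\<Omega>" by (rule G.omega_map_closed[OF c[OF b] x])
  show "omega_map (val_ring K v) A (\<iota> b) (x \<oplus>\<^bsub>G.\<Omega>\<^esub> y) = omega_map (val_ring K v) A (\<iota> b) x \<oplus>\<^bsub>G.\<Omega>\<^esub> omega_map (val_ring K v) A (\<iota> b) y"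
   if "y \<in> carrier G.\<Omega>" for y by (rule G.omega_map_add[OF c[OF b] x that])
  show "omega_map (val_ring K v) A (\<iota> b) (t \<odot>\<^bsub>G.\<Omega>\<^esub> x) = t \<odot>\<^bsub>G.\<Omega>\<^esub> omega_map (val_ring K v) A (\<iota> b) x"
   if "t \<in> vint" for t by (rule G.omega_map_smult[OF c[OF b] _ x]) (use that in \<open>simp add: val_ring_def\<close>)
 next
  fix a b x assume ab: "a \<in> carrier OF" "b \<in> carrier OF" and x: "x \<in> carrier G.\<Omega>"
  have s: "\<iota> (a \<oplus>\<^sub>F b) = \<iota> a \<oplus>\<^bsub>G.End\<^esub> \<iota> b" using ring_hom_add[OF hom ab] by (simp add: OFp)
  have "\<iota> (a \<oplus>\<^sub>F b) \<in> carrier G.End" by (rule c[OF OF_ops(5)[OF ab]])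
  thus "omega_map (val_ring K v) A (\<iota> (a \<oplus>\<^sub>F b)) x =
    omega_map (val_ring K v) A (\<iota> a) x \<oplus>\<^bsub>G.\<Omega>\<^esub> omega_map (val_ring K v) A (\<iota> b) x"
   using G.omega_map_sum[OF c[OF ab(1)] c[OF ab(2)] _ x] s by simp
  \<comment> \<open>The product of \<open>End_ring\<close> acts on differentials in reversed order;
    commutativity of \<open>F\<close> restores it.\<close>
  have ba: "a \<otimes>\<^sub>F b = b \<otimes>\<^sub>F a" using FF.m_comm ab OF_closed by blast
  have s: "\<iota> (a \<otimes>\<^sub>F b) = \<iota> b \<otimes>\<^bsub>G.End\<^esub> \<iota> a" using ring_hom_mult[OF hom ab(2,1)] ba by (simp add: OFp)
  have "\<iota> (a \<otimes>\<^sub>F b) \<in> carrier G.End" by (rule c[OF OF_ops(4)[OF ab]])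
  thus "omega_map (val_ring K v) A (\<iota> (a \<otimes>\<^sub>F b)) x =
    omega_map (val_ring K v) A (\<iota> a) (omega_map (val_ring K v) A (\<iota> b) x)"
   using G.omega_map_mult[OF c[OF ab(2)] c[OF ab(1)] _ x] s by simp
 next
  fix z x assume z: "z \<in> Zp K v" and x: "x \<in> carrier G.\<Omega>"
  have zv: "z \<in> carrier K" "0 \<le> v z" using z Zp_carrier Zp_v by auto
  have "\<exists>m. ereal (real i) \<le> v (z \<ominus> nat_in K m)" for i by (rule Zp_approx[OF z, of i]) blast
  then obtain m where m: "!!i. ereal (real i) \<le> v (z \<ominus> nat_in K (m i))" by metis
  show "omega_map (val_ring K v) A (\<iota> (j z)) x = z \<odot>\<^bsub>G.\<Omega>\<^esub> x"
  proof (rule G.omega_map_scalar[OF c[OF j_Zp_OF[OF z]] x])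
   show "z \<in> carrier (val_ring K v)" using zv by (simp add: val_ring_def)
   show "\<iota> (j z) i = mult_by (A i) (m i)" for i by (rule Z[OF z m])
   show "\<exists>t\<in>carrier (val_ring K v). z = nat_in (val_ring K v) (m i) \<oplus>\<^bsub>val_ring K v\<^esub> t \<otimes>\<^bsub>val_ring K v\<^esub> nat_in (val_ring K v) (p ^ i)" for i
   proof -
    \<comment> \<open>\<open>?t\<close> is the quotient of \<open>z - m i\<close> by
      \<open>p ^ i\<close>, integral because \<open>m i\<close> approximates \<open>z\<close> to
      order \<open>i\<close>.\<close>
    let ?y = "z \<ominus> nat_in K (m i)" and ?t = "(z \<ominus> nat_in K (m i)) \<otimes> inv (pp [^] i)"
    have y: "?y \<in> carrier K" using zv by simp
    have "0 \<le> v ?t"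
     using m[of i] v_mult[OF y pp_inv(1)[of i]] pp_inv(3)[of i] by (cases "v ?y") (auto simp: zero_ereal_def)
    moreover have "?t \<otimes> pp [^] i = ?y"
     using pp_inv[of i] y m_comm[of "inv (pp [^] i)" "pp [^] i"] by (simp add: m_assoc)
    moreover have "nat_in K (m i) \<oplus> ?y = z" using zv by (simp add: a_minus_def a_lcomm r_neg)
    ultimately show ?thesis
     unfolding nat_in_val_ring using y pp_inv(1)[of i]
     by (intro bexI[of _ ?t]) (auto simp: val_ring_def nat_in_pow simp del: add.nat_pow_Suc)
   qed
  qed
 qed (rule padic_uniformiser_axioms fm.free_valued_module_axioms)+
qed

section \<open>Comparison of the polygons\<close>

lemma polygon_nat: "m \<le> n ==> polygon n a (real m) = (\<Sum>i=1..m. a i)"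
proof -
 assume m: "m \<le> n"
 have "polygon n a (real m) = (\<Sum>i=1..n. if i \<in> {1..m} then a i else 0)"
  unfolding polygon_def by (intro sum.cong) (auto simp: max_def min_def)
 also have "\<dots> = (\<Sum>i=1..m. a i)" using m by (subst sum.inter_restrict[symmetric]) (auto intro: sum.cong)
 finally show ?thesis .
qed

text \<open>Each summand of \<open>polygon\<close> has its breaks at the integers i - 1 and i, so it
  is affine on the interval from \<open>m\<close> to \<open>m + 1\<close>.\<close>

lemma polygon_between:
 assumes "0 \<le> t" "t \<le> 1"
 shows "polygon n a (real m + t) = (1 - t) * polygon n a (real m) + t * polygon n a (real (Suc m))"
proof -
 let ?g = "\<lambda>i x. max 0 (min 1 (x - (real i - 1)))"
 have g: "?g i (real m + t) = (1 - t) * ?g i (real m) + t * ?g i (real (Suc m))" for i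
 proof -
  have 0: "max 0 (min 1 y) = 0" if "y \<le> 0" for y :: real using that by simp
  have 1: "max 0 (min 1 y) = 1" if "1 \<le> y" for y :: real using that by simp
  consider "real i \<le> real m" | "i = Suc m" | "real m + 2 \<le> real i" by linarith
  thus ?thesis
  proof cases
   case 1 thus ?thesis using assms by (simp add: \<open>!!y::real. 1 \<le> y ==> max 0 (min 1 y) = 1\<close>)
  next
   case 2 thus ?thesis using assms by simp
  next
   case 3 thus ?thesis using assms by (simp add: 0)
  qed
 qed
 show ?thesis
  unfolding polygon_def sum_distrib_left sum.distrib[symmetric]
  by (intro sum.cong HOL.refl) (simp only: g, simp add: algebra_simps)
qed

text \<open>The only break of the function is at \<open>r\<close>, a natural number.\<close>

lemma min_between:
 fixes r m :: nat and t :: real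
 assumes "0 \<le> t" "t \<le> 1"
 shows "min (real m + t) (real r) = (1 - t) * min (real m) (real r) + t * min (real (Suc m)) (real r)"
proof (cases "Suc m \<le> r")
 case True
 hence "real m + 1 \<le> real r" by linarith
 thus ?thesis using assms by (simp add: min_def algebra_simps)
next
 case False
 hence "real r \<le> real m" by simp
 thus ?thesis using assms by (simp add: min_def algebra_simps)
qed

lemma polygon_leI:
 fixes r :: "'t => nat"
 assumes le: "!!m. m \<le> n ==> (\<Sum>i=1..m. a i) \<le> c * (\<Sum>t\<in>T. min (real m) (real (r t)))"
  and eq: "(\<Sum>i=1..n. a i) = c * (\<Sum>t\<in>T. min (real n) (real (r t)))"
 shows "polygon_le n (polygon n a) (\<lambda>x. c * (\<Sum>t\<in>T. min x (real (r t))))"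
 unfolding polygon_le_def
proof (intro conjI ballI)
 let ?G = "\<lambda>x. c * (\<Sum>t\<in>T. min x (real (r t)))"
 show "polygon n a (real n) = ?G (real n)" using eq polygon_nat[of n n a] by simp
 fix x assume x: "x \<in> {0..real n}"
 show "polygon n a x \<le> ?G x"
 \<comment> \<open>The endpoint is separate because for x = n the interval from \<open>m\<close> to
   \<open>m + 1\<close> would leave the domain.\<close>
 proof (cases "x = real n")
  case True thus ?thesis using eq polygon_nat[of n n a] by simp
 next
  case False
  define m where "m = nat \<lfloor>x\<rfloor>"
  define t where "t = x - real m"
  have t: "0 \<le> t" "t \<le> 1" "x = real m + t" using x by (auto simp: t_def m_def) linarith
  have "x < real n" using x False by simp
  hence "real m < real n" using t by linarith
  hence m: "m \<le> n" "Suc m \<le> n" by auto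
  have "polygon n a x = (1 - t) * (\<Sum>i=1..m. a i) + t * (\<Sum>i=1..Suc m. a i)"
   unfolding t(3) polygon_between[OF t(1,2)] polygon_nat[OF m(1)] polygon_nat[OF m(2)] ..
  also have "\<dots> \<le> (1 - t) * ?G (real m) + t * ?G (real (Suc m))"
   by (intro add_mono mult_left_mono le m) (use t in auto)
  also have "\<dots> = ?G x"
   unfolding t(3) min_between[OF t(1,2)] sum_distrib_left sum.distrib[symmetric]
   by (intro sum.cong HOL.refl) (simp add: algebra_simps)
  finally show ?thesis .
 qed
qed

theorem theorem4p7:
  fixes p d n e f :: nat
    and K :: "'k ring" and v :: "'k \<Rightarrow> ereal" and W :: "'k set"
    and F :: "'f ring" and j :: "'k \<Rightarrow> 'f" and Fnr :: "'f set" and \<pi> :: 'f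
    and A :: "nat \<Rightarrow> ('k, 'a) hopf" and res :: "nat \<Rightarrow> 'a \<Rightarrow> 'a"
    and \<iota> :: "'f \<Rightarrow> nat \<Rightarrow> 'a \<Rightarrow> 'a"
    and a :: "('f \<Rightarrow> 'k) \<Rightarrow> nat \<Rightarrow> 'k"
  assumes "Factorial_Ring.prime p"
    and "complete_valued_field K v" and "v (nat_in K p) = 1"
    and "perfect_residue_field p K v"
    and "is_witt_subring p K v W"
    and "finite_extension_of_Qp K v F j d"
    and "maximal_unramified_subextension p K v F j Fnr"
    and "is_uniformiser K v F j \<pi>"
    and "ramification_index p K v F j \<pi> e" and "inertia_degree K v F j f"
    and "contains_galois_closure K v F j"
    and "p_divisible_group (val_ring K v) p (d * n) A res"
    and "endomorphism_structure K v F j A res \<iota>"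
    and "free_module (val_ring K v) (omega (val_ring K v) A res)"
    and "\<forall>\<upsilon>\<in>embeddings K v F j Fnr (fractions_in K W).
           hdg_int_tuple K v F j Fnr \<pi> A res \<iota> n \<upsilon> (a \<upsilon>)"
  shows "polygon_le n
           (polygon n (hdg_int v f (embeddings K v F j Fnr (fractions_in K W)) a))
           (PR p K v F j d A res \<iota>)"
proof -
 have K: "field K" "!!x. x \<in> carrier K ==> v x \<noteq> -\<infinity>" "!!x. x \<in> carrier K ==> v x = \<infinity> \<longleftrightarrow> x = \<zero>\<^sub>K"
  "!!x y. x \<in> carrier K ==> y \<in> carrier K ==> v (x \<otimes>\<^sub>K y) = v x + v y"
  "!!x y. x \<in> carrier K ==> y \<in> carrier K ==> min (v x) (v y) \<le> v (x \<oplus>\<^sub>K y)"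
  using assms(2) unfolding complete_valued_field_def by blast+
 have pu: "padic_uniformiser K v p F j d \<pi> e"
  by (intro padic_uniformiser.intro padic_extension.intro padic_field.intro valued_field.intro valued_field_axioms.intro
    padic_field_axioms.intro padic_extension_axioms.intro padic_uniformiser_axioms.intro) (fact K assms)+
 interpret padic_uniformiser K v p F j d \<pi> e by (rule pu)
 let ?R = "val_ring K v"
 let ?M = "omega ?R A res" and ?act = "\<lambda>b. omega_map ?R A (\<iota> b)"
 obtain B where B: "module ?R ?M" "is_basis ?R ?M B" using assms(14) unfolding free_module_def by blast
 have la: "lattice_action K v p F j d \<pi> e ?M B ?act" by (rule lattice_action_omega[OF assms(12,13) B])
 interpret LA: lattice_action K v p F j d \<pi> e ?M B ?act by (rule la)
 let ?Y = "embeddings K v F j Fnr (fractions_in K W)" and ?r = "\<lambda>\<tau>. vdim K (omega_K p K v F j A res \<iota> \<tau>)"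
 have un: "unramified_subextension p K v F j Fnr"
  using assms(7) unfolding maximal_unramified_subextension_def by blast
 have E: "subfield Fnr F" "j ` Qp K v \<subseteq> Fnr"
  using un unfolding unramified_subextension_def subextension_def by blast+
 have "fractions_in K W \<subseteq> carrier K"
 proof -
  have "W \<subseteq> carrier K" using assms(5) subringE(1) unfolding is_witt_subring_def by blast
  thus ?thesis using inv_nonzero(1) unfolding fractions_in_def by blast
 qed
 hence Y: "?Y \<subseteq> Emb Fnr" by (auto simp: embeddings_def ring_hom_def)
 have finE: "finite (Emb (carrier F))" by (rule finite_emb[OF FF.carrier_is_subfield j_image])
 have finY: "finite ?Y" using finite_emb[OF E] Y finite_subset by blast
 \<comment> \<open>The action in \<open>omega_K_act\<close> uses the same least exponent as
   \<open>dexp\<close>, so both sides agree after unfolding.\<close>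
 have eig: "omega_K p K v F j A res \<iota> \<tau> = base_change ?R K ?M\<lparr>carrier := LA.eig \<tau>\<rparr>" for \<tau>
  unfolding omega_K_def omega_K_act_def LA.eig_def LA.op_def LA.dexp_def Let_def ..
 let ?O = "\<lambda>\<upsilon>. {\<tau> \<in> Emb (carrier F). restrict \<tau> Fnr = \<upsilon>}"
 have piece: "(\<forall>m\<le>n. (\<Sum>i=1..m. rv (a \<upsilon> i)) \<le> 1 / real e * (\<Sum>\<tau>\<in>?O \<upsilon>. min (real m) (real (?r \<tau>)))) \<and>
   (\<Sum>i=1..n. rv (a \<upsilon> i)) = 1 / real e * (\<Sum>\<tau>\<in>?O \<upsilon>. min (real n) (real (?r \<tau>)))" if u: "\<upsilon> \<in> ?Y" for \<upsilon>
 proof -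
  define N where "N = {x \<in> carrier ?M. \<forall>b\<in>carrier (OE Fnr). ?act b x = \<upsilon> b \<odot>\<^bsub>?M\<^esub> x}"
  have nr: "omega_nr K v F j Fnr A res \<iota> \<upsilon> = ?M\<lparr>carrier := N\<rparr>" unfolding omega_nr_def N_def ..
  have t: "hdg_int_tuple K v F j Fnr \<pi> A res \<iota> n \<upsilon> (a \<upsilon>)" using assms(15) u by blast
  have av: "a \<upsilon> i \<in> vint \<and> a \<upsilon> i \<noteq> \<zero>\<^sub>K" if "i \<in> {1..n}" for i
   using t that unfolding hdg_int_tuple_def val_ring_def by auto
  obtain h where h: "h \<in> Defs.linear_map ?R (quot_module (?M\<lparr>carrier := N\<rparr>) (?act \<pi> ` N))
    (fin_direct_sum {1..n} (\<lambda>i. quot_module (self_module ?R) (PIdl\<^bsub>?R\<^esub> (a \<upsilon> i))))"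
   "bij_betw h (carrier (quot_module (?M\<lparr>carrier := N\<rparr>) (?act \<pi> ` N)))
    (carrier (fin_direct_sum {1..n} (\<lambda>i. quot_module (self_module ?R) (PIdl\<^bsub>?R\<^esub> (a \<upsilon> i)))))"
   using t unfolding hdg_int_tuple_def module_isomorphic_def nr by auto
  interpret P: graded_piece K v p F j d \<pi> e ?M B ?act Fnr \<upsilon> n "a \<upsilon>" N h
   by (intro graded_piece.intro graded_piece_axioms.intro la E av h N_def) (use u Y in blast)
  obtain r where r: "!!\<tau>. \<tau> \<in> P.Over ==> r \<tau> = vdim K (base_change ?R K ?M\<lparr>carrier := LA.eig \<tau>\<rparr>)" "!!\<tau>. \<tau> \<in> P.Over ==> r \<tau> \<le> n"
   "!!m. m \<le> n ==> (\<Sum>i=1..m. rv (a \<upsilon> i)) \<le> 1 / real e * (\<Sum>\<tau>\<in>P.Over. real (min m (r \<tau>)))"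
   "(\<Sum>i=1..n. rv (a \<upsilon> i)) = 1 / real e * (\<Sum>\<tau>\<in>P.Over. real (r \<tau>))"
   by (rule P.piece_basis) blast
  have rr: "r \<tau> = ?r \<tau>" if "\<tau> \<in> ?O \<upsilon>" for \<tau> using r(1)[OF that] eig[of \<tau>] by simp
  have s: "(\<Sum>\<tau>\<in>?O \<upsilon>. real (min m (r \<tau>))) = (\<Sum>\<tau>\<in>?O \<upsilon>. min (real m) (real (?r \<tau>)))" for m
   using rr by (intro sum.cong) auto
  \<comment> \<open>The bound \<open>r \<tau> \<le> n\<close> allows the truncation at
    \<open>n\<close> to be inserted, which gives the equality the shape of the inequality at m =
    n.\<close>
  have s': "(\<Sum>\<tau>\<in>?O \<upsilon>. real (r \<tau>)) = (\<Sum>\<tau>\<in>?O \<upsilon>. real (min n (r \<tau>)))"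
   using r(2) by (intro sum.cong) auto
  show ?thesis using r(3) r(4)[unfolded s'] unfolding s by blast
 qed
 have df: "real d = real e * real f"
  using degree_eq_ramification_inertia[OF assms(10)] by simp
 have "1 / real f * (\<Sum>\<upsilon>\<in>?Y. 1 / real e * (\<Sum>\<tau>\<in>?O \<upsilon>. g \<tau>)) = 1 / real d * (\<Sum>\<tau>\<in>Emb (carrier F). g \<tau>)" for g :: "('f => 'k) => real"
 proof -
  \<comment> \<open>Each embedding of \<open>F\<close> restricts to a member of \<open>?Y\<close>,
    so the fibres \<open>?O \<upsilon>\<close> partition the embeddings of \<open>F\<close>; with d
    = e f the two averages combine into one.\<close>
  have "(\<Sum>\<upsilon>\<in>?Y. \<Sum>\<tau>\<in>?O \<upsilon>. g \<tau>) = (\<Sum>\<tau>\<in>Emb (carrier F). g \<tau>)"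
   by (rule sum.group[OF finE finY]) (use restrict_emb_unramified[OF assms(10,5) un] in blast)
  thus ?thesis unfolding df sum_distrib_left[symmetric] by (simp add: mult.commute)
 qed
 note group = this
 have hdg: "(\<Sum>i=1..m. hdg_int v f ?Y a i) = 1 / real f * (\<Sum>\<upsilon>\<in>?Y. \<Sum>i=1..m. rv (a \<upsilon> i))" for m
  unfolding hdg_int_def sum_distrib_left[symmetric] rv_def[symmetric] by (subst sum.swap) simp
 have PR: "PR p K v F j d A res \<iota> = (\<lambda>x. 1 / real d * (\<Sum>\<tau>\<in>Emb (carrier F). min x (real (?r \<tau>))))"
  unfolding PR_def ..
 show ?thesis
  unfolding PR
 proof (rule polygon_leI)
  fix m assume "m \<le> n"
  hence "(\<Sum>\<upsilon>\<in>?Y. \<Sum>i=1..m. rv (a \<upsilon> i)) \<le> (\<Sum>\<upsilon>\<in>?Y. 1 / real e * (\<Sum>\<tau>\<in>?O \<upsilon>. min (real m) (real (?r \<tau>))))"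
   using piece by (intro sum_mono) blast
  thus "(\<Sum>i=1..m. hdg_int v f ?Y a i) \<le> 1 / real d * (\<Sum>\<tau>\<in>Emb (carrier F). min (real m) (real (?r \<tau>)))"
   unfolding hdg group[symmetric] by (intro mult_left_mono) auto
 next
  have "(\<Sum>\<upsilon>\<in>?Y. \<Sum>i=1..n. rv (a \<upsilon> i)) = (\<Sum>\<upsilon>\<in>?Y. 1 / real e * (\<Sum>\<tau>\<in>?O \<upsilon>. min (real n) (real (?r \<tau>))))"
   using piece by (intro sum.cong HOL.refl) blast
  thus "(\<Sum>i=1..n. hdg_int v f ?Y a i) = 1 / real d * (\<Sum>\<tau>\<in>Emb (carrier F). min (real n) (real (?r \<tau>)))"
   unfolding hdg group[symmetric] by simp
 qed
qed

end
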